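(* Let $\Omega\subset\mathbb{R}^N$, $N\ge 2$, be a bounded smooth domain. For every $p>N$ let $q(p)\in[1,\infty)$ and $\mu_p>0$ be given such that $$\lim_{p\to\infty}\frac{q(p)}{p}=\infty\qquad\text{and}\qquad \Theta:=\lim_{p\to\infty}(\mu_p)^{1/q(p)}\in(0,\infty).$$ For all $p$ sufficiently large, let $v_{p,q(p)}$ be a positive least energy solution to $$\begin{cases}-\Delta_p v=\mu_p|v|^{q(p)-2}v & \text{in }\Omega\\ v=0&\text{on }\partial\Omega.\end{cases}$$ Then for each sequence $p_n\to\infty$, the sequence $v_{p_n,q(p_n)}$ admits a subsequence that converges uniformly to a viscosity solution $v_\infty\in C_0(\overline\Omega)\cap W^{1,\infty}(\Omega)$ to the Dirichlet problem $$\begin{cases}-\Delta_\infty v=0 & \text{in }\Omega\setminus M\\ v=0 & \text{on }\partial\Omega\\ v=\Theta^{-1} & \text{in } M,\end{cases}$$ where $M$ is a closed subset of $M_\Omega:=\{x\in\Omega:d_\Omega(x)=\|d_\Omega\|_\infty\}$. Moreover, $$v_\infty=\frac{d_\Omega}{\Theta\|d_\Omega\|_\infty}\quad\text{if and only if}\quad M=M_\Omega=\Sigma_\Omega,$$ where $\Sigma_\Omega:=\{x\in\Omega: d_\Omega\text{ is not differentiable at }x\}$.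
   Context: $\|\cdot\|_r$ is the standard norm of $L^r(\Omega)$, $1\le r\le\infty$. $C_0(\overline\Omega)$ is the set of continuous functions on $\overline\Omega$ vanishing on $\partial\Omega$. $d_\Omega(x):=\inf_{y\in\partial\Omega}|x-y|$, $x\in\overline\Omega$. $\Delta_p v:=\operatorname{div}(|\nabla v|^{p-2}\nabla v)$ is the $p$-Laplacian. Functions in $W_0^{1,p}(\Omega)$, $p>N$, are identified with their continuous representatives on $\overline\Omega$. For $p>N$, $q>p$ and $\lambda>0$, the positive least energy solutions to $-\Delta_p v=\lambda|v|^{q-2}v$ in $\Omega$, $v=0$ on $\partial\Omega$, are the positive weak solutions at which the energy functional $$E_\lambda(v):=\frac1p\|\nabla v\|_p^p-\frac{\lambda}{q}\|v\|_q^q$$ takes its lowest value among such solutions; equivalently, they are the positive minimizers of $E_\lambda$ on the Nehari manifold $$N_\lambda:=\{v\in W_0^{1,p}(\Omega)\setminus\{0\}:\|\nabla v\|_p^p=\lambda\|v\|_q^q\}.$$ (Here $q=q(p)>p$ for all large $p$.) The infinity Laplacian is $\Delta_\infty\phi:=\sum_{i,j=1}^N \phi_{x_i}\phi_{x_j}\phi_{x_ix_j}$. Let $D\subset\mathbb{R}^N$ be a bounded open set and $u\in C(D)$. $u$ is a viscosity supersolution of $-\Delta_\infty u=0$ in $D$ if for each $x_0\in D$, each ball $B(x_0)\subset D$ centered at $x_0$, and each $\phi\in C^2(B(x_0))$ with $\phi(x)-u(x)<0=\phi(x_0)-u(x_0)$ for all $x\in B(x_0)\setminus\{x_0\}$,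 one has $-\Delta_\infty\phi(x_0)\ge 0$. It is a viscosity subsolution if for each such $x_0$, $B(x_0)$ and each $\phi\in C^2(B(x_0))$ with $\phi(x)-u(x)>0=\phi(x_0)-u(x_0)$ for all $x\in B(x_0)\setminus\{x_0\}$, one has $-\Delta_\infty\phi(x_0)\le 0$. $u$ is infinity harmonic in $D$ if it is both. A viscosity solution to the displayed Dirichlet problem for $\Delta_\infty$ is a function $v\in C(\overline\Omega)$ that is infinity harmonic in the open set $\Omega\setminus M$, with $v=0$ on $\partial\Omega$ and $v=\Theta^{-1}$ on $M$. *)

theory Defs
  imports "HOL-Analysis.Analysis" "HOL-Probability.Essential_Supremum"
begin

definition partial_deriv :: "'a::euclidean_space \<Rightarrow> ('a \<Rightarrow> real) \<Rightarrow> 'a \<Rightarrow> real" where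
  "partial_deriv b f x = frechet_derivative f (at x) b"

text \<open>The class \<open>C\<^sup>k(S)\<close>; meaningful for open \<open>S\<close> only, since derivatives are taken in the full space.\<close>

primrec Ck_on :: "nat \<Rightarrow> 'a::euclidean_space set \<Rightarrow> ('a \<Rightarrow> real) \<Rightarrow> bool" where
  "Ck_on 0 S f \<longleftrightarrow> continuous_on S f"
| "Ck_on (Suc k) S f \<longleftrightarrow>
     (\<forall>x\<in>S. f differentiable (at x)) \<and> (\<forall>b\<in>Basis. Ck_on k S (partial_deriv b f))"

definition smooth_on :: "'a::euclidean_space set \<Rightarrow> ('a \<Rightarrow> real) \<Rightarrow> bool" where
  "smooth_on S f \<longleftrightarrow> (\<forall>k. Ck_on k S f)"

text \<open>Smoothness of the boundary is expressed by local defining functions with non-vanishing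
  gradient; in particular \<open>\<Omega>\<close> lies locally on one side of its boundary.\<close>

definition bounded_smooth_domain :: "'a::euclidean_space set \<Rightarrow> bool" where
  "bounded_smooth_domain \<Omega> \<longleftrightarrow>
     open \<Omega> \<and> connected \<Omega> \<and> \<Omega> \<noteq> {} \<and> bounded \<Omega> \<and>
     (\<forall>x\<in>frontier \<Omega>. \<exists>U \<psi>. open U \<and> x \<in> U \<and> smooth_on U \<psi> \<and>
        (\<forall>y\<in>U. \<exists>b\<in>Basis. partial_deriv b \<psi> y \<noteq> 0) \<and>
        \<Omega> \<inter> U = {y\<in>U. \<psi> y < 0})"

definition Lp_mem :: "'a::euclidean_space set \<Rightarrow> real \<Rightarrow> ('a \<Rightarrow> 'b::euclidean_space) \<Rightarrow> bool" where
  "Lp_mem \<Omega> p f \<longleftrightarrow> f \<in> borel_measurable (lebesgue_on \<Omega>) \<and>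
     integrable (lebesgue_on \<Omega>) (\<lambda>x. norm (f x) powr p)"

definition Lp_norm :: "'a::euclidean_space set \<Rightarrow> real \<Rightarrow> ('a \<Rightarrow> 'b::euclidean_space) \<Rightarrow> real" where
  "Lp_norm \<Omega> p f = (\<integral>x. norm (f x) powr p \<partial>lebesgue_on \<Omega>) powr (1 / p)"

definition Linf_mem :: "'a::euclidean_space set \<Rightarrow> ('a \<Rightarrow> 'b::euclidean_space) \<Rightarrow> bool" where
  "Linf_mem \<Omega> f \<longleftrightarrow> f \<in> borel_measurable (lebesgue_on \<Omega>) \<and>
     esssup (lebesgue_on \<Omega>) (\<lambda>x. ereal (norm (f x))) < \<infinity>"

definition Linf_norm :: "'a::euclidean_space set \<Rightarrow> ('a \<Rightarrow> 'b::euclidean_space) \<Rightarrow> real" where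
  "Linf_norm \<Omega> f = real_of_ereal (esssup (lebesgue_on \<Omega>) (\<lambda>x. ereal (norm (f x))))"

definition test_function :: "'a::euclidean_space set \<Rightarrow> ('a \<Rightarrow> real) \<Rightarrow> bool" where
  "test_function \<Omega> \<phi> \<longleftrightarrow> smooth_on UNIV \<phi> \<and>
     (\<exists>K. compact K \<and> K \<subseteq> \<Omega> \<and> (\<forall>x. x \<notin> K \<longrightarrow> \<phi> x = 0))"

definition locally_integrable :: "'a::euclidean_space set \<Rightarrow> ('a \<Rightarrow> 'b::euclidean_space) \<Rightarrow> bool" where
  "locally_integrable \<Omega> f \<longleftrightarrow> (\<forall>K. compact K \<and> K \<subseteq> \<Omega> \<longrightarrow> integrable (lebesgue_on K) f)"

definition has_weak_gradient ::
    "'a::euclidean_space set \<Rightarrow> ('a \<Rightarrow> real) \<Rightarrow> ('a \<Rightarrow> 'a) \<Rightarrow> bool" where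
  "has_weak_gradient \<Omega> u g \<longleftrightarrow>
     locally_integrable \<Omega> u \<and> locally_integrable \<Omega> g \<and>
     (\<forall>\<phi>. test_function \<Omega> \<phi> \<longrightarrow> (\<forall>b\<in>Basis.
        (\<integral>x. u x * partial_deriv b \<phi> x \<partial>lebesgue_on \<Omega>)
          = - (\<integral>x. (g x \<bullet> b) * \<phi> x \<partial>lebesgue_on \<Omega>)))"

text \<open>Weak gradients are unique only up to null sets; \<open>weak_grad\<close> picks one of them. It is used
  below only inside integrals, which do not depend on the choice.\<close>

definition weak_grad :: "'a::euclidean_space set \<Rightarrow> ('a \<Rightarrow> real) \<Rightarrow> 'a \<Rightarrow> 'a" where
  "weak_grad \<Omega> u = (SOME g. has_weak_gradient \<Omega> u g)"

definition W1p :: "'a::euclidean_space set \<Rightarrow> real \<Rightarrow> ('a \<Rightarrow> real) set" where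
  "W1p \<Omega> p = {u. Lp_mem \<Omega> p u \<and> (\<exists>g. has_weak_gradient \<Omega> u g \<and> Lp_mem \<Omega> p g)}"

definition W1inf :: "'a::euclidean_space set \<Rightarrow> ('a \<Rightarrow> real) set" where
  "W1inf \<Omega> = {u. Linf_mem \<Omega> u \<and> (\<exists>g. has_weak_gradient \<Omega> u g \<and> Linf_mem \<Omega> g)}"

definition W1p_norm :: "'a::euclidean_space set \<Rightarrow> real \<Rightarrow> ('a \<Rightarrow> real) \<Rightarrow> real" where
  "W1p_norm \<Omega> p u = (Lp_norm \<Omega> p u powr p + Lp_norm \<Omega> p (weak_grad \<Omega> u) powr p) powr (1 / p)"

text \<open>The closure of \<open>C\<^sub>c\<^sup>\<infinity>(\<Omega>)\<close> in \<open>W\<^sup>1\<^sup>,\<^sup>p(\<Omega>)\<close>. Elements are represented by functions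
  continuous on \<open>closure \<Omega>\<close>, which for \<open>p > N\<close> selects the unique continuous representative
  of each class; values outside \<open>closure \<Omega>\<close> are irrelevant.\<close>

definition W01p :: "'a::euclidean_space set \<Rightarrow> real \<Rightarrow> ('a \<Rightarrow> real) set" where
  "W01p \<Omega> p = {u \<in> W1p \<Omega> p. continuous_on (closure \<Omega>) u \<and>
     (\<exists>\<phi>. (\<forall>n. test_function \<Omega> (\<phi> n)) \<and>
          (\<lambda>n. W1p_norm \<Omega> p (\<lambda>x. \<phi> n x - u x)) \<longlonglongrightarrow> 0)}"

definition C0_closure :: "'a::euclidean_space set \<Rightarrow> ('a \<Rightarrow> real) set" where
  "C0_closure \<Omega> = {u. continuous_on (closure \<Omega>) u \<and> (\<forall>x\<in>frontier \<Omega>. u x = 0)}"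

text \<open>Weak solutions of \<open>-\<Delta>\<^sub>p v = lam |v|\<^sup>q\<^sup>-\<^sup>2 v\<close> in \<open>\<Omega>\<close> with \<open>v = 0\<close> on the boundary; the boundary
  condition is membership in \<open>W01p\<close>.\<close>

definition weak_solution ::
    "'a::euclidean_space set \<Rightarrow> real \<Rightarrow> real \<Rightarrow> real \<Rightarrow> ('a \<Rightarrow> real) \<Rightarrow> bool" where
  "weak_solution \<Omega> p q lam v \<longleftrightarrow> v \<in> W01p \<Omega> p \<and>
     (\<forall>\<phi>\<in>W01p \<Omega> p.
        (\<integral>x. norm (weak_grad \<Omega> v x) powr (p - 2) * (weak_grad \<Omega> v x \<bullet> weak_grad \<Omega> \<phi> x)
            \<partial>lebesgue_on \<Omega>)
        = lam * (\<integral>x. \<bar>v x\<bar> powr (q - 2) * v x * \<phi> x \<partial>lebesgue_on \<Omega>))"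

definition positive_weak_solution ::
    "'a::euclidean_space set \<Rightarrow> real \<Rightarrow> real \<Rightarrow> real \<Rightarrow> ('a \<Rightarrow> real) \<Rightarrow> bool" where
  "positive_weak_solution \<Omega> p q lam v \<longleftrightarrow> weak_solution \<Omega> p q lam v \<and> (\<forall>x\<in>\<Omega>. v x > 0)"

definition energy ::
    "'a::euclidean_space set \<Rightarrow> real \<Rightarrow> real \<Rightarrow> real \<Rightarrow> ('a \<Rightarrow> real) \<Rightarrow> real" where
  "energy \<Omega> p q lam v =
     1 / p * Lp_norm \<Omega> p (weak_grad \<Omega> v) powr p - lam / q * Lp_norm \<Omega> q v powr q"

definition positive_least_energy_solution ::
    "'a::euclidean_space set \<Rightarrow> real \<Rightarrow> real \<Rightarrow> real \<Rightarrow> ('a \<Rightarrow> real) \<Rightarrow> bool" where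
  "positive_least_energy_solution \<Omega> p q lam v \<longleftrightarrow> positive_weak_solution \<Omega> p q lam v \<and>
     (\<forall>w. positive_weak_solution \<Omega> p q lam w \<longrightarrow> energy \<Omega> p q lam v \<le> energy \<Omega> p q lam w)"

definition infinity_laplacian :: "('a::euclidean_space \<Rightarrow> real) \<Rightarrow> 'a \<Rightarrow> real" where
  "infinity_laplacian \<phi> x = (\<Sum>i\<in>Basis. \<Sum>j\<in>Basis.
     partial_deriv i \<phi> x * partial_deriv j \<phi> x * partial_deriv j (partial_deriv i \<phi>) x)"

definition viscosity_supersolution :: "'a::euclidean_space set \<Rightarrow> ('a \<Rightarrow> real) \<Rightarrow> bool" where
  "viscosity_supersolution D u \<longleftrightarrow> continuous_on D u \<and>
     (\<forall>x0\<in>D. \<forall>r>0. \<forall>\<phi>. ball x0 r \<subseteq> D \<and> Ck_on 2 (ball x0 r) \<phi> \<and>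
        (\<forall>x\<in>ball x0 r - {x0}. \<phi> x - u x < 0) \<and> \<phi> x0 - u x0 = 0
        \<longrightarrow> - infinity_laplacian \<phi> x0 \<ge> 0)"

definition viscosity_subsolution :: "'a::euclidean_space set \<Rightarrow> ('a \<Rightarrow> real) \<Rightarrow> bool" where
  "viscosity_subsolution D u \<longleftrightarrow> continuous_on D u \<and>
     (\<forall>x0\<in>D. \<forall>r>0. \<forall>\<phi>. ball x0 r \<subseteq> D \<and> Ck_on 2 (ball x0 r) \<phi> \<and>
        (\<forall>x\<in>ball x0 r - {x0}. \<phi> x - u x > 0) \<and> \<phi> x0 - u x0 = 0
        \<longrightarrow> - infinity_laplacian \<phi> x0 \<le> 0)"

definition infinity_harmonic :: "'a::euclidean_space set \<Rightarrow> ('a \<Rightarrow> real) \<Rightarrow> bool" where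
  "infinity_harmonic D u \<longleftrightarrow> viscosity_supersolution D u \<and> viscosity_subsolution D u"

definition infinity_dirichlet_solution ::
    "'a::euclidean_space set \<Rightarrow> 'a set \<Rightarrow> real \<Rightarrow> ('a \<Rightarrow> real) \<Rightarrow> bool" where
  "infinity_dirichlet_solution \<Omega> M c v \<longleftrightarrow> continuous_on (closure \<Omega>) v \<and>
     infinity_harmonic (\<Omega> - M) v \<and> (\<forall>x\<in>frontier \<Omega>. v x = 0) \<and> (\<forall>x\<in>M. v x = c)"

definition bdist :: "'a::euclidean_space set \<Rightarrow> 'a \<Rightarrow> real" where
  "bdist \<Omega> x = infdist x (frontier \<Omega>)"

definition max_set :: "'a::euclidean_space set \<Rightarrow> 'a set" where
  "max_set \<Omega> = {x\<in>\<Omega>. bdist \<Omega> x = Linf_norm \<Omega> (bdist \<Omega>)}"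

definition singular_set :: "'a::euclidean_space set \<Rightarrow> 'a set" where
  "singular_set \<Omega> = {x\<in>\<Omega>. \<not> bdist \<Omega> differentiable (at x)}"

end

theory Submission
  imports Defs "HOL-Complex_Analysis.Great_Picard"
begin

text \<open>
  Testing the Rayleigh quotient with smoothed cones shows that a least energy solution for \<open>p\<close> has
  a gradient whose \<open>L\<^sup>p\<close> norm is at most \<open>1 / (\<Theta> R) + o(1)\<close>, where \<open>R\<close> is the inradius of the domain.
  By Morrey's inequality and the Arzela-Ascoli theorem a subsequence converges uniformly, and the
  limit \<open>g\<close> has Lipschitz constant \<open>1 / (\<Theta> R)\<close>; hence \<open>g \<le> d / (\<Theta> R)\<close> for the distance \<open>d\<close> to the
  boundary, and \<open>M = {g = 1 / \<Theta>}\<close> is a closed subset of the maximum set of \<open>d\<close>. Where \<open>g < 1 / \<Theta>\<close> the source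
  term \<open>\<mu>\<^sub>p v\<^sup>q\<^sup>-\<^sup>1\<close> decays faster than every \<open>c\<^sup>p\<close> with \<open>0 < c < 1\<close>, because \<open>q / p \<rightarrow> \<infinity>\<close>. A quadratic
  function with positive \<open>\<Delta>\<^sub>\<infinity>\<close> and nonzero gradient at a point satisfies \<open>\<Delta>\<^sub>p \<ge> c\<^sup>p\<close> on a small ball
  for some such \<open>c\<close> and all large \<open>p\<close>, so comparing it with the solutions shows that \<open>g\<close> and \<open>- g\<close> are viscosity
  supersolutions there.

  If \<open>g\<close> is a multiple of \<open>d\<close>, then \<open>d\<close> is infinity harmonic off \<open>M\<close>, which is impossible at a point with
  two nearest boundary points. Conversely, if \<open>d\<close> is differentiable off its maximum set, then from
  every \<open>x\<close> one can ascend along a steepest path of \<open>d\<close> up to a maximum point at distance \<open>R - d x\<close>,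
  and the Lipschitz bound along this path gives \<open>g x \<ge> d x / (\<Theta> R)\<close>.
\<close>

section \<open>Lebesgue spaces\<close>

text \<open>The energy is compared among positive weak solutions only, so the gradient bound needs a
  genuine positive solution of low energy; a test function does not suffice. This is why a minimiser
  of the Rayleigh quotient, its Euler-Lagrange equation and a strong maximum principle are
  established before any limit is taken. Weak compactness is replaced by convexity: the midpoints of
  a minimising sequence cannot fall much below the infimum, so Clarkson's inequality makes its
  gradients a Cauchy sequence. The same device later extracts a weak gradient of a Lipschitz
  function from difference quotients.

  Membership in \<open>W01p\<close> means approximation by test functions, hence truncations are
  performed on approximants. All comparison is with quadratic functions, whose p-Laplacian is
  explicit where their gradient does not vanish; Hopf's argument and the viscosity limit share one
  comparison lemma. Morrey's inequality keeps the side of its averaging cube free: the slope of the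
  limit must be exactly \<open>1 / (\<Theta> * inrad)\<close>, since a larger constant would not
  place the contact set inside the maximum set of the distance.\<close>

lemma convex_on_powr_nonneg:
  fixes p :: real
  assumes p: "p \<ge> 1"
  shows "convex_on {0..} (\<lambda>x. x powr p)"
proof (rule convex_onI)
  fix t x y :: real
  assume t: "0 < t" "t < 1" and "x \<in> {0..}" "y \<in> {0..}"
  then have xy: "x \<ge> 0" "y \<ge> 0" by auto
  \<comment> \<open>If one argument is 0, convexity reduces to this bound for the weight of the
    other one.\<close>
  have le: "s powr p \<le> s" if "0 < s" "s < 1" for s :: real
    using powr_mono'[of 1 p s] p that by simp
  consider "x = 0" | "y = 0" | "x > 0" "y > 0" using xy by linarith
  then show "((1 - t) *\<^sub>R x + t *\<^sub>R y) powr p \<le> (1 - t) * x powr p + t * y powr p"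
  proof cases
    case 1
    then show ?thesis using t xy le[of t] by (simp add: powr_mult mult_right_mono)
  next
    case 2
    then show ?thesis using t xy le[of "1 - t"] by (simp add: powr_mult mult_right_mono)
  next
    case 3
    then show ?thesis
      using convex_onD[OF powr_convex[OF p], of t x y] t by simp
  qed
qed (simp add: convex_real_interval)

lemma powr_add_le:
  fixes a b p :: real
  assumes "a \<ge> 0" "b \<ge> 0" "p \<ge> 0"
  shows "(a + b) powr p \<le> 2 powr p * (a powr p + b powr p)"
proof -
  have "(a + b) powr p \<le> (2 * max a b) powr p"
    using assms by (intro powr_mono2) auto
  also have "\<dots> = 2 powr p * (max a b) powr p"
    using assms by (simp add: powr_mult)
  also have "\<dots> \<le> 2 powr p * (a powr p + b powr p)"
    by (intro mult_left_mono) (auto simp: max_def)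
  finally show ?thesis .
qed

text \<open>By homogeneity one may divide by \<open>a + b\<close>; on the unit interval
  \<open>x powr s\<close> lies below \<open>x\<close>, and the two fractions add up to 1.\<close>

lemma powr_superadd:
  fixes a b s :: real
  assumes "a \<ge> 0" "b \<ge> 0" "s \<ge> 1"
  shows "a powr s + b powr s \<le> (a + b) powr s"
proof (cases "a + b = 0")
  case True
  then have "a = 0" "b = 0" using assms by auto
  then show ?thesis by simp
next
  case False
  then have pos: "a + b > 0" using assms by simp
  have *: "(x / (a + b)) powr s \<le> x / (a + b)" if "0 \<le> x" "x \<le> a + b" for x
    using powr_mono'[of 1 s "x / (a + b)"] assms that pos by (cases "x = 0") auto
  have "(a / (a + b)) powr s + (b / (a + b)) powr s \<le> a / (a + b) + b / (a + b)"
    using *[of a] *[of b] assms by auto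
  also have "\<dots> = 1" using pos by (simp add: add_divide_distrib[symmetric])
  finally show ?thesis
    using pos assms by (simp add: powr_divide field_simps)
qed

text \<open>The parallelogram law settles the squares. Since \<open>p / 2 \<ge> 1\<close>, the
  function \<open>t powr (p / 2)\<close> is superadditive, which collects the left side into one
  power, and convex, which then splits that power. The term in \<open>a - b\<close> is what later
  makes almost optimal sequences Cauchy.\<close>

lemma Clarkson_pointwise:
  fixes a b :: "'b::real_inner" and p :: real
  assumes p: "p \<ge> 2"
  shows "norm ((a + b) /\<^sub>R 2) powr p + norm ((a - b) /\<^sub>R 2) powr p
    \<le> (norm a powr p + norm b powr p) / 2"
proof -
  have sq: "x powr p = (x\<^sup>2) powr (p / 2)" if "x \<ge> 0" for x :: real
    using that powr_powr[of x 2 "p / 2"] by simp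
  have par: "(norm ((a + b) /\<^sub>R 2))\<^sup>2 + (norm ((a - b) /\<^sub>R 2))\<^sup>2 = ((norm a)\<^sup>2 + (norm b)\<^sup>2) / 2"
    by (simp add: power2_norm_eq_inner inner_simps inner_commute algebra_simps)
  have "norm ((a + b) /\<^sub>R 2) powr p + norm ((a - b) /\<^sub>R 2) powr p
      \<le> ((norm ((a + b) /\<^sub>R 2))\<^sup>2 + (norm ((a - b) /\<^sub>R 2))\<^sup>2) powr (p / 2)"
    unfolding sq[OF norm_ge_zero] using p by (intro powr_superadd) auto
  also have "\<dots> = ((1 - 1/2) *\<^sub>R (norm a)\<^sup>2 + (1/2) *\<^sub>R (norm b)\<^sup>2) powr (p / 2)"
    unfolding par by (simp add: field_simps)
  also have "\<dots> \<le> (1 - 1/2) * ((norm a)\<^sup>2) powr (p/2) + (1/2) * ((norm b)\<^sup>2) powr (p/2)"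
    using convex_onD[OF convex_on_powr_nonneg[of "p/2"], of "1/2" "(norm a)\<^sup>2" "(norm b)\<^sup>2"] p by simp
  also have "\<dots> = (norm a powr p + norm b powr p) / 2"
    by (simp add: sq)
  finally show ?thesis .
qed

section \<open>Rules for membership in L^p and for the norm; Minkowski's and Hoelder's
  inequalities\<close>

lemma Lp_mem_measurable: "Lp_mem \<Omega> p f \<Longrightarrow> f \<in> borel_measurable (lebesgue_on \<Omega>)"
  by (simp add: Lp_mem_def)

lemma Lp_mem_integrable: "Lp_mem \<Omega> p f \<Longrightarrow> integrable (lebesgue_on \<Omega>) (\<lambda>x. norm (f x) powr p)"
  by (simp add: Lp_mem_def)

lemma Lp_memI:
  assumes "f \<in> borel_measurable (lebesgue_on \<Omega>)" "integrable (lebesgue_on \<Omega>) h"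
    "AE x in lebesgue_on \<Omega>. norm (f x) powr p \<le> h x"
  shows "Lp_mem \<Omega> p f"
  unfolding Lp_mem_def
proof
  have [measurable]: "f \<in> borel_measurable (lebesgue_on \<Omega>)" by fact
  have m: "(\<lambda>x. norm (f x) powr p) \<in> borel_measurable (lebesgue_on \<Omega>)" by measurable
  show "integrable (lebesgue_on \<Omega>) (\<lambda>x. norm (f x) powr p)"
    by (rule Bochner_Integration.integrable_bound[OF assms(2) m]) (use assms(3) in auto)
qed fact

lemma Lp_mem_dominated:
  assumes "f \<in> borel_measurable (lebesgue_on \<Omega>)" "Lp_mem \<Omega> p g" "p \<ge> 0"
    "AE x in lebesgue_on \<Omega>. norm (f x) \<le> norm (g x)"
  shows "Lp_mem \<Omega> p f"
  by (rule Lp_memI[OF assms(1) Lp_mem_integrable[OF assms(2)]])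
     (use assms(3,4) in \<open>auto elim!: eventually_mono intro: powr_mono2\<close>)

lemma Lp_mem_add:
  assumes "Lp_mem \<Omega> p f" "Lp_mem \<Omega> p g" "p \<ge> 0"
  shows "Lp_mem \<Omega> p (\<lambda>x. f x + g x)"
proof -
  have [measurable]: "f \<in> borel_measurable (lebesgue_on \<Omega>)" "g \<in> borel_measurable (lebesgue_on \<Omega>)"
    using assms by (auto simp: Lp_mem_def)
  show ?thesis
  proof (rule Lp_memI)
    show "integrable (lebesgue_on \<Omega>) (\<lambda>x. 2 powr p * (norm (f x) powr p + norm (g x) powr p))"
      using assms by (auto simp: Lp_mem_def)
    have "norm (f x + g x) powr p \<le> 2 powr p * (norm (f x) powr p + norm (g x) powr p)" for x
      using powr_add_le[of "norm (f x)" "norm (g x)" p] assms(3)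
        powr_mono2[OF assms(3) norm_ge_zero norm_triangle_ineq[of "f x" "g x"]] by auto
    then show "AE x in lebesgue_on \<Omega>. norm (f x + g x) powr p \<le> 2 powr p * (norm (f x) powr p + norm (g x) powr p)"
      by auto
  qed measurable
qed

lemma Lp_mem_scale:
  assumes "Lp_mem \<Omega> p f"
  shows "Lp_mem \<Omega> p (\<lambda>x. c *\<^sub>R f x)"
  using assms unfolding Lp_mem_def by (auto simp: powr_mult)

lemma Lp_mem_diff:
  assumes "Lp_mem \<Omega> p f" "Lp_mem \<Omega> p g" "p \<ge> 0"
  shows "Lp_mem \<Omega> p (\<lambda>x. f x - g x)"
  using Lp_mem_add[OF assms(1) Lp_mem_scale[OF assms(2), of "-1"] assms(3)] by simp

lemma Lp_mem_norm: "Lp_mem \<Omega> p f \<Longrightarrow> Lp_mem \<Omega> p (\<lambda>x. norm (f x))"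
  by (auto simp: Lp_mem_def)

lemma Lp_mem_cong_AE:
  assumes "Lp_mem \<Omega> p f" "g \<in> borel_measurable (lebesgue_on \<Omega>)" "AE x in lebesgue_on \<Omega>. f x = g x"
  shows "Lp_mem \<Omega> p g"
  by (rule Lp_memI[OF assms(2) Lp_mem_integrable[OF assms(1)]]) (use assms(3) in auto)

lemma Lp_mem_bounded:
  assumes "\<Omega> \<in> lmeasurable" "f \<in> borel_measurable (lebesgue_on \<Omega>)"
    "\<And>x. x \<in> \<Omega> \<Longrightarrow> norm (f x) \<le> B" "p \<ge> 0"
  shows "Lp_mem \<Omega> p f"
proof (rule Lp_memI[OF assms(2)])
  interpret finite_measure "lebesgue_on \<Omega>" using assms(1) by (rule finite_measure_lebesgue_on)
  show "integrable (lebesgue_on \<Omega>) (\<lambda>x. B powr p)" by simp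
  show "AE x in lebesgue_on \<Omega>. norm (f x) powr p \<le> B powr p"
    using assms(3,4) by (intro AE_I2) (auto simp: powr_mono2)
qed

lemma Lp_norm_nonneg [simp]: "Lp_norm \<Omega> p f \<ge> 0"
  by (simp add: Lp_norm_def)

lemma Lp_norm_powr: "p > 0 \<Longrightarrow> Lp_norm \<Omega> p f powr p = (\<integral>x. norm (f x) powr p \<partial>lebesgue_on \<Omega>)"
  by (simp add: Lp_norm_def powr_powr)

lemma Lp_norm_le_iff:
  assumes "p > 0" "c \<ge> 0"
  shows "Lp_norm \<Omega> p f \<le> c \<longleftrightarrow> (\<integral>x. norm (f x) powr p \<partial>lebesgue_on \<Omega>) \<le> c powr p"
  using powr_mono2[of p "Lp_norm \<Omega> p f" c] powr_less_mono2[of p c "Lp_norm \<Omega> p f"] assms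
  by (metis Lp_norm_nonneg Lp_norm_powr less_eq_real_def linorder_not_le)

lemma Lp_norm_scale:
  assumes "p > 0"
  shows "Lp_norm \<Omega> p (\<lambda>x. c *\<^sub>R f x) = \<bar>c\<bar> * Lp_norm \<Omega> p f"
  using assms by (simp add: Lp_norm_def powr_mult powr_powr)

lemma Lp_norm_minus_commute: "Lp_norm \<Omega> p (\<lambda>x. f x - g x) = Lp_norm \<Omega> p (\<lambda>x. g x - f x)"
  by (simp add: Lp_norm_def norm_minus_commute)

lemma Lp_norm_cong_AE:
  assumes "f \<in> borel_measurable (lebesgue_on \<Omega>)" "g \<in> borel_measurable (lebesgue_on \<Omega>)"
    "AE x in lebesgue_on \<Omega>. norm (f x) = norm (g x)"
  shows "Lp_norm \<Omega> p f = Lp_norm \<Omega> p g"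
proof -
  have [measurable]: "f \<in> borel_measurable (lebesgue_on \<Omega>)" "g \<in> borel_measurable (lebesgue_on \<Omega>)"
    using assms by auto
  have "(\<integral>x. norm (f x) powr p \<partial>lebesgue_on \<Omega>) = (\<integral>x. norm (g x) powr p \<partial>lebesgue_on \<Omega>)"
    by (rule integral_cong_AE) (use assms(3) in auto)
  then show ?thesis by (simp add: Lp_norm_def)
qed

lemma Lp_norm_mono_AE:
  assumes "f \<in> borel_measurable (lebesgue_on \<Omega>)" "Lp_mem \<Omega> p g" "p > 0"
    "AE x in lebesgue_on \<Omega>. norm (f x) \<le> norm (g x)"
  shows "Lp_norm \<Omega> p f \<le> Lp_norm \<Omega> p g"
  unfolding Lp_norm_def
proof (rule powr_mono2)
  have "Lp_mem \<Omega> p f" using Lp_mem_dominated[OF assms(1,2) _ assms(4)] assms(3) by simp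
  then show "(\<integral>x. norm (f x) powr p \<partial>lebesgue_on \<Omega>) \<le> (\<integral>x. norm (g x) powr p \<partial>lebesgue_on \<Omega>)"
    using assms by (intro integral_mono_AE) (auto simp: Lp_mem_def elim!: eventually_mono intro: powr_mono2)
qed (use assms in auto)

lemma Lp_norm_eq_0D:
  assumes "Lp_mem \<Omega> p f" "Lp_norm \<Omega> p f = 0" "p > 0"
  shows "AE x in lebesgue_on \<Omega>. f x = 0"
proof -
  have "(\<integral>x. norm (f x) powr p \<partial>lebesgue_on \<Omega>) = 0"
    using Lp_norm_powr[OF assms(3), of \<Omega> f] assms(2) by simp
  then have "AE x in lebesgue_on \<Omega>. norm (f x) powr p = 0"
    using integral_nonneg_eq_0_iff_AE[OF Lp_mem_integrable[OF assms(1)]] by simp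
  then show ?thesis by auto
qed

text \<open>Minkowski's inequality from convexity alone: after normalising \<open>f\<close> by
  \<open>A\<close> and \<open>g\<close> by \<open>B\<close>, the sum divided by \<open>A + B\<close>
  is a convex combination with weights proportional to \<open>A\<close> and
  \<open>B\<close>.\<close>

lemma Lp_norm_triangle:
  fixes f g :: "'a::euclidean_space \<Rightarrow> 'b::euclidean_space"
  assumes f: "Lp_mem \<Omega> p f" and g: "Lp_mem \<Omega> p g" and p: "p \<ge> 1"
  shows "Lp_norm \<Omega> p (\<lambda>x. f x + g x) \<le> Lp_norm \<Omega> p f + Lp_norm \<Omega> p g"
proof (rule field_le_epsilon)
  fix e :: real assume "e > 0"
  \<comment> \<open>The added \<open>e / 2\<close> keeps both normalising constants positive when a
    norm vanishes.\<close>
  define A where "A = Lp_norm \<Omega> p f + e / 2"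
  define B where "B = Lp_norm \<Omega> p g + e / 2"
  have AB: "A > 0" "B > 0" using \<open>e > 0\<close> by (auto simp: A_def B_def add_nonneg_pos)
  have fA: "(\<integral>x. norm (f x) powr p \<partial>lebesgue_on \<Omega>) \<le> A powr p"
    using Lp_norm_le_iff[of p A \<Omega> f] p AB \<open>e > 0\<close> by (simp add: A_def)
  have gB: "(\<integral>x. norm (g x) powr p \<partial>lebesgue_on \<Omega>) \<le> B powr p"
    using Lp_norm_le_iff[of p B \<Omega> g] p AB \<open>e > 0\<close> by (simp add: B_def)
  define h where "h x = (A + B) powr p * (A / (A + B) * (norm (f x) powr p / A powr p)
      + B / (A + B) * (norm (g x) powr p / B powr p))" for x
  have le: "norm (f x + g x) powr p \<le> h x" for x
  proof -
    have "norm (f x + g x) powr p \<le> (norm (f x) + norm (g x)) powr p"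
      using p by (intro powr_mono2) (auto simp: norm_triangle_ineq)
    also have "norm (f x) + norm (g x) = (A + B) * ((1 - B / (A + B)) *\<^sub>R (norm (f x) / A)
        + (B / (A + B)) *\<^sub>R (norm (g x) / B))"
    proof -
      have "1 - B / (A + B) = A / (A + B)" using AB by (simp add: field_simps)
      then show ?thesis using AB by (simp add: distrib_left)
    qed
    also have "\<dots> powr p = (A + B) powr p * (((1 - B / (A + B)) *\<^sub>R (norm (f x) / A)
        + (B / (A + B)) *\<^sub>R (norm (g x) / B)) powr p)"
      using AB by (simp add: powr_mult)
    also have "\<dots> \<le> (A + B) powr p * ((1 - B / (A + B)) * (norm (f x) / A) powr p
        + (B / (A + B)) * (norm (g x) / B) powr p)"
      using AB by (intro mult_left_mono convex_onD[OF convex_on_powr_nonneg[OF p]]) auto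
    also have "1 - B / (A + B) = A / (A + B)" using AB by (simp add: field_simps)
    finally show ?thesis using AB by (simp add: h_def powr_divide)
  qed
  have ih: "integrable (lebesgue_on \<Omega>) h"
    unfolding h_def using Lp_mem_integrable[OF f] Lp_mem_integrable[OF g] by auto
  have "(\<integral>x. norm (f x + g x) powr p \<partial>lebesgue_on \<Omega>) \<le> (\<integral>x. h x \<partial>lebesgue_on \<Omega>)"
    using Lp_mem_add[OF f g] p le ih by (intro integral_mono) (auto simp: Lp_mem_def)
  also have "\<dots> = (A + B) powr p * (A / (A + B) * ((\<integral>x. norm (f x) powr p \<partial>lebesgue_on \<Omega>) / A powr p)
      + B / (A + B) * ((\<integral>x. norm (g x) powr p \<partial>lebesgue_on \<Omega>) / B powr p))"
    unfolding h_def using Lp_mem_integrable[OF f] Lp_mem_integrable[OF g] by simp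
  also have "\<dots> \<le> (A + B) powr p * (A / (A + B) * 1 + B / (A + B) * 1)"
    using AB fA gB by (intro mult_left_mono add_mono) (auto simp: field_simps)
  also have "\<dots> = (A + B) powr p" using AB by (simp add: add_divide_distrib[symmetric])
  finally have "Lp_norm \<Omega> p (\<lambda>x. f x + g x) \<le> A + B"
    using Lp_norm_le_iff[of p "A + B" \<Omega> "\<lambda>x. f x + g x"] AB p by simp
  then show "Lp_norm \<Omega> p (\<lambda>x. f x + g x) \<le> Lp_norm \<Omega> p f + Lp_norm \<Omega> p g + e"
    by (simp add: A_def B_def)
qed

lemma Lp_norm_triangle_diff:
  fixes f g h :: "'a::euclidean_space \<Rightarrow> 'b::euclidean_space"
  assumes "Lp_mem \<Omega> p f" "Lp_mem \<Omega> p g" "Lp_mem \<Omega> p h" "p \<ge> 1"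
  shows "Lp_norm \<Omega> p (\<lambda>x. f x - h x) \<le> Lp_norm \<Omega> p (\<lambda>x. f x - g x) + Lp_norm \<Omega> p (\<lambda>x. g x - h x)"
  using Lp_norm_triangle[OF Lp_mem_diff[OF assms(1,2)] Lp_mem_diff[OF assms(2,3)] assms(4)] assms(4) by simp

lemma Lp_norm_le_add_diff:
  fixes f g :: "'a::euclidean_space \<Rightarrow> 'b::euclidean_space"
  assumes "Lp_mem \<Omega> p f" "Lp_mem \<Omega> p g" "p \<ge> 1"
  shows "Lp_norm \<Omega> p f \<le> Lp_norm \<Omega> p g + Lp_norm \<Omega> p (\<lambda>x. f x - g x)"
  using Lp_norm_triangle[OF assms(2) Lp_mem_diff[OF assms(1,2)] assms(3)] assms(3) by simp

lemma Lp_norm_tendsto: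
  fixes f :: "nat \<Rightarrow> 'a::euclidean_space \<Rightarrow> 'b::euclidean_space"
  assumes f: "\<And>n. Lp_mem \<Omega> p (f n)" and g: "Lp_mem \<Omega> p g" and p: "p \<ge> 1"
    and lim: "(\<lambda>n. Lp_norm \<Omega> p (\<lambda>x. f n x - g x)) \<longlonglongrightarrow> 0"
  shows "(\<lambda>n. Lp_norm \<Omega> p (f n)) \<longlonglongrightarrow> Lp_norm \<Omega> p g"
proof (rule LIM_zero_cancel, rule tendsto_rabs_zero_cancel, rule tendsto_sandwich[OF _ _ tendsto_const lim])
  show "\<forall>\<^sub>F n in sequentially. \<bar>Lp_norm \<Omega> p (f n) - Lp_norm \<Omega> p g\<bar> \<le> Lp_norm \<Omega> p (\<lambda>x. f n x - g x)"
  proof (rule always_eventually, rule allI)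
    fix n
    show "\<bar>Lp_norm \<Omega> p (f n) - Lp_norm \<Omega> p g\<bar> \<le> Lp_norm \<Omega> p (\<lambda>x. f n x - g x)"
      using Lp_norm_le_add_diff[OF f[of n] g p] Lp_norm_le_add_diff[OF g f[of n] p]
        Lp_norm_minus_commute[of \<Omega> p "f n" g] by auto
  qed
qed auto

lemma Lp_integrable:
  assumes \<Omega>: "\<Omega> \<in> lmeasurable" and f: "Lp_mem \<Omega> p f" and p: "p \<ge> 1"
  shows "integrable (lebesgue_on \<Omega>) f"
proof -
  interpret finite_measure "lebesgue_on \<Omega>" using \<Omega> by (rule finite_measure_lebesgue_on)
  have "x \<le> 1 + x powr p" if "x \<ge> 0" for x :: real
  proof (cases "x \<le> 1")
    case False
    then show ?thesis using powr_mono[of 1 p x] p by simp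
  qed (simp add: add_increasing2)
  then show ?thesis
    by (intro Bochner_Integration.integrable_bound[of _ "\<lambda>x. 1 + norm (f x) powr p" f])
       (use f in \<open>auto simp: Lp_mem_def\<close>)
qed

text \<open>Hoelder's inequality against the constant 1, obtained by integrating Young's inequality
  at a suitable scale.\<close>

lemma Lp_Hoelder:
  assumes \<Omega>: "\<Omega> \<in> lmeasurable" and f: "Lp_mem \<Omega> p f" and p: "p > 1"
  shows "(\<integral>x. norm (f x) \<partial>lebesgue_on \<Omega>) \<le> measure lebesgue \<Omega> powr (1 - 1 / p) * Lp_norm \<Omega> p f"
proof -
  interpret finite_measure "lebesgue_on \<Omega>" using \<Omega> by (rule finite_measure_lebesgue_on)
  define m where "m = measure lebesgue \<Omega>"
  have m': "measure (lebesgue_on \<Omega>) (space (lebesgue_on \<Omega>)) = m"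
    using \<Omega> by (simp add: m_def measure_restrict_space)
  have int: "integrable (lebesgue_on \<Omega>) (\<lambda>x. norm (f x))"
    using Lp_integrable[OF \<Omega> f] p by simp
  define A where "A = Lp_norm \<Omega> p f"
  show ?thesis
  proof (cases "A = 0 \<or> m = 0")
    case True
    have "AE x in lebesgue_on \<Omega>. f x = 0"
    proof (cases "A = 0")
      case True
      then show ?thesis using Lp_norm_eq_0D[OF f] p by (simp add: A_def)
    next
      case False
      then have "m = 0" using True by simp
      then have "emeasure (lebesgue_on \<Omega>) (space (lebesgue_on \<Omega>)) = 0"
        using m' by (simp add: emeasure_eq_measure)
      then show ?thesis by (auto intro: AE_I[where N = "space (lebesgue_on \<Omega>)"])
    qed
    then have "(\<integral>x. norm (f x) \<partial>lebesgue_on \<Omega>) = 0"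
      by (intro integral_eq_zero_AE) auto
    then show ?thesis by simp
  next
    case False
    then have A: "A > 0" and m: "m > 0" by (auto simp: A_def m_def zero_less_measure_iff less_le)
    \<comment> \<open>The p-th power mean of the norm of \<open>f\<close>. At this scale the
      integrated Young bound collapses to \<open>l * m\<close>, which is the claim.\<close>
    define l where "l = A * m powr (- 1 / p)"
    have l: "l > 0" using A m by (simp add: l_def)
    have lp: "l powr p = A powr p / m"
      proof -
      have "(m powr (- 1 / p)) powr p = m powr (-1)" using p by (simp add: powr_powr)
      then show ?thesis using A m by (simp add: l_def powr_mult powr_minus divide_inverse)
    qed
    have Ap: "A powr p = (\<integral>x. norm (f x) powr p \<partial>lebesgue_on \<Omega>)"
      unfolding A_def using p by (intro Lp_norm_powr) simp
    have le: "norm (f x) \<le> l * (norm (f x) powr p / (l powr p) / p + (1 - 1 / p))" for x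
    proof -
      have "(norm (f x) / l) * 1 \<le> (norm (f x) / l) powr p / p + 1 powr (p / (p - 1)) / (p / (p - 1))"
        using p l by (intro Youngs_inequality) (auto simp: field_simps)
      then show ?thesis using l p by (simp add: powr_divide field_simps)
    qed
    have "(\<integral>x. norm (f x) \<partial>lebesgue_on \<Omega>)
        \<le> (\<integral>x. l * (norm (f x) powr p / (l powr p) / p + (1 - 1 / p)) \<partial>lebesgue_on \<Omega>)"
      using int le Lp_mem_integrable[OF f] by (intro integral_mono) auto
    also have "\<dots> = l * (A powr p / (l powr p) / p + m * (1 - 1 / p))"
      unfolding Ap using Lp_mem_integrable[OF f] m' by simp
    also have "A powr p / l powr p = m" using A m l by (simp add: lp)
    also have "l * (m / p + m * (1 - 1 / p)) = l * m" using p by (simp add: field_simps)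
    also have "\<dots> = m powr (1 - 1 / p) * A"
      using m by (simp add: l_def powr_diff powr_minus_divide)
    finally show ?thesis by (simp add: A_def m_def)
  qed
qed

section \<open>Convergence and completeness in L^p\<close>

lemma Lp_AE_subseq:
  assumes f: "\<And>n. Lp_mem \<Omega> p (f n)" and g: "Lp_mem \<Omega> p g" and p: "p > 0"
    and lim: "(\<lambda>n. Lp_norm \<Omega> p (\<lambda>x. f n x - g x)) \<longlonglongrightarrow> 0"
  shows "\<exists>r::nat\<Rightarrow>nat. strict_mono r \<and> (AE x in lebesgue_on \<Omega>. (\<lambda>n. f (r n) x) \<longlonglongrightarrow> g x)"
proof -
  have "(\<lambda>n. Lp_norm \<Omega> p (\<lambda>x. f n x - g x) powr p) \<longlonglongrightarrow> 0 powr p"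
    using p by (intro tendsto_powr2 lim tendsto_const) auto
  then have "(\<lambda>n. \<integral>x. norm (norm (f n x - g x) powr p) \<partial>lebesgue_on \<Omega>) \<longlonglongrightarrow> 0"
    using p by (simp add: Lp_norm_powr)
  moreover have "integrable (lebesgue_on \<Omega>) (\<lambda>x. norm (f n x - g x) powr p)" for n
    using Lp_mem_diff[OF f g] p by (simp add: Lp_mem_def)
  ultimately obtain r :: "nat \<Rightarrow> nat" where r: "strict_mono r"
    and ae: "AE x in lebesgue_on \<Omega>. (\<lambda>n. norm (f (r n) x - g x) powr p) \<longlonglongrightarrow> 0"
    using tendsto_L1_AE_subseq[of "lebesgue_on \<Omega>" "\<lambda>n x. norm (f n x - g x) powr p"] by blast
  have "AE x in lebesgue_on \<Omega>. (\<lambda>n. f (r n) x) \<longlonglongrightarrow> g x"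
    using ae
  proof eventually_elim
    case (elim x)
    have "(\<lambda>n. (norm (f (r n) x - g x) powr p) powr (1 / p)) \<longlonglongrightarrow> 0 powr (1 / p)"
      using p by (intro tendsto_powr2 elim tendsto_const) auto
    then have "(\<lambda>n. norm (f (r n) x - g x)) \<longlonglongrightarrow> 0" using p by (simp add: powr_powr)
    then show ?case by (rule LIM_zero_cancel[OF tendsto_norm_zero_cancel])
  qed
  with r show ?thesis by blast
qed

lemma Lp_dominated_convergence:
  fixes f :: "nat \<Rightarrow> 'a::euclidean_space \<Rightarrow> 'b::euclidean_space"
  assumes f: "\<And>n. f n \<in> borel_measurable (lebesgue_on \<Omega>)" and p: "p > 0"
    and h: "integrable (lebesgue_on \<Omega>) (\<lambda>x. norm (h x) powr p)"
    and dom: "\<And>n. AE x in lebesgue_on \<Omega>. norm (f n x) \<le> norm (h x)"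
    and lim: "AE x in lebesgue_on \<Omega>. (\<lambda>n. f n x) \<longlonglongrightarrow> 0"
  shows "(\<lambda>n. Lp_norm \<Omega> p (f n)) \<longlonglongrightarrow> 0"
proof -
  have [measurable]: "f n \<in> borel_measurable (lebesgue_on \<Omega>)" for n by fact
  have "(\<lambda>n. \<integral>x. norm (f n x) powr p \<partial>lebesgue_on \<Omega>) \<longlonglongrightarrow> (\<integral>x. 0 \<partial>lebesgue_on \<Omega>)"
  proof (rule integral_dominated_convergence[OF _ _ h])
    show "AE x in lebesgue_on \<Omega>. (\<lambda>n. norm (f n x) powr p) \<longlonglongrightarrow> 0"
      using lim
    proof eventually_elim
      case (elim x)
      have "(\<lambda>n. norm (f n x) powr p) \<longlonglongrightarrow> 0 powr p"
        using p by (intro tendsto_powr2 tendsto_norm_zero elim tendsto_const) auto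
      then show ?case by simp
    qed
    show "AE x in lebesgue_on \<Omega>. norm (norm (f n x) powr p) \<le> norm (h x) powr p" for n
      using dom[of n] p by (auto elim!: eventually_mono intro: powr_mono2)
  qed measurable
  then have "(\<lambda>n. (\<integral>x. norm (f n x) powr p \<partial>lebesgue_on \<Omega>) powr (1 / p)) \<longlonglongrightarrow> 0 powr (1 / p)"
    using p by (intro tendsto_powr2 tendsto_const) auto
  then show ?thesis by (simp add: Lp_norm_def)
qed

text \<open>The Riesz-Fischer argument. A subsequence has geometrically small increments in L^p,
  hence by Hoelder on the finite measure space also in L^1, so the increments are absolutely
  summable almost everywhere. Fatou's lemma upgrades the pointwise limit to a limit in norm.\<close>

lemma Lp_complete:
  fixes f :: "nat \<Rightarrow> 'a::euclidean_space \<Rightarrow> 'b::euclidean_space"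
  assumes \<Omega>: "\<Omega> \<in> lmeasurable" and f: "\<And>n. Lp_mem \<Omega> p (f n)" and p: "p > 1"
    and cauchy: "\<And>e. e > 0 \<Longrightarrow> \<exists>N. \<forall>m\<ge>N. \<forall>n\<ge>N. Lp_norm \<Omega> p (\<lambda>x. f m x - f n x) < e"
  shows "\<exists>g. Lp_mem \<Omega> p g \<and> (\<lambda>n. Lp_norm \<Omega> p (\<lambda>x. f n x - g x)) \<longlonglongrightarrow> 0"
proof -
  let ?M = "lebesgue_on \<Omega>"
  have [measurable]: "f n \<in> borel_measurable ?M" for n using f by (simp add: Lp_mem_def)
  have "\<exists>N. \<forall>m\<ge>N. \<forall>n\<ge>N. Lp_norm \<Omega> p (\<lambda>x. f m x - f n x) < (1/2)^k" for k :: nat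
    by (rule cauchy) simp
  then obtain N where N: "\<And>k m n. m \<ge> N k \<Longrightarrow> n \<ge> N k \<Longrightarrow> Lp_norm \<Omega> p (\<lambda>x. f m x - f n x) < (1/2)^k"
    by metis
  \<comment> \<open>The sum dominates \<open>N k\<close> and makes \<open>r\<close> monotone; the
    summand \<open>k\<close> lets \<open>r\<close> pass every threshold.\<close>
  define r where "r k = (\<Sum>i\<le>k. N i) + k" for k
  have rN: "r k \<ge> N k" for k
    unfolding r_def by (meson finite_atMost atMost_iff le_add1 le_refl le_trans member_le_sum zero_le)
  have rS: "r (Suc k) \<ge> r k" for k by (simp add: r_def)
  have rk: "r k \<ge> k" for k by (simp add: r_def)
  define C where "C = measure lebesgue \<Omega> powr (1 - 1 / p)"
  have C: "C \<ge> 0" by (simp add: C_def)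
  define d where "d k x = f (r (Suc k)) x - f (r k) x" for k x
  have dL: "Lp_mem \<Omega> p (d k)" for k
    unfolding d_def using f p by (intro Lp_mem_diff) auto
  have [measurable]: "d k \<in> borel_measurable ?M" for k using dL by (simp add: Lp_mem_def)
  have dI: "integrable ?M (d k)" for k using Lp_integrable[OF \<Omega> dL] p by simp
  have dn: "(\<integral>x. norm (d k x) \<partial>?M) \<le> C * (1/2)^k" for k
  proof -
    have "Lp_norm \<Omega> p (d k) \<le> (1/2)^k"
      unfolding d_def using N[of k "r (Suc k)" "r k"] rN[of k] rS[of k] by simp
    then show ?thesis
      using Lp_Hoelder[OF \<Omega> dL[of k] p] C mult_left_mono[of "Lp_norm \<Omega> p (d k)" "(1/2)^k" C] by (simp add: C_def)
  qed
  have "(\<integral>\<^sup>+x. (\<Sum>k. ennreal (norm (d k x))) \<partial>?M) = (\<Sum>k. \<integral>\<^sup>+x. ennreal (norm (d k x)) \<partial>?M)"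
    by (rule nn_integral_suminf) measurable
  also have "\<dots> \<le> (\<Sum>k. ennreal (C * (1/2)^k))"
  proof (rule suminf_le)
    show "(\<integral>\<^sup>+x. ennreal (norm (d k x)) \<partial>?M) \<le> ennreal (C * (1/2)^k)" for k
      using dn[of k] dI[of k] by (subst nn_integral_eq_integral) (auto intro: ennreal_leI)
  qed auto
  also have "\<dots> = ennreal (\<Sum>k. C * (1/2)^k)"
    using C by (intro suminf_ennreal2) (auto intro: summable_mult summable_geometric)
  also have "\<dots> < \<infinity>" by simp
  finally have "AE x in ?M. (\<Sum>k. ennreal (norm (d k x))) \<noteq> \<infinity>"
    by (intro nn_integral_PInf_AE) auto
  then have conv: "AE x in ?M. convergent (\<lambda>k. f (r k) x)"
  proof eventually_elim
    case (elim x)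
    then have "summable (\<lambda>k. norm (d k x))"
      by (intro summable_suminf_not_top) auto
    then have "summable (\<lambda>k. d k x)" by (rule summable_norm_cancel)
    then have "convergent (\<lambda>n. \<Sum>k<n. d k x)" by (simp add: summable_iff_convergent)
    moreover have "(\<Sum>k<n. d k x) = f (r n) x - f (r 0) x" for n
      unfolding d_def by (rule sum_lessThan_telescope)
    ultimately have "convergent (\<lambda>n. (f (r n) x - f (r 0) x) + f (r 0) x)"
      by (intro convergent_add convergent_const) simp
    then show ?case by simp
  qed
  define g where "g x = lim (\<lambda>k. f (r k) x)" for x
  have [measurable]: "g \<in> borel_measurable ?M" unfolding g_def by measurable
  have glim: "AE x in ?M. (\<lambda>k. f (r k) x) \<longlonglongrightarrow> g x"
    using conv by eventually_elim (simp add: g_def convergent_LIMSEQ_iff)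
  \<comment> \<open>Fatou along the subsequence: the Cauchy bound between \<open>f n\<close> and
    late terms survives when these are replaced by their limit.\<close>
  have key: "integrable ?M (\<lambda>x. norm (f n x - g x) powr p) \<and> Lp_norm \<Omega> p (\<lambda>x. f n x - g x) \<le> e"
    if e: "e > 0" and n: "n \<ge> N0" and N0: "\<forall>m\<ge>N0. \<forall>n\<ge>N0. Lp_norm \<Omega> p (\<lambda>x. f m x - f n x) < e" for e n N0
  proof -
    have fat: "(\<integral>\<^sup>+x. ennreal (norm (f n x - g x) powr p) \<partial>?M) \<le> ennreal (e powr p)"
    proof -
      have "(\<integral>\<^sup>+x. ennreal (norm (f n x - g x) powr p) \<partial>?M)
          = (\<integral>\<^sup>+x. liminf (\<lambda>k. ennreal (norm (f n x - f (r k) x) powr p)) \<partial>?M)"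
      proof (rule nn_integral_cong_AE)
        show "AE x in ?M. ennreal (norm (f n x - g x) powr p) = liminf (\<lambda>k. ennreal (norm (f n x - f (r k) x) powr p))"
          using glim
        proof eventually_elim
          case (elim x)
          have "(\<lambda>k. ennreal (norm (f n x - f (r k) x) powr p)) \<longlonglongrightarrow> ennreal (norm (f n x - g x) powr p)"
            using p by (intro tendsto_ennrealI tendsto_powr2 tendsto_norm tendsto_diff tendsto_const elim) auto
          then show ?case using lim_imp_Liminf[OF sequentially_bot] by metis
        qed
      qed
      also have "\<dots> \<le> liminf (\<lambda>k. \<integral>\<^sup>+x. ennreal (norm (f n x - f (r k) x) powr p) \<partial>?M)"
        by (rule nn_integral_liminf) measurable
      also have "\<dots> \<le> ennreal (e powr p)"
      proof (rule Liminf_le)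
        show "\<forall>\<^sub>F k in sequentially. (\<integral>\<^sup>+x. ennreal (norm (f n x - f (r k) x) powr p) \<partial>?M) \<le> ennreal (e powr p)"
          using eventually_ge_at_top[of N0]
        proof eventually_elim
          case (elim k)
          then have "r k \<ge> N0" using rk[of k] by simp
          then have "Lp_norm \<Omega> p (\<lambda>x. f n x - f (r k) x) \<le> e" using N0 n by fastforce
          then have "(\<integral>x. norm (f n x - f (r k) x) powr p \<partial>?M) \<le> e powr p"
            using Lp_norm_le_iff[of p e \<Omega> "\<lambda>x. f n x - f (r k) x"] p e by simp
          moreover have "integrable ?M (\<lambda>x. norm (f n x - f (r k) x) powr p)"
            using Lp_mem_diff[OF f f] p by (simp add: Lp_mem_def)
          ultimately show ?case by (subst nn_integral_eq_integral) (auto intro: ennreal_leI)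
        qed
      qed simp
      finally show ?thesis .
    qed
    have int: "integrable ?M (\<lambda>x. norm (f n x - g x) powr p)"
      using fat by (intro integrableI_bounded) (auto intro: le_less_trans)
    then have "(\<integral>x. norm (f n x - g x) powr p \<partial>?M) \<le> e powr p"
      using fat by (subst (asm) nn_integral_eq_integral) auto
    then show ?thesis using int Lp_norm_le_iff[of p e \<Omega> "\<lambda>x. f n x - g x"] p e by simp
  qed
  obtain N1 where N1: "\<forall>m\<ge>N1. \<forall>n\<ge>N1. Lp_norm \<Omega> p (\<lambda>x. f m x - f n x) < 1" using cauchy[of 1] by auto
  have "Lp_mem \<Omega> p (\<lambda>x. f N1 x - g x)"
    using key[OF _ order_refl N1] by (auto simp: Lp_mem_def)
  from Lp_mem_diff[OF f[of N1] this] have "Lp_mem \<Omega> p (\<lambda>x. f N1 x - (f N1 x - g x))" using p by simp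
  then have gL: "Lp_mem \<Omega> p g" by simp
  have "(\<lambda>n. Lp_norm \<Omega> p (\<lambda>x. f n x - g x)) \<longlonglongrightarrow> 0"
  proof (rule LIMSEQ_I)
    fix e :: real assume e: "e > 0"
    obtain N0 where N0: "\<forall>m\<ge>N0. \<forall>n\<ge>N0. Lp_norm \<Omega> p (\<lambda>x. f m x - f n x) < e / 2"
      using cauchy[of "e/2"] e by auto
    then show "\<exists>no. \<forall>n\<ge>no. norm (Lp_norm \<Omega> p (\<lambda>x. f n x - g x) - 0) < e"
      using key[of "e/2", OF _ _ N0] e by (intro exI[of _ N0]) fastforce
  qed
  with gL show ?thesis by blast
qed

section \<open>Smooth functions and cut-offs\<close>

lemma partial_deriv_eq: "(f has_derivative f') (at x) \<Longrightarrow> partial_deriv b f x = f' b"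
  using frechet_derivative_at[of f f' x] by (simp add: partial_deriv_def)

lemma partial_deriv_cong:
  assumes "open S" "x \<in> S" "\<And>y. y \<in> S \<Longrightarrow> f y = g y" "f differentiable (at x)"
  shows "g differentiable (at x)" "partial_deriv b f x = partial_deriv b g x"
proof -
  obtain f' where f': "(f has_derivative f') (at x)" using assms(4) by (auto simp: differentiable_def)
  have g': "(g has_derivative f') (at x)"
    by (rule has_derivative_transform_within_open[OF f' assms(1,2,3)])
  show "g differentiable (at x)" using g' by (auto simp: differentiable_def)
  show "partial_deriv b f x = partial_deriv b g x"
    by (simp add: partial_deriv_eq[OF f'] partial_deriv_eq[OF g'])
qed

lemma Ck_on_cong:
  assumes "open S" "\<And>x. x \<in> S \<Longrightarrow> f x = g x" "Ck_on k S f"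
  shows "Ck_on k S g"
  using assms(2,3)
proof (induction k arbitrary: f g)
  case 0
  then show ?case by (simp cong: continuous_on_cong)
next
  case (Suc k)
  have "g differentiable (at x)" "partial_deriv b f x = partial_deriv b g x" if "x \<in> S" for b x
    using partial_deriv_cong[of S x f g] assms(1) that Suc.prems by auto
  then show ?case using Suc.IH[of "partial_deriv _ f" "partial_deriv _ g"] Suc.prems by auto
qed

lemma Ck_on_subset: "Ck_on k S f \<Longrightarrow> T \<subseteq> S \<Longrightarrow> Ck_on k T f"
  by (induction k arbitrary: f) (auto intro: continuous_on_subset)

lemma Ck_on_Un:
  assumes "open S" "open T"
  shows "Ck_on k S f \<Longrightarrow> Ck_on k T f \<Longrightarrow> Ck_on k (S \<union> T) f"
  using assms by (induction k arbitrary: f) (auto intro: continuous_on_open_Un)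

lemma Ck_on_continuous:
  assumes "Ck_on k S f" shows "continuous_on S f"
  using assms by (cases k) (auto intro!: continuous_at_imp_continuous_on differentiable_imp_continuous_within)

lemma Ck_on_SucD: "Ck_on (Suc k) S f \<Longrightarrow> Ck_on k S f"
proof (induction k arbitrary: f)
  case 0
  then show ?case using Ck_on_continuous[of "Suc 0" S f] by simp
next
  case (Suc k)
  then show ?case by auto
qed

lemma Ck_on_const: "Ck_on k S (\<lambda>x. c)"
proof (induction k arbitrary: c)
  case (Suc k)
  have "partial_deriv b (\<lambda>x. c) = (\<lambda>x. 0)" for b :: 'a
    by (rule ext, rule partial_deriv_eq) simp
  then show ?case using Suc by simp
qed simp

lemma Ck_on_add:
  assumes "open S"
  shows "Ck_on k S f \<Longrightarrow> Ck_on k S g \<Longrightarrow> Ck_on k S (\<lambda>x. f x + g x)"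
proof (induction k arbitrary: f g)
  case 0
  then show ?case by (simp add: continuous_on_add)
next
  case (Suc k)
  have eq: "partial_deriv b f x + partial_deriv b g x = partial_deriv b (\<lambda>x. f x + g x) x" if "x \<in> S" for b x
    using Suc.prems that
    by (auto simp: differentiable_def partial_deriv_eq partial_deriv_eq[OF has_derivative_add] dest!: bspec)
  show ?case
    using Suc.prems Suc.IH by (auto intro!: Ck_on_cong[OF assms eq])
qed

lemma Ck_on_mult:
  assumes "open S"
  shows "Ck_on k S f \<Longrightarrow> Ck_on k S g \<Longrightarrow> Ck_on k S (\<lambda>x. f x * g x)"
proof (induction k arbitrary: f g)
  case 0
  then show ?case by (simp add: continuous_on_mult)
next
  case (Suc k)
  have eq: "f x * partial_deriv b g x + partial_deriv b f x * g x = partial_deriv b (\<lambda>x. f x * g x) x"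
    if "x \<in> S" for b x
    using Suc.prems that
    by (auto simp: differentiable_def partial_deriv_eq partial_deriv_eq[OF has_derivative_mult] dest!: bspec)
  have "Ck_on k S f" "Ck_on k S g" using Suc.prems Ck_on_SucD by blast+
  then show ?case
    using Suc.prems Suc.IH by (auto intro!: Ck_on_cong[OF assms eq] Ck_on_add[OF assms])
qed

lemma Ck_on_cmult: "open S \<Longrightarrow> Ck_on k S f \<Longrightarrow> Ck_on k S (\<lambda>x. c * f x)"
  using Ck_on_mult[OF _ Ck_on_const] .

lemma Ck_on_diff: "open S \<Longrightarrow> Ck_on k S f \<Longrightarrow> Ck_on k S g \<Longrightarrow> Ck_on k S (\<lambda>x. f x - g x)"
  using Ck_on_add[of S k f "\<lambda>x. (-1) * g x"] Ck_on_cmult[of S k g "-1"] by simp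

lemma Ck_on_prod: "open S \<Longrightarrow> (\<And>i. i \<in> I \<Longrightarrow> Ck_on k S (f i)) \<Longrightarrow> Ck_on k S (\<lambda>x. \<Prod>i\<in>I. f i x)"
  by (induction I rule: infinite_finite_induct) (auto intro: Ck_on_const Ck_on_mult)

lemma Ck_on_inner: "Ck_on k S (\<lambda>x. a \<bullet> x)"
proof (cases k)
  case (Suc l)
  have "partial_deriv b (\<lambda>x. a \<bullet> x) = (\<lambda>x. a \<bullet> b)" for b :: 'a
    by (rule ext, rule partial_deriv_eq) (auto intro!: derivative_eq_intros)
  then show ?thesis using Suc
    by (auto intro!: Ck_on_const bounded_linear_imp_differentiable bounded_linear_inner_right)
qed (auto intro: continuous_intros)

text \<open>The outer function comes as the sequence of all its derivatives, so that the chain rule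
  leads from \<open>F n\<close> to \<open>F (Suc n)\<close> and the induction on \<open>k\<close>
  closes.\<close>

lemma Ck_on_compose:
  fixes F :: "nat \<Rightarrow> real \<Rightarrow> real"
  assumes F: "\<And>n t. t \<in> T \<Longrightarrow> (F n has_real_derivative F (Suc n) t) (at t)"
    and S: "open S" "g ` S \<subseteq> T"
  shows "Ck_on k S g \<Longrightarrow> Ck_on k S (\<lambda>x. F n (g x))"
proof (induction k arbitrary: n)
  case 0
  have "continuous_on T (F n)"
    using F by (intro continuous_at_imp_continuous_on ballI DERIV_isCont) auto
  then show ?case using 0 S by (auto intro: continuous_on_compose2)
next
  case (Suc k)
  have der: "((\<lambda>x. F n (g x)) has_derivative (\<lambda>h. F (Suc n) (g x) * frechet_derivative g (at x) h)) (at x)"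
    if "x \<in> S" for x
  proof -
    have g: "(g has_derivative frechet_derivative g (at x)) (at x)"
      using Suc.prems that frechet_derivative_works by auto
    have "(F n has_derivative (*) (F (Suc n) (g x))) (at (g x))"
      using F[of "g x" n] S that by (auto simp: has_field_derivative_def)
    from has_derivative_compose[OF g this] show ?thesis .
  qed
  have eq: "F (Suc n) (g x) * partial_deriv b g x = partial_deriv b (\<lambda>x. F n (g x)) x" if "x \<in> S" for b x
    using partial_deriv_eq[OF der[OF that], of b] by (simp add: partial_deriv_def)
  have "Ck_on k S g" using Suc.prems Ck_on_SucD by blast
  then show ?case
    using Suc.prems Suc.IH der
    by (auto intro!: Ck_on_cong[OF S(1) eq] Ck_on_mult[OF S(1)] simp: differentiable_def)
qed

lemma smooth_on_continuous: "smooth_on S f \<Longrightarrow> continuous_on S f"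
  unfolding smooth_on_def using Ck_on_continuous by blast

lemma smooth_on_partial_deriv: "smooth_on S f \<Longrightarrow> b \<in> Basis \<Longrightarrow> smooth_on S (partial_deriv b f)"
  unfolding smooth_on_def by (metis Ck_on.simps(2))

lemma smooth_on_differentiable: "smooth_on S f \<Longrightarrow> x \<in> S \<Longrightarrow> f differentiable (at x)"
  unfolding smooth_on_def by (metis Ck_on.simps(2))

text \<open>The functions \<open>t P(1/t) exp (-\<eta>/t)\<close>, extended by 0 to \<open>t \<le> 0\<close>, form a class of smooth functions
  that is closed under differentiation.\<close>

definition flat :: "real \<Rightarrow> real poly \<Rightarrow> real \<Rightarrow> real" where
  "flat \<eta> P t = (if t > 0 then t * poly P (1 / t) * exp (- \<eta> / t) else 0)"

text \<open>With \<open>s = 1 / t\<close> the derivative is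
  \<open>(P(s) - s P'(s) + \<eta> s P(s)) exp (- \<eta> s)\<close>; the leading factor
  \<open>[:0, 1:]\<close> compensates the factor \<open>t\<close> that \<open>flat\<close> puts in
  front.\<close>

definition flat_step :: "real \<Rightarrow> real poly \<Rightarrow> real poly" where
  "flat_step \<eta> P = [:0, 1:] * (P - [:0, 1:] * pderiv P + smult \<eta> ([:0, 1:] * P))"

lemma poly_times_exp_tendsto_0:
  fixes P :: "real poly" and \<eta> :: real
  assumes \<eta>: "\<eta> > 0"
  shows "((\<lambda>s. poly P s * exp (- \<eta> * s)) \<longlongrightarrow> 0) at_top"
proof -
  have 1: "((\<lambda>s. s ^ i * exp (- \<eta> * s)) \<longlongrightarrow> 0) at_top" for i
  proof -
    have "((\<lambda>s. (\<eta> * s) ^ i / exp (\<eta> * s)) \<longlongrightarrow> 0) at_top"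
      by (rule filterlim_compose[OF tendsto_power_div_exp_0])
         (use \<eta> in \<open>auto intro!: filterlim_tendsto_pos_mult_at_top filterlim_ident\<close>)
    then have "((\<lambda>s. (1 / \<eta> ^ i) * ((\<eta> * s) ^ i / exp (\<eta> * s))) \<longlongrightarrow> (1 / \<eta> ^ i) * 0) at_top"
      by (intro tendsto_mult tendsto_const)
    then show ?thesis using \<eta> by (simp add: power_mult_distrib exp_minus field_simps)
  qed
  have "((\<lambda>s. \<Sum>i\<le>degree P. coeff P i * (s ^ i * exp (- \<eta> * s))) \<longlongrightarrow> (\<Sum>i\<le>degree P. coeff P i * 0)) at_top"
    by (intro tendsto_sum tendsto_mult tendsto_const 1)
  then show ?thesis by (simp add: poly_altdef sum_distrib_right sum_distrib_left mult_ac)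
qed

lemma flat_has_derivative:
  assumes \<eta>: "\<eta> > 0"
  shows "(flat \<eta> P has_real_derivative flat \<eta> (flat_step \<eta> P) t) (at t)"
proof -
  consider "t > 0" | "t < 0" | "t = 0" by linarith
  then show ?thesis
  proof cases
    case 1
    have "((\<lambda>t. t * poly P (1 / t) * exp (- \<eta> / t)) has_real_derivative flat \<eta> (flat_step \<eta> P) t) (at t)"
      using 1 by (auto intro!: derivative_eq_intros DERIV_chain2[OF poly_DERIV]
          simp: flat_def flat_step_def power2_eq_square) (simp add: field_simps)
    then show ?thesis
      by (rule has_field_derivative_transform_within_open[where S = "{0<..}"]) (use 1 in \<open>auto simp: flat_def\<close>)
  next
    case 2
    have "((\<lambda>t. 0) has_real_derivative flat \<eta> (flat_step \<eta> P) t) (at t)"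
      using 2 by (simp add: flat_def)
    then show ?thesis
      by (rule has_field_derivative_transform_within_open[where S = "{..<0}"]) (use 2 in \<open>auto simp: flat_def\<close>)
  next
    case 3
    \<comment> \<open>With \<open>s = 1 / h\<close> the difference quotient at 0 is
      \<open>poly P s * exp (- \<eta> * s)\<close>, where the exponential wins.\<close>
    have r: "((\<lambda>h. flat \<eta> P h / h) \<longlongrightarrow> 0) (at_right 0)"
    proof -
      have "((\<lambda>h. poly P (inverse h) * exp (- \<eta> * inverse h)) \<longlongrightarrow> 0) (at_right 0)"
        by (rule filterlim_compose[OF poly_times_exp_tendsto_0[OF \<eta>] filterlim_inverse_at_top_right])
      then show ?thesis
        by (rule Lim_transform_eventually)
           (auto simp: eventually_at_filter flat_def divide_inverse)
    qed
    have l: "((\<lambda>h. flat \<eta> P h / h) \<longlongrightarrow> 0) (at_left 0)"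
      by (rule Lim_transform_eventually[OF tendsto_const])
         (auto simp: eventually_at_filter flat_def)
    have "((\<lambda>h. flat \<eta> P h / h) \<longlongrightarrow> 0) (at 0)"
      using l r by (rule filterlim_split_at)
    then show ?thesis using 3 by (simp add: DERIV_def flat_def)
  qed
qed

lemma smooth_on_flat:
  assumes "\<eta> > 0" "open S" "smooth_on S g"
  shows "smooth_on S (\<lambda>x. flat \<eta> P (g x))"
  unfolding smooth_on_def
proof
  fix k
  define F where "F n = flat \<eta> ((flat_step \<eta> ^^ n) P)" for n
  have "Ck_on k S (\<lambda>x. F 0 (g x))"
    by (rule Ck_on_compose[where T = UNIV])
       (use assms flat_has_derivative in \<open>auto simp: F_def smooth_on_def\<close>)
  then show "Ck_on k S (\<lambda>x. flat \<eta> P (g x))" by (simp add: F_def)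
qed

text \<open>A smooth substitute for the positive part: nonnegative, zero on the negative axis,
  within \<open>\<eta>\<close> of it and with slope between 0 and 1. Composition with it keeps a
  test function a test function and does not enlarge its gradient.\<close>

definition soft_pos :: "real \<Rightarrow> real \<Rightarrow> real" where
  "soft_pos \<eta> t = (if t > 0 then t * exp (- \<eta> / t) else 0)"

definition soft_pos' :: "real \<Rightarrow> real \<Rightarrow> real" where
  "soft_pos' \<eta> t = (if t > 0 then (1 + \<eta> / t) * exp (- \<eta> / t) else 0)"

lemma soft_pos_flat: "soft_pos \<eta> = flat \<eta> 1"
  by (auto simp: soft_pos_def flat_def)

lemma soft_pos_has_derivative:
  assumes "\<eta> > 0" shows "(soft_pos \<eta> has_real_derivative soft_pos' \<eta> t) (at t)"
proof -
  have "flat \<eta> (flat_step \<eta> 1) = soft_pos' \<eta>"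
    by (rule ext) (auto simp: flat_def flat_step_def soft_pos'_def field_simps)
  then show ?thesis using flat_has_derivative[OF assms, of 1 t] by (simp add: soft_pos_flat)
qed

lemma soft_pos'_bounds:
  assumes "\<eta> > 0" shows "soft_pos' \<eta> t \<ge> 0" "soft_pos' \<eta> t \<le> 1"
proof -
  show "soft_pos' \<eta> t \<ge> 0" using assms by (auto simp: soft_pos'_def)
  have "(1 + \<eta> / t) * exp (- (\<eta> / t)) \<le> exp (\<eta> / t) * exp (- (\<eta> / t))"
    using exp_ge_add_one_self by (intro mult_right_mono) auto
  then show "soft_pos' \<eta> t \<le> 1" by (auto simp: soft_pos'_def exp_minus)
qed

lemma isCont_soft_pos':
  assumes "\<eta> > 0" shows "isCont (soft_pos' \<eta>) t"
proof -
  have "flat \<eta> (flat_step \<eta> 1) = soft_pos' \<eta>"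
    by (rule ext) (auto simp: flat_def flat_step_def soft_pos'_def field_simps)
  then show ?thesis using DERIV_isCont[OF flat_has_derivative[OF assms]] by metis
qed

lemma soft_pos_bounds:
  assumes "\<eta> > 0"
  shows "soft_pos \<eta> t \<ge> 0" "t - \<eta> \<le> soft_pos \<eta> t" "soft_pos \<eta> t \<le> max t 0"
    "soft_pos \<eta> t > 0 \<longleftrightarrow> t > 0"
proof -
  show "soft_pos \<eta> t \<ge> 0" by (simp add: soft_pos_def)
  show "t - \<eta> \<le> soft_pos \<eta> t"
  proof (cases "t > 0")
    case True
    have "t * (1 + - \<eta> / t) \<le> t * exp (- \<eta> / t)"
      using True exp_ge_add_one_self[of "- \<eta> / t"] by (intro mult_left_mono) auto
    also have "t * (1 + - \<eta> / t) = t - \<eta>" using True by (simp add: field_simps)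
    finally show ?thesis using True by (simp add: soft_pos_def)
  qed (use assms in \<open>auto simp: soft_pos_def\<close>)
  have "t * exp (- \<eta> / t) \<le> t * 1" if "t > 0"
    using that assms by (intro mult_left_mono) auto
  then show "soft_pos \<eta> t \<le> max t 0" by (auto simp: soft_pos_def)
  show "soft_pos \<eta> t > 0 \<longleftrightarrow> t > 0" by (simp add: soft_pos_def zero_less_mult_iff)
qed

lemma smooth_on_soft_pos:
  assumes "\<eta> > 0" "open S" "smooth_on S g"
  shows "smooth_on S (\<lambda>x. soft_pos \<eta> (g x))"
  using smooth_on_flat[OF assms] by (simp add: soft_pos_flat)

lemma smooth_on_powr:
  fixes a :: real
  assumes "open S" "smooth_on S g" "\<And>x. x \<in> S \<Longrightarrow> g x > 0"
  shows "smooth_on S (\<lambda>x. g x powr a)"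
  unfolding smooth_on_def
proof
  fix k
  define F where "F n t = (\<Prod>i<n. a - real i) * t powr (a - real n)" for n and t :: real
  have "Ck_on k S (\<lambda>x. F 0 (g x))"
  proof (rule Ck_on_compose[where T = "{0<..}" and F = F and n = 0 and g = g])
    show "(F n has_real_derivative F (Suc n) t) (at t)" if "t \<in> {0<..}" for n t
      unfolding F_def using that by (auto intro!: derivative_eq_intros simp: algebra_simps)
  qed (use assms in \<open>auto simp: smooth_on_def\<close>)
  then show "Ck_on k S (\<lambda>x. g x powr a)" by (simp add: F_def)
qed

section \<open>Weak gradients\<close>

definition grad :: "('a::euclidean_space \<Rightarrow> real) \<Rightarrow> 'a \<Rightarrow> 'a" where
  "grad \<phi> x = (\<Sum>b\<in>Basis. partial_deriv b \<phi> x *\<^sub>R b)"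

lemma grad_inner_Basis: "b \<in> Basis \<Longrightarrow> grad \<phi> x \<bullet> b = partial_deriv b \<phi> x"
  by (simp add: grad_def inner_sum_left_Basis)

lemma grad_has_derivative:
  assumes "\<phi> differentiable (at x)"
  shows "(\<phi> has_derivative (\<lambda>h. grad \<phi> x \<bullet> h)) (at x)"
proof -
  have d: "(\<phi> has_derivative frechet_derivative \<phi> (at x)) (at x)"
    using assms frechet_derivative_works by blast
  then interpret linear "frechet_derivative \<phi> (at x)" by (rule has_derivative_linear)
  have "frechet_derivative \<phi> (at x) h = grad \<phi> x \<bullet> h" for h
  proof -
    have "frechet_derivative \<phi> (at x) h = frechet_derivative \<phi> (at x) (\<Sum>b\<in>Basis. (h \<bullet> b) *\<^sub>R b)"
      by (simp add: euclidean_representation)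
    also have "\<dots> = (\<Sum>b\<in>Basis. (h \<bullet> b) * frechet_derivative \<phi> (at x) b)"
      by (simp add: sum scaleR)
    also have "\<dots> = grad \<phi> x \<bullet> h"
      by (simp add: grad_def inner_sum_left partial_deriv_def mult.commute inner_commute[of h])
    finally show ?thesis .
  qed
  then show ?thesis using d by presburger
qed

lemma grad_eq:
  assumes "(\<phi> has_derivative (\<lambda>h. g \<bullet> h)) (at x)"
  shows "grad \<phi> x = g"
  by (simp add: grad_def partial_deriv_eq[OF assms] euclidean_representation)

lemma grad_add: "\<lbrakk>\<phi> differentiable (at x); \<psi> differentiable (at x)\<rbrakk> \<Longrightarrow> grad (\<lambda>x. \<phi> x + \<psi> x) x = grad \<phi> x + grad \<psi> x"
  by (rule grad_eq) (auto intro!: derivative_eq_intros grad_has_derivative simp: inner_add_left)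

lemma grad_cmult: "\<phi> differentiable (at x) \<Longrightarrow> grad (\<lambda>x. c * \<phi> x) x = c *\<^sub>R grad \<phi> x"
  by (rule grad_eq) (auto intro!: derivative_eq_intros grad_has_derivative)

lemma grad_diff: "\<lbrakk>\<phi> differentiable (at x); \<psi> differentiable (at x)\<rbrakk> \<Longrightarrow> grad (\<lambda>x. \<phi> x - \<psi> x) x = grad \<phi> x - grad \<psi> x"
  by (rule grad_eq) (auto intro!: derivative_eq_intros grad_has_derivative simp: inner_diff_left)

lemma grad_compose:
  assumes "\<phi> differentiable (at x)" "(f has_real_derivative d) (at (\<phi> x))"
  shows "grad (\<lambda>x. f (\<phi> x)) x = d *\<^sub>R grad \<phi> x"
proof (rule grad_eq)
  have "(f has_derivative (\<lambda>h. d * h)) (at (\<phi> x))" using assms(2) by (simp add: has_field_derivative_def mult_commute_abs)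
  from has_derivative_compose[OF grad_has_derivative[OF assms(1)] this]
  show "((\<lambda>x. f (\<phi> x)) has_derivative (\<lambda>h. (d *\<^sub>R grad \<phi> x) \<bullet> h)) (at x)" by simp
qed

lemma grad_zero_outside:
  assumes "closed K" "\<And>x. x \<notin> K \<Longrightarrow> \<phi> x = 0" "x \<notin> K"
  shows "grad \<phi> x = 0"
proof (rule grad_eq)
  have 0: "((\<lambda>x. 0::real) has_derivative (\<lambda>h. 0 \<bullet> h)) (at x)" by simp
  have K: "open (- K)" "x \<in> - K" "\<And>y. y \<in> - K \<Longrightarrow> 0 = \<phi> y" using assms by auto
  show "(\<phi> has_derivative (\<lambda>h. 0 \<bullet> h)) (at x)"
    by (rule has_derivative_transform_within_open[OF 0 K])
qed

section \<open>Test functions\<close>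

lemma test_functionE:
  assumes "test_function \<Omega> \<phi>"
  obtains K where "compact K" "K \<subseteq> \<Omega>" "\<And>x. x \<notin> K \<Longrightarrow> \<phi> x = 0"
  using assms unfolding test_function_def by blast

lemma test_function_smooth: "test_function \<Omega> \<phi> \<Longrightarrow> smooth_on UNIV \<phi>"
  by (simp add: test_function_def)

lemma test_function_differentiable: "test_function \<Omega> \<phi> \<Longrightarrow> \<phi> differentiable (at x)"
  using smooth_on_differentiable[OF test_function_smooth] by blast

lemma test_function_continuous: "test_function \<Omega> \<phi> \<Longrightarrow> continuous_on S \<phi>"
  using smooth_on_continuous[OF test_function_smooth] continuous_on_subset by blast

lemma continuous_on_grad_smooth:
  assumes "smooth_on S \<phi>" shows "continuous_on S (grad \<phi>)"
proof -
  have "continuous_on S (\<lambda>x. \<Sum>b\<in>Basis. partial_deriv b \<phi> x *\<^sub>R b)"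
    using assms by (intro continuous_intros) (auto intro: smooth_on_continuous smooth_on_partial_deriv)
  then show ?thesis unfolding grad_def[abs_def] by simp
qed

lemma continuous_on_grad_test: "test_function \<Omega> \<phi> \<Longrightarrow> continuous_on S (grad \<phi>)"
  using continuous_on_grad_smooth[OF test_function_smooth] continuous_on_subset by blast

lemma test_function_add:
  assumes "test_function \<Omega> \<phi>" "test_function \<Omega> \<psi>"
  shows "test_function \<Omega> (\<lambda>x. \<phi> x + \<psi> x)"
proof -
  obtain K where K: "compact K" "K \<subseteq> \<Omega>" "\<And>x. x \<notin> K \<Longrightarrow> \<phi> x = 0" using assms(1) by (rule test_functionE) blast
  obtain L where L: "compact L" "L \<subseteq> \<Omega>" "\<And>x. x \<notin> L \<Longrightarrow> \<psi> x = 0" using assms(2) by (rule test_functionE) blast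
  have "smooth_on UNIV (\<lambda>x. \<phi> x + \<psi> x)"
    using assms by (auto simp: test_function_def smooth_on_def intro: Ck_on_add)
  moreover have "compact (K \<union> L) \<and> K \<union> L \<subseteq> \<Omega> \<and> (\<forall>x. x \<notin> K \<union> L \<longrightarrow> \<phi> x + \<psi> x = 0)"
    using K L by auto
  ultimately show ?thesis unfolding test_function_def by blast
qed

lemma test_function_cmult:
  assumes "test_function \<Omega> \<phi>"
  shows "test_function \<Omega> (\<lambda>x. c * \<phi> x)"
  using assms unfolding test_function_def smooth_on_def by (metis Ck_on_cmult mult_zero_right open_UNIV)

lemma test_function_soft_pos:
  assumes "test_function \<Omega> \<phi>" "\<eta> > 0"
  shows "test_function \<Omega> (\<lambda>x. soft_pos \<eta> (\<phi> x))"
proof -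
  obtain K where K: "compact K" "K \<subseteq> \<Omega>" "\<And>x. x \<notin> K \<Longrightarrow> \<phi> x = 0" using assms(1) by (rule test_functionE) blast
  have "\<forall>x. x \<notin> K \<longrightarrow> soft_pos \<eta> (\<phi> x) = 0" using K by (simp add: soft_pos_def)
  then show ?thesis
    unfolding test_function_def using K smooth_on_soft_pos[OF assms(2) open_UNIV test_function_smooth[OF assms(1)]] by blast
qed

lemma test_function_extend:
  assumes U: "open U" "U \<subseteq> \<Omega>" and f: "smooth_on U f" and K: "compact K" "K \<subseteq> U" "\<And>x. x \<in> U - K \<Longrightarrow> f x = 0"
  shows "test_function \<Omega> (\<lambda>x. if x \<in> U then f x else 0)" (is "test_function \<Omega> ?g")
  unfolding test_function_def
proof (intro conjI exI)
  show "smooth_on UNIV ?g"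
    unfolding smooth_on_def
  proof
    fix k
    have "Ck_on k U ?g"
      by (rule Ck_on_cong[of U f]) (use f U in \<open>auto simp: smooth_on_def\<close>)
    moreover have "Ck_on k (- K) ?g"
    proof (rule Ck_on_cong[where f = "\<lambda>x. 0"])
      show "open (- K)" using K(1) compact_imp_closed by blast
      show "0 = ?g x" if "x \<in> - K" for x using that K(3)[of x] by simp
    qed (rule Ck_on_const)
    ultimately have "Ck_on k (U \<union> - K) ?g"
      using U K by (intro Ck_on_Un) (auto intro: compact_imp_closed)
    moreover have "U \<union> - K = UNIV" using K by auto
    ultimately show "Ck_on k UNIV ?g" by simp
  qed
  show "compact K" "K \<subseteq> \<Omega>" "\<forall>x. x \<notin> K \<longrightarrow> ?g x = 0" using U K by auto
qed

lemma test_function_bounded: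
  assumes "test_function \<Omega> \<phi>"
  obtains B where "B > 0" "\<And>x. \<bar>\<phi> x\<bar> \<le> B" "\<And>x. norm (grad \<phi> x) \<le> B"
proof -
  obtain K where K: "compact K" "K \<subseteq> \<Omega>" "\<And>x. x \<notin> K \<Longrightarrow> \<phi> x = 0" using assms by (rule test_functionE) blast
  have "bounded (\<phi> ` K)" "bounded (grad \<phi> ` K)"
    using K assms test_function_continuous continuous_on_grad_test
    by (auto intro!: compact_imp_bounded compact_continuous_image)
  then obtain B1 B2 where B: "B1 > 0" "\<And>x. x \<in> K \<Longrightarrow> \<bar>\<phi> x\<bar> \<le> B1" "B2 > 0" "\<And>x. x \<in> K \<Longrightarrow> norm (grad \<phi> x) \<le> B2"
    by (force simp: bounded_pos)
  have 1: "\<bar>\<phi> x\<bar> \<le> max B1 B2" for x using B K(3)[of x] by (cases "x \<in> K") (auto simp: le_max_iff_disj)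
  have 2: "norm (grad \<phi> x) \<le> max B1 B2" for x
  proof (cases "x \<in> K")
    case False
    then have "grad \<phi> x = 0" using K by (intro grad_zero_outside[OF compact_imp_closed[OF K(1)]]) auto
    then show ?thesis using B by auto
  qed (use B in \<open>auto simp: le_max_iff_disj\<close>)
  show ?thesis by (rule that[of "max B1 B2"]) (use 1 2 B in auto)
qed

lemma borel_measurable_continuous_lebesgue_on:
  "continuous_on UNIV f \<Longrightarrow> \<Omega> \<in> sets lebesgue \<Longrightarrow> f \<in> borel_measurable (lebesgue_on \<Omega>)"
  using continuous_imp_measurable_on_sets_lebesgue continuous_on_subset by blast

section \<open>Bumps on boxes and the fundamental lemma of the calculus of variations\<close>

definition box_bump :: "nat \<Rightarrow> 'a::euclidean_space \<Rightarrow> 'a \<Rightarrow> 'a \<Rightarrow> real" where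
  "box_bump n a c x = (\<Prod>b\<in>Basis. flat (1 / Suc n) [:0, 1:] ((x - a) \<bullet> b) * flat (1 / Suc n) [:0, 1:] ((c - x) \<bullet> b))"

lemma flat_01: "flat \<eta> [:0, 1:] t = (if t > 0 then exp (- \<eta> / t) else 0)"
  by (simp add: flat_def)

lemma box_bump_outside:
  assumes "x \<notin> box a c" shows "box_bump n a c x = 0"
proof -
  obtain b where b: "b \<in> Basis" "\<not> ((x - a) \<bullet> b > 0 \<and> (c - x) \<bullet> b > 0)"
    using assms by (auto simp: mem_box inner_diff_left)
  then have "flat (1 / Suc n) [:0, 1:] ((x - a) \<bullet> b) * flat (1 / Suc n) [:0, 1:] ((c - x) \<bullet> b) = 0"
    by (auto simp: flat_01)
  then show ?thesis unfolding box_bump_def using b(1) by (intro prod_zero) auto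
qed

lemma test_function_box_bump:
  assumes "cbox a c \<subseteq> \<Omega>"
  shows "test_function \<Omega> (box_bump n a c)"
  unfolding test_function_def
proof (intro conjI exI)
  have l: "smooth_on UNIV (\<lambda>x. (x - a) \<bullet> b)" "smooth_on UNIV (\<lambda>x. (c - x) \<bullet> b)" for b
  proof -
    have "Ck_on k UNIV (\<lambda>x. (b \<bullet> x) - (a \<bullet> b))" "Ck_on k UNIV (\<lambda>x. (c \<bullet> b) - (b \<bullet> x))" for k
      by (intro Ck_on_diff Ck_on_inner Ck_on_const open_UNIV)+
    moreover have "(\<lambda>x. (x - a) \<bullet> b) = (\<lambda>x. (b \<bullet> x) - (a \<bullet> b))" "(\<lambda>x. (c - x) \<bullet> b) = (\<lambda>x. (c \<bullet> b) - (b \<bullet> x))"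
      by (auto simp: inner_diff_left inner_diff_right inner_commute)
    ultimately show "smooth_on UNIV (\<lambda>x. (x - a) \<bullet> b)" "smooth_on UNIV (\<lambda>x. (c - x) \<bullet> b)"
      by (simp_all add: smooth_on_def)
  qed
  show "smooth_on UNIV (box_bump n a c)"
    unfolding box_bump_def[abs_def] smooth_on_def
    using smooth_on_flat[OF _ open_UNIV l(1), of "1 / Suc n"] smooth_on_flat[OF _ open_UNIV l(2), of "1 / Suc n"]
    by (auto intro!: Ck_on_prod Ck_on_mult simp: smooth_on_def)
  show "\<forall>x. x \<notin> cbox a c \<longrightarrow> box_bump n a c x = 0"
    using box_bump_outside box_subset_cbox by blast
qed (use assms in auto)

lemma box_bump_bounds: "0 \<le> box_bump n a c x" "box_bump n a c x \<le> 1"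
  unfolding box_bump_def
  by (auto simp: flat_01 intro!: prod_nonneg prod_le_1 mult_le_one)

text \<open>Each factor \<open>exp (- \<eta> / t)\<close> rises to 1 as
  \<open>\<eta> = 1 / Suc n\<close> tends to 0. By dominated convergence, testing against bumps
  therefore determines integrals over open boxes.\<close>

lemma box_bump_tendsto: "(\<lambda>n. box_bump n a c x) \<longlonglongrightarrow> indicator (box a c) x"
proof (cases "x \<in> box a c")
  case True
  have *: "(\<lambda>n. flat (1 / Suc n) [:0, 1:] t) \<longlonglongrightarrow> 1" if "t > 0" for t
  proof -
    have "(\<lambda>n. exp (- (1 / Suc n) / t)) \<longlonglongrightarrow> exp (- 0 / t)"
      by (intro tendsto_exp tendsto_divide tendsto_minus tendsto_const LIMSEQ_Suc[OF lim_1_over_n]) (use that in auto)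
    then show ?thesis using that by (simp add: flat_01)
  qed
  have "(\<lambda>n. box_bump n a c x) \<longlonglongrightarrow> (\<Prod>b\<in>(Basis::'a set). 1 * 1)"
    unfolding box_bump_def
    using True by (intro tendsto_prod tendsto_mult *) (auto simp: mem_box inner_diff_left)
  then show ?thesis using True by simp
next
  case False
  then have "box_bump n a c x = 0" for n by (rule box_bump_outside)
  then show ?thesis using False by simp
qed

text \<open>Open boxes generate the Borel sets and are stable under intersection, so by Dynkin's
  argument all Borel sets carry integral zero; \<open>tot\<close> serves the complements. The sets
  where \<open>k\<close> is positive and where it is negative then finish the proof.\<close>

lemma AE_zero_if_box_integrals_zero:
  fixes k :: "'a::euclidean_space \<Rightarrow> real"
  assumes k: "integrable lborel k"
    and tot: "integral\<^sup>L lborel k = 0"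
    and boxes: "\<And>a c. (\<integral>x. indicator (box a c) x * k x \<partial>lborel) = 0"
  shows "AE x in lborel. k x = 0"
proof -
  have [measurable]: "k \<in> borel_measurable lborel" using k by auto
  have all: "(\<integral>x. indicator A x * k x \<partial>lborel) = 0" if "A \<in> sets borel" for A
  proof -
    have A: "A \<in> sigma_sets UNIV (range (\<lambda>(a, b). box a b))"
      using that by (simp add: borel_eq_box)
    have st: "Int_stable (range (\<lambda>(a, b). box a b :: 'a set))"
      by (auto simp: Int_stable_def box_Int_box)
    have cl: "range (\<lambda>(a, b). box a b :: 'a set) \<subseteq> Pow UNIV" by simp
    from st cl A show ?thesis
    proof (induction rule: sigma_sets_induct_disjoint)
      case (basic A)
      then show ?case using boxes by auto
    next
      case (compl A)
      have A[measurable]: "A \<in> sets borel" using compl(1) by (simp add: borel_eq_box)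
      have "(\<integral>x. indicator (UNIV - A) x * k x \<partial>lborel) = (\<integral>x. k x - indicator A x * k x \<partial>lborel)"
        by (rule Bochner_Integration.integral_cong) (auto simp: indicator_def)
      also have "\<dots> = 0" using k compl(2) tot
        by (subst Bochner_Integration.integral_diff) (auto intro: integrable_real_mult_indicator simp: mult.commute)
      finally show ?case .
    next
      case (union A)
      have A[measurable]: "A i \<in> sets borel" for i using union(2) by (auto simp: borel_eq_box)
      have si: "set_integrable lborel (\<Union>i. A i) k"
        unfolding set_integrable_def using integrable_mult_indicator[OF _ k, of "\<Union>i. A i"] by simp
      have "(\<integral>x. indicator (\<Union>i. A i) x * k x \<partial>lborel) = (\<Sum>i. (\<integral>x. indicator (A i) x * k x \<partial>lborel))"
        using lebesgue_integral_countable_add[of A lborel k] union(1) si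
        by (auto simp: set_lebesgue_integral_def disjoint_family_on_def)
      then show ?case using union(3) by simp
    qed auto
  qed
  have p: "(\<integral>x. max (k x) 0 \<partial>lborel) = 0"
  proof -
    have "(\<integral>x. max (k x) 0 \<partial>lborel) = (\<integral>x. indicator {x. k x > 0} x * k x \<partial>lborel)"
      by (rule Bochner_Integration.integral_cong) (auto simp: indicator_def max_def)
    also have "\<dots> = 0" using all[of "{x. k x > 0}"] by simp
    finally show ?thesis .
  qed
  have m: "(\<integral>x. max (- k x) 0 \<partial>lborel) = 0"
  proof -
    have "(\<integral>x. max (- k x) 0 \<partial>lborel) = (\<integral>x. - (indicator {x. k x < 0} x * k x) \<partial>lborel)"
      by (rule Bochner_Integration.integral_cong) (auto simp: indicator_def max_def)
    also have "\<dots> = 0" using all[of "{x. k x < 0}"] by simp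
    finally show ?thesis .
  qed
  have "AE x in lborel. max (k x) 0 = 0" "AE x in lborel. max (- k x) 0 = 0"
    using integral_nonneg_eq_0_iff_AE[of lborel "\<lambda>x. max (k x) 0"] integral_nonneg_eq_0_iff_AE[of lborel "\<lambda>x. max (- k x) 0"]
      p m k by auto
  then show ?thesis by eventually_elim auto
qed

text \<open>The problem is localised to closed boxes inside the domain, where \<open>h\<close> is
  integrable; countably many of them cover the domain, so the exceptional null sets can be
  united.\<close>

lemma fundamental_lemma:
  fixes h :: "'a::euclidean_space \<Rightarrow> real"
  assumes \<Omega>: "open \<Omega>" and h: "locally_integrable \<Omega> h"
    and zero: "\<And>\<phi>. test_function \<Omega> \<phi> \<Longrightarrow> (\<integral>x. h x * \<phi> x \<partial>lebesgue_on \<Omega>) = 0"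
  shows "AE x in lebesgue_on \<Omega>. h x = 0"
proof -
  have O[simp]: "\<Omega> \<in> sets lebesgue" using \<Omega> by auto
  have int: "integrable lebesgue (\<lambda>x. indicator (cbox a c) x * h x)" if "cbox a c \<subseteq> \<Omega>" for a c
  proof -
    have "integrable (lebesgue_on (cbox a c)) h" using h that unfolding locally_integrable_def by (metis compact_cbox)
    then show ?thesis by (subst (asm) integrable_restrict_space) auto
  qed
  have box0: "(\<integral>x. indicator (box a c) x * h x \<partial>lebesgue) = 0" if ac: "cbox a c \<subseteq> \<Omega>" for a c
  proof -
    have meas: "(\<lambda>x. indicator (cbox a c) x * h x) \<in> borel_measurable lebesgue" using int[OF ac] by auto
    have supp: "box_bump n a c x = 0" if "x \<notin> cbox a c" for n x
      using that box_bump_outside box_subset_cbox by blast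
    have bm: "box_bump n a c \<in> borel_measurable lebesgue" for n
      using test_function_continuous[OF test_function_box_bump[OF ac], of UNIV n]
      using borel_measurable_continuous_onI[of "box_bump n a c"] by (simp add: measurable_completion)
    have eq: "(\<integral>x. h x * box_bump n a c x \<partial>lebesgue_on \<Omega>) = (\<integral>x. (indicator (cbox a c) x * h x) * box_bump n a c x \<partial>lebesgue)" for n
      unfolding integral_restrict_space[of \<Omega> lebesgue, simplified]
      by (rule Bochner_Integration.integral_cong) (use ac supp in \<open>auto simp: indicator_def\<close>)
    have "(\<lambda>n. \<integral>x. (indicator (cbox a c) x * h x) * box_bump n a c x \<partial>lebesgue)
        \<longlonglongrightarrow> (\<integral>x. (indicator (cbox a c) x * h x) * indicator (box a c) x \<partial>lebesgue)"
    proof (rule integral_dominated_convergence[where w = "\<lambda>x. norm (indicator (cbox a c) x * h x)"])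
      show "AE x in lebesgue. norm (indicator (cbox a c) x * h x * box_bump n a c x) \<le> norm (indicator (cbox a c) x * h x)" for n
        using box_bump_bounds[of n a c] by (auto simp: abs_mult intro!: mult_left_le)
      show "(\<lambda>x. indicator (cbox a c) x * h x * indicator (box a c) x) \<in> borel_measurable lebesgue"
        using borel_measurable_times[OF meas borel_measurable_indicator[of "box a c" lebesgue]] by simp
    qed (use meas bm int[OF ac] in \<open>auto intro!: tendsto_mult tendsto_const box_bump_tendsto\<close>)
    then have "(\<integral>x. (indicator (cbox a c) x * h x) * indicator (box a c) x \<partial>lebesgue) = 0"
      using zero[OF test_function_box_bump[OF ac]] eq LIMSEQ_unique[OF _ tendsto_const] by auto
    moreover have "(indicator (cbox a c) x * h x) * indicator (box a c) x = indicator (box a c) x * h x" for x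
      using box_subset_cbox[of a c] by (auto simp: indicator_def)
    ultimately show ?thesis by simp
  qed
  have cb: "AE x in lebesgue. x \<in> cbox a c \<longrightarrow> h x = 0" if ac: "cbox a c \<subseteq> \<Omega>" for a c
  proof -
    define k where "k x = indicator (box a c) x * h x" for x
    have kint: "integrable lebesgue k"
    proof -
      have "integrable lebesgue (\<lambda>x. indicator (box a c) x *\<^sub>R (indicator (cbox a c) x * h x))"
        using int[OF ac] by (intro integrable_mult_indicator) auto
      moreover have "indicator (box a c) x *\<^sub>R (indicator (cbox a c) x * h x) = k x" for x
        using box_subset_cbox[of a c] by (auto simp: indicator_def k_def)
      ultimately show ?thesis by simp
    qed
    \<comment> \<open>The Dynkin argument lives on Borel sets, so the Lebesgue measurable function
      is exchanged for a Borel version.\<close>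
    obtain k' where k': "k' \<in> borel_measurable lborel" "AE x in lborel. k x = k' x"
      using completion_ex_borel_measurable_real[of k lborel] kint by auto
    have [measurable]: "k' \<in> borel_measurable borel" using k' by simp
    have ae: "AE x in lebesgue. k x = k' x" using k' AE_completion by blast
    have k'L: "integrable lebesgue k'"
      using kint ae k'(1) by (subst integrable_cong_AE[symmetric, of k]) (auto intro: measurable_completion)
    then have k'i: "integrable lborel k'" using k'(1) integrable_completion by blast
    have ki: "(\<integral>x. indicator A x * k' x \<partial>lborel) = (\<integral>x. indicator A x * k x \<partial>lebesgue)" if [measurable]: "A \<in> sets borel" for A
    proof -
      have "(\<integral>x. indicator A x * k' x \<partial>lborel) = (\<integral>x. indicator A x * k' x \<partial>lebesgue)"
        by (rule integral_completion[symmetric]) auto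
      also have "\<dots> = (\<integral>x. indicator A x * k x \<partial>lebesgue)"
      proof (rule integral_cong_AE)
        show "(\<lambda>x. indicator A x * k' x) \<in> borel_measurable lebesgue" "(\<lambda>x. indicator A x * k x) \<in> borel_measurable lebesgue"
          using kint k'L that by (auto intro!: borel_measurable_times borel_measurable_indicator)
      qed (use ae in auto)
      finally show ?thesis .
    qed
    have "AE x in lborel. k' x = 0"
    proof (rule AE_zero_if_box_integrals_zero[OF k'i])
      show "integral\<^sup>L lborel k' = 0"
        using ki[of UNIV] box0[OF ac] by (simp add: k_def)
      fix d e
      \<comment> \<open>An arbitrary box meets \<open>box a c\<close> in a box whose closed version
        still lies in the domain, so \<open>box0\<close> applies to it.\<close>
      define l where "l = (\<Sum>i\<in>Basis. max (d\<bullet>i) (a\<bullet>i) *\<^sub>R i)"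
      define u where "u = (\<Sum>i\<in>Basis. min (e\<bullet>i) (c\<bullet>i) *\<^sub>R i)"
      have 1: "box d e \<inter> box a c = box l u" and 2: "cbox d e \<inter> cbox a c = cbox l u"
        unfolding l_def u_def by (rule box_Int_box, rule Int_interval)
      have "(\<integral>x. indicator (box d e) x * k' x \<partial>lborel) = (\<integral>x. indicator (box d e) x * k x \<partial>lebesgue)"
        by (rule ki) simp
      also have "\<dots> = (\<integral>x. indicator (box l u) x * h x \<partial>lebesgue)"
        unfolding k_def 1[symmetric] by (simp add: indicator_inter_arith mult.assoc)
      also have "\<dots> = 0" using 2 ac by (intro box0) blast
      finally show "(\<integral>x. indicator (box d e) x * k' x \<partial>lborel) = 0" .
    qed
    then have "AE x in lebesgue. k' x = 0" by (rule AE_completion)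
    moreover have "negligible (cbox a c - box a c)"
      by (rule negligible_frontier_interval)
    then have "AE x in lebesgue. x \<notin> cbox a c - box a c"
      using AE_not_in[of "cbox a c - box a c" lebesgue] by (simp add: negligible_iff_null_sets)
    ultimately show ?thesis using ae by eventually_elim (auto simp: k_def)
  qed
  obtain D where D: "countable D" "D \<subseteq> Pow \<Omega>" "\<And>X. X \<in> D \<Longrightarrow> \<exists>a b. X = cbox a b" "\<Union>D = \<Omega>"
    using open_countable_Union_open_cbox[OF \<Omega>] by metis
  have "AE x in lebesgue. \<forall>X\<in>D. x \<in> X \<longrightarrow> h x = 0"
    unfolding AE_ball_countable[OF D(1)]
  proof
    fix X assume X: "X \<in> D"
    then obtain a b where "X = cbox a b" using D(3) by blast
    then show "AE x in lebesgue. x \<in> X \<longrightarrow> h x = 0" using cb X D(2) by auto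
  qed
  then have "AE x in lebesgue. x \<in> \<Omega> \<longrightarrow> h x = 0"
    by eventually_elim (use D(4) in auto)
  then show ?thesis by (subst AE_restrict_space_iff) auto
qed

text \<open>Difference quotients have integral zero by translation invariance. The mean value
  theorem bounds them by \<open>C\<close> and compact support confines them to one compact set, so
  dominated convergence passes to the derivative.\<close>

lemma integral_partial_deriv_zero:
  fixes f :: "'a::euclidean_space \<Rightarrow> real"
  assumes diff: "\<And>x. f differentiable (at x)" and K: "compact K" "\<And>x. x \<notin> K \<Longrightarrow> f x = 0"
    and bd: "\<And>x. \<bar>partial_deriv b f x\<bar> \<le> C" and b: "b \<in> Basis"
  shows "integrable lborel (partial_deriv b f)" "(\<integral>x. partial_deriv b f x \<partial>lborel) = 0"
proof -
  have contf: "continuous_on UNIV f"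
    using diff by (auto intro!: continuous_at_imp_continuous_on differentiable_imp_continuous_within)
  have fint: "integrable lborel f"
  proof -
    have "integrable lborel (\<lambda>x. indicator K x *\<^sub>R f x)"
      using K contf by (intro borel_integrable_compact) (auto intro: continuous_on_subset)
    moreover have "(\<lambda>x. indicator K x *\<^sub>R f x) = f" by (rule ext) (use K(2) in \<open>auto simp: indicator_def\<close>)
    ultimately show ?thesis by simp
  qed
  have dl: "((\<lambda>t. f (x + t *\<^sub>R b)) has_real_derivative partial_deriv b f (x + t *\<^sub>R b)) (at t)" for x t
  proof -
    have "((\<lambda>t. f (x + t *\<^sub>R b)) has_derivative (\<lambda>h. grad f (x + t *\<^sub>R b) \<bullet> (h *\<^sub>R b))) (at t)"
      by (rule has_derivative_compose[OF _ grad_has_derivative[OF diff]]) (auto intro!: derivative_eq_intros)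
    then show ?thesis
      using b by (simp add: has_field_derivative_def grad_inner_Basis mult_commute_abs)
  qed
  define D where "D n x = (f (x + (1 / Suc n) *\<^sub>R b) - f x) * Suc n" for n x
  have fs: "integrable lborel (\<lambda>x. f (x + t *\<^sub>R b))" "(\<integral>x. f (x + t *\<^sub>R b) \<partial>lborel) = integral\<^sup>L lborel f" for t
  proof -
    have "integrable (distr lborel borel ((+) (t *\<^sub>R b))) f" using fint by (simp add: lborel_distr_plus)
    then show "integrable lborel (\<lambda>x. f (x + t *\<^sub>R b))"
      by (subst (asm) integrable_distr_eq) (use fint in \<open>auto simp: add.commute\<close>)
    have "integral\<^sup>L (distr lborel borel ((+) (t *\<^sub>R b))) f = integral\<^sup>L lborel f" by (simp add: lborel_distr_plus)
    then show "(\<integral>x. f (x + t *\<^sub>R b) \<partial>lborel) = integral\<^sup>L lborel f"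
      by (subst (asm) integral_distr) (use fint in \<open>auto simp: add.commute\<close>)
  qed
  have D0: "(\<integral>x. D n x \<partial>lborel) = 0" for n
    unfolding D_def using fs[of "1 / Suc n"] fint by simp
  have Dlim: "(\<lambda>n. D n x) \<longlonglongrightarrow> partial_deriv b f x" for x
  proof -
    have "((\<lambda>h. (f (x + h *\<^sub>R b) - f x) / h) \<longlongrightarrow> partial_deriv b f x) (at 0)"
      using dl[of x 0] by (simp add: DERIV_def)
    then have "(\<lambda>n. (f (x + (1 / Suc n) *\<^sub>R b) - f x) / (1 / Suc n)) \<longlonglongrightarrow> partial_deriv b f x"
    proof (rule filterlim_compose)
      show "filterlim (\<lambda>n. 1 / real (Suc n)) (at 0) sequentially"
        by (rule filterlim_atI[OF LIMSEQ_Suc[OF lim_1_over_n]]) simp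
    qed
    then show ?thesis by (simp add: D_def)
  qed
  \<comment> \<open>The closed 1-neighbourhood of \<open>K\<close>: the step
    \<open>1 / Suc n\<close> never exceeds 1, hence every difference quotient vanishes
    outside.\<close>
  define K' where "K' = {x + y | x y. x \<in> K \<and> y \<in> cball 0 1}"
  have K': "compact K'" unfolding K'_def using K by (intro compact_sums) auto
  have KK: "K \<subseteq> K'" unfolding K'_def by (force intro: exI[of _ 0])
  have C: "C \<ge> 0" using bd[of 0] by linarith
  have Dbd: "\<bar>D n x\<bar> \<le> C * indicator K' x" for n x
  proof (cases "x \<in> K'")
    case True
    have "(1 / Suc n :: real) > 0" by simp
    from MVT2[OF this, of "\<lambda>t. f (x + t *\<^sub>R b)" "\<lambda>t. partial_deriv b f (x + t *\<^sub>R b)"] dl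
    obtain z where "f (x + (1 / Suc n) *\<^sub>R b) - f x = (1 / Suc n) * partial_deriv b f (x + z *\<^sub>R b)"
      by auto
    then have "D n x = partial_deriv b f (x + z *\<^sub>R b)" by (simp add: D_def)
    then show ?thesis using bd True by simp
  next
    case False
    have "x + (1 / Suc n) *\<^sub>R b \<notin> K"
    proof
      assume a: "x + (1 / Suc n) *\<^sub>R b \<in> K"
      have "x = (x + (1 / Suc n) *\<^sub>R b) + (- (1 / Suc n)) *\<^sub>R b" by (simp flip: scaleR_left.add add: add.assoc)
      moreover have "(- (1 / Suc n)) *\<^sub>R b \<in> cball 0 1" using b by simp
      ultimately show False using a False unfolding K'_def by blast
    qed
    then show ?thesis using False KK K(2) by (auto simp: D_def)
  qed
  have w: "integrable lborel (\<lambda>x. C * indicator K' x)"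
    using K' borel_integrable_compact[of K' "\<lambda>x. 1::real"] by simp
  have meas: "D n \<in> borel_measurable lborel" for n
    unfolding D_def using contf by (auto intro!: borel_measurable_continuous_onI continuous_intros continuous_on_compose2[OF contf])
  have measp: "partial_deriv b f \<in> borel_measurable lborel"
    by (rule borel_measurable_LIMSEQ_real[OF Dlim meas])
  have Dbd': "AE x in lborel. norm (D n x) \<le> C * indicator K' x" for n using Dbd by auto
  have Dlim': "AE x in lborel. (\<lambda>n. D n x) \<longlonglongrightarrow> partial_deriv b f x" using Dlim by auto
  show "integrable lborel (partial_deriv b f)"
    by (rule integrable_dominated_convergence[OF measp meas w Dlim' Dbd'])
  have "(\<lambda>n. \<integral>x. D n x \<partial>lborel) \<longlonglongrightarrow> (\<integral>x. partial_deriv b f x \<partial>lborel)"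
    by (rule integral_dominated_convergence[OF measp meas w Dlim' Dbd'])
  then show "(\<integral>x. partial_deriv b f x \<partial>lborel) = 0"
    using D0 LIMSEQ_unique[OF _ tendsto_const] by auto
qed

lemma integral_lebesgue_on_support:
  fixes f :: "'a::euclidean_space \<Rightarrow> 'b::{banach, second_countable_topology}"
  assumes "\<Omega> \<in> sets lebesgue" "f \<in> borel_measurable borel" "\<And>x. x \<notin> \<Omega> \<Longrightarrow> f x = 0"
  shows "(\<integral>x. f x \<partial>lebesgue_on \<Omega>) = (\<integral>x. f x \<partial>lborel)"
proof -
  have "(\<integral>x. f x \<partial>lebesgue_on \<Omega>) = (\<integral>x. indicator \<Omega> x *\<^sub>R f x \<partial>lebesgue)"
    using assms(1) by (intro integral_restrict_space) simp
  also have "\<dots> = (\<integral>x. f x \<partial>lebesgue)"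
    by (rule Bochner_Integration.integral_cong) (use assms(3) in \<open>auto simp: indicator_def\<close>)
  also have "\<dots> = (\<integral>x. f x \<partial>lborel)" using assms(2) by (intro integral_completion) simp
  finally show ?thesis .
qed

lemma locally_integrable_continuous:
  fixes f :: "'a::euclidean_space \<Rightarrow> 'b::euclidean_space"
  assumes "continuous_on \<Omega> f"
  shows "locally_integrable \<Omega> f"
  unfolding locally_integrable_def
proof (intro allI impI)
  fix K assume K: "compact K \<and> K \<subseteq> \<Omega>"
  then have "continuous_on K f" using assms continuous_on_subset by blast
  then have "integrable lborel (\<lambda>x. indicator K x *\<^sub>R f x)" using K by (intro borel_integrable_compact) auto
  then have "integrable lebesgue (\<lambda>x. indicator K x *\<^sub>R f x)"
    by (subst integrable_completion) auto
  then show "integrable (lebesgue_on K) f"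
    using K by (subst integrable_restrict_space) (auto intro: fmeasurableD[OF lmeasurable_compact])
qed

text \<open>The product rule turns integration by parts into the vanishing integral of a derivative
  of the compactly supported function \<open>\<phi> * \<psi>\<close>.\<close>

lemma has_weak_gradient_test:
  assumes \<Omega>: "open \<Omega>" and \<phi>: "test_function \<Omega> \<phi>"
  shows "has_weak_gradient \<Omega> \<phi> (grad \<phi>)"
  unfolding has_weak_gradient_def
proof (intro conjI allI impI ballI)
  show "locally_integrable \<Omega> \<phi>" "locally_integrable \<Omega> (grad \<phi>)"
    using test_function_continuous[OF \<phi>] continuous_on_grad_test[OF \<phi>] locally_integrable_continuous by blast+
  fix \<psi> :: "'a \<Rightarrow> real" and b :: 'a assume \<psi>: "test_function \<Omega> \<psi>" and b: "b \<in> Basis"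
  obtain K where K: "compact K" "K \<subseteq> \<Omega>" "\<And>x. x \<notin> K \<Longrightarrow> \<phi> x = 0" using \<phi> by (rule test_functionE) blast
  have gK: "grad \<phi> x = 0" if "x \<notin> K" for x using grad_zero_outside[OF compact_imp_closed[OF K(1)] K(3) that] .
  have p: "partial_deriv b (\<lambda>x. \<phi> x * \<psi> x) x = \<phi> x * partial_deriv b \<psi> x + (grad \<phi> x \<bullet> b) * \<psi> x" for x
    using grad_has_derivative[OF test_function_differentiable[OF \<phi>], of x]
      grad_has_derivative[OF test_function_differentiable[OF \<psi>], of x] b
    by (simp add: partial_deriv_eq[OF has_derivative_mult] grad_inner_Basis)
  obtain B1 where B1: "B1 > 0" "\<And>x. \<bar>\<phi> x\<bar> \<le> B1" "\<And>x. norm (grad \<phi> x) \<le> B1" using \<phi> by (rule test_function_bounded) blast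
  obtain B2 where B2: "B2 > 0" "\<And>x. \<bar>\<psi> x\<bar> \<le> B2" "\<And>x. norm (grad \<psi> x) \<le> B2" using \<psi> by (rule test_function_bounded) blast
  have pb: "\<bar>partial_deriv b \<psi> x\<bar> \<le> B2" "\<bar>grad \<phi> x \<bullet> b\<bar> \<le> B1" for x
    using b B1(3) B2(3) Basis_le_norm order_trans grad_inner_Basis by metis+
  have zero: "(\<integral>x. partial_deriv b (\<lambda>x. \<phi> x * \<psi> x) x \<partial>lborel) = 0"
  proof (rule integral_partial_deriv_zero(2)[OF _ K(1) _ _ b, where C = "B1 * B2 + B1 * B2"])
    show "\<bar>partial_deriv b (\<lambda>x. \<phi> x * \<psi> x) x\<bar> \<le> B1 * B2 + B1 * B2" for x
    proof -
      have "\<bar>\<phi> x\<bar> * \<bar>partial_deriv b \<psi> x\<bar> \<le> B1 * B2" "\<bar>grad \<phi> x \<bullet> b\<bar> * \<bar>\<psi> x\<bar> \<le> B1 * B2"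
        using B1 B2 pb less_imp_le[OF B1(1)] less_imp_le[OF B2(1)] by (auto intro!: mult_mono)
      then show ?thesis unfolding p
        using abs_triangle_ineq[of "\<phi> x * partial_deriv b \<psi> x" "(grad \<phi> x \<bullet> b) * \<psi> x"] by (simp add: abs_mult)
    qed
  qed (use K test_function_differentiable[OF \<phi>] test_function_differentiable[OF \<psi>] in \<open>auto intro: differentiable_mult\<close>)
  have c: "continuous_on UNIV (\<lambda>x. \<phi> x * partial_deriv b \<psi> x)" "continuous_on UNIV (\<lambda>x. (grad \<phi> x \<bullet> b) * \<psi> x)"
    using b smooth_on_continuous[OF smooth_on_partial_deriv[OF test_function_smooth[OF \<psi>] b]]
    by (auto intro!: continuous_intros test_function_continuous[OF \<psi>] test_function_continuous[OF \<phi>] continuous_on_grad_test[OF \<phi>])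
  have int: "integrable lborel f" if "continuous_on UNIV f" "\<And>x. x \<notin> K \<Longrightarrow> f x = 0" for f :: "'a \<Rightarrow> real"
  proof -
    have "integrable lborel (\<lambda>x. indicator K x *\<^sub>R f x)"
      using K that by (intro borel_integrable_compact) (auto intro: continuous_on_subset)
    moreover have "(\<lambda>x. indicator K x *\<^sub>R f x) = f" by (rule ext) (use that(2) in \<open>auto simp: indicator_def\<close>)
    ultimately show ?thesis by simp
  qed
  have i: "integrable lborel (\<lambda>x. \<phi> x * partial_deriv b \<psi> x)" "integrable lborel (\<lambda>x. (grad \<phi> x \<bullet> b) * \<psi> x)"
    using int[OF c(1)] int[OF c(2)] K(3) gK by auto
  have "(\<integral>x. \<phi> x * partial_deriv b \<psi> x \<partial>lborel) = - (\<integral>x. (grad \<phi> x \<bullet> b) * \<psi> x \<partial>lborel)"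
    using zero unfolding p Bochner_Integration.integral_add[OF i] by simp
  moreover have "(\<integral>x. \<phi> x * partial_deriv b \<psi> x \<partial>lebesgue_on \<Omega>) = (\<integral>x. \<phi> x * partial_deriv b \<psi> x \<partial>lborel)"
    using \<Omega> K c(1) by (intro integral_lebesgue_on_support) (auto intro: borel_measurable_continuous_onI)
  moreover have "(\<integral>x. (grad \<phi> x \<bullet> b) * \<psi> x \<partial>lebesgue_on \<Omega>) = (\<integral>x. (grad \<phi> x \<bullet> b) * \<psi> x \<partial>lborel)"
  proof (rule integral_lebesgue_on_support)
    show "(grad \<phi> x \<bullet> b) * \<psi> x = 0" if "x \<notin> \<Omega>" for x
    proof -
      have "grad \<phi> x = 0" using gK that K(2) by blast
      then show ?thesis by simp
    qed
  qed (use \<Omega> c(2) in \<open>auto intro: borel_measurable_continuous_onI\<close>)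
  ultimately show "(\<integral>x. \<phi> x * partial_deriv b \<psi> x \<partial>lebesgue_on \<Omega>) = - (\<integral>x. (grad \<phi> x \<bullet> b) * \<psi> x \<partial>lebesgue_on \<Omega>)"
    by simp
qed

lemma integrable_times_test:
  fixes h :: "'a::euclidean_space \<Rightarrow> real"
  assumes \<Omega>: "open \<Omega>" and h: "locally_integrable \<Omega> h" and K: "compact K" "K \<subseteq> \<Omega>" "\<And>x. x \<notin> K \<Longrightarrow> f x = 0"
    and f: "continuous_on UNIV f"
  shows "integrable (lebesgue_on \<Omega>) (\<lambda>x. h x * f x)"
proof -
  have "bounded (f ` K)" using K f by (intro compact_imp_bounded compact_continuous_image) (auto intro: continuous_on_subset)
  then obtain B where B: "\<And>x. x \<in> K \<Longrightarrow> \<bar>f x\<bar> \<le> B" by (auto simp: bounded_iff)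
  have hK: "integrable lebesgue (\<lambda>x. indicator K x * h x)"
  proof -
    have "integrable (lebesgue_on K) h" using h K unfolding locally_integrable_def by blast
    then show ?thesis using K by (subst (asm) integrable_restrict_space) (auto intro: fmeasurableD[OF lmeasurable_compact])
  qed
  have fm: "f \<in> borel_measurable lebesgue" using f borel_measurable_continuous_onI[of f] by (simp add: measurable_completion)
  have "integrable lebesgue (\<lambda>x. (indicator K x * h x) * f x)"
  proof (rule Bochner_Integration.integrable_bound[OF integrable_mult_right[OF hK, of B]])
    show "AE x in lebesgue. norm (indicator K x * h x * f x) \<le> norm (B * (indicator K x * h x))"
    proof (rule AE_I2)
      fix x
      show "norm (indicator K x * h x * f x) \<le> norm (B * (indicator K x * h x))"
      proof (cases "x \<in> K")
        case True
        then have "\<bar>f x\<bar> \<le> \<bar>B\<bar>" using B[of x] by linarith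
        then show ?thesis using True mult_left_mono[of "\<bar>f x\<bar>" "\<bar>B\<bar>" "\<bar>h x\<bar>"] by (simp add: abs_mult mult.commute)
      qed simp
    qed
  qed (use hK fm in auto)
  moreover have "(indicator K x * h x) * f x = indicator \<Omega> x *\<^sub>R (h x * f x)" for x
    using K(2) K(3)[of x] by (auto simp: indicator_def)
  ultimately show ?thesis using \<Omega> by (subst integrable_restrict_space) auto
qed

lemma weak_gradient_unique:
  assumes \<Omega>: "open \<Omega>" and g: "has_weak_gradient \<Omega> u g" and h: "has_weak_gradient \<Omega> u h"
  shows "AE x in lebesgue_on \<Omega>. g x = h x"
proof -
  have "AE x in lebesgue_on \<Omega>. (g x - h x) \<bullet> b = 0" if b: "b \<in> Basis" for b
  proof (rule fundamental_lemma[OF \<Omega>])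
    have li: "locally_integrable \<Omega> (\<lambda>x. g x \<bullet> b)" "locally_integrable \<Omega> (\<lambda>x. h x \<bullet> b)"
      using g h by (auto simp: has_weak_gradient_def locally_integrable_def)
    then show "locally_integrable \<Omega> (\<lambda>x. (g x - h x) \<bullet> b)"
      by (auto simp: locally_integrable_def inner_diff_left)
    fix \<phi> :: "'a \<Rightarrow> real" assume \<phi>: "test_function \<Omega> \<phi>"
    obtain K where K: "compact K" "K \<subseteq> \<Omega>" "\<And>x. x \<notin> K \<Longrightarrow> \<phi> x = 0" using \<phi> by (rule test_functionE) blast
    note i = integrable_times_test[OF \<Omega> li(1) K test_function_continuous[OF \<phi>]]
      integrable_times_test[OF \<Omega> li(2) K test_function_continuous[OF \<phi>]]
    have "(\<integral>x. (g x \<bullet> b) * \<phi> x \<partial>lebesgue_on \<Omega>) = (\<integral>x. (h x \<bullet> b) * \<phi> x \<partial>lebesgue_on \<Omega>)"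
    proof -
      have "(\<integral>x. u x * partial_deriv b \<phi> x \<partial>lebesgue_on \<Omega>) = - (\<integral>x. (g x \<bullet> b) * \<phi> x \<partial>lebesgue_on \<Omega>)"
        "(\<integral>x. u x * partial_deriv b \<phi> x \<partial>lebesgue_on \<Omega>) = - (\<integral>x. (h x \<bullet> b) * \<phi> x \<partial>lebesgue_on \<Omega>)"
        using g h \<phi> b by (auto simp: has_weak_gradient_def)
      then show ?thesis by simp
    qed
    then show "(\<integral>x. ((g x - h x) \<bullet> b) * \<phi> x \<partial>lebesgue_on \<Omega>) = 0"
      using i by (simp add: inner_diff_left left_diff_distrib)
  qed
  then have "AE x in lebesgue_on \<Omega>. \<forall>b\<in>Basis. (g x - h x) \<bullet> b = 0"
    by (subst AE_ball_countable) (auto intro: countable_finite)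
  then show ?thesis
  proof eventually_elim
    case (elim x)
    then have "g x - h x = 0" using euclidean_all_zero_iff by blast
    then show ?case by simp
  qed
qed

lemma has_weak_gradient_weak_grad:
  "has_weak_gradient \<Omega> u g \<Longrightarrow> has_weak_gradient \<Omega> u (weak_grad \<Omega> u)"
  unfolding weak_grad_def by (rule someI[of "has_weak_gradient \<Omega> u" g])

lemma weak_grad_eq:
  "open \<Omega> \<Longrightarrow> has_weak_gradient \<Omega> u g \<Longrightarrow> AE x in lebesgue_on \<Omega>. weak_grad \<Omega> u x = g x"
  using weak_gradient_unique has_weak_gradient_weak_grad by blast

lemma has_weak_gradient_diff:
  assumes \<Omega>: "open \<Omega>" and u: "has_weak_gradient \<Omega> u g" and w: "has_weak_gradient \<Omega> w h"
  shows "has_weak_gradient \<Omega> (\<lambda>x. u x - w x) (\<lambda>x. g x - h x)"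
  unfolding has_weak_gradient_def
proof (intro conjI allI impI ballI)
  show "locally_integrable \<Omega> (\<lambda>x. u x - w x)" "locally_integrable \<Omega> (\<lambda>x. g x - h x)"
    using u w by (auto simp: has_weak_gradient_def locally_integrable_def)
  fix \<phi> :: "'a \<Rightarrow> real" and b :: 'a assume \<phi>: "test_function \<Omega> \<phi>" and b: "b \<in> Basis"
  obtain K where K: "compact K" "K \<subseteq> \<Omega>" "\<And>x. x \<notin> K \<Longrightarrow> \<phi> x = 0" using \<phi> by (rule test_functionE) blast
  have K': "partial_deriv b \<phi> x = 0" if "x \<notin> K" for x
    using grad_zero_outside[OF compact_imp_closed[OF K(1)] K(3) that] grad_inner_Basis[OF b, of \<phi> x] by simp
  have c: "continuous_on UNIV (partial_deriv b \<phi>)"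
    by (rule smooth_on_continuous[OF smooth_on_partial_deriv[OF test_function_smooth[OF \<phi>] b]])
  have l: "locally_integrable \<Omega> u" "locally_integrable \<Omega> w" "locally_integrable \<Omega> (\<lambda>x. g x \<bullet> b)" "locally_integrable \<Omega> (\<lambda>x. h x \<bullet> b)"
    using u w by (auto simp: has_weak_gradient_def locally_integrable_def)
  note i = integrable_times_test[OF \<Omega> l(1) K(1,2) K' c] integrable_times_test[OF \<Omega> l(2) K(1,2) K' c]
    integrable_times_test[OF \<Omega> l(3) K(1,2,3) test_function_continuous[OF \<phi>]]
    integrable_times_test[OF \<Omega> l(4) K(1,2,3) test_function_continuous[OF \<phi>]]
  have "(\<integral>x. u x * partial_deriv b \<phi> x \<partial>lebesgue_on \<Omega>) = - (\<integral>x. (g x \<bullet> b) * \<phi> x \<partial>lebesgue_on \<Omega>)"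
    "(\<integral>x. w x * partial_deriv b \<phi> x \<partial>lebesgue_on \<Omega>) = - (\<integral>x. (h x \<bullet> b) * \<phi> x \<partial>lebesgue_on \<Omega>)"
    using u w \<phi> b by (auto simp: has_weak_gradient_def)
  then show "(\<integral>x. (u x - w x) * partial_deriv b \<phi> x \<partial>lebesgue_on \<Omega>) = - (\<integral>x. ((g x - h x) \<bullet> b) * \<phi> x \<partial>lebesgue_on \<Omega>)"
    using i by (simp add: inner_diff_left left_diff_distrib)
qed

section \<open>Morrey's inequality\<close>

text \<open>This holds by completeness of Lebesgue measure. It serves \<open>weak_grad\<close>,
  which is picked by choice: its measurability is carried over from a known representative.\<close>

lemma borel_measurable_lebesgue_on_AE:
  fixes f g :: "'a::euclidean_space \<Rightarrow> 'b::euclidean_space"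
  assumes f: "f \<in> borel_measurable (lebesgue_on \<Omega>)" and \<Omega>: "\<Omega> \<in> sets lebesgue"
    and ae: "AE x in lebesgue_on \<Omega>. f x = g x"
  shows "g \<in> borel_measurable (lebesgue_on \<Omega>)"
proof (rule measurableI)
  fix A :: "'b set" assume A: "A \<in> sets borel"
  have fA: "f -` A \<inter> \<Omega> \<in> sets lebesgue"
    using measurable_sets[OF f A] \<Omega> by (simp add: sets_restrict_space_iff)
  have "AE x in lebesgue. x \<in> \<Omega> \<longrightarrow> f x = g x"
    using ae \<Omega> by (subst (asm) AE_restrict_space_iff) auto
  then have "AE x in lebesgue. x \<in> f -` A \<inter> \<Omega> \<longleftrightarrow> x \<in> g -` A \<inter> \<Omega>"
    by eventually_elim auto
  then have "g -` A \<inter> \<Omega> \<in> sets lebesgue"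
    by (rule completion.in_sets_AE) (use fA in auto)
  then show "g -` A \<inter> space (lebesgue_on \<Omega>) \<in> sets (lebesgue_on \<Omega>)"
    using \<Omega> by (simp add: sets_restrict_space_iff)
qed simp

abbreviation cube :: "real \<Rightarrow> 'a::euclidean_space set" where
  "cube \<epsilon> \<equiv> cbox (- (\<epsilon> *\<^sub>R One)) (\<epsilon> *\<^sub>R One)"

lemma content_cube: "\<epsilon> \<ge> 0 \<Longrightarrow> measure lborel (cube \<epsilon> :: 'a::euclidean_space set) = (2 * \<epsilon>) ^ DIM('a)"
  by (subst content_cbox) (auto simp: inner_sum_left_Basis)

lemma norm_cube_le:
  fixes z :: "'a::euclidean_space"
  assumes "z \<in> cube \<epsilon>" shows "norm z \<le> real DIM('a) * \<epsilon>"
proof -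
  have "norm z \<le> (\<Sum>b\<in>Basis. \<bar>z \<bullet> b\<bar>)" by (rule norm_le_l1)
  also have "\<dots> \<le> (\<Sum>b\<in>(Basis::'a set). \<epsilon>)"
    using assms by (intro sum_mono) (force simp: mem_box inner_sum_left_Basis abs_le_iff)
  finally show ?thesis by simp
qed

text \<open>Scaling by \<open>t\<close> costs the factor \<open>t\<close> to the power
  \<open>- N / p\<close> in the L^p norm. It is integrable at 0 exactly because
  \<open>p > N\<close>, and this is where Morrey's inequality gets its condition.\<close>

lemma Lp_norm_affine_le:
  fixes g :: "'a::euclidean_space \<Rightarrow> 'a"
  assumes \<Omega>: "open \<Omega>" and g: "continuous_on UNIV g" "Lp_mem \<Omega> p g" "\<And>x. x \<notin> \<Omega> \<Longrightarrow> g x = 0"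
    and p: "p > 0" and t: "t > 0" and Q: "Q \<in> lmeasurable"
  shows "Lp_mem Q p (\<lambda>z. g (y + t *\<^sub>R z))"
    "Lp_norm Q p (\<lambda>z. g (y + t *\<^sub>R z)) \<le> t powr (- (real DIM('a) / p)) * Lp_norm \<Omega> p g"
proof -
  define f where "f x = norm (g x) powr p" for x
  have f0: "f x = 0" if "x \<notin> \<Omega>" for x using g(3)[OF that] by (simp add: f_def)
  have fc: "continuous_on UNIV f"
    unfolding f_def using g(1) p by (intro continuous_on_powr' continuous_intros) auto
  then have fm[measurable]: "f \<in> borel_measurable borel" by (rule borel_measurable_continuous_onI)
  have "integrable (lebesgue_on \<Omega>) f" using g(2) by (simp add: f_def[abs_def] Lp_mem_def)
  then have "integrable lebesgue (\<lambda>x. indicator \<Omega> x *\<^sub>R f x)" using \<Omega> by (subst (asm) integrable_restrict_space) auto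
  moreover have "(\<lambda>x. indicator \<Omega> x *\<^sub>R f x) = f"
    by (rule ext) (use f0 in \<open>auto simp: indicator_def\<close>)
  ultimately have fi: "integrable lborel f" using fm by (simp add: integrable_completion)
  have I: "integral\<^sup>L lborel f = Lp_norm \<Omega> p g powr p"
    unfolding Lp_norm_powr[OF p] f_def[symmetric]
    by (rule integral_lebesgue_on_support[symmetric]) (use \<Omega> f0 in auto)
  have aff: "lborel = density (distr lborel borel (\<lambda>x. y + t *\<^sub>R x)) (\<lambda>_. ennreal (\<bar>t\<bar> ^ DIM('a)))"
    by (rule lborel_affine) (use t in simp)
  have ti: "integrable lborel (\<lambda>z. f (y + t *\<^sub>R z))"
  proof -
    have "integrable (density (distr lborel borel (\<lambda>x. y + t *\<^sub>R x)) (\<lambda>_. ennreal (\<bar>t\<bar> ^ DIM('a)))) f"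
      using fi aff by metis
    then have "integrable (distr lborel borel (\<lambda>x. y + t *\<^sub>R x)) (\<lambda>x. \<bar>t\<bar> ^ DIM('a) *\<^sub>R f x)"
      by (subst (asm) integrable_density) auto
    then have "integrable lborel (\<lambda>z. \<bar>t\<bar> ^ DIM('a) *\<^sub>R f (y + t *\<^sub>R z))"
      by (subst (asm) integrable_distr_eq) auto
    then show ?thesis using t by simp
  qed
  have tI: "t ^ DIM('a) * (\<integral>z. f (y + t *\<^sub>R z) \<partial>lborel) = integral\<^sup>L lborel f"
  proof -
    have "integral\<^sup>L lborel f = integral\<^sup>L (density (distr lborel borel (\<lambda>x. y + t *\<^sub>R x)) (\<lambda>_. ennreal (\<bar>t\<bar> ^ DIM('a)))) f"
      using aff by metis
    also have "\<dots> = (\<integral>x. \<bar>t\<bar> ^ DIM('a) *\<^sub>R f x \<partial>distr lborel borel (\<lambda>x. y + t *\<^sub>R x))"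
      by (rule integral_density) auto
    also have "\<dots> = (\<integral>z. \<bar>t\<bar> ^ DIM('a) *\<^sub>R f (y + t *\<^sub>R z) \<partial>lborel)"
      by (rule integral_distr) auto
    finally show ?thesis using t by simp
  qed
  have gm: "(\<lambda>z. g (y + t *\<^sub>R z)) \<in> borel_measurable (lebesgue_on Q)"
    using Q by (intro borel_measurable_continuous_lebesgue_on continuous_on_compose2[OF g(1)] continuous_intros) auto
  have tiL: "integrable lebesgue (\<lambda>z. f (y + t *\<^sub>R z))" using ti by (subst integrable_completion) auto
  have Qi: "integrable lebesgue (\<lambda>z. indicator Q z *\<^sub>R f (y + t *\<^sub>R z))"
    using Q by (intro integrable_mult_indicator tiL) auto
  have tiQ: "integrable (lebesgue_on Q) (\<lambda>z. f (y + t *\<^sub>R z))"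
    using Q Qi by (subst integrable_restrict_space) auto
  show "Lp_mem Q p (\<lambda>z. g (y + t *\<^sub>R z))"
    using gm tiQ by (simp add: Lp_mem_def f_def)
  have "(\<integral>z. f (y + t *\<^sub>R z) \<partial>lebesgue_on Q) = (\<integral>z. indicator Q z *\<^sub>R f (y + t *\<^sub>R z) \<partial>lebesgue)"
    using Q by (intro integral_restrict_space) auto
  also have "\<dots> \<le> (\<integral>z. f (y + t *\<^sub>R z) \<partial>lebesgue)"
    using Qi tiL by (intro integral_mono) (auto simp: indicator_def f_def)
  also have "\<dots> = (\<integral>z. f (y + t *\<^sub>R z) \<partial>lborel)" by (rule integral_completion) auto
  also have "\<dots> = (t powr (- (real DIM('a) / p)) * Lp_norm \<Omega> p g) powr p"
  proof -
    have "(t powr (- (real DIM('a) / p))) powr p = inverse (t ^ DIM('a))"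
    proof -
      have "(t powr (- (real DIM('a) / p))) powr p = t powr (- real DIM('a))"
        using p by (subst powr_powr) simp
      then show ?thesis using t by (simp add: powr_minus powr_realpow)
    qed
    moreover have "(\<integral>z. f (y + t *\<^sub>R z) \<partial>lborel) = inverse (t ^ DIM('a)) * integral\<^sup>L lborel f"
      using tI t by (simp add: field_simps)
    ultimately show ?thesis by (simp add: powr_mult I)
  qed
  finally show "Lp_norm Q p (\<lambda>z. g (y + t *\<^sub>R z)) \<le> t powr (- (real DIM('a) / p)) * Lp_norm \<Omega> p g"
    using p by (subst Lp_norm_le_iff) (auto simp: f_def)
qed

lemma integral_lebesgue_on_cbox:
  fixes f :: "'a::euclidean_space \<Rightarrow> real"
  assumes "continuous_on (cbox a b) f"
  shows "integrable (lebesgue_on (cbox a b)) f" "integral\<^sup>L (lebesgue_on (cbox a b)) f = integral (cbox a b) f"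
proof -
  show "integrable (lebesgue_on (cbox a b)) f" by (rule continuous_imp_integrable[OF assms])
  then show "integral\<^sup>L (lebesgue_on (cbox a b)) f = integral (cbox a b) f"
    by (rule lebesgue_integral_eq_integral) simp
qed

locale bdd_domain =
  fixes \<Omega> :: "'a::euclidean_space set"
  assumes open_dom: "open \<Omega>" and bounded_dom: "bounded \<Omega>" and nonempty_dom: "\<Omega> \<noteq> {}"
begin

lemma lmeas: "\<Omega> \<in> lmeasurable"
  using open_dom bounded_dom by (simp add: lmeasurable_open)

lemma sets_dom: "\<Omega> \<in> sets lebesgue"
  using lmeas by blast

lemma finite_measure_dom: "finite_measure (lebesgue_on \<Omega>)"
  using lmeas by (rule finite_measure_lebesgue_on)

lemma test_function_Lp:
  assumes "test_function \<Omega> \<phi>" "p \<ge> 0"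
  shows "Lp_mem \<Omega> p \<phi>" "Lp_mem \<Omega> p (grad \<phi>)"
proof -
  obtain B where B: "B > 0" "\<And>x. \<bar>\<phi> x\<bar> \<le> B" "\<And>x. norm (grad \<phi> x) \<le> B" using assms(1) by (rule test_function_bounded) blast
  show "Lp_mem \<Omega> p \<phi>"
    by (rule Lp_mem_bounded[OF lmeas _ _ assms(2), of _ B])
       (use B test_function_continuous[OF assms(1)] sets_dom in \<open>auto intro: borel_measurable_continuous_lebesgue_on\<close>)
  show "Lp_mem \<Omega> p (grad \<phi>)"
    by (rule Lp_mem_bounded[OF lmeas _ _ assms(2), of _ B])
       (use B continuous_on_grad_test[OF assms(1)] sets_dom in \<open>auto intro: borel_measurable_continuous_lebesgue_on\<close>)
qed

lemma test_function_zero: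
  assumes "test_function \<Omega> \<phi>" "x \<notin> \<Omega>"
  shows "\<phi> x = 0" "grad \<phi> x = 0"
proof -
  obtain K where K: "compact K" "K \<subseteq> \<Omega>" "\<And>x. x \<notin> K \<Longrightarrow> \<phi> x = 0" using assms(1) by (rule test_functionE) blast
  show "\<phi> x = 0" using K assms by blast
  show "grad \<phi> x = 0" using K assms by (intro grad_zero_outside[OF compact_imp_closed[OF K(1)]]) auto
qed

text \<open>A cube average of \<open>\<phi>\<close> along the moving points \<open>y + t w(z) + c z\<close>.\<close>

lemma cube_average_derivative:
  assumes \<phi>: "test_function \<Omega> \<phi>" and w: "continuous_on UNIV w"
  shows "((\<lambda>t. integral (cube \<epsilon>) (\<lambda>z. \<phi> (y + t *\<^sub>R w z + c *\<^sub>R z))) has_real_derivative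
    integral (cube \<epsilon>) (\<lambda>z. grad \<phi> (y + t *\<^sub>R w z + c *\<^sub>R z) \<bullet> w z)) (at t)"
proof -
  have "((\<lambda>t. integral (cube \<epsilon>) (\<lambda>z. \<phi> (y + t *\<^sub>R w z + c *\<^sub>R z))) has_field_derivative
    integral (cube \<epsilon>) (\<lambda>z. grad \<phi> (y + t *\<^sub>R w z + c *\<^sub>R z) \<bullet> w z)) (at t within UNIV)"
  proof (rule leibniz_rule_field_derivative)
    fix t z
    have "((\<lambda>t. \<phi> (y + t *\<^sub>R w z + c *\<^sub>R z)) has_derivative (\<lambda>h. grad \<phi> (y + t *\<^sub>R w z + c *\<^sub>R z) \<bullet> (h *\<^sub>R w z))) (at t)"
      by (rule has_derivative_compose[OF _ grad_has_derivative[OF test_function_differentiable[OF \<phi>]]])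
         (auto intro!: derivative_eq_intros)
    then show "((\<lambda>t. \<phi> (y + t *\<^sub>R w z + c *\<^sub>R z)) has_real_derivative grad \<phi> (y + t *\<^sub>R w z + c *\<^sub>R z) \<bullet> w z) (at t within UNIV)"
      by (simp add: has_field_derivative_def mult_commute_abs)
  next
    fix t
    show "(\<lambda>z. \<phi> (y + t *\<^sub>R w z + c *\<^sub>R z)) integrable_on cube \<epsilon>"
      by (intro integrable_continuous continuous_on_compose2[OF test_function_continuous[OF \<phi>, of UNIV]] continuous_intros
          continuous_on_subset[OF w]) auto
  next
    have "continuous_on (UNIV \<times> cube \<epsilon>) (\<lambda>x. grad \<phi> (y + fst x *\<^sub>R w (snd x) + c *\<^sub>R snd x) \<bullet> w (snd x))"
      by (intro continuous_on_compose2[OF continuous_on_grad_test[OF \<phi>, of UNIV]] continuous_intros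
          continuous_on_compose2[OF w]) auto
    then show "continuous_on (UNIV \<times> cube \<epsilon>) (\<lambda>(t, z). grad \<phi> (y + t *\<^sub>R w z + c *\<^sub>R z) \<bullet> w z)"
      by (simp add: case_prod_beta)
  qed auto
  then show ?thesis by simp
qed

text \<open>Hoelder on the cube, followed by the change of variables. The assumption
  \<open>path\<close> covers two motions of the cube: translation, with constant \<open>w\<close>
  and scale 1, and dilation about a point, with \<open>w z = z\<close> and scale equal to the
  time.\<close>

lemma cube_average_derivative_bound:
  assumes \<phi>: "test_function \<Omega> \<phi>" and w: "continuous_on UNIV w" and p: "p > 1" and t: "t > 0" and \<epsilon>: "\<epsilon> > 0"
    and path: "\<And>z. y + t' *\<^sub>R w z + c *\<^sub>R z = y' + t *\<^sub>R z" and W: "\<And>z. z \<in> cube \<epsilon> \<Longrightarrow> norm (w z) \<le> W"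
  shows "\<bar>integral (cube \<epsilon>) (\<lambda>z. grad \<phi> (y + t' *\<^sub>R w z + c *\<^sub>R z) \<bullet> w z)\<bar>
    \<le> W * (((2 * \<epsilon>) ^ DIM('a)) powr (1 - 1 / p) * (t powr (- (real DIM('a) / p)) * Lp_norm \<Omega> p (grad \<phi>)))"
proof -
  let ?Q = "cube \<epsilon> :: 'a set"
  have W0: "W \<ge> 0" using W[of 0] \<epsilon> norm_ge_zero[of "w 0"] by (auto simp: mem_box inner_sum_left_Basis intro: order_trans[of 0 "norm (w 0)"])
  note gc = continuous_on_grad_test[OF \<phi>, of UNIV]
  note Lp = Lp_norm_affine_le[OF open_dom gc test_function_Lp(2)[OF \<phi>] test_function_zero(2)[OF \<phi>] _ t, where Q = ?Q and y = y' and p = p]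
  have c1: "continuous_on ?Q (\<lambda>z. grad \<phi> (y' + t *\<^sub>R z) \<bullet> w z)" "continuous_on ?Q (\<lambda>z. norm (grad \<phi> (y' + t *\<^sub>R z)))"
    by (intro continuous_intros continuous_on_compose2[OF gc] continuous_on_subset[OF w]; simp)+
  have "\<bar>integral ?Q (\<lambda>z. grad \<phi> (y' + t *\<^sub>R z) \<bullet> w z)\<bar> = \<bar>\<integral>z. grad \<phi> (y' + t *\<^sub>R z) \<bullet> w z \<partial>lebesgue_on ?Q\<bar>"
    using integral_lebesgue_on_cbox(2)[OF c1(1)] by simp
  also have "\<dots> \<le> (\<integral>z. norm (grad \<phi> (y' + t *\<^sub>R z) \<bullet> w z) \<partial>lebesgue_on ?Q)"
    using integral_norm_bound[of "lebesgue_on ?Q" "\<lambda>z. grad \<phi> (y' + t *\<^sub>R z) \<bullet> w z"] by simp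
  also have "\<dots> \<le> (\<integral>z. W * norm (grad \<phi> (y' + t *\<^sub>R z)) \<partial>lebesgue_on ?Q)"
  proof (rule integral_mono)
    show "norm (grad \<phi> (y' + t *\<^sub>R z) \<bullet> w z) \<le> W * norm (grad \<phi> (y' + t *\<^sub>R z))" if "z \<in> space (lebesgue_on ?Q)" for z
      using W[of z] that Cauchy_Schwarz_ineq2[of "grad \<phi> (y' + t *\<^sub>R z)" "w z"]
        mult_left_mono[of "norm (w z)" W "norm (grad \<phi> (y' + t *\<^sub>R z))"] by (simp add: mult.commute)
  qed (use integral_lebesgue_on_cbox(1)[OF c1(1)] integral_lebesgue_on_cbox(1)[OF c1(2)] in auto)
  also have "\<dots> = W * (\<integral>z. norm (grad \<phi> (y' + t *\<^sub>R z)) \<partial>lebesgue_on ?Q)" by simp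
  also have "\<dots> \<le> W * (measure lebesgue ?Q powr (1 - 1 / p) * Lp_norm ?Q p (\<lambda>z. grad \<phi> (y' + t *\<^sub>R z)))"
    using Lp p W0 by (intro mult_left_mono Lp_Hoelder) auto
  also have "\<dots> \<le> W * (measure lebesgue ?Q powr (1 - 1 / p) * (t powr (- (real DIM('a) / p)) * Lp_norm \<Omega> p (grad \<phi>)))"
    using Lp p W0 by (intro mult_left_mono) auto
  also have "measure lebesgue ?Q = (2 * \<epsilon>) ^ DIM('a)"
    using content_cube[of \<epsilon>, where 'a = 'a] \<epsilon> by simp
  finally show ?thesis unfolding path .
qed

lemma cube_average_shift:
  assumes \<phi>: "test_function \<Omega> \<phi>" and p: "p > 1" and \<epsilon>: "\<epsilon> > 0"
  shows "\<bar>integral (cube \<epsilon>) (\<lambda>z. \<phi> (x + z)) - integral (cube \<epsilon>) (\<lambda>z. \<phi> (y + z))\<bar>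
    \<le> dist x y * (((2 * \<epsilon>) ^ DIM('a)) powr (1 - 1 / p) * Lp_norm \<Omega> p (grad \<phi>))" (is "_ \<le> ?B")
proof -
  define c where "c t = integral (cube \<epsilon>) (\<lambda>z. \<phi> (y + t *\<^sub>R (x - y) + 1 *\<^sub>R z))" for t
  define c' where "c' t = integral (cube \<epsilon>) (\<lambda>z. grad \<phi> (y + t *\<^sub>R (x - y) + 1 *\<^sub>R z) \<bullet> (x - y))" for t
  have d: "(c has_real_derivative c' t) (at t)" for t
    unfolding c_def c'_def by (rule cube_average_derivative[OF \<phi>]) auto
  have b: "\<bar>c' t\<bar> \<le> ?B" for t
    unfolding c'_def
    using cube_average_derivative_bound[OF \<phi> continuous_on_const p zero_less_one \<epsilon>, of y t "x - y" 1 "y + t *\<^sub>R (x - y)" "dist x y"]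
    by (simp add: dist_norm)
  obtain z where "c 1 - c 0 = (1 - 0) * c' z" using MVT2[of 0 1 c c'] d by auto
  then have "\<bar>c 1 - c 0\<bar> \<le> ?B" using b by simp
  then show ?thesis by (simp add: c_def)
qed

text \<open>The cube is contracted to its centre. Along the contraction the derivative of the
  average is at most a multiple of \<open>t powr (\<beta> - 1)\<close> with
  \<open>\<beta> = 1 - N / p > 0\<close>, which integrates to the factor
  \<open>1 / \<beta>\<close>.\<close>

lemma cube_average_center:
  assumes \<phi>: "test_function \<Omega> \<phi>" and p: "p > real DIM('a)" and \<epsilon>: "\<epsilon> > 0"
  shows "\<bar>integral (cube \<epsilon>) (\<lambda>z. \<phi> (x + z)) - (2 * \<epsilon>) ^ DIM('a) * \<phi> x\<bar>
    \<le> (real DIM('a) * \<epsilon> / (1 - real DIM('a) / p)) * (((2 * \<epsilon>) ^ DIM('a)) powr (1 - 1 / p) * Lp_norm \<Omega> p (grad \<phi>))"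
proof -
  have D1: "real DIM('a) \<ge> 1" by (simp add: Suc_leI)
  have p1: "p > 1" using p D1 by linarith
  define \<beta> where "\<beta> = 1 - real DIM('a) / p"
  have \<beta>: "\<beta> > 0" "\<beta> \<le> 1" using p p1 by (auto simp: \<beta>_def)
  define C where "C = (real DIM('a) * \<epsilon>) * (((2 * \<epsilon>) ^ DIM('a)) powr (1 - 1 / p) * Lp_norm \<Omega> p (grad \<phi>))"
  have C: "C \<ge> 0" using \<epsilon> by (simp add: C_def)
  define a where "a t = integral (cube \<epsilon>) (\<lambda>z. \<phi> (x + t *\<^sub>R z + 0 *\<^sub>R z))" for t
  define a' where "a' t = integral (cube \<epsilon>) (\<lambda>z. grad \<phi> (x + t *\<^sub>R z + 0 *\<^sub>R z) \<bullet> z)" for t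
  have d: "(a has_real_derivative a' t) (at t)" for t
    unfolding a_def a'_def by (rule cube_average_derivative[OF \<phi>]) auto
  have b: "\<bar>a' t\<bar> \<le> C * t powr (\<beta> - 1)" if t: "t > 0" for t
  proof -
    have "\<bar>a' t\<bar> \<le> (real DIM('a) * \<epsilon>) * (((2 * \<epsilon>) ^ DIM('a)) powr (1 - 1 / p) * (t powr (- (real DIM('a) / p)) * Lp_norm \<Omega> p (grad \<phi>)))"
      unfolding a'_def
      by (rule cube_average_derivative_bound[OF \<phi> _ p1 t \<epsilon>, of "\<lambda>z. z" x t 0 x]) (auto intro: norm_cube_le)
    then show ?thesis by (simp add: C_def \<beta>_def mult_ac)
  qed
  \<comment> \<open>The bound on the derivative blows up at 0, so the primitive
    \<open>C * t powr \<beta> / \<beta>\<close> is compared with \<open>a\<close> on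
    \<open>[s, 1]\<close> only, and \<open>s\<close> tends to 0 afterwards.\<close>
  have main: "\<bar>a 1 - a s\<bar> \<le> C / \<beta>" if s: "0 < s" "s < 1" for s
  proof -
    have dp: "((\<lambda>t. C * t powr \<beta> / \<beta>) has_real_derivative C * t powr (\<beta> - 1)) (at t)" if "t > 0" for t
      using that \<beta> by (auto intro!: derivative_eq_intros)
    have "C * s powr \<beta> / \<beta> + a s \<le> C * 1 powr \<beta> / \<beta> + a 1"
    proof (rule DERIV_nonneg_imp_nondecreasing[of s 1 "\<lambda>t. C * t powr \<beta> / \<beta> + a t"])
      fix t assume "s \<le> t" "t \<le> 1"
      then have "t > 0" using s by simp
      then show "\<exists>y. ((\<lambda>t. C * t powr \<beta> / \<beta> + a t) has_real_derivative y) (at t) \<and> 0 \<le> y"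
        using b[of t] by (intro exI[of _ "C * t powr (\<beta> - 1) + a' t"] conjI DERIV_add dp d) auto
    qed (use s in simp)
    moreover have "C * s powr \<beta> / \<beta> - a s \<le> C * 1 powr \<beta> / \<beta> - a 1"
    proof (rule DERIV_nonneg_imp_nondecreasing[of s 1 "\<lambda>t. C * t powr \<beta> / \<beta> - a t"])
      fix t assume "s \<le> t" "t \<le> 1"
      then have "t > 0" using s by simp
      then show "\<exists>y. ((\<lambda>t. C * t powr \<beta> / \<beta> - a t) has_real_derivative y) (at t) \<and> 0 \<le> y"
        using b[of t] by (intro exI[of _ "C * t powr (\<beta> - 1) - a' t"] conjI DERIV_diff dp d) auto
    qed (use s in simp)
    moreover have "C * s powr \<beta> / \<beta> \<ge> 0" using C \<beta> by simp
    ultimately show ?thesis by (simp add: abs_le_iff)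
  qed
  have "isCont a 0" using d DERIV_isCont by blast
  then have "(a \<longlongrightarrow> a 0) (at_right 0)" by (auto simp: isCont_def filterlim_at_split)
  then have lim: "((\<lambda>s. \<bar>a 1 - a s\<bar>) \<longlongrightarrow> \<bar>a 1 - a 0\<bar>) (at_right 0)" by (intro tendsto_intros)
  have "\<forall>\<^sub>F s in at_right 0. s \<in> {0<..<(1::real)}" by (rule eventually_at_right_real) simp
  then have ev: "\<forall>\<^sub>F s in at_right 0. \<bar>a 1 - a s\<bar> \<le> C / \<beta>"
    by eventually_elim (use main in auto)
  have "\<bar>a 1 - a 0\<bar> \<le> C / \<beta>" by (rule tendsto_upperbound[OF lim ev]) simp
  moreover have "a 0 = (2 * \<epsilon>) ^ DIM('a) * \<phi> x"
    using content_cube[of \<epsilon>, where 'a = 'a] \<epsilon> by (simp add: a_def)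
  moreover have "a 1 = integral (cube \<epsilon>) (\<lambda>z. \<phi> (x + z))" by (simp add: a_def)
  ultimately show ?thesis by (simp add: C_def \<beta>_def)
qed

text \<open>The cube has side \<open>2 * \<epsilon>\<close>: the summand \<open>d\<close> comes from
  moving it between the two points, the other one from replacing both values by averages. The side
  is kept free for two purposes. With \<open>\<epsilon> = d / 2\<close> one gets a Hoelder modulus;
  with \<open>\<epsilon>\<close> fixed and \<open>p\<close> tending to infinity the constant tends
  to \<open>d + 2 * N * \<epsilon>\<close>, which is sharp as \<open>\<epsilon>\<close> tends to
  0.\<close>

definition morrey :: "real \<Rightarrow> real \<Rightarrow> real \<Rightarrow> real" where
  "morrey p \<epsilon> d = (d + 2 * real DIM('a) * \<epsilon> / (1 - real DIM('a) / p)) * (2 * \<epsilon>) powr (- (real DIM('a) / p))"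

lemma Morrey_test:
  assumes \<phi>: "test_function \<Omega> \<phi>" and p: "p > real DIM('a)" and \<epsilon>: "\<epsilon> > 0"
  shows "\<bar>\<phi> x - \<phi> y\<bar> \<le> morrey p \<epsilon> (dist x y) * Lp_norm \<Omega> p (grad \<phi>)"
proof -
  have D1: "real DIM('a) \<ge> 1" by (simp add: Suc_leI)
  have p1: "p > 1" using p D1 by linarith
  define V where "V = (2 * \<epsilon>) ^ DIM('a)"
  have V: "V > 0" using \<epsilon> by (simp add: V_def)
  define G where "G = Lp_norm \<Omega> p (grad \<phi>)"
  define S where "S = real DIM('a) * \<epsilon> / (1 - real DIM('a) / p)"
  define m where "m x = integral (cube \<epsilon>) (\<lambda>z. \<phi> (x + z))" for x
  have 1: "\<bar>m x - m y\<bar> \<le> dist x y * (V powr (1 - 1 / p) * G)"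
    unfolding m_def V_def G_def by (rule cube_average_shift[OF \<phi> p1 \<epsilon>])
  have 2: "\<bar>m x - V * \<phi> x\<bar> \<le> S * (V powr (1 - 1 / p) * G)" for x
    unfolding m_def V_def G_def S_def by (rule cube_average_center[OF \<phi> p \<epsilon>])
  have "V * \<bar>\<phi> x - \<phi> y\<bar> = \<bar>V * \<phi> x - V * \<phi> y\<bar>" using V by (simp add: abs_mult flip: right_diff_distrib)
  also have "\<dots> \<le> (dist x y + 2 * S) * (V powr (1 - 1 / p) * G)"
    using 1 2[of x] 2[of y] by (simp add: algebra_simps abs_le_iff)
  finally have "V * \<bar>\<phi> x - \<phi> y\<bar> \<le> V * ((dist x y + 2 * S) * (V powr (- (1 / p)) * G))"
    using V by (simp add: powr_diff powr_minus_divide field_simps)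
  then have "\<bar>\<phi> x - \<phi> y\<bar> \<le> (dist x y + 2 * S) * (V powr (- (1 / p)) * G)" using V by simp
  moreover have "V powr (- (1 / p)) = (2 * \<epsilon>) powr (- (real DIM('a) / p))"
  proof -
    have "V = (2 * \<epsilon>) powr real DIM('a)" unfolding V_def using \<epsilon> by (intro powr_realpow[symmetric]) simp
    then have "V powr (- (1 / p)) = (2 * \<epsilon>) powr (real DIM('a) * (- (1 / p)))" by (simp only: powr_powr)
    then show ?thesis by simp
  qed
  ultimately show ?thesis by (simp add: morrey_def G_def S_def mult_ac)
qed

section \<open>The space \<open>W\<^sub>0\<^sup>1\<^sup>,\<^sup>p\<close>\<close>

definition diam :: real where "diam = diameter (closure \<Omega>)"

lemma diam_nonneg: "diam \<ge> 0"
  unfolding diam_def using bounded_dom by (intro diameter_ge_0 bounded_closure)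

lemma exists_frontier_near:
  assumes "x \<in> closure \<Omega>"
  shows "\<exists>y\<in>frontier \<Omega>. dist x y \<le> diam"
proof -
  have "\<Omega> \<noteq> UNIV" using bounded_dom not_bounded_UNIV by auto
  then obtain y where y: "y \<in> frontier \<Omega>" using nonempty_dom frontier_not_empty by blast
  then have "y \<in> closure \<Omega>" by (simp add: frontier_def)
  then show ?thesis using y assms bounded_dom
    unfolding diam_def by (intro bexI[of _ y] diameter_bounded_bound) auto
qed

lemma frontier_disjoint: "x \<in> frontier \<Omega> \<Longrightarrow> x \<notin> \<Omega>"
  using open_dom by (simp add: frontier_def interior_open)

lemma morrey_mono: "p > real DIM('a) \<Longrightarrow> \<epsilon> > 0 \<Longrightarrow> d \<le> d' \<Longrightarrow> morrey p \<epsilon> d \<le> morrey p \<epsilon> d'"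
  unfolding morrey_def by (intro mult_right_mono add_right_mono) auto

lemma morrey_nonneg:
  assumes "p > real DIM('a)" "\<epsilon> > 0" "d \<ge> 0"
  shows "morrey p \<epsilon> d \<ge> 0"
proof -
  have "real DIM('a) / p < 1" using assms by (simp add: divide_less_eq)
  then show ?thesis using assms unfolding morrey_def by (intro mult_nonneg_nonneg add_nonneg_nonneg divide_nonneg_nonneg) auto
qed

text \<open>A cube of side 1 removes the power, and some boundary point, where the function
  vanishes, lies within \<open>diam\<close>.\<close>

definition supc :: "real \<Rightarrow> real" where "supc p = morrey p (1/2) diam"

lemma supc_nonneg: "p > real DIM('a) \<Longrightarrow> supc p \<ge> 0"
  unfolding supc_def using diam_nonneg by (intro morrey_nonneg) auto

lemma test_function_sup:
  assumes \<phi>: "test_function \<Omega> \<phi>" and p: "p > real DIM('a)"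
  shows "\<bar>\<phi> x\<bar> \<le> supc p * Lp_norm \<Omega> p (grad \<phi>)"
proof (cases "x \<in> \<Omega>")
  case True
  then obtain y where y: "y \<in> frontier \<Omega>" "dist x y \<le> diam" using exists_frontier_near[of x] closure_subset by blast
  have "\<phi> y = 0" using frontier_disjoint[OF y(1)] test_function_zero(1)[OF \<phi>] by blast
  then have "\<bar>\<phi> x\<bar> \<le> morrey p (1/2) (dist x y) * Lp_norm \<Omega> p (grad \<phi>)"
    using Morrey_test[OF \<phi> p, of "1/2" x y] by simp
  also have "\<dots> \<le> supc p * Lp_norm \<Omega> p (grad \<phi>)"
    unfolding supc_def using y p by (intro mult_right_mono morrey_mono) auto
  finally show ?thesis .
next
  case False
  then show ?thesis using test_function_zero(1)[OF \<phi>] supc_nonneg[OF p] by simp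
qed

lemma W1p_weak_grad:
  assumes "u \<in> W1p \<Omega> p"
  shows "has_weak_gradient \<Omega> u (weak_grad \<Omega> u)" "Lp_mem \<Omega> p (weak_grad \<Omega> u)" "Lp_mem \<Omega> p u"
proof -
  obtain g where g: "has_weak_gradient \<Omega> u g" "Lp_mem \<Omega> p g" using assms by (auto simp: W1p_def)
  show "has_weak_gradient \<Omega> u (weak_grad \<Omega> u)" using g(1) by (rule has_weak_gradient_weak_grad)
  have ae: "AE x in lebesgue_on \<Omega>. g x = weak_grad \<Omega> u x"
    using weak_grad_eq[OF open_dom g(1)] by eventually_elim simp
  then show "Lp_mem \<Omega> p (weak_grad \<Omega> u)"
    using g(2) by (intro Lp_mem_cong_AE[OF g(2)] borel_measurable_lebesgue_on_AE[OF Lp_mem_measurable[OF g(2)] sets_dom]) auto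
  show "Lp_mem \<Omega> p u" using assms by (simp add: W1p_def)
qed

lemma weak_grad_Lp_norm:
  assumes g: "has_weak_gradient \<Omega> u g" and m: "g \<in> borel_measurable (lebesgue_on \<Omega>)"
  shows "Lp_norm \<Omega> p (weak_grad \<Omega> u) = Lp_norm \<Omega> p g"
proof -
  have ae: "AE x in lebesgue_on \<Omega>. g x = weak_grad \<Omega> u x"
    using weak_grad_eq[OF open_dom g] by eventually_elim simp
  show ?thesis
    by (rule Lp_norm_cong_AE[OF borel_measurable_lebesgue_on_AE[OF m sets_dom ae] m])
       (use ae in eventually_elim, simp)
qed

lemma W1p_norm_ge:
  assumes "p > 0"
  shows "Lp_norm \<Omega> p u \<le> W1p_norm \<Omega> p u" "Lp_norm \<Omega> p (weak_grad \<Omega> u) \<le> W1p_norm \<Omega> p u"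
proof -
  have *: "a \<le> (a powr p + b powr p) powr (1 / p)" if "a \<ge> 0" for a b :: real
  proof -
    have "a = (a powr p) powr (1 / p)" using that assms by (simp add: powr_powr)
    also have "\<dots> \<le> (a powr p + b powr p) powr (1 / p)" using assms by (intro powr_mono2) auto
    finally show ?thesis .
  qed
  show "Lp_norm \<Omega> p u \<le> W1p_norm \<Omega> p u" unfolding W1p_norm_def by (rule *) simp
  show "Lp_norm \<Omega> p (weak_grad \<Omega> u) \<le> W1p_norm \<Omega> p u"
    unfolding W1p_norm_def by (subst add.commute, rule *) simp
qed

text \<open>Convergence of the gradients controls the supremum of differences, so the approximants
  converge uniformly. Their uniform limit agrees with \<open>u\<close> almost everywhere along a
  subsequence, hence everywhere on the closure since both are continuous.\<close>

lemma W01pD: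
  assumes u: "u \<in> W01p \<Omega> p" and p: "p > real DIM('a)"
  shows "\<exists>\<phi>. (\<forall>n. test_function \<Omega> (\<phi> n)) \<and> uniform_limit (closure \<Omega>) \<phi> u sequentially \<and>
    (\<lambda>n. Lp_norm \<Omega> p (\<lambda>x. grad (\<phi> n) x - weak_grad \<Omega> u x)) \<longlonglongrightarrow> 0"
proof -
  have D1: "real DIM('a) \<ge> 1" by (simp add: Suc_leI)
  have p1: "p > 1" using p D1 by linarith
  obtain \<phi> where \<phi>: "\<And>n. test_function \<Omega> (\<phi> n)" and lim: "(\<lambda>n. W1p_norm \<Omega> p (\<lambda>x. \<phi> n x - u x)) \<longlonglongrightarrow> 0"
    and uc: "continuous_on (closure \<Omega>) u" and uW: "u \<in> W1p \<Omega> p"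
    using u by (auto simp: W01p_def)
  note wg = W1p_weak_grad[OF uW]
  have tL: "Lp_mem \<Omega> p (\<phi> n)" "Lp_mem \<Omega> p (grad (\<phi> n))" for n using test_function_Lp[OF \<phi>] p1 by auto
  have hw: "has_weak_gradient \<Omega> (\<lambda>x. \<phi> n x - u x) (\<lambda>x. grad (\<phi> n) x - weak_grad \<Omega> u x)" for n
    by (rule has_weak_gradient_diff[OF open_dom has_weak_gradient_test[OF open_dom \<phi>] wg(1)])
  have gm: "(\<lambda>x. grad (\<phi> n) x - weak_grad \<Omega> u x) \<in> borel_measurable (lebesgue_on \<Omega>)" for n
    using Lp_mem_diff[OF tL(2) wg(2)] p1 by (intro Lp_mem_measurable[where p = p]) auto
  have 1: "(\<lambda>n. Lp_norm \<Omega> p (\<lambda>x. grad (\<phi> n) x - weak_grad \<Omega> u x)) \<longlonglongrightarrow> 0"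
  proof (rule tendsto_sandwich[OF _ _ tendsto_const lim])
    show "\<forall>\<^sub>F n in sequentially. Lp_norm \<Omega> p (\<lambda>x. grad (\<phi> n) x - weak_grad \<Omega> u x) \<le> W1p_norm \<Omega> p (\<lambda>x. \<phi> n x - u x)"
      using W1p_norm_ge(2)[of p] p1 weak_grad_Lp_norm[OF hw gm] by (intro always_eventually) (metis less_trans zero_less_one)
  qed auto
  have 2: "(\<lambda>n. Lp_norm \<Omega> p (\<lambda>x. \<phi> n x - u x)) \<longlonglongrightarrow> 0"
  proof (rule tendsto_sandwich[OF _ _ tendsto_const lim])
    show "\<forall>\<^sub>F n in sequentially. Lp_norm \<Omega> p (\<lambda>x. \<phi> n x - u x) \<le> W1p_norm \<Omega> p (\<lambda>x. \<phi> n x - u x)"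
      using W1p_norm_ge(1) p1 by (intro always_eventually) simp
  qed auto
  \<comment> \<open>The sup bound is applied to the difference of two approximants, itself a test
    function.\<close>
  have cauchy: "uniformly_Cauchy_on UNIV \<phi>"
    unfolding uniformly_Cauchy_on_def
  proof (intro allI impI)
    fix e :: real assume e: "e > 0"
    define d where "d = e / (2 * (supc p + 1))"
    have sp: "supc p \<ge> 0" using supc_nonneg[OF p] .
    have d: "d > 0" using e sp by (simp add: d_def)
    obtain N where N: "\<And>n. n \<ge> N \<Longrightarrow> Lp_norm \<Omega> p (\<lambda>x. grad (\<phi> n) x - weak_grad \<Omega> u x) < d"
      using LIMSEQ_D[OF 1 d] by auto
    show "\<exists>M. \<forall>x\<in>UNIV. \<forall>m\<ge>M. \<forall>n\<ge>M. dist (\<phi> m x) (\<phi> n x) < e"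
    proof (intro exI ballI allI impI)
      fix x m n assume mn: "m \<ge> N" "n \<ge> N"
      have t: "test_function \<Omega> (\<lambda>x. \<phi> m x + (-1) * \<phi> n x)" by (intro test_function_add test_function_cmult \<phi>)
      have g: "grad (\<lambda>x. \<phi> m x + (-1) * \<phi> n x) = (\<lambda>x. grad (\<phi> m) x - grad (\<phi> n) x)"
        using grad_diff[OF test_function_differentiable[OF \<phi>] test_function_differentiable[OF \<phi>]] by auto
      have "Lp_norm \<Omega> p (\<lambda>x. grad (\<phi> m) x - grad (\<phi> n) x) \<le>
          Lp_norm \<Omega> p (\<lambda>x. grad (\<phi> m) x - weak_grad \<Omega> u x) + Lp_norm \<Omega> p (\<lambda>x. weak_grad \<Omega> u x - grad (\<phi> n) x)"
        by (rule Lp_norm_triangle_diff[OF tL(2) wg(2) tL(2)]) (use p1 in simp)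
      also have "\<dots> < 2 * d"
        using N[OF mn(1)] N[OF mn(2)] Lp_norm_minus_commute[of \<Omega> p "weak_grad \<Omega> u" "grad (\<phi> n)"] by linarith
      finally have "Lp_norm \<Omega> p (\<lambda>x. grad (\<phi> m) x - grad (\<phi> n) x) < 2 * d" .
      then have "\<bar>\<phi> m x - \<phi> n x\<bar> \<le> supc p * (2 * d)"
        using order_trans[OF test_function_sup[OF t p, of x, unfolded g] mult_left_mono[OF less_imp_le sp]] by simp
      also have "\<dots> < e" using e sp by (simp add: d_def field_simps)
      finally show "dist (\<phi> m x) (\<phi> n x) < e" by (simp add: dist_real_def)
    qed
  qed
  then have "uniformly_convergent_on UNIV \<phi>" by (rule Cauchy_uniformly_convergent)
  then obtain w where w: "uniform_limit UNIV \<phi> w sequentially" by (auto simp: uniformly_convergent_on_def)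
  have wc: "continuous_on UNIV w"
    by (rule uniform_limit_theorem[OF _ w]) (use test_function_continuous[OF \<phi>] in auto)
  obtain r :: "nat \<Rightarrow> nat" where r: "strict_mono r" and ae: "AE x in lebesgue_on \<Omega>. (\<lambda>n. \<phi> (r n) x) \<longlonglongrightarrow> u x"
    using Lp_AE_subseq[OF tL(1) wg(3) _ 2] p1 by auto
  have pw: "(\<lambda>n. \<phi> (r n) x) \<longlonglongrightarrow> w x" for x
    using tendsto_uniform_limitI[OF w] LIMSEQ_subseq_LIMSEQ[OF _ r] by (auto simp: o_def)
  have "AE x in lebesgue_on \<Omega>. w x = u x"
    using ae by eventually_elim (use pw LIMSEQ_unique in blast)
  then have ae2: "AE x in lebesgue. x \<in> \<Omega> \<longrightarrow> w x = u x"
    using sets_dom by (subst (asm) AE_restrict_space_iff) auto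
  have eqO: "w x = u x" if x: "x \<in> \<Omega>" for x
  proof (rule ccontr)
    assume ne: "w x \<noteq> u x"
    have "continuous_on \<Omega> (\<lambda>y. w y - u y)"
      using continuous_on_subset[OF wc] continuous_on_subset[OF uc closure_subset] by (intro continuous_intros) auto
    then have "open ((\<lambda>y. w y - u y) -` (- {0}) \<inter> \<Omega>)"
      using continuous_on_open_vimage[OF open_dom] open_Compl[OF closed_singleton[of "0::real"]] by blast
    moreover have "x \<in> (\<lambda>y. w y - u y) -` (- {0}) \<inter> \<Omega>" using x ne by simp
    ultimately have "\<not> negligible ((\<lambda>y. w y - u y) -` (- {0}) \<inter> \<Omega>)"
      using open_not_negligible by blast
    moreover have "negligible {y. \<not> (y \<in> \<Omega> \<longrightarrow> w y = u y)}"
      using ae2 by (simp add: negligible_iff_null_sets completion.AE_iff_null_sets)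
    moreover have "(\<lambda>y. w y - u y) -` (- {0}) \<inter> \<Omega> \<subseteq> {y. \<not> (y \<in> \<Omega> \<longrightarrow> w y = u y)}" by auto
    ultimately show False using negligible_subset by blast
  qed
  have eqC: "w x = u x" if x: "x \<in> closure \<Omega>" for x
  proof -
    have c: "continuous_on (closure \<Omega>) (\<lambda>y. w y - u y)"
      using wc uc by (intro continuous_intros) (auto intro: continuous_on_subset)
    have "w x - u x = 0"
      by (rule continuous_constant_on_closure[OF c _ x]) (use eqO in auto)
    then show ?thesis by simp
  qed
  have "uniform_limit (closure \<Omega>) \<phi> u sequentially"
    using uniform_limit_on_subset[OF w, of "closure \<Omega>"] eqC
    by (subst uniform_limit_cong'[where g = \<phi> and i = w]) auto
  then show ?thesis using 1 \<phi> by blast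
qed

lemma W01p_mem:
  assumes "u \<in> W01p \<Omega> p"
  shows "has_weak_gradient \<Omega> u (weak_grad \<Omega> u)" "Lp_mem \<Omega> p (weak_grad \<Omega> u)" "Lp_mem \<Omega> p u"
    "continuous_on (closure \<Omega>) u"
  using assms W1p_weak_grad[of u p] by (auto simp: W01p_def)

lemma locally_integrable_Lp:
  fixes G :: "'a \<Rightarrow> 'b::euclidean_space"
  assumes "Lp_mem \<Omega> p G" "p \<ge> 1" shows "locally_integrable \<Omega> G"
  unfolding locally_integrable_def
proof (intro allI impI)
  fix K assume K: "compact K \<and> K \<subseteq> \<Omega>"
  have KS: "K \<in> sets lebesgue" using K fmeasurableD[OF lmeasurable_compact] by blast
  have "integrable (lebesgue_on \<Omega>) G" by (rule Lp_integrable[OF lmeas assms])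
  then have "integrable lebesgue (\<lambda>x. indicator \<Omega> x *\<^sub>R G x)"
    using integrable_restrict_space[of \<Omega> lebesgue G] sets_dom by simp
  then have "integrable lebesgue (\<lambda>x. indicator K x *\<^sub>R (indicator \<Omega> x *\<^sub>R G x))" by (rule integrable_mult_indicator[OF KS])
  moreover have "(\<lambda>x. indicator K x *\<^sub>R (indicator \<Omega> x *\<^sub>R G x)) = (\<lambda>x. indicator K x *\<^sub>R G x)"
    by (rule ext) (use K in \<open>auto simp: indicator_def\<close>)
  ultimately show "integrable (lebesgue_on K) G" using KS by (subst integrable_restrict_space) auto
qed

lemma integral_Lp_inner_tendsto:
  fixes f :: "nat \<Rightarrow> 'a \<Rightarrow> 'b::euclidean_space"
  assumes f: "\<And>n. Lp_mem \<Omega> p (f n)" and g: "Lp_mem \<Omega> p g" and p: "p > 1"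
    and lim: "(\<lambda>n. Lp_norm \<Omega> p (\<lambda>x. f n x - g x)) \<longlonglongrightarrow> 0"
    and b: "b \<in> borel_measurable (lebesgue_on \<Omega>)" "\<And>x. x \<in> \<Omega> \<Longrightarrow> norm (b x) \<le> B"
  shows "(\<lambda>n. \<integral>x. f n x \<bullet> b x \<partial>lebesgue_on \<Omega>) \<longlonglongrightarrow> (\<integral>x. g x \<bullet> b x \<partial>lebesgue_on \<Omega>)"
    "integrable (lebesgue_on \<Omega>) (\<lambda>x. g x \<bullet> b x)"
proof -
  have ptw: "norm (y \<bullet> b x) \<le> \<bar>B\<bar> * norm y" if "x \<in> space (lebesgue_on \<Omega>)" for x and y :: 'b
  proof -
    have "norm (b x) \<le> \<bar>B\<bar>" using b(2)[of x] that by force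
    then show ?thesis
      using mult_left_mono[of "norm (b x)" "\<bar>B\<bar>" "norm y"] Cauchy_Schwarz_ineq2[of y "b x"] by (simp add: mult.commute)
  qed
  have int: "integrable (lebesgue_on \<Omega>) (\<lambda>x. h x \<bullet> b x)" if h: "Lp_mem \<Omega> p h" for h
  proof (rule Bochner_Integration.integrable_bound[of _ "\<lambda>x. \<bar>B\<bar> * norm (h x)"])
    show "integrable (lebesgue_on \<Omega>) (\<lambda>x. \<bar>B\<bar> * norm (h x))" using Lp_integrable[OF lmeas h] p by auto
    show "AE x in lebesgue_on \<Omega>. norm (h x \<bullet> b x) \<le> norm (\<bar>B\<bar> * norm (h x))"
      using ptw by (intro AE_I2) simp
  qed (use h b(1) in \<open>auto simp: Lp_mem_def\<close>)
  show "integrable (lebesgue_on \<Omega>) (\<lambda>x. g x \<bullet> b x)" by (rule int[OF g])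
  have dL: "Lp_mem \<Omega> p (\<lambda>x. f n x - g x)" for n using Lp_mem_diff[OF f g] p by simp
  let ?C = "\<bar>B\<bar> * measure lebesgue \<Omega> powr (1 - 1 / p)"
  have le: "\<bar>(\<integral>x. f n x \<bullet> b x \<partial>lebesgue_on \<Omega>) - (\<integral>x. g x \<bullet> b x \<partial>lebesgue_on \<Omega>)\<bar> \<le> ?C * Lp_norm \<Omega> p (\<lambda>x. f n x - g x)" for n
  proof -
    have "(\<integral>x. f n x \<bullet> b x \<partial>lebesgue_on \<Omega>) - (\<integral>x. g x \<bullet> b x \<partial>lebesgue_on \<Omega>) = (\<integral>x. (f n x - g x) \<bullet> b x \<partial>lebesgue_on \<Omega>)"
      using int[OF f] int[OF g] by (simp add: inner_diff_left)
    also have "\<bar>\<dots>\<bar> \<le> (\<integral>x. norm ((f n x - g x) \<bullet> b x) \<partial>lebesgue_on \<Omega>)"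
      using integral_norm_bound[of "lebesgue_on \<Omega>" "\<lambda>x. (f n x - g x) \<bullet> b x"] by simp
    also have "\<dots> \<le> (\<integral>x. \<bar>B\<bar> * norm (f n x - g x) \<partial>lebesgue_on \<Omega>)"
    proof (rule integral_mono)
      show "integrable (lebesgue_on \<Omega>) (\<lambda>x. norm ((f n x - g x) \<bullet> b x))" using int[OF dL] by (rule integrable_norm)
      show "integrable (lebesgue_on \<Omega>) (\<lambda>x. \<bar>B\<bar> * norm (f n x - g x))" using Lp_integrable[OF lmeas dL] p by auto
    qed (rule ptw)
    also have "\<dots> = \<bar>B\<bar> * (\<integral>x. norm (f n x - g x) \<partial>lebesgue_on \<Omega>)" by simp
    also have "\<dots> \<le> \<bar>B\<bar> * (measure lebesgue \<Omega> powr (1 - 1 / p) * Lp_norm \<Omega> p (\<lambda>x. f n x - g x))"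
      using Lp_Hoelder[OF lmeas dL p] by (intro mult_left_mono) auto
    finally show ?thesis by (simp add: mult.assoc)
  qed
  show "(\<lambda>n. \<integral>x. f n x \<bullet> b x \<partial>lebesgue_on \<Omega>) \<longlonglongrightarrow> (\<integral>x. g x \<bullet> b x \<partial>lebesgue_on \<Omega>)"
  proof (rule LIM_zero_cancel, rule tendsto_rabs_zero_cancel, rule tendsto_sandwich[OF _ _ tendsto_const])
    show "(\<lambda>n. ?C * Lp_norm \<Omega> p (\<lambda>x. f n x - g x)) \<longlonglongrightarrow> 0"
      using tendsto_mult_left[OF lim, of ?C] by simp
  qed (use le in \<open>auto intro: always_eventually\<close>)
qed

lemma integral_Lp_bounded_tendsto:
  fixes f :: "nat \<Rightarrow> 'a \<Rightarrow> real"
  assumes "\<And>n. Lp_mem \<Omega> p (f n)" "Lp_mem \<Omega> p g" "p > 1"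
    and "(\<lambda>n. Lp_norm \<Omega> p (\<lambda>x. f n x - g x)) \<longlonglongrightarrow> 0"
    and "b \<in> borel_measurable (lebesgue_on \<Omega>)" "\<And>x. x \<in> \<Omega> \<Longrightarrow> \<bar>b x\<bar> \<le> B"
  shows "(\<lambda>n. \<integral>x. f n x * b x \<partial>lebesgue_on \<Omega>) \<longlonglongrightarrow> (\<integral>x. g x * b x \<partial>lebesgue_on \<Omega>)"
    "integrable (lebesgue_on \<Omega>) (\<lambda>x. g x * b x)"
  using integral_Lp_inner_tendsto[OF assms(1-5), of B] assms(6) by auto

lemma Lp_mem_continuous:
  fixes u :: "'a \<Rightarrow> real"
  assumes "continuous_on (closure \<Omega>) u" "p \<ge> 0"
  shows "Lp_mem \<Omega> p u"
proof -
  have "compact (closure \<Omega>)" using bounded_dom by (simp add: compact_closure)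
  then have "bounded (u ` closure \<Omega>)" using assms compact_continuous_image compact_imp_bounded by blast
  then obtain B where B: "\<And>x. x \<in> closure \<Omega> \<Longrightarrow> norm (u x) \<le> B" by (auto simp: bounded_iff)
  have "u \<in> borel_measurable (lebesgue_on \<Omega>)"
    using assms(1) sets_dom closure_subset by (intro continuous_imp_measurable_on_sets_lebesgue) (auto intro: continuous_on_subset)
  then show ?thesis by (rule Lp_mem_bounded[OF lmeas]) (use B closure_subset assms in auto)
qed

lemma Lp_norm_le_sup:
  fixes u :: "'a \<Rightarrow> real"
  assumes "u \<in> borel_measurable (lebesgue_on \<Omega>)" "\<And>x. x \<in> \<Omega> \<Longrightarrow> \<bar>u x\<bar> \<le> B" "B \<ge> 0" "p > 0"
  shows "Lp_norm \<Omega> p u \<le> measure lebesgue \<Omega> powr (1 / p) * B"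
proof -
  interpret finite_measure "lebesgue_on \<Omega>" by (rule finite_measure_dom)
  have L: "Lp_mem \<Omega> p (\<lambda>x. B)" by (rule Lp_mem_bounded[OF lmeas]) (use assms in auto)
  have "Lp_norm \<Omega> p u \<le> Lp_norm \<Omega> p (\<lambda>x. B)"
    by (rule Lp_norm_mono_AE[OF assms(1) L assms(4)]) (use assms in auto)
  also have "\<dots> = measure lebesgue \<Omega> powr (1 / p) * B"
    using assms lmeas by (simp add: Lp_norm_def powr_mult powr_powr measure_restrict_space)
  finally show ?thesis .
qed

lemma Lp_norm_uniform_limit:
  fixes f :: "nat \<Rightarrow> 'a \<Rightarrow> real"
  assumes f: "\<And>n. continuous_on (closure \<Omega>) (f n)" and lim: "uniform_limit (closure \<Omega>) f u sequentially" and p: "p > 0"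
  shows "(\<lambda>n. Lp_norm \<Omega> p (\<lambda>x. f n x - u x)) \<longlonglongrightarrow> 0"
proof (rule LIMSEQ_I)
  have uc: "continuous_on (closure \<Omega>) u" by (rule uniform_limit_theorem[OF _ lim]) (use f in auto)
  fix e :: real assume e: "e > 0"
  define C where "C = measure lebesgue \<Omega> powr (1 / p)"
  have C: "C \<ge> 0" by (simp add: C_def)
  define d where "d = e / (2 * (C + 1))"
  have d: "d > 0" using e C by (simp add: d_def)
  obtain N where N: "\<And>n x. n \<ge> N \<Longrightarrow> x \<in> closure \<Omega> \<Longrightarrow> dist (f n x) (u x) < d"
    using uniform_limitD[OF lim d] by (auto simp: eventually_sequentially)
  show "\<exists>no. \<forall>n\<ge>no. norm (Lp_norm \<Omega> p (\<lambda>x. f n x - u x) - 0) < e"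
  proof (intro exI allI impI)
    fix n assume n: "n \<ge> N"
    have "Lp_norm \<Omega> p (\<lambda>x. f n x - u x) \<le> C * d"
      unfolding C_def
    proof (rule Lp_norm_le_sup)
      show "(\<lambda>x. f n x - u x) \<in> borel_measurable (lebesgue_on \<Omega>)"
        using f uc p by (intro Lp_mem_measurable[OF Lp_mem_continuous[of _ p]] continuous_intros) auto
      show "\<bar>f n x - u x\<bar> \<le> d" if "x \<in> \<Omega>" for x using N[OF n, of x] that closure_subset by (force simp: dist_real_def)
    qed (use d p in auto)
    also have "C * d < e"
    proof -
      have "C * e + e * 2 > 0" using e C by (simp add: add_nonneg_pos)
      then show ?thesis using e C by (simp add: d_def field_simps)
    qed
    finally show "norm (Lp_norm \<Omega> p (\<lambda>x. f n x - u x) - 0) < e" by simp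
  qed
qed

text \<open>Integration by parts survives the limit because the test function and its derivatives
  are bounded. Together with \<open>W01pD\<close> this lets operations on \<open>W01p\<close> be
  performed on test functions, with uniform convergence of values and convergence of gradients in
  L^p.\<close>

lemma W01pI:
  assumes \<phi>: "\<And>n. test_function \<Omega> (\<phi> n)" and lim: "uniform_limit (closure \<Omega>) \<phi> u sequentially"
    and G: "Lp_mem \<Omega> p G" and glim: "(\<lambda>n. Lp_norm \<Omega> p (\<lambda>x. grad (\<phi> n) x - G x)) \<longlonglongrightarrow> 0" and p: "p > 1"
  shows "u \<in> W01p \<Omega> p" "AE x in lebesgue_on \<Omega>. weak_grad \<Omega> u x = G x"
proof -
  have tL: "Lp_mem \<Omega> p (\<phi> n)" "Lp_mem \<Omega> p (grad (\<phi> n))" for n using test_function_Lp[OF \<phi>] p by auto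
  have uc: "continuous_on (closure \<Omega>) u"
    by (rule uniform_limit_theorem[OF _ lim]) (use test_function_continuous[OF \<phi>] in auto)
  have uL: "Lp_mem \<Omega> p u" using uc p by (intro Lp_mem_continuous) auto
  have ulim: "(\<lambda>n. Lp_norm \<Omega> p (\<lambda>x. \<phi> n x - u x)) \<longlonglongrightarrow> 0"
    by (rule Lp_norm_uniform_limit[OF _ lim]) (use test_function_continuous[OF \<phi>] p in auto)
  have hw: "has_weak_gradient \<Omega> u G"
    unfolding has_weak_gradient_def
  proof (intro conjI allI impI ballI)
    show "locally_integrable \<Omega> u" "locally_integrable \<Omega> G" using locally_integrable_Lp uL G p by (auto intro: less_imp_le)
    fix \<psi> :: "'a \<Rightarrow> real" and b :: 'a assume \<psi>: "test_function \<Omega> \<psi>" and b: "b \<in> Basis"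
    obtain B where B: "B > 0" "\<And>x. \<bar>\<psi> x\<bar> \<le> B" "\<And>x. norm (grad \<psi> x) \<le> B" using \<psi> by (rule test_function_bounded) blast
    have c: "continuous_on UNIV (partial_deriv b \<psi>)"
      by (rule smooth_on_continuous[OF smooth_on_partial_deriv[OF test_function_smooth[OF \<psi>] b]])
    have pb: "\<bar>partial_deriv b \<psi> x\<bar> \<le> B" for x using grad_inner_Basis[OF b, of \<psi> x] Basis_le_norm[OF b, of "grad \<psi> x"] B(3)[of x] by simp
    have m: "\<psi> \<in> borel_measurable (lebesgue_on \<Omega>)" "partial_deriv b \<psi> \<in> borel_measurable (lebesgue_on \<Omega>)"
      using c test_function_continuous[OF \<psi>] sets_dom by (auto intro: borel_measurable_continuous_lebesgue_on)
    have 1: "(\<lambda>n. \<integral>x. \<phi> n x * partial_deriv b \<psi> x \<partial>lebesgue_on \<Omega>) \<longlonglongrightarrow> (\<integral>x. u x * partial_deriv b \<psi> x \<partial>lebesgue_on \<Omega>)"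
      by (rule integral_Lp_bounded_tendsto(1)[OF tL(1) uL p ulim m(2)]) (use pb in auto)
    have iL: "Lp_mem \<Omega> p (\<lambda>x. H x \<bullet> b)" if H: "Lp_mem \<Omega> p H" for H :: "'a \<Rightarrow> 'a"
      by (rule Lp_mem_dominated[OF _ H]) (use H p Basis_le_norm[OF b] in \<open>auto simp: Lp_mem_def\<close>)
    have 2: "(\<lambda>n. \<integral>x. (grad (\<phi> n) x \<bullet> b) * \<psi> x \<partial>lebesgue_on \<Omega>) \<longlonglongrightarrow> (\<integral>x. (G x \<bullet> b) * \<psi> x \<partial>lebesgue_on \<Omega>)"
    proof (rule integral_Lp_bounded_tendsto(1)[OF iL[OF tL(2)] iL[OF G] p _ m(1)])
      show "(\<lambda>n. Lp_norm \<Omega> p (\<lambda>x. grad (\<phi> n) x \<bullet> b - G x \<bullet> b)) \<longlonglongrightarrow> 0"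
      proof (rule tendsto_sandwich[OF _ _ tendsto_const glim])
        have dL: "Lp_mem \<Omega> p (\<lambda>x. grad (\<phi> n) x - G x)" for n using Lp_mem_diff[OF tL(2) G] p by simp
        show "\<forall>\<^sub>F n in sequentially. Lp_norm \<Omega> p (\<lambda>x. grad (\<phi> n) x \<bullet> b - G x \<bullet> b) \<le> Lp_norm \<Omega> p (\<lambda>x. grad (\<phi> n) x - G x)"
          using dL p Basis_le_norm[OF b] iL[OF dL]
          by (intro always_eventually allI Lp_norm_mono_AE[OF _ dL]) (auto simp: inner_diff_left[symmetric] Lp_mem_def)
      qed auto
    qed (use B in auto)
    have "(\<integral>x. \<phi> n x * partial_deriv b \<psi> x \<partial>lebesgue_on \<Omega>) = - (\<integral>x. (grad (\<phi> n) x \<bullet> b) * \<psi> x \<partial>lebesgue_on \<Omega>)" for n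
      using has_weak_gradient_test[OF open_dom \<phi>] \<psi> b unfolding has_weak_gradient_def by blast
    then show "(\<integral>x. u x * partial_deriv b \<psi> x \<partial>lebesgue_on \<Omega>) = - (\<integral>x. (G x \<bullet> b) * \<psi> x \<partial>lebesgue_on \<Omega>)"
      using LIMSEQ_unique[OF 1] tendsto_minus[OF 2] by simp
  qed
  show ae: "AE x in lebesgue_on \<Omega>. weak_grad \<Omega> u x = G x" by (rule weak_grad_eq[OF open_dom hw])
  have "(\<lambda>n. W1p_norm \<Omega> p (\<lambda>x. \<phi> n x - u x)) \<longlonglongrightarrow> 0"
  proof -
    have hwn: "has_weak_gradient \<Omega> (\<lambda>x. \<phi> n x - u x) (\<lambda>x. grad (\<phi> n) x - G x)" for n
      by (rule has_weak_gradient_diff[OF open_dom has_weak_gradient_test[OF open_dom \<phi>] hw])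
    have "Lp_mem \<Omega> p (\<lambda>x. grad (\<phi> n) x - G x)" for n using Lp_mem_diff[OF tL(2) G] p by simp
    then have eq: "Lp_norm \<Omega> p (weak_grad \<Omega> (\<lambda>x. \<phi> n x - u x)) = Lp_norm \<Omega> p (\<lambda>x. grad (\<phi> n) x - G x)" for n
      by (intro weak_grad_Lp_norm[OF hwn]) (auto simp: Lp_mem_def)
    have "(\<lambda>n. (Lp_norm \<Omega> p (\<lambda>x. \<phi> n x - u x) powr p + Lp_norm \<Omega> p (\<lambda>x. grad (\<phi> n) x - G x) powr p) powr (1 / p))
        \<longlonglongrightarrow> (0 powr p + 0 powr p) powr (1 / p)"
      using p by (intro tendsto_powr2 tendsto_add ulim glim tendsto_const always_eventually allI add_nonneg_nonneg) auto
    then show ?thesis by (simp add: W1p_norm_def eq)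
  qed
  then show "u \<in> W01p \<Omega> p"
    using uL uc hw G \<phi> unfolding W01p_def W1p_def by blast
qed

lemma W01p_test:
  assumes "test_function \<Omega> \<phi>" "p > 1"
  shows "\<phi> \<in> W01p \<Omega> p" "AE x in lebesgue_on \<Omega>. weak_grad \<Omega> \<phi> x = grad \<phi> x"
  using W01pI[of "\<lambda>_. \<phi>" \<phi> p "grad \<phi>"] assms test_function_Lp[OF assms(1)]
  by (auto simp: uniform_limit_const Lp_norm_def)

lemma W01p_add_cmult:
  assumes u: "u \<in> W01p \<Omega> p" and w: "w \<in> W01p \<Omega> p" and p: "p > real DIM('a)"
  shows "(\<lambda>x. a * u x + c * w x) \<in> W01p \<Omega> p"
    "AE x in lebesgue_on \<Omega>. weak_grad \<Omega> (\<lambda>x. a * u x + c * w x) x = a *\<^sub>R weak_grad \<Omega> u x + c *\<^sub>R weak_grad \<Omega> w x"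
proof -
  have D1: "real DIM('a) \<ge> 1" by (simp add: Suc_leI)
  have p1: "p > 1" using p D1 by linarith
  obtain \<phi> where \<phi>: "\<And>n. test_function \<Omega> (\<phi> n)" "uniform_limit (closure \<Omega>) \<phi> u sequentially"
    "(\<lambda>n. Lp_norm \<Omega> p (\<lambda>x. grad (\<phi> n) x - weak_grad \<Omega> u x)) \<longlonglongrightarrow> 0" using W01pD[OF u p] by blast
  obtain \<psi> where \<psi>: "\<And>n. test_function \<Omega> (\<psi> n)" "uniform_limit (closure \<Omega>) \<psi> w sequentially"
    "(\<lambda>n. Lp_norm \<Omega> p (\<lambda>x. grad (\<psi> n) x - weak_grad \<Omega> w x)) \<longlonglongrightarrow> 0" using W01pD[OF w p] by blast
  note uw = W01p_mem[OF u] W01p_mem[OF w]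
  define f where "f n x = a * \<phi> n x + c * \<psi> n x" for n x
  have f: "test_function \<Omega> (f n)" for n
    unfolding f_def by (intro test_function_add test_function_cmult \<phi> \<psi>)
  have fg: "grad (f n) x = a *\<^sub>R grad (\<phi> n) x + c *\<^sub>R grad (\<psi> n) x" for n x
    unfolding f_def using test_function_differentiable[OF \<phi>(1)] test_function_differentiable[OF \<psi>(1)]
    by (subst grad_add) (auto simp: grad_cmult intro!: test_function_differentiable[OF test_function_cmult] \<phi> \<psi>)
  have flim: "uniform_limit (closure \<Omega>) f (\<lambda>x. a * u x + c * w x) sequentially"
    unfolding f_def[abs_def]
    by (intro uniform_limit_add bounded_linear.uniform_limit[OF bounded_linear_mult_right] \<phi>(2) \<psi>(2))
  have tL: "Lp_mem \<Omega> p (grad (\<phi> n))" "Lp_mem \<Omega> p (grad (\<psi> n))" for n using test_function_Lp[OF \<phi>(1)] test_function_Lp[OF \<psi>(1)] p1 by auto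
  have GL: "Lp_mem \<Omega> p (\<lambda>x. a *\<^sub>R weak_grad \<Omega> u x + c *\<^sub>R weak_grad \<Omega> w x)"
    using uw p1 by (intro Lp_mem_add Lp_mem_scale) auto
  have glim: "(\<lambda>n. Lp_norm \<Omega> p (\<lambda>x. grad (f n) x - (a *\<^sub>R weak_grad \<Omega> u x + c *\<^sub>R weak_grad \<Omega> w x))) \<longlonglongrightarrow> 0"
  proof (rule tendsto_sandwich[OF _ _ tendsto_const])
    show "(\<lambda>n. \<bar>a\<bar> * Lp_norm \<Omega> p (\<lambda>x. grad (\<phi> n) x - weak_grad \<Omega> u x) + \<bar>c\<bar> * Lp_norm \<Omega> p (\<lambda>x. grad (\<psi> n) x - weak_grad \<Omega> w x)) \<longlonglongrightarrow> 0"
      using tendsto_add[OF tendsto_mult_left[OF \<phi>(3), of "\<bar>a\<bar>"] tendsto_mult_left[OF \<psi>(3), of "\<bar>c\<bar>"]] by simp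
    show "\<forall>\<^sub>F n in sequentially. Lp_norm \<Omega> p (\<lambda>x. grad (f n) x - (a *\<^sub>R weak_grad \<Omega> u x + c *\<^sub>R weak_grad \<Omega> w x))
      \<le> \<bar>a\<bar> * Lp_norm \<Omega> p (\<lambda>x. grad (\<phi> n) x - weak_grad \<Omega> u x) + \<bar>c\<bar> * Lp_norm \<Omega> p (\<lambda>x. grad (\<psi> n) x - weak_grad \<Omega> w x)"
    proof (rule always_eventually, rule allI)
      fix n
      have d: "Lp_mem \<Omega> p (\<lambda>x. grad (\<phi> n) x - weak_grad \<Omega> u x)" "Lp_mem \<Omega> p (\<lambda>x. grad (\<psi> n) x - weak_grad \<Omega> w x)"
        using Lp_mem_diff[OF tL(1) uw(2)] Lp_mem_diff[OF tL(2) uw(6)] p1 by auto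
      have "(\<lambda>x. grad (f n) x - (a *\<^sub>R weak_grad \<Omega> u x + c *\<^sub>R weak_grad \<Omega> w x))
          = (\<lambda>x. a *\<^sub>R (grad (\<phi> n) x - weak_grad \<Omega> u x) + c *\<^sub>R (grad (\<psi> n) x - weak_grad \<Omega> w x))"
        by (simp add: fg algebra_simps)
      then show "Lp_norm \<Omega> p (\<lambda>x. grad (f n) x - (a *\<^sub>R weak_grad \<Omega> u x + c *\<^sub>R weak_grad \<Omega> w x))
        \<le> \<bar>a\<bar> * Lp_norm \<Omega> p (\<lambda>x. grad (\<phi> n) x - weak_grad \<Omega> u x) + \<bar>c\<bar> * Lp_norm \<Omega> p (\<lambda>x. grad (\<psi> n) x - weak_grad \<Omega> w x)"
        using Lp_norm_triangle[OF Lp_mem_scale[OF d(1), of a] Lp_mem_scale[OF d(2), of c]] p1 by (simp add: Lp_norm_scale)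
    qed
  qed auto
  show "(\<lambda>x. a * u x + c * w x) \<in> W01p \<Omega> p"
    "AE x in lebesgue_on \<Omega>. weak_grad \<Omega> (\<lambda>x. a * u x + c * w x) x = a *\<^sub>R weak_grad \<Omega> u x + c *\<^sub>R weak_grad \<Omega> w x"
    using W01pI[OF f flim GL glim p1] by auto
qed

lemma Morrey_W01p:
  assumes u: "u \<in> W01p \<Omega> p" and p: "p > real DIM('a)"
  shows "\<lbrakk>x \<in> closure \<Omega>; y \<in> closure \<Omega>; \<epsilon> > 0\<rbrakk> \<Longrightarrow> \<bar>u x - u y\<bar> \<le> morrey p \<epsilon> (dist x y) * Lp_norm \<Omega> p (weak_grad \<Omega> u)"
    and "x \<in> closure \<Omega> \<Longrightarrow> \<bar>u x\<bar> \<le> supc p * Lp_norm \<Omega> p (weak_grad \<Omega> u)"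
    and "x \<in> frontier \<Omega> \<Longrightarrow> u x = 0"
proof -
  have D1: "real DIM('a) \<ge> 1" by (simp add: Suc_leI)
  have p1: "p > 1" using p D1 by linarith
  obtain \<phi> where \<phi>: "\<And>n. test_function \<Omega> (\<phi> n)" "uniform_limit (closure \<Omega>) \<phi> u sequentially"
    "(\<lambda>n. Lp_norm \<Omega> p (\<lambda>x. grad (\<phi> n) x - weak_grad \<Omega> u x)) \<longlonglongrightarrow> 0" using W01pD[OF u p] by blast
  have tL: "Lp_mem \<Omega> p (grad (\<phi> n))" for n using test_function_Lp[OF \<phi>(1)] p1 by auto
  have nlim: "(\<lambda>n. Lp_norm \<Omega> p (grad (\<phi> n))) \<longlonglongrightarrow> Lp_norm \<Omega> p (weak_grad \<Omega> u)"
    by (rule Lp_norm_tendsto[OF tL W01p_mem(2)[OF u] _ \<phi>(3)]) (use p1 in simp)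
  have pw: "(\<lambda>n. \<phi> n x) \<longlonglongrightarrow> u x" if "x \<in> closure \<Omega>" for x
    using tendsto_uniform_limitI[OF \<phi>(2) that] .
  show "\<bar>u x - u y\<bar> \<le> morrey p \<epsilon> (dist x y) * Lp_norm \<Omega> p (weak_grad \<Omega> u)"
    if "x \<in> closure \<Omega>" "y \<in> closure \<Omega>" "\<epsilon> > 0"
    using tendsto_rabs[OF tendsto_diff[OF pw pw]] tendsto_mult_left[OF nlim] Morrey_test[OF \<phi>(1) p] that
    by (intro LIMSEQ_le[of "\<lambda>n. \<bar>\<phi> n x - \<phi> n y\<bar>" _ "\<lambda>n. morrey p \<epsilon> (dist x y) * Lp_norm \<Omega> p (grad (\<phi> n))"]) auto
  show "\<bar>u x\<bar> \<le> supc p * Lp_norm \<Omega> p (weak_grad \<Omega> u)" if "x \<in> closure \<Omega>"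
    using tendsto_rabs[OF pw] tendsto_mult_left[OF nlim] test_function_sup[OF \<phi>(1) p] that
    by (intro LIMSEQ_le[of "\<lambda>n. \<bar>\<phi> n x\<bar>" _ "\<lambda>n. supc p * Lp_norm \<Omega> p (grad (\<phi> n))"]) auto
  show "u x = 0" if x: "x \<in> frontier \<Omega>"
  proof -
    have "\<phi> n x = 0" for n using test_function_zero(1)[OF \<phi>(1)] frontier_disjoint[OF x] by blast
    then show ?thesis using pw[of x] x LIMSEQ_unique[OF _ tendsto_const] by (simp add: frontier_def LIMSEQ_const_iff)
  qed
qed

end

section \<open>Compactness and Rayleigh quotients\<close>

lemma norm_powr_has_derivative:
  fixes a b :: "'b::euclidean_space"
  assumes p: "p > 1"
  shows "((\<lambda>t. norm (a + t *\<^sub>R b) powr p) has_real_derivative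
    p * norm (a + t *\<^sub>R b) powr (p - 2) * ((a + t *\<^sub>R b) \<bullet> b)) (at t)"
proof (cases "a + t *\<^sub>R b = 0")
  case False
  have eq: "norm (a + s *\<^sub>R b) powr p = ((a + s *\<^sub>R b) \<bullet> (a + s *\<^sub>R b)) powr (p / 2)" for s
  proof -
    have "((norm (a + s *\<^sub>R b))\<^sup>2) powr (p / 2) = norm (a + s *\<^sub>R b) powr p"
      using powr_powr[of "norm (a + s *\<^sub>R b)" 2 "p / 2"] by simp
    then show ?thesis by (simp add: power2_norm_eq_inner)
  qed
  have pos: "(a + t *\<^sub>R b) \<bullet> (a + t *\<^sub>R b) > 0" using False by simp
  have "((\<lambda>s. (a + s *\<^sub>R b) \<bullet> (a + s *\<^sub>R b)) has_real_derivative 2 * ((a + t *\<^sub>R b) \<bullet> b)) (at t)"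
    unfolding has_field_derivative_def
    by (auto intro!: derivative_eq_intros simp: inner_commute algebra_simps)
  from DERIV_powr[OF this pos DERIV_const[of "p / 2"]]
  have "((\<lambda>s. ((a + s *\<^sub>R b) \<bullet> (a + s *\<^sub>R b)) powr (p / 2)) has_real_derivative
      ((a + t *\<^sub>R b) \<bullet> (a + t *\<^sub>R b)) powr (p / 2) * (2 * ((a + t *\<^sub>R b) \<bullet> b) * (p / 2) / ((a + t *\<^sub>R b) \<bullet> (a + t *\<^sub>R b)))) (at t)"
    by simp
  moreover have "norm (a + t *\<^sub>R b) powr (p - 2) = norm (a + t *\<^sub>R b) powr p / ((a + t *\<^sub>R b) \<bullet> (a + t *\<^sub>R b))"
    using False by (simp add: powr_diff power2_norm_eq_inner[symmetric])
  ultimately show ?thesis unfolding eq[symmetric] by (simp add: mult_ac)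
next
  case True
  \<comment> \<open>Where the norm vanishes, the difference quotient has absolute value
    \<open>\<bar>h\<bar> powr (p - 1) * norm b powr p\<close>, which tends to 0 because
    \<open>p > 1\<close>.\<close>
  then have a: "a = - (t *\<^sub>R b)" by (simp add: eq_neg_iff_add_eq_0)
  have ab: "norm (a + (t + h) *\<^sub>R b) = \<bar>h\<bar> * norm b" for h
    by (simp add: a scaleR_left.add)
  have "((\<lambda>h. \<bar>h\<bar> powr (p - 1) * norm b powr p) \<longlongrightarrow> \<bar>0\<bar> powr (p - 1) * norm b powr p) (at 0)"
    using p by (intro tendsto_mult tendsto_powr2 tendsto_rabs tendsto_ident_at tendsto_const always_eventually) auto
  then have l: "((\<lambda>h. \<bar>h\<bar> powr (p - 1) * norm b powr p) \<longlongrightarrow> 0) (at 0)" using p by simp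
  have "((\<lambda>h. (norm (a + (t + h) *\<^sub>R b) powr p - norm (a + t *\<^sub>R b) powr p) / h) \<longlongrightarrow> 0) (at 0)"
  proof (rule Lim_null_comparison[OF _ l])
    show "\<forall>\<^sub>F h in at 0. norm ((norm (a + (t + h) *\<^sub>R b) powr p - norm (a + t *\<^sub>R b) powr p) / h) \<le> \<bar>h\<bar> powr (p - 1) * norm b powr p"
      unfolding ab True using p by (auto simp: eventually_at_filter powr_mult powr_diff divide_simps)
  qed
  then show ?thesis using True by (simp add: DERIV_def)
qed

lemma integral_norm_powr_has_derivative:
  fixes a b :: "'a::euclidean_space \<Rightarrow> 'b::euclidean_space"
  assumes a: "Lp_mem \<Omega> p a" and b: "Lp_mem \<Omega> p b" and p: "p > 1"
  shows "((\<lambda>t. \<integral>x. norm (a x + t *\<^sub>R b x) powr p \<partial>lebesgue_on \<Omega>) has_real_derivative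
    p * (\<integral>x. norm (a x) powr (p - 2) * (a x \<bullet> b x) \<partial>lebesgue_on \<Omega>)) (at 0)"
proof -
  let ?M = "lebesgue_on \<Omega>"
  have [measurable]: "a \<in> borel_measurable ?M" "b \<in> borel_measurable ?M"
    using a b by (auto simp: Lp_mem_def)
  define D where "D t x = (norm (a x + t *\<^sub>R b x) powr p - norm (a x) powr p) / t" for t x
  define d where "d x = p * norm (a x) powr (p - 2) * (a x \<bullet> b x)" for x
  \<comment> \<open>A dominating function for all difference quotients with
    \<open>\<bar>t\<bar> \<le> 1\<close>: by the mean value theorem they equal a derivative at an
    intermediate point, where the norm is at most \<open>norm (a x) + norm (b x)\<close>.\<close>
  define w where "w x = p * (norm (a x) + norm (b x)) powr p" for x
  have wi: "integrable ?M w"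
  proof -
    have "Lp_mem \<Omega> p (\<lambda>x. norm (a x) + norm (b x))"
      using Lp_mem_add[OF Lp_mem_norm[OF a] Lp_mem_norm[OF b]] p by simp
    then show ?thesis unfolding w_def by (auto simp: Lp_mem_def)
  qed
  have Dw: "\<bar>D t x\<bar> \<le> w x" if t: "\<bar>t\<bar> \<le> 1" "t \<noteq> 0" for t x
  proof -
    define f where "f s = norm (a x + s *\<^sub>R b x) powr p" for s
    define f' where "f' s = p * norm (a x + s *\<^sub>R b x) powr (p - 2) * ((a x + s *\<^sub>R b x) \<bullet> b x)" for s
    have df: "(f has_real_derivative f' s) (at s)" for s
      unfolding f_def f'_def by (rule norm_powr_has_derivative[OF p])
    have "\<exists>z. \<bar>z\<bar> \<le> 1 \<and> f t - f 0 = t * f' z"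
    proof (cases "t > 0")
      case True
      obtain z where "z > 0" "z < t" "f t - f 0 = (t - 0) * f' z" using MVT2[OF True, of f f'] df by blast
      then show ?thesis using t by (intro exI[of _ z]) auto
    next
      case False
      then have "t < 0" using t by simp
      then obtain z where "z > t" "z < 0" "f 0 - f t = (0 - t) * f' z" using MVT2[of t 0 f f'] df by blast
      then show ?thesis using t by (intro exI[of _ z]) auto
    qed
    then obtain z where z: "\<bar>z\<bar> \<le> 1" "f t - f 0 = t * f' z" by blast
    then have "D t x = f' z" using t by (simp add: D_def f_def)
    also have "\<bar>f' z\<bar> \<le> w x"
    proof -
      define n where "n = norm (a x + z *\<^sub>R b x)"
      have n: "n \<ge> 0" "n \<le> norm (a x) + norm (b x)"
        using norm_triangle_ineq[of "a x" "z *\<^sub>R b x"] z(1) mult_right_mono[of "\<bar>z\<bar>" 1 "norm (b x)"] by (auto simp: n_def)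
      have "\<bar>(a x + z *\<^sub>R b x) \<bullet> b x\<bar> \<le> n * norm (b x)"
        unfolding n_def by (rule Cauchy_Schwarz_ineq2)
      then have "\<bar>f' z\<bar> \<le> p * (n powr (p - 2) * (n * norm (b x)))"
        unfolding f'_def n_def[symmetric] using p by (simp add: abs_mult mult.assoc mult_left_mono)
      also have "n powr (p - 2) * (n * norm (b x)) = n powr (p - 1) * norm (b x)"
        using n(1) by (cases "n = 0") (auto simp: powr_diff power2_eq_square)
      also have "\<dots> \<le> (norm (a x) + norm (b x)) powr (p - 1) * (norm (a x) + norm (b x))"
        using n p by (intro mult_mono powr_mono2) auto
      also have "\<dots> = (norm (a x) + norm (b x)) powr p"
        by (cases "norm (a x) + norm (b x) = 0") (auto simp: powr_diff add_nonneg_eq_0_iff)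
      finally show ?thesis using p by (simp add: w_def)
    qed
    finally show ?thesis .
  qed
  have int: "integrable ?M (\<lambda>x. norm (a x + t *\<^sub>R b x) powr p)" for t
    using Lp_mem_add[OF a Lp_mem_scale[OF b, of t]] p by (simp add: Lp_mem_def)
  have lim: "((\<lambda>t. \<integral>x. D t x \<partial>?M) \<longlongrightarrow> (\<integral>x. d x \<partial>?M)) (at 0)"
    unfolding LIMSEQ_SEQ_conv[symmetric]
  proof (intro allI impI)
    fix S :: "nat \<Rightarrow> real" assume S: "(\<forall>n. S n \<noteq> 0) \<and> S \<longlonglongrightarrow> 0"
    then obtain N where N: "\<And>n. n \<ge> N \<Longrightarrow> \<bar>S n\<bar> < 1" using LIMSEQ_D[of S 0 1] by auto
    have "(\<lambda>n. \<integral>x. D (S (n + N)) x \<partial>?M) \<longlonglongrightarrow> (\<integral>x. d x \<partial>?M)"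
    proof (rule integral_dominated_convergence[OF _ _ wi])
      show "d \<in> borel_measurable ?M" unfolding d_def by measurable
      show "D (S (n + N)) \<in> borel_measurable ?M" for n unfolding D_def by measurable
      show "AE x in ?M. norm (D (S (n + N)) x) \<le> w x" for n
        using Dw[of "S (n + N)"] N[of "n + N"] S by (auto simp: less_imp_le)
      show "AE x in ?M. (\<lambda>n. D (S (n + N)) x) \<longlonglongrightarrow> d x"
      proof (rule AE_I2)
        fix x
        have "((\<lambda>t. D t x) \<longlongrightarrow> d x) (at 0)"
          using norm_powr_has_derivative[OF p, of "a x" "b x" 0] by (simp add: DERIV_def D_def d_def)
        moreover have "filterlim (\<lambda>n. S (n + N)) (at 0) sequentially"
          using S by (intro filterlim_atI LIMSEQ_ignore_initial_segment) auto
        ultimately show "(\<lambda>n. D (S (n + N)) x) \<longlonglongrightarrow> d x" by (rule filterlim_compose)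
      qed
    qed
    then show "(\<lambda>n. \<integral>x. D (S n) x \<partial>?M) \<longlonglongrightarrow> (\<integral>x. d x \<partial>?M)" by (rule LIMSEQ_offset)
  qed
  have "(\<integral>x. D t x \<partial>?M) = ((\<integral>x. norm (a x + t *\<^sub>R b x) powr p \<partial>?M) - (\<integral>x. norm (a x) powr p \<partial>?M)) / t" for t
    unfolding D_def using int[of t] int[of 0] by simp
  moreover have "(\<integral>x. d x \<partial>?M) = p * (\<integral>x. norm (a x) powr (p - 2) * (a x \<bullet> b x) \<partial>?M)"
    unfolding d_def by (simp add: mult.assoc)
  ultimately show ?thesis using lim by (simp add: DERIV_def)
qed

context bdd_domain
begin

lemma AE_zero_continuous:
  fixes f :: "'a \<Rightarrow> real"
  assumes f: "continuous_on \<Omega> f" and ae: "AE x in lebesgue_on \<Omega>. f x = 0" and x: "x \<in> \<Omega>"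
  shows "f x = 0"
proof (rule ccontr)
  assume ne: "f x \<noteq> 0"
  have "open (f -` (- {0}) \<inter> \<Omega>)"
    using continuous_on_open_vimage[OF open_dom] f open_Compl[OF closed_singleton[of "0::real"]] by blast
  moreover have "x \<in> f -` (- {0}) \<inter> \<Omega>" using x ne by simp
  ultimately have "\<not> negligible (f -` (- {0}) \<inter> \<Omega>)"
    using open_not_negligible by blast
  moreover have "AE x in lebesgue. x \<in> \<Omega> \<longrightarrow> f x = 0"
    using sets_dom ae by (subst (asm) AE_restrict_space_iff) auto
  then have "negligible {y. \<not> (y \<in> \<Omega> \<longrightarrow> f y = 0)}"
    by (simp add: negligible_iff_null_sets completion.AE_iff_null_sets)
  moreover have "f -` (- {0}) \<inter> \<Omega> \<subseteq> {y. \<not> (y \<in> \<Omega> \<longrightarrow> f y = 0)}" by auto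
  ultimately show False using negligible_subset by blast
qed

text \<open>From \<open>2 * N\<close> on, the denominators \<open>1 - N / p\<close> stay above one
  half, so the Morrey constants are bounded uniformly in \<open>p\<close>.\<close>

lemma half_bound:
  assumes "p \<ge> 2 * real DIM('a)"
  shows "1 - real DIM('a) / p \<ge> 1 / 2" "real DIM('a) / p \<le> 1 / 2" "p > real DIM('a)" "p > 1"
proof -
  have D1: "real DIM('a) \<ge> 1" by (simp add: Suc_leI)
  show 1: "p > real DIM('a)" "p > 1" using D1 assms by linarith+
  from 1 show "1 - real DIM('a) / p \<ge> 1 / 2" "real DIM('a) / p \<le> 1 / 2" using assms by (auto simp: field_simps)
qed

lemma two_div_le:
  assumes "p \<ge> 2 * real DIM('a)" "c \<ge> 0"
  shows "c / (1 - real DIM('a) / p) \<le> 2 * c"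
proof -
  have "c / (1 - real DIM('a) / p) \<le> c / (1 / 2)"
    using half_bound[OF assms(1)] assms(2) by (intro divide_left_mono) auto
  then show ?thesis by simp
qed

lemma supc_le:
  assumes "p \<ge> 2 * real DIM('a)"
  shows "supc p \<le> diam + 2 * real DIM('a)"
  using two_div_le[OF assms, of "real DIM('a)"] by (simp add: supc_def morrey_def)

text \<open>Matching the side of the cube to the distance gives a modulus of order 1/2 that does not
  depend on \<open>p\<close>.\<close>

lemma morrey_half_le:
  assumes p: "p \<ge> 2 * real DIM('a)" and d: "0 < d" "d \<le> 1"
  shows "morrey p (d / 2) d \<le> (1 + 2 * real DIM('a)) * sqrt d"
proof -
  note h = half_bound[OF p]
  have "morrey p (d / 2) d = (d + (real DIM('a) * d) / (1 - real DIM('a) / p)) * d powr (- (real DIM('a) / p))"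
    by (simp add: morrey_def mult_ac)
  also have "\<dots> \<le> (d + 2 * (real DIM('a) * d)) * d powr (- (1 / 2))"
  proof (rule mult_mono)
    show "d + (real DIM('a) * d) / (1 - real DIM('a) / p) \<le> d + 2 * (real DIM('a) * d)"
      using two_div_le[OF p, of "real DIM('a) * d"] d by simp
    show "d powr (- (real DIM('a) / p)) \<le> d powr (- (1 / 2))" using d h by (intro powr_mono') auto
  qed (use d in auto)
  also have "\<dots> = (1 + 2 * real DIM('a)) * (d powr 1 * d powr (- (1 / 2)))" using d by (simp add: algebra_simps)
  also have "d powr 1 * d powr (- (1 / 2)) = d powr (1 / 2)" by (subst powr_add[symmetric]) simp
  finally show ?thesis using d by (simp add: powr_half_sqrt)
qed

text \<open>Arzela-Ascoli, with bounds uniform in the exponent. The exponent may vary with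
  \<open>n\<close>: a constant one serves the minimising sequences, a divergent one the
  solutions.\<close>

lemma W01p_compactness:
  assumes f: "\<And>n. f n \<in> W01p \<Omega> (P n)" and P: "\<And>n. P n \<ge> 2 * real DIM('a)"
    and C: "\<And>n. Lp_norm \<Omega> (P n) (weak_grad \<Omega> (f n)) \<le> C"
  shows "\<exists>g k. strict_mono (k :: nat \<Rightarrow> nat) \<and> continuous_on (closure \<Omega>) g \<and> uniform_limit (closure \<Omega>) (\<lambda>n. f (k n)) g sequentially"
proof -
  have C0: "C \<ge> 0" using C[of 0] Lp_norm_nonneg order_trans by blast
  note h = half_bound[OF P]
  have cpt: "compact (closure \<Omega>)" using bounded_dom by (simp add: compact_closure)
  have bd: "norm (f n x) \<le> (diam + 2 * real DIM('a)) * C" if "x \<in> closure \<Omega>" for n x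
  proof -
    have "\<bar>f n x\<bar> \<le> supc (P n) * Lp_norm \<Omega> (P n) (weak_grad \<Omega> (f n))"
      by (rule Morrey_W01p(2)[OF f h(3) that])
    also have "\<dots> \<le> (diam + 2 * real DIM('a)) * C"
      using supc_le[OF P] C diam_nonneg by (intro mult_mono) auto
    finally show ?thesis by simp
  qed
  have eq: "\<exists>d. 0 < d \<and> (\<forall>n y. y \<in> closure \<Omega> \<and> norm (x - y) < d \<longrightarrow> norm (f n x - f n y) < e)"
    if x: "x \<in> closure \<Omega>" and e: "0 < e" for x e
  proof -
    \<comment> \<open>The summand 1 keeps \<open>K\<close> positive when \<open>C = 0\<close> and
      makes the final estimate strict.\<close>
    define K where "K = (1 + 2 * real DIM('a)) * C + 1"
    have K: "K > 0" using C0 by (simp add: K_def add_nonneg_pos)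
    define d where "d = min 1 ((e / K)\<^sup>2)"
    have d: "d > 0" "d \<le> 1" using e K by (auto simp: d_def)
    have "norm (f n x - f n y) < e" if y: "y \<in> closure \<Omega>" "norm (x - y) < d" for n y
    proof (cases "x = y")
      case False
      define t where "t = dist x y"
      have t: "0 < t" "t \<le> 1" "t < d" using False y d by (auto simp: t_def dist_norm)
      have "\<bar>f n x - f n y\<bar> \<le> morrey (P n) (t / 2) t * Lp_norm \<Omega> (P n) (weak_grad \<Omega> (f n))"
        unfolding t_def using Morrey_W01p(1)[OF f h(3) x y(1)] t by (simp add: t_def)
      also have "\<dots> \<le> ((1 + 2 * real DIM('a)) * sqrt t) * C"
        using morrey_half_le[OF P t(1,2)] C t by (intro mult_mono) auto
      also have "\<dots> = (K - 1) * sqrt t" by (simp add: K_def)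
      also have "\<dots> < K * sqrt t" using t by simp
      also have "\<dots> \<le> K * (e / K)"
        using K e t by (intro mult_left_mono real_le_lsqrt) (auto simp: d_def)
      also have "\<dots> = e" using K by simp
      finally show ?thesis by simp
    qed (use e in simp)
    then show ?thesis using d by blast
  qed
  obtain g and k :: "nat \<Rightarrow> nat" where gk: "continuous_on (closure \<Omega>) g" "strict_mono k"
    "\<And>e. 0 < e \<Longrightarrow> \<exists>N. \<forall>n x. n \<ge> N \<and> x \<in> closure \<Omega> \<longrightarrow> norm (f (k n) x - g x) < e"
    using Arzela_Ascoli[OF cpt bd eq] by blast
  have "uniform_limit (closure \<Omega>) (\<lambda>n. f (k n)) g sequentially"
  proof (rule uniform_limitI)
    fix e :: real assume "e > 0"
    then show "\<forall>\<^sub>F n in sequentially. \<forall>x\<in>closure \<Omega>. dist (f (k n) x) (g x) < e"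
      using gk(3)[of e] by (auto simp: eventually_sequentially dist_norm)
  qed
  then show ?thesis using gk by blast
qed

section \<open>The reciprocal of the best constant in the embedding of W_0^{1,p} into L^q, and its
  minimiser\<close>

definition rayleigh :: "real \<Rightarrow> real \<Rightarrow> real" where
  "rayleigh p q = Inf {Lp_norm \<Omega> p (grad \<phi>) / Lp_norm \<Omega> q \<phi> | \<phi>. test_function \<Omega> \<phi> \<and> Lp_norm \<Omega> q \<phi> > 0}"

lemma rayleigh_le:
  assumes "test_function \<Omega> \<phi>"
  shows "rayleigh p q * Lp_norm \<Omega> q \<phi> \<le> Lp_norm \<Omega> p (grad \<phi>)"
proof (cases "Lp_norm \<Omega> q \<phi> > 0")
  case True
  have "rayleigh p q \<le> Lp_norm \<Omega> p (grad \<phi>) / Lp_norm \<Omega> q \<phi>"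
    unfolding rayleigh_def
    by (rule cInf_lower) (use assms True in \<open>auto intro!: bdd_belowI[where m = 0]\<close>)
  then show ?thesis using True by (simp add: field_simps)
next
  case False
  then have "Lp_norm \<Omega> q \<phi> = 0" using Lp_norm_nonneg[of \<Omega> q \<phi>] by linarith
  then show ?thesis by simp
qed

lemma exists_test_function:
  assumes q: "q > 0"
  shows "\<exists>\<phi>. test_function \<Omega> \<phi> \<and> Lp_norm \<Omega> q \<phi> > 0"
proof -
  obtain x where x: "x \<in> \<Omega>" using nonempty_dom by blast
  obtain a b where ab: "x \<in> box a b" "cbox a b \<subseteq> \<Omega>"
    using open_contains_cbox[OF open_dom x] by metis
  have t: "test_function \<Omega> (box_bump 0 a b)" by (rule test_function_box_bump[OF ab(2)])
  have pos: "box_bump 0 a b x > 0"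
    unfolding box_bump_def using ab(1) by (intro prod_pos) (auto simp: flat_01 mem_box inner_diff_left)
  have "Lp_norm \<Omega> q (box_bump 0 a b) \<noteq> 0"
  proof
    assume "Lp_norm \<Omega> q (box_bump 0 a b) = 0"
    then have "AE x in lebesgue_on \<Omega>. box_bump 0 a b x = 0"
      using Lp_norm_eq_0D[OF test_function_Lp(1)[OF t]] q by simp
    from AE_zero_continuous[OF test_function_continuous[OF t] this x] pos show False by simp
  qed
  then have "Lp_norm \<Omega> q (box_bump 0 a b) > 0"
    using Lp_norm_nonneg[of \<Omega> q "box_bump 0 a b"] by linarith
  then show ?thesis using t by blast
qed

text \<open>The absolute value of \<open>\<phi>\<close> would have the same Rayleigh quotient but is
  not smooth. It is replaced by \<open>soft_pos\<close> of \<open>\<phi>\<close> plus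
  \<open>soft_pos\<close> of its negative, which converges uniformly to it and has no larger
  gradient.\<close>

lemma nonneg_test_function:
  assumes \<phi>: "test_function \<Omega> \<phi>" and nz: "Lp_norm \<Omega> q \<phi> > 0" and e: "e > 0" and p: "p > 1" and q: "q > 1"
  shows "\<exists>\<psi>. test_function \<Omega> \<psi> \<and> (\<forall>x. \<psi> x \<ge> 0) \<and> Lp_norm \<Omega> q \<psi> = 1 \<and>
    Lp_norm \<Omega> p (grad \<psi>) < Lp_norm \<Omega> p (grad \<phi>) / Lp_norm \<Omega> q \<phi> + e"
proof -
  define s where "s k x = soft_pos (1 / Suc k) (\<phi> x) + soft_pos (1 / Suc k) (- 1 * \<phi> x)" for k x
  have s: "test_function \<Omega> (s k)" for k
    unfolding s_def by (intro test_function_add test_function_soft_pos test_function_cmult \<phi>) auto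
  have sg: "norm (grad (s k) x) \<le> norm (grad \<phi> x)" for k x
  proof -
    let ?\<eta> = "1 / Suc k :: real"
    have d: "\<phi> differentiable (at x)" "(\<lambda>x. - 1 * \<phi> x) differentiable (at x)"
      using test_function_differentiable[OF \<phi>] test_function_differentiable[OF test_function_cmult[OF \<phi>]] by blast+
    have g: "grad (\<lambda>x. soft_pos ?\<eta> (\<phi> x)) x = soft_pos' ?\<eta> (\<phi> x) *\<^sub>R grad \<phi> x"
      "grad (\<lambda>x. soft_pos ?\<eta> (- 1 * \<phi> x)) x = soft_pos' ?\<eta> (- 1 * \<phi> x) *\<^sub>R grad (\<lambda>x. - 1 * \<phi> x) x"
      by (rule grad_compose[OF d(1) soft_pos_has_derivative], simp) (rule grad_compose[OF d(2) soft_pos_has_derivative], simp)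
    have ds: "(\<lambda>x. soft_pos ?\<eta> (\<phi> x)) differentiable (at x)" "(\<lambda>x. soft_pos ?\<eta> (- 1 * \<phi> x)) differentiable (at x)"
      by (rule test_function_differentiable[OF test_function_soft_pos[OF \<phi>]], simp)
         (rule test_function_differentiable[OF test_function_soft_pos[OF test_function_cmult[OF \<phi>]]], simp)
    have "grad (s k) x = soft_pos' ?\<eta> (\<phi> x) *\<^sub>R grad \<phi> x + soft_pos' ?\<eta> (- 1 * \<phi> x) *\<^sub>R (- 1 *\<^sub>R grad \<phi> x)"
      using grad_add[OF ds] grad_cmult[OF d(1), of "-1"] g unfolding s_def[abs_def] by presburger
    also have "\<dots> = (soft_pos' ?\<eta> (\<phi> x) - soft_pos' ?\<eta> (- \<phi> x)) *\<^sub>R grad \<phi> x" by (simp add: scaleR_left_diff_distrib)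
    finally have "norm (grad (s k) x) = \<bar>soft_pos' ?\<eta> (\<phi> x) - soft_pos' ?\<eta> (- \<phi> x)\<bar> * norm (grad \<phi> x)" by simp
    also have "\<dots> \<le> 1 * norm (grad \<phi> x)"
      using soft_pos'_bounds[of ?\<eta> "\<phi> x"] soft_pos'_bounds[of ?\<eta> "- \<phi> x"] by (intro mult_right_mono) auto
    finally show ?thesis by simp
  qed
  have sb: "\<bar>s k x - \<bar>\<phi> x\<bar>\<bar> \<le> 1 / Suc k" "s k x \<ge> 0" for k x
  proof -
    let ?\<eta> = "1 / Suc k :: real"
    have \<eta>: "?\<eta> > 0" by simp
    show "s k x \<ge> 0" unfolding s_def using soft_pos_bounds(1)[OF \<eta>] by simp
    have 0: "soft_pos ?\<eta> t = 0" if "t \<le> 0" for t using that by (simp add: soft_pos_def)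
    \<comment> \<open>At each point at most one of the two summands is nonzero.\<close>
    have "s k x = soft_pos ?\<eta> \<bar>\<phi> x\<bar>"
      unfolding s_def using 0[of "\<phi> x"] 0[of "- \<phi> x"] by (cases "\<phi> x \<ge> 0") auto
    then show "\<bar>s k x - \<bar>\<phi> x\<bar>\<bar> \<le> 1 / Suc k"
      using soft_pos_bounds(2,3)[OF \<eta>, of "\<bar>\<phi> x\<bar>"] by auto
  qed
  have ul: "uniform_limit (closure \<Omega>) s (\<lambda>x. \<bar>\<phi> x\<bar>) sequentially"
  proof (rule uniform_limitI)
    fix e :: real assume "e > 0"
    then have "\<forall>\<^sub>F k in sequentially. 1 / real (Suc k) < e"
      using order_tendstoD(2)[OF LIMSEQ_Suc[OF lim_1_over_n]] by blast
    then show "\<forall>\<^sub>F k in sequentially. \<forall>x\<in>closure \<Omega>. dist (s k x) \<bar>\<phi> x\<bar> < e"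
      by eventually_elim (use sb in \<open>auto simp: dist_real_def intro: le_less_trans\<close>)
  qed
  have "(\<lambda>k. Lp_norm \<Omega> q (s k)) \<longlonglongrightarrow> Lp_norm \<Omega> q (\<lambda>x. \<bar>\<phi> x\<bar>)"
  proof (rule Lp_norm_tendsto)
    show "(\<lambda>n. Lp_norm \<Omega> q (\<lambda>x. s n x - \<bar>\<phi> x\<bar>)) \<longlonglongrightarrow> 0"
      by (rule Lp_norm_uniform_limit[OF _ ul]) (use s q in \<open>auto intro: test_function_continuous\<close>)
    show "Lp_mem \<Omega> q (s n)" for n by (rule test_function_Lp(1)[OF s]) (use q in simp)
    show "Lp_mem \<Omega> q (\<lambda>x. \<bar>\<phi> x\<bar>)" using Lp_mem_norm[OF test_function_Lp(1)[OF \<phi>, of q]] q by simp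
  qed (use q in simp)
  then have nl: "(\<lambda>k. Lp_norm \<Omega> q (s k)) \<longlonglongrightarrow> Lp_norm \<Omega> q \<phi>" by (simp add: Lp_norm_def)
  then have "(\<lambda>k. Lp_norm \<Omega> p (grad \<phi>) / Lp_norm \<Omega> q (s k)) \<longlonglongrightarrow> Lp_norm \<Omega> p (grad \<phi>) / Lp_norm \<Omega> q \<phi>"
    using nz by (intro tendsto_intros) auto
  from order_tendstoD(2)[OF this, of "Lp_norm \<Omega> p (grad \<phi>) / Lp_norm \<Omega> q \<phi> + e"] order_tendstoD(1)[OF nl nz] e
  have "\<forall>\<^sub>F k in sequentially. Lp_norm \<Omega> p (grad \<phi>) / Lp_norm \<Omega> q (s k) < Lp_norm \<Omega> p (grad \<phi>) / Lp_norm \<Omega> q \<phi> + e \<and> Lp_norm \<Omega> q (s k) > 0"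
    by (auto intro: eventually_conj)
  then obtain k where k: "Lp_norm \<Omega> p (grad \<phi>) / Lp_norm \<Omega> q (s k) < Lp_norm \<Omega> p (grad \<phi>) / Lp_norm \<Omega> q \<phi> + e" "Lp_norm \<Omega> q (s k) > 0"
    using eventually_happens'[OF sequentially_bot] by blast
  define c where "c = 1 / Lp_norm \<Omega> q (s k)"
  have c: "c > 0" using k by (simp add: c_def)
  have gc: "grad (\<lambda>x. c * s k x) = (\<lambda>x. c *\<^sub>R grad (s k) x)"
    using grad_cmult[OF test_function_differentiable[OF s]] by auto
  have "Lp_norm \<Omega> p (grad (s k)) \<le> Lp_norm \<Omega> p (grad \<phi>)"
    using sg test_function_Lp(2)[OF s, of p] test_function_Lp(2)[OF \<phi>, of p] p
    by (intro Lp_norm_mono_AE) (auto simp: Lp_mem_def)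
  then have "c * Lp_norm \<Omega> p (grad (s k)) \<le> Lp_norm \<Omega> p (grad \<phi>) / Lp_norm \<Omega> q (s k)"
    using k by (simp add: c_def divide_right_mono)
  then have "Lp_norm \<Omega> p (grad (\<lambda>x. c * s k x)) < Lp_norm \<Omega> p (grad \<phi>) / Lp_norm \<Omega> q \<phi> + e"
    unfolding gc using Lp_norm_scale[of p \<Omega> c "grad (s k)"] p c k by simp
  moreover have "Lp_norm \<Omega> q (\<lambda>x. c * s k x) = 1"
    using Lp_norm_scale[of q \<Omega> c "s k"] q k by (simp add: c_def)
  ultimately show ?thesis
    using test_function_cmult[OF s, of c k] sb(2) c by (intro exI[of _ "\<lambda>x. c * s k x"]) auto
qed

lemma minimizing_sequence:
  assumes p: "p > 1" and q: "q > 1"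
  shows "\<exists>\<psi>. (\<forall>n. test_function \<Omega> (\<psi> n) \<and> (\<forall>x. \<psi> n x \<ge> 0) \<and> Lp_norm \<Omega> q (\<psi> n) = 1) \<and>
    (\<lambda>n. Lp_norm \<Omega> p (grad (\<psi> n))) \<longlonglongrightarrow> rayleigh p q"
proof -
  let ?S = "{Lp_norm \<Omega> p (grad \<phi>) / Lp_norm \<Omega> q \<phi> | \<phi>. test_function \<Omega> \<phi> \<and> Lp_norm \<Omega> q \<phi> > 0}"
  have ne: "?S \<noteq> {}" using exists_test_function[of q] q by auto
  have bd: "bdd_below ?S" by (auto intro!: bdd_belowI[where m = 0])
  \<comment> \<open>Half of the slack pays for the near-minimiser, the other half for making it
    nonnegative.\<close>
  have "\<exists>\<psi>. test_function \<Omega> \<psi> \<and> (\<forall>x. \<psi> x \<ge> 0) \<and> Lp_norm \<Omega> q \<psi> = 1 \<and> Lp_norm \<Omega> p (grad \<psi>) < rayleigh p q + 2 / Suc n" for n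
  proof -
    have "Inf ?S < rayleigh p q + 1 / Suc n" by (simp add: rayleigh_def)
    then obtain \<phi> where \<phi>: "test_function \<Omega> \<phi>" "Lp_norm \<Omega> q \<phi> > 0" "Lp_norm \<Omega> p (grad \<phi>) / Lp_norm \<Omega> q \<phi> < rayleigh p q + 1 / Suc n"
      using cInf_less_iff[OF ne bd] by blast
    have "1 / real (Suc n) > 0" by simp
    then obtain \<psi> where \<psi>: "test_function \<Omega> \<psi>" "\<forall>x. \<psi> x \<ge> 0" "Lp_norm \<Omega> q \<psi> = 1"
      "Lp_norm \<Omega> p (grad \<psi>) < Lp_norm \<Omega> p (grad \<phi>) / Lp_norm \<Omega> q \<phi> + 1 / real (Suc n)"
      using nonneg_test_function[OF \<phi>(1,2) _ p q] by blast
    have "2 / real (Suc n) = 1 / real (Suc n) + 1 / real (Suc n)" by (simp add: add_divide_distrib[symmetric])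
    then have "Lp_norm \<Omega> p (grad \<psi>) < rayleigh p q + 2 / Suc n" using \<psi>(4) \<phi>(3) by linarith
    then show ?thesis using \<psi> by blast
  qed
  then obtain \<psi> where \<psi>: "\<And>n. test_function \<Omega> (\<psi> n)" "\<And>n x. \<psi> n x \<ge> 0" "\<And>n. Lp_norm \<Omega> q (\<psi> n) = 1"
    "\<And>n. Lp_norm \<Omega> p (grad (\<psi> n)) < rayleigh p q + 2 / Suc n" by metis
  have "(\<lambda>n. Lp_norm \<Omega> p (grad (\<psi> n))) \<longlonglongrightarrow> rayleigh p q"
  proof (rule tendsto_sandwich[OF _ _ tendsto_const])
    show "\<forall>\<^sub>F n in sequentially. rayleigh p q \<le> Lp_norm \<Omega> p (grad (\<psi> n))"
      using rayleigh_le[OF \<psi>(1), of p q] \<psi>(3) by (auto intro!: always_eventually)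
    show "\<forall>\<^sub>F n in sequentially. Lp_norm \<Omega> p (grad (\<psi> n)) \<le> rayleigh p q + 2 * (1 / Suc n)"
      using \<psi>(4) by (auto intro!: always_eventually less_imp_le)
    show "(\<lambda>n. rayleigh p q + 2 * (1 / Suc n)) \<longlonglongrightarrow> rayleigh p q"
      using tendsto_add[OF tendsto_const[of "rayleigh p q"] tendsto_mult_left[OF LIMSEQ_Suc[OF lim_1_over_n], of 2]] by simp
  qed
  then show ?thesis using \<psi> by blast
qed

lemma rayleigh_W01p_le:
  assumes u: "u \<in> W01p \<Omega> p" and p: "p > real DIM('a)" and q: "q > 1"
  shows "rayleigh p q * Lp_norm \<Omega> q u \<le> Lp_norm \<Omega> p (weak_grad \<Omega> u)"
proof -
  have D1: "real DIM('a) \<ge> 1" by (simp add: Suc_leI)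
  have p1: "p > 1" using p D1 by linarith
  obtain \<phi> where \<phi>: "\<And>n. test_function \<Omega> (\<phi> n)" "uniform_limit (closure \<Omega>) \<phi> u sequentially"
    "(\<lambda>n. Lp_norm \<Omega> p (\<lambda>x. grad (\<phi> n) x - weak_grad \<Omega> u x)) \<longlonglongrightarrow> 0" using W01pD[OF u p] by blast
  have tL: "Lp_mem \<Omega> p (grad (\<phi> n))" "Lp_mem \<Omega> q (\<phi> n)" for n using test_function_Lp[OF \<phi>(1)] p1 q by auto
  have uL: "Lp_mem \<Omega> q u" using Lp_mem_continuous[OF W01p_mem(4)[OF u]] q by simp
  have 1: "(\<lambda>n. Lp_norm \<Omega> p (grad (\<phi> n))) \<longlonglongrightarrow> Lp_norm \<Omega> p (weak_grad \<Omega> u)"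
    by (rule Lp_norm_tendsto[OF tL(1) W01p_mem(2)[OF u] _ \<phi>(3)]) (use p1 in simp)
  have 2: "(\<lambda>n. Lp_norm \<Omega> q (\<phi> n)) \<longlonglongrightarrow> Lp_norm \<Omega> q u"
    by (rule Lp_norm_tendsto[OF tL(2) uL _ Lp_norm_uniform_limit[OF _ \<phi>(2)]]) (use q \<phi>(1) in \<open>auto intro: test_function_continuous\<close>)
  show ?thesis
    by (rule LIMSEQ_le[OF tendsto_mult_left[OF 2] 1]) (use rayleigh_le[OF \<phi>(1)] in auto)
qed

lemma Clarkson_integral:
  fixes f g :: "'a \<Rightarrow> 'a"
  assumes "Lp_mem \<Omega> p f" "Lp_mem \<Omega> p g" "p \<ge> 2"
  shows "Lp_norm \<Omega> p (\<lambda>x. (f x + g x) /\<^sub>R 2) powr p + Lp_norm \<Omega> p (\<lambda>x. (f x - g x) /\<^sub>R 2) powr p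
    \<le> (Lp_norm \<Omega> p f powr p + Lp_norm \<Omega> p g powr p) / 2"
proof -
  have p: "p > 0" "p \<ge> 0" using assms by auto
  have L: "Lp_mem \<Omega> p (\<lambda>x. (f x + g x) /\<^sub>R 2)" "Lp_mem \<Omega> p (\<lambda>x. (f x - g x) /\<^sub>R 2)"
    by (intro Lp_mem_scale Lp_mem_add Lp_mem_diff assms p)+
  note I = Lp_mem_integrable[OF L(1)] Lp_mem_integrable[OF L(2)] Lp_mem_integrable[OF assms(1)] Lp_mem_integrable[OF assms(2)]
  have "(\<integral>x. norm ((f x + g x) /\<^sub>R 2) powr p + norm ((f x - g x) /\<^sub>R 2) powr p \<partial>lebesgue_on \<Omega>)
      \<le> (\<integral>x. (norm (f x) powr p + norm (g x) powr p) / 2 \<partial>lebesgue_on \<Omega>)"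
    using I Clarkson_pointwise[OF assms(3)] by (intro integral_mono) auto
  then show ?thesis using I by (simp add: Lp_norm_powr[OF p(1)])
qed

text \<open>Compactness gives a uniform limit with q-norm 1. The gradients converge strongly:
  midpoints of late terms still have q-norm close to 1, so by definition of the infimum their
  gradient norm is almost \<open>rayleigh p q\<close>, and Clarkson's inequality leaves no room for
  the difference of the gradients.\<close>

lemma minimizer_exists:
  assumes p: "p \<ge> 2 * real DIM('a)" and q: "q > 1"
  shows "\<exists>u\<in>W01p \<Omega> p. (\<forall>x\<in>closure \<Omega>. u x \<ge> 0) \<and> Lp_norm \<Omega> q u = 1 \<and> Lp_norm \<Omega> p (weak_grad \<Omega> u) = rayleigh p q"
proof -
  note h = half_bound[OF p]
  have p2: "p \<ge> 2" using p DIM_positive[where 'a = 'a] by (simp add: order_trans[of 2 "2 * real DIM('a)" p] Suc_leI)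
  let ?\<Lambda> = "rayleigh p q"
  obtain \<psi> where \<psi>: "\<And>n. test_function \<Omega> (\<psi> n)" "\<And>n x. \<psi> n x \<ge> 0" "\<And>n. Lp_norm \<Omega> q (\<psi> n) = 1"
    and lim: "(\<lambda>n. Lp_norm \<Omega> p (grad (\<psi> n))) \<longlonglongrightarrow> ?\<Lambda>"
    using minimizing_sequence[OF h(4) q] by blast
  have \<Lambda>0: "?\<Lambda> \<ge> 0" by (rule LIMSEQ_le_const[OF lim]) simp
  obtain C where C: "\<And>n. Lp_norm \<Omega> p (grad (\<psi> n)) \<le> C"
    using Bseq_eq_bounded lim convergent_imp_Bseq[OF convergentI[OF lim]] by (metis BseqE real_norm_def abs_le_D1)
  have wn: "Lp_norm \<Omega> p (weak_grad \<Omega> (\<psi> n)) = Lp_norm \<Omega> p (grad (\<psi> n))" for n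
    by (rule weak_grad_Lp_norm[OF has_weak_gradient_test[OF open_dom \<psi>(1)]])
       (use test_function_Lp(2)[OF \<psi>(1), of p] h in \<open>auto simp: Lp_mem_def\<close>)
  obtain u k where k: "strict_mono (k :: nat \<Rightarrow> nat)" and uc: "continuous_on (closure \<Omega>) u"
    and ul: "uniform_limit (closure \<Omega>) (\<lambda>n. \<psi> (k n)) u sequentially"
    using W01p_compactness[of \<psi> "\<lambda>_. p" C] W01p_test(1)[OF \<psi>(1) h(4)] p C wn by auto
  define f where "f n = \<psi> (k n)" for n
  have f: "test_function \<Omega> (f n)" "f n x \<ge> 0" "Lp_norm \<Omega> q (f n) = 1" for n x using \<psi> by (auto simp: f_def)
  have fl: "(\<lambda>n. Lp_norm \<Omega> p (grad (f n))) \<longlonglongrightarrow> ?\<Lambda>"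
    using LIMSEQ_subseq_LIMSEQ[OF lim k] by (simp add: f_def o_def)
  have ul: "uniform_limit (closure \<Omega>) f u sequentially" using ul by (simp add: f_def[abs_def])
  have fLq: "Lp_mem \<Omega> q (f n)" and fLp: "Lp_mem \<Omega> p (grad (f n))" for n using test_function_Lp[OF f(1)] q h by auto
  have uLq: "Lp_mem \<Omega> q u" using Lp_mem_continuous[OF uc] q by simp
  have dq: "(\<lambda>n. Lp_norm \<Omega> q (\<lambda>x. f n x - u x)) \<longlonglongrightarrow> 0"
    by (rule Lp_norm_uniform_limit[OF _ ul]) (use f q in \<open>auto intro: test_function_continuous\<close>)
  have uq: "Lp_norm \<Omega> q u = 1"
    using LIMSEQ_unique[OF Lp_norm_tendsto[OF fLq uLq _ dq]] q f(3) by simp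
  have u0: "u x \<ge> 0" if "x \<in> closure \<Omega>" for x
    by (rule LIMSEQ_le_const[OF tendsto_uniform_limitI[OF ul that]]) (use f(2) in auto)
  have fp: "(\<lambda>n. Lp_norm \<Omega> p (grad (f n)) powr p) \<longlonglongrightarrow> ?\<Lambda> powr p"
    using h by (intro tendsto_powr2 fl tendsto_const) auto
  have cauchy: "\<exists>N. \<forall>m\<ge>N. \<forall>n\<ge>N. Lp_norm \<Omega> p (\<lambda>x. grad (f m) x - grad (f n) x) < e" if e: "e > 0" for e
  proof -
    \<comment> \<open>Clarkson controls the p-th power of half the difference, hence the target
      \<open>(e / 2) powr p\<close>. One half of it is spent on the midpoint, through
      \<open>d\<close>, and the other on the two endpoints, through \<open>N2\<close>.\<close>
    define e' where "e' = (e / 2) powr p"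
    have e': "e' > 0" using e by (simp add: e'_def)
    have "((\<lambda>d. ?\<Lambda> powr p * (1 - d) powr p) \<longlongrightarrow> ?\<Lambda> powr p * (1 - 0) powr p) (at_right 0)"
      by (intro tendsto_intros) auto
    then have "\<forall>\<^sub>F d in at_right 0. ?\<Lambda> powr p * (1 - d) powr p > ?\<Lambda> powr p - e' / 2"
      using e' by (intro order_tendstoD(1)) auto
    moreover have "\<forall>\<^sub>F d in at_right 0. d \<in> {0<..<(1::real)}" by (rule eventually_at_right_real) simp
    ultimately have "\<forall>\<^sub>F d in at_right 0. ?\<Lambda> powr p * (1 - d) powr p > ?\<Lambda> powr p - e' / 2 \<and> d \<in> {0<..<(1::real)}"
      by (rule eventually_conj)
    then obtain d where d: "?\<Lambda> powr p * (1 - d) powr p > ?\<Lambda> powr p - e' / 2" "0 < d" "d < 1"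
      using eventually_happens'[of "at_right (0::real)"] by auto
    obtain N1 where N1: "\<And>n. n \<ge> N1 \<Longrightarrow> Lp_norm \<Omega> q (\<lambda>x. f n x - u x) < d"
      using LIMSEQ_D[OF dq d(2)] by auto
    have "\<forall>\<^sub>F n in sequentially. Lp_norm \<Omega> p (grad (f n)) powr p < ?\<Lambda> powr p + e' / 2"
      using e' by (intro order_tendstoD(2)[OF fp]) auto
    then obtain N2 where N2: "\<And>n. n \<ge> N2 \<Longrightarrow> Lp_norm \<Omega> p (grad (f n)) powr p < ?\<Lambda> powr p + e' / 2"
      by (auto simp: eventually_sequentially)
    show ?thesis
    proof (intro exI allI impI)
      fix m n assume mn: "max N1 N2 \<le> m" "max N1 N2 \<le> n"
      define w where "w x = (1/2) * (f m x + f n x)" for x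
      have w: "test_function \<Omega> w" unfolding w_def by (intro test_function_cmult test_function_add f)
      have wg: "grad w x = (grad (f m) x + grad (f n) x) /\<^sub>R 2" for x
      proof -
        have "grad w x = (1/2) *\<^sub>R grad (\<lambda>x. f m x + f n x) x"
          unfolding w_def by (rule grad_cmult[OF test_function_differentiable[OF test_function_add[OF f(1) f(1)]]])
        also have "grad (\<lambda>x. f m x + f n x) x = grad (f m) x + grad (f n) x"
          by (rule grad_add[OF test_function_differentiable[OF f(1)] test_function_differentiable[OF f(1)]])
        finally show ?thesis by simp
      qed
      have wu: "Lp_norm \<Omega> q (\<lambda>x. u x - w x) \<le> d"
      proof -
        have "(\<lambda>x. u x - w x) = (\<lambda>x. (1/2) *\<^sub>R (u x - f m x) + (1/2) *\<^sub>R (u x - f n x))"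
          by (auto simp: w_def field_simps)
        then have "Lp_norm \<Omega> q (\<lambda>x. u x - w x) \<le> Lp_norm \<Omega> q (\<lambda>x. (1/2) *\<^sub>R (u x - f m x)) + Lp_norm \<Omega> q (\<lambda>x. (1/2) *\<^sub>R (u x - f n x))"
          using Lp_norm_triangle[OF Lp_mem_scale[OF Lp_mem_diff[OF uLq fLq]] Lp_mem_scale[OF Lp_mem_diff[OF uLq fLq]], of "1/2" m "1/2" n] q by simp
        also have "\<dots> = 1/2 * Lp_norm \<Omega> q (\<lambda>x. f m x - u x) + 1/2 * Lp_norm \<Omega> q (\<lambda>x. f n x - u x)"
          using q Lp_norm_scale[of q \<Omega> "1/2" "\<lambda>x. u x - f m x"] Lp_norm_scale[of q \<Omega> "1/2" "\<lambda>x. u x - f n x"]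
            Lp_norm_minus_commute[of \<Omega> q u "f m"] Lp_norm_minus_commute[of \<Omega> q u "f n"] by simp
        also have "\<dots> \<le> d" using N1[of m] N1[of n] mn by auto
        finally show ?thesis .
      qed
      \<comment> \<open>The midpoint \<open>w\<close> is within \<open>d\<close> of \<open>u\<close>
        in the q-norm, so its own q-norm is at least \<open>1 - d\<close>.\<close>
      have "1 \<le> Lp_norm \<Omega> q w + Lp_norm \<Omega> q (\<lambda>x. u x - w x)"
        using Lp_norm_le_add_diff[OF uLq test_function_Lp(1)[OF w]] q uq by simp
      then have "1 - d \<le> Lp_norm \<Omega> q w" using wu by simp
      then have "?\<Lambda> * (1 - d) \<le> Lp_norm \<Omega> p (grad w)"
        using rayleigh_le[OF w, of p q] mult_left_mono[OF _ \<Lambda>0, of "1 - d" "Lp_norm \<Omega> q w"] by linarith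
      then have "(?\<Lambda> * (1 - d)) powr p \<le> Lp_norm \<Omega> p (grad w) powr p"
        using \<Lambda>0 d h by (intro powr_mono2) auto
      then have 1: "?\<Lambda> powr p * (1 - d) powr p \<le> Lp_norm \<Omega> p (grad w) powr p" by (simp add: powr_mult)
      have "Lp_norm \<Omega> p (\<lambda>x. (grad (f m) x - grad (f n) x) /\<^sub>R 2) powr p < e'"
        using Clarkson_integral[OF fLp fLp p2, of m n] 1 d(1) N2[of m] N2[of n] mn
        unfolding wg[symmetric] by (auto simp: field_simps)
      moreover have "Lp_norm \<Omega> p (\<lambda>x. (grad (f m) x - grad (f n) x) /\<^sub>R 2) = 1/2 * Lp_norm \<Omega> p (\<lambda>x. grad (f m) x - grad (f n) x)"
        using h by (subst Lp_norm_scale) auto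
      ultimately have "(1/2 * Lp_norm \<Omega> p (\<lambda>x. grad (f m) x - grad (f n) x)) powr p < (e / 2) powr p"
        unfolding e'_def by (simp only:)
      then have "1/2 * Lp_norm \<Omega> p (\<lambda>x. grad (f m) x - grad (f n) x) < e / 2"
      proof (rule contrapos_pp)
        assume "\<not> 1/2 * Lp_norm \<Omega> p (\<lambda>x. grad (f m) x - grad (f n) x) < e / 2"
        then have "(e / 2) powr p \<le> (1/2 * Lp_norm \<Omega> p (\<lambda>x. grad (f m) x - grad (f n) x)) powr p"
          using e h by (intro powr_mono2) linarith+
        then show "\<not> (1/2 * Lp_norm \<Omega> p (\<lambda>x. grad (f m) x - grad (f n) x)) powr p < (e / 2) powr p" by (rule leD)
      qed
      then show "Lp_norm \<Omega> p (\<lambda>x. grad (f m) x - grad (f n) x) < e" by simp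
    qed
  qed
  obtain G where G: "Lp_mem \<Omega> p G" "(\<lambda>n. Lp_norm \<Omega> p (\<lambda>x. grad (f n) x - G x)) \<longlonglongrightarrow> 0"
    using Lp_complete[OF lmeas fLp h(4) cauchy] by blast
  note W = W01pI[OF f(1) ul G h(4)]
  have "Lp_norm \<Omega> p (weak_grad \<Omega> u) = Lp_norm \<Omega> p G"
  proof (rule Lp_norm_cong_AE)
    show "weak_grad \<Omega> u \<in> borel_measurable (lebesgue_on \<Omega>)" "G \<in> borel_measurable (lebesgue_on \<Omega>)"
      using W01p_mem(2)[OF W(1)] G by (auto simp: Lp_mem_def)
    show "AE x in lebesgue_on \<Omega>. norm (weak_grad \<Omega> u x) = norm (G x)" using W(2) by eventually_elim simp
  qed
  also have "\<dots> = ?\<Lambda>"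
    using LIMSEQ_unique[OF Lp_norm_tendsto[OF fLp G(1) _ G(2)] fl] h by simp
  finally show ?thesis using W(1) u0 uq by blast
qed

text \<open>The infimum is attained; were it 0, the sup bound by the gradient would annihilate a
  function of q-norm 1.\<close>

lemma rayleigh_pos:
  assumes p: "p \<ge> 2 * real DIM('a)" and q: "q > 1"
  shows "rayleigh p q > 0"
proof -
  note h = half_bound[OF p]
  obtain u where u: "u \<in> W01p \<Omega> p" "Lp_norm \<Omega> q u = 1" "Lp_norm \<Omega> p (weak_grad \<Omega> u) = rayleigh p q"
    using minimizer_exists[OF p q] by blast
  have "rayleigh p q \<noteq> 0"
  proof
    assume "rayleigh p q = 0"
    then have "u x = 0" if "x \<in> \<Omega>" for x
      using Morrey_W01p(2)[OF u(1) h(3), of x] u(3) that closure_subset[of \<Omega>] by auto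
    then have "Lp_norm \<Omega> q u \<le> measure lebesgue \<Omega> powr (1 / q) * 0"
      using Lp_mem_continuous[OF W01p_mem(4)[OF u(1)], of q] q by (intro Lp_norm_le_sup) (auto simp: Lp_mem_def)
    then show False using u by simp
  qed
  then show ?thesis using u(3) Lp_norm_nonneg[of \<Omega> p "weak_grad \<Omega> u"] by linarith
qed

text \<open>The perturbation of \<open>u\<close> by \<open>t\<close> times \<open>\<phi>\<close> has
  Rayleigh quotient minimal at \<open>t = 0\<close>.\<close>

lemma Euler_Lagrange:
  assumes p: "p \<ge> 2 * real DIM('a)" and q: "q > 1" and u: "u \<in> W01p \<Omega> p" and uq: "Lp_norm \<Omega> q u = 1"
    and min: "Lp_norm \<Omega> p (weak_grad \<Omega> u) = rayleigh p q" and \<phi>: "\<phi> \<in> W01p \<Omega> p"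
  shows "(\<integral>x. norm (weak_grad \<Omega> u x) powr (p - 2) * (weak_grad \<Omega> u x \<bullet> weak_grad \<Omega> \<phi> x) \<partial>lebesgue_on \<Omega>)
    = rayleigh p q powr p * (\<integral>x. \<bar>u x\<bar> powr (q - 2) * u x * \<phi> x \<partial>lebesgue_on \<Omega>)"
proof -
  note h = half_bound[OF p]
  let ?\<Lambda> = "rayleigh p q"
  define F where "F t = (\<integral>x. norm (weak_grad \<Omega> u x + t *\<^sub>R weak_grad \<Omega> \<phi> x) powr p \<partial>lebesgue_on \<Omega>)" for t
  define H where "H t = (\<integral>x. norm (u x + t *\<^sub>R \<phi> x) powr q \<partial>lebesgue_on \<Omega>)" for t
  define F' where "F' = (\<integral>x. norm (weak_grad \<Omega> u x) powr (p - 2) * (weak_grad \<Omega> u x \<bullet> weak_grad \<Omega> \<phi> x) \<partial>lebesgue_on \<Omega>)"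
  define H' where "H' = (\<integral>x. norm (u x) powr (q - 2) * (u x \<bullet> \<phi> x) \<partial>lebesgue_on \<Omega>)"
  have uL: "Lp_mem \<Omega> q u" "Lp_mem \<Omega> q \<phi>" using Lp_mem_continuous W01p_mem(4) u \<phi> q by auto
  have dF: "(F has_real_derivative p * F') (at 0)"
    unfolding F_def F'_def by (rule integral_norm_powr_has_derivative[OF W01p_mem(2)[OF u] W01p_mem(2)[OF \<phi>] h(4)])
  have dH: "(H has_real_derivative q * H') (at 0)"
    unfolding H_def H'_def by (rule integral_norm_powr_has_derivative[OF uL q])
  have H0: "H 0 = 1" using Lp_norm_powr[of q \<Omega> u] q uq by (simp add: H_def)
  have F0: "F 0 = ?\<Lambda> powr p" using Lp_norm_powr[of p \<Omega> "weak_grad \<Omega> u"] h min by (simp add: F_def)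
  \<comment> \<open>The homogeneous form of the Rayleigh inequality: it is nonnegative for all
    \<open>t\<close> and zero at \<open>t = 0\<close>, so its derivative there vanishes without
    dividing by a norm.\<close>
  define K where "K t = F t - ?\<Lambda> powr p * H t powr (p / q)" for t
  have K0: "K 0 = 0" by (simp add: K_def F0 H0)
  have Kt: "K t \<ge> 0" for t
  proof -
    note W = W01p_add_cmult[OF u \<phi> h(3), of 1 t]
    have "Lp_norm \<Omega> p (weak_grad \<Omega> (\<lambda>x. 1 * u x + t * \<phi> x)) = Lp_norm \<Omega> p (\<lambda>x. weak_grad \<Omega> u x + t *\<^sub>R weak_grad \<Omega> \<phi> x)"
    proof (rule Lp_norm_cong_AE)
      show "AE x in lebesgue_on \<Omega>. norm (weak_grad \<Omega> (\<lambda>x. 1 * u x + t * \<phi> x) x) = norm (weak_grad \<Omega> u x + t *\<^sub>R weak_grad \<Omega> \<phi> x)"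
        using W(2) by eventually_elim simp
      show "weak_grad \<Omega> (\<lambda>x. 1 * u x + t * \<phi> x) \<in> borel_measurable (lebesgue_on \<Omega>)"
        using W01p_mem(2)[OF W(1)] by (simp add: Lp_mem_def)
      show "(\<lambda>x. weak_grad \<Omega> u x + t *\<^sub>R weak_grad \<Omega> \<phi> x) \<in> borel_measurable (lebesgue_on \<Omega>)"
        using W01p_mem(2)[OF u] W01p_mem(2)[OF \<phi>] by (auto simp: Lp_mem_def)
    qed
    then have "?\<Lambda> * Lp_norm \<Omega> q (\<lambda>x. u x + t *\<^sub>R \<phi> x) \<le> Lp_norm \<Omega> p (\<lambda>x. weak_grad \<Omega> u x + t *\<^sub>R weak_grad \<Omega> \<phi> x)"
      using rayleigh_W01p_le[OF W(1) h(3) q] by simp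
    then have "(?\<Lambda> * Lp_norm \<Omega> q (\<lambda>x. u x + t *\<^sub>R \<phi> x)) powr p \<le> Lp_norm \<Omega> p (\<lambda>x. weak_grad \<Omega> u x + t *\<^sub>R weak_grad \<Omega> \<phi> x) powr p"
      using h rayleigh_pos[OF p q] by (intro powr_mono2) auto
    also have "\<dots> = F t" using h by (simp add: Lp_norm_powr F_def)
    also have "(?\<Lambda> * Lp_norm \<Omega> q (\<lambda>x. u x + t *\<^sub>R \<phi> x)) powr p = ?\<Lambda> powr p * H t powr (p / q)"
      by (simp add: powr_mult Lp_norm_def H_def powr_powr)
    finally show ?thesis by (simp add: K_def)
  qed
  have "((\<lambda>t. H t powr (p / q)) has_real_derivative (p / q) * (q * H')) (at 0)"
    using DERIV_powr[OF dH _ DERIV_const[of "p / q"]] H0 by (simp add: mult_ac)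
  then have dK: "(K has_real_derivative (p * F' - ?\<Lambda> powr p * ((p / q) * (q * H')))) (at 0)"
    unfolding K_def by (intro DERIV_diff dF DERIV_cmult)
  have "p * F' - ?\<Lambda> powr p * ((p / q) * (q * H')) = 0"
    by (rule DERIV_local_min[OF dK zero_less_one]) (use K0 Kt in auto)
  then have "p * (F' - ?\<Lambda> powr p * H') = 0" using q by (simp add: algebra_simps)
  then have "F' = ?\<Lambda> powr p * H'" using h by simp
  then show ?thesis by (simp add: F'_def H'_def mult.assoc)
qed

end

section \<open>Comparison with quadratic functions\<close>

definition quad :: "real \<Rightarrow> 'a::euclidean_space \<Rightarrow> ('a \<Rightarrow> 'a) \<Rightarrow> 'a \<Rightarrow> 'a \<Rightarrow> real" where
  "quad c b A x0 x = c + b \<bullet> (x - x0) + ((x - x0) \<bullet> A (x - x0)) / 2"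

definition trace_op :: "('a::euclidean_space \<Rightarrow> 'a) \<Rightarrow> real" where
  "trace_op A = (\<Sum>i\<in>Basis. A i \<bullet> i)"

definition sym_op :: "('a::euclidean_space \<Rightarrow> 'a) \<Rightarrow> bool" where
  "sym_op A \<longleftrightarrow> linear A \<and> (\<forall>h k. A h \<bullet> k = h \<bullet> A k)"

text \<open>The \<open>p\<close>-Laplacian of \<open>quad c b A x0\<close> at a point where its gradient is \<open>g\<close>.\<close>

definition quad_plap :: "real \<Rightarrow> ('a::euclidean_space \<Rightarrow> 'a) \<Rightarrow> 'a \<Rightarrow> real" where
  "quad_plap p A g = norm g powr (p - 2) * trace_op A + (p - 2) * norm g powr (p - 4) * (g \<bullet> A g)"

lemma sym_opD: "sym_op A \<Longrightarrow> linear A" "sym_op A \<Longrightarrow> A h \<bullet> k = h \<bullet> A k"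
  by (auto simp: sym_op_def)

lemma sym_op_continuous: "sym_op A \<Longrightarrow> continuous_on S A"
  using linear_continuous_on linear_conv_bounded_linear sym_opD(1) by blast

lemma quad_has_derivative:
  assumes A: "sym_op A"
  shows "(quad c b A x0 has_derivative (\<lambda>h. (b + A (x - x0)) \<bullet> h)) (at x)"
proof -
  have bl: "bounded_linear A" using sym_opD(1)[OF A] linear_conv_bounded_linear by blast
  have dA: "((\<lambda>x. A (x - x0)) has_derivative (\<lambda>h. A h)) (at x)"
    by (rule has_derivative_compose[OF _ bounded_linear_imp_has_derivative[OF bl]]) (auto intro!: derivative_eq_intros)
  have "(quad c b A x0 has_derivative (\<lambda>h. b \<bullet> h + ((x - x0) \<bullet> A h + h \<bullet> A (x - x0)) / 2)) (at x)"
    unfolding quad_def[abs_def] by (auto intro!: derivative_eq_intros dA)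
  then show ?thesis
  proof (rule has_derivative_eq_rhs, intro ext)
    fix h
    show "b \<bullet> h + ((x - x0) \<bullet> A h + h \<bullet> A (x - x0)) / 2 = (b + A (x - x0)) \<bullet> h"
    using sym_opD(2)[OF A, of "x - x0" h] by (simp add: inner_add_left inner_add_right inner_commute)
  qed
qed

lemma quad_grad: "sym_op A \<Longrightarrow> grad (quad c b A x0) x = b + A (x - x0)"
  by (rule grad_eq[OF quad_has_derivative])

lemma quad_partial_deriv: "sym_op A \<Longrightarrow> partial_deriv i (quad c b A x0) x = (b + A (x - x0)) \<bullet> i"
  by (rule partial_deriv_eq[OF quad_has_derivative])

lemma quad_partial_deriv_affine:
  assumes "sym_op A"
  shows "partial_deriv i (quad c b A x0) = (\<lambda>x. (b \<bullet> i - A i \<bullet> x0) + A i \<bullet> x)"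
  by (rule ext) (use sym_opD(2)[OF assms, of i] in \<open>simp add: quad_partial_deriv[OF assms] inner_add_left inner_add_right inner_diff_right
      linear_diff[OF sym_opD(1)[OF assms]] inner_diff_left inner_commute\<close>)

lemma quad_partial_deriv2:
  assumes "sym_op A"
  shows "partial_deriv j (partial_deriv i (quad c b A x0)) x = A i \<bullet> j"
  unfolding quad_partial_deriv_affine[OF assms]
  by (rule partial_deriv_eq) (auto intro!: derivative_eq_intros)

lemma smooth_on_quad:
  assumes "sym_op A" shows "smooth_on S (quad c b A x0)"
  unfolding smooth_on_def
proof
  fix k
  have "quad c b A x0 differentiable (at x)" for x
    using quad_has_derivative[OF assms] unfolding differentiable_def by blast
  then have "Ck_on (Suc k) UNIV (quad c b A x0)"
    by (auto simp: quad_partial_deriv_affine[OF assms] intro: Ck_on_add Ck_on_const Ck_on_inner)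
  then show "Ck_on k S (quad c b A x0)" using Ck_on_SucD Ck_on_subset by blast
qed

lemma infinity_laplacian_quad:
  assumes A: "sym_op A"
  shows "infinity_laplacian (quad c b A x0) x = (b + A (x - x0)) \<bullet> A (b + A (x - x0))"
proof -
  define g where "g = b + A (x - x0)"
  have "infinity_laplacian (quad c b A x0) x = (\<Sum>i\<in>Basis. \<Sum>j\<in>Basis. (g \<bullet> i) * (g \<bullet> j) * (A i \<bullet> j))"
    unfolding infinity_laplacian_def quad_partial_deriv2[OF A] quad_partial_deriv[OF A] g_def ..
  also have "\<dots> = (\<Sum>i\<in>Basis. (g \<bullet> i) * (A i \<bullet> g))"
    by (rule sum.cong) (auto simp: euclidean_inner[of "A _" g] sum_distrib_left mult_ac)
  also have "\<dots> = (\<Sum>i\<in>Basis. (g \<bullet> i) * (A g \<bullet> i))"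
    using sym_opD(2)[OF A] by (simp add: inner_commute)
  also have "\<dots> = g \<bullet> A g" by (simp add: euclidean_inner[of g "A g"])
  finally show ?thesis by (simp add: g_def)
qed

text \<open>Cauchy-Schwarz on the mixed terms reduces the claim to the product of
  \<open>s powr (p - 1) - t powr (p - 1)\<close> and \<open>s - t\<close> for the norms, whose
  factors have the same sign.\<close>

lemma p_flux_monotone:
  fixes a b :: "'b::real_inner"
  assumes p: "p > 1"
  shows "(norm a powr (p - 2) *\<^sub>R a - norm b powr (p - 2) *\<^sub>R b) \<bullet> (a - b) \<ge> 0"
proof -
  define s t where "s = norm a" and "t = norm b"
  have st: "s \<ge> 0" "t \<ge> 0" by (auto simp: s_def t_def)
  have eq: "r powr (p - 1) = r powr (p - 2) * r" if "r \<ge> 0" for r :: real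
    using that by (cases "r = 0") (auto simp: powr_diff power2_eq_square)
  have "(s powr (p - 1) - t powr (p - 1)) * (s - t) \<ge> 0"
  proof (cases "s \<le> t")
    case True
    then have "s powr (p - 1) \<le> t powr (p - 1)" using st p by (intro powr_mono2) auto
    then show ?thesis using True by (simp add: mult_nonpos_nonpos)
  next
    case False
    then have "t powr (p - 1) \<le> s powr (p - 1)" using st p by (intro powr_mono2) auto
    then show ?thesis using False by simp
  qed
  moreover have "(s powr (p - 1) - t powr (p - 1)) * (s - t)
      = s powr (p - 2) * (s * s) + t powr (p - 2) * (t * t) - (s powr (p - 2) + t powr (p - 2)) * (s * t)"
    unfolding eq[OF st(1)] eq[OF st(2)] by (simp add: algebra_simps)
  moreover have "(s powr (p - 2) + t powr (p - 2)) * (a \<bullet> b) \<le> (s powr (p - 2) + t powr (p - 2)) * (s * t)"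
    unfolding s_def t_def by (intro mult_left_mono norm_cauchy_schwarz) auto
  moreover have "(s powr (p - 2) *\<^sub>R a - t powr (p - 2) *\<^sub>R b) \<bullet> (a - b)
      = s powr (p - 2) * (s * s) + t powr (p - 2) * (t * t) - (s powr (p - 2) + t powr (p - 2)) * (a \<bullet> b)"
    by (simp add: inner_diff_left inner_diff_right s_def t_def power2_eq_square[symmetric] power2_norm_eq_inner inner_commute algebra_simps)
  ultimately show ?thesis by (simp add: s_def t_def)
qed

lemma Lp_flux_integrable:
  fixes a b :: "'a::euclidean_space \<Rightarrow> 'b::euclidean_space"
  assumes "Lp_mem \<Omega> p a" "Lp_mem \<Omega> p b" "p > 1"
  shows "integrable (lebesgue_on \<Omega>) (\<lambda>x. norm (a x) powr (p - 2) * (a x \<bullet> b x))"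
proof -
  have [measurable]: "a \<in> borel_measurable (lebesgue_on \<Omega>)" "b \<in> borel_measurable (lebesgue_on \<Omega>)"
    using assms by (auto simp: Lp_mem_def)
  have "Lp_mem \<Omega> p (\<lambda>x. norm (a x) + norm (b x))"
    using Lp_mem_add[OF Lp_mem_norm[OF assms(1)] Lp_mem_norm[OF assms(2)]] assms(3) by simp
  then have w: "integrable (lebesgue_on \<Omega>) (\<lambda>x. (norm (a x) + norm (b x)) powr p)" by (auto simp: Lp_mem_def)
  show ?thesis
  proof (rule Bochner_Integration.integrable_bound[OF w])
    have "\<bar>norm (a x) powr (p - 2) * (a x \<bullet> b x)\<bar> \<le> (norm (a x) + norm (b x)) powr p" for x
    proof -
      let ?n = "norm (a x)"
      have "\<bar>?n powr (p - 2) * (a x \<bullet> b x)\<bar> \<le> ?n powr (p - 2) * (?n * norm (b x))"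
        by (simp add: abs_mult Cauchy_Schwarz_ineq2 mult_left_mono)
      also have "\<dots> = ?n powr (p - 1) * norm (b x)"
        by (cases "?n = 0") (auto simp: powr_diff power2_eq_square)
      also have "\<dots> \<le> (?n + norm (b x)) powr (p - 1) * (?n + norm (b x))"
        using assms(3) by (intro mult_mono powr_mono2) auto
      also have "\<dots> = (?n + norm (b x)) powr p"
        by (cases "?n + norm (b x) = 0") (auto simp: powr_diff add_nonneg_eq_0_iff)
      finally show ?thesis .
    qed
    then show "AE x in lebesgue_on \<Omega>. norm (norm (a x) powr (p - 2) * (a x \<bullet> b x)) \<le> norm ((norm (a x) + norm (b x)) powr p)"
      by (intro AE_I2) simp
  qed measurable
qed

lemma norm_powr_gradient:
  fixes g :: "'a::euclidean_space"
  assumes g: "g \<noteq> 0"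
  shows "((\<lambda>y. norm y powr s) has_derivative (\<lambda>h. s * norm g powr (s - 2) * (g \<bullet> h))) (at g)"
proof -
  have "((\<lambda>y. norm y) has_derivative (\<lambda>h. (g \<bullet> h) / norm g)) (at g)"
    using has_derivative_norm[OF g] by (simp add: sgn_div_norm inner_commute divide_inverse mult.commute)
  moreover have "((\<lambda>r. r powr s) has_derivative (\<lambda>h. s * norm g powr (s - 1) * h)) (at (norm g))"
    using g by (auto intro!: derivative_eq_intros simp: has_field_derivative_def[symmetric])
  ultimately have "((\<lambda>y. norm y powr s) has_derivative (\<lambda>h. s * norm g powr (s - 1) * ((g \<bullet> h) / norm g))) (at g)"
    by (rule has_derivative_compose)
  then show ?thesis
    by (rule has_derivative_eq_rhs) (use g in \<open>auto simp: powr_diff power2_eq_square\<close>)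
qed

context bdd_domain
begin

text \<open>On the ball the gradient does not vanish, so the flux is differentiable and its
  divergence is \<open>quad_plap\<close>. The product of the flux with \<open>\<psi>\<close> has
  compact support, hence the integral of its divergence is zero.\<close>

lemma quad_weak_form:
  assumes A: "sym_op A" and ball: "ball x0 r \<subseteq> \<Omega>" and nz: "\<And>x. x \<in> ball x0 r \<Longrightarrow> b + A (x - x0) \<noteq> 0"
    and \<psi>: "smooth_on UNIV \<psi>" and K: "compact K" "K \<subseteq> ball x0 r" "\<And>x. x \<notin> K \<Longrightarrow> \<psi> x = 0"
  shows "(\<integral>x. norm (b + A (x - x0)) powr (p - 2) * ((b + A (x - x0)) \<bullet> grad \<psi> x) \<partial>lebesgue_on \<Omega>)
    = - (\<integral>x. quad_plap p A (b + A (x - x0)) * \<psi> x \<partial>lebesgue_on \<Omega>)"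
proof -
  define g where "g x = b + A (x - x0)" for x
  have gK: "grad \<psi> x = 0" if "x \<notin> K" for x using grad_zero_outside[OF compact_imp_closed[OF K(1)] K(3) that] .
  have nzK: "g x \<noteq> 0" if "x \<in> ball x0 r" for x using nz[OF that] by (simp add: g_def)
  \<comment> \<open>The i-th partial derivative of the i-th component \<open>f i\<close> of the flux
    times \<open>\<psi>\<close>. Summed over \<open>i\<close>, the first group of terms is
    \<open>quad_plap\<close> times \<open>\<psi>\<close> and the last is the flux against the
    gradient of \<open>\<psi>\<close>.\<close>
  define D where "D i x = (norm (g x) powr (p - 2) * (A i \<bullet> i) + (p - 2) * norm (g x) powr (p - 4) * (g x \<bullet> A i) * (g x \<bullet> i)) * \<psi> x
      + norm (g x) powr (p - 2) * (g x \<bullet> i) * partial_deriv i \<psi> x" for i x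
  define f where "f i x = norm (g x) powr (p - 2) * (g x \<bullet> i) * \<psi> x" for i x
  have bl: "bounded_linear A" using sym_opD(1)[OF A] linear_conv_bounded_linear by blast
  have dg: "(g has_derivative (\<lambda>h. A h)) (at x)" for x
    unfolding g_def by (auto intro!: derivative_eq_intros has_derivative_compose[OF _ bounded_linear_imp_has_derivative[OF bl]])
  have psid: "\<psi> differentiable (at x)" for x using smooth_on_differentiable[OF \<psi>] by blast
  have pz: "partial_deriv i \<psi> x = 0" if "x \<notin> K" "i \<in> Basis" for i x
    using gK[OF that(1)] grad_inner_Basis[OF that(2), of \<psi> x] by simp
  have df: "f i differentiable (at x) \<and> partial_deriv i (f i) x = D i x" if i: "i \<in> Basis" for i x
  proof (cases "x \<in> K")
    case True
    then have nz: "g x \<noteq> 0" using K nzK by blast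
    have "(f i has_derivative (\<lambda>h. (norm (g x) powr (p - 2) * (A h \<bullet> i) + (p - 2) * norm (g x) powr (p - 4) * (g x \<bullet> A h) * (g x \<bullet> i)) * \<psi> x
      + norm (g x) powr (p - 2) * (g x \<bullet> i) * (grad \<psi> x \<bullet> h))) (at x)"
    proof -
      have d1: "((\<lambda>x. norm (g x) powr (p - 2)) has_derivative (\<lambda>h. (p - 2) * norm (g x) powr (p - 4) * (g x \<bullet> A h))) (at x)"
        using has_derivative_compose[OF dg norm_powr_gradient[OF nz, of "p - 2"]] by simp
      have d2: "((\<lambda>x. g x \<bullet> i) has_derivative (\<lambda>h. A h \<bullet> i)) (at x)"
        by (auto intro!: derivative_eq_intros dg)
      show ?thesis unfolding f_def
        by (rule has_derivative_eq_rhs[OF has_derivative_mult[OF has_derivative_mult[OF d1 d2] grad_has_derivative[OF psid]]])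
           (auto simp: algebra_simps)
    qed
    then show ?thesis using i by (auto simp: differentiable_def partial_deriv_eq D_def grad_inner_Basis)
  next
    case False
    have 0: "((\<lambda>x. 0::real) has_derivative (\<lambda>h. 0)) (at x)" by simp
    have "open (- K)" "x \<in> - K" using False K compact_imp_closed by auto
    then have "(f i has_derivative (\<lambda>h. 0)) (at x)"
      by (rule has_derivative_transform_within_open[OF 0]) (use K(3) in \<open>auto simp: f_def\<close>)
    then show ?thesis using False K(3) pz[OF False i] by (auto simp: differentiable_def partial_deriv_eq D_def)
  qed
  have gc: "continuous_on S g" for S
    unfolding g_def by (intro continuous_intros continuous_on_compose2[OF sym_op_continuous[OF A, of UNIV]]) auto
  have pc: "continuous_on K (\<lambda>x. norm (g x) powr s)" for s
    using nzK K by (intro continuous_on_powr gc continuous_intros) auto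
  have psic: "continuous_on S \<psi>" "i \<in> Basis \<Longrightarrow> continuous_on S (partial_deriv i \<psi>)" for S i
    using smooth_on_continuous[OF \<psi>] smooth_on_continuous[OF smooth_on_partial_deriv[OF \<psi>]] continuous_on_subset by blast+
  have Dc: "continuous_on K (D i)" if i: "i \<in> Basis" for i
    unfolding D_def by (intro continuous_intros pc gc psic i)
  have D0: "D i x = 0" if "i \<in> Basis" "x \<notin> K" for i x using pz K(3) that by (simp add: D_def)
  have int: "integrable lborel F" if "continuous_on K F" "\<And>x. x \<notin> K \<Longrightarrow> F x = 0" for F :: "'a \<Rightarrow> real"
  proof -
    have "integrable lborel (\<lambda>x. indicator K x *\<^sub>R F x)"
      using K that by (intro borel_integrable_compact)
    moreover have "(\<lambda>x. indicator K x *\<^sub>R F x) = F" by (rule ext) (use that(2) in \<open>auto simp: indicator_def\<close>)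
    ultimately show ?thesis by simp
  qed
  have Di: "integrable lborel (D i)" if "i \<in> Basis" for i using int[OF Dc[OF that]] D0[OF that] by blast
  have Dz: "(\<integral>x. D i x \<partial>lborel) = 0" if i: "i \<in> Basis" for i
  proof -
    have "bounded (D i ` K)" using compact_imp_bounded[OF compact_continuous_image[OF Dc[OF i] K(1)]] .
    then obtain B where B: "\<And>x. x \<in> K \<Longrightarrow> \<bar>D i x\<bar> \<le> B" by (auto simp: bounded_iff)
    have "\<bar>D i x\<bar> \<le> \<bar>B\<bar>" for x using B[of x] D0[OF i, of x] by (cases "x \<in> K") force+
    then have "(\<integral>x. partial_deriv i (f i) x \<partial>lborel) = 0"
      using df[OF i] K(3) by (intro integral_partial_deriv_zero(2)[OF _ K(1) _ _ i, where C = "\<bar>B\<bar>"]) (auto simp: f_def)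
    then show ?thesis using df[OF i] by simp
  qed
  define F1 where "F1 x = norm (g x) powr (p - 2) * (g x \<bullet> grad \<psi> x)" for x
  define F2 where "F2 x = quad_plap p A (g x) * \<psi> x" for x
  have F1i: "integrable lborel F1"
    unfolding F1_def by (rule int) (auto intro!: continuous_intros pc gc continuous_on_subset[OF continuous_on_grad_smooth[OF \<psi>]] simp: gK)
  have F2i: "integrable lborel F2"
    unfolding F2_def quad_plap_def by (rule int) (auto intro!: continuous_intros pc gc psic continuous_on_compose2[OF sym_op_continuous[OF A, of UNIV] gc] simp: K(3))
  have sum: "(\<Sum>i\<in>Basis. D i x) = F2 x + F1 x" for x
  proof -
    have 1: "(\<Sum>i\<in>Basis. (g x \<bullet> A i) * (g x \<bullet> i)) = g x \<bullet> A (g x)"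
      unfolding euclidean_inner[of "g x" "A (g x)"] sym_opD(2)[OF A, of "g x"] by (simp add: mult.commute)
    have 2: "(\<Sum>i\<in>Basis. (g x \<bullet> i) * partial_deriv i \<psi> x) = g x \<bullet> grad \<psi> x"
      unfolding euclidean_inner[of "g x" "grad \<psi> x"] by (simp add: grad_inner_Basis)
    have "(\<Sum>i\<in>Basis. D i x) = norm (g x) powr (p - 2) * trace_op A * \<psi> x
        + (p - 2) * norm (g x) powr (p - 4) * (\<Sum>i\<in>Basis. (g x \<bullet> A i) * (g x \<bullet> i)) * \<psi> x
        + norm (g x) powr (p - 2) * (\<Sum>i\<in>Basis. (g x \<bullet> i) * partial_deriv i \<psi> x)"
      unfolding D_def trace_op_def by (simp add: sum.distrib sum_subtractf sum_distrib_left sum_distrib_right algebra_simps)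
    then show ?thesis unfolding 1 2 F1_def F2_def quad_plap_def by (simp add: algebra_simps)
  qed
  have "0 = (\<integral>x. (\<Sum>i\<in>Basis. D i x) \<partial>lborel)"
    using Di Dz by (subst Bochner_Integration.integral_sum) auto
  also have "\<dots> = (\<integral>x. F2 x \<partial>lborel) + (\<integral>x. F1 x \<partial>lborel)"
    unfolding sum using F1i F2i by simp
  finally have "(\<integral>x. F1 x \<partial>lborel) = - (\<integral>x. F2 x \<partial>lborel)" by simp
  moreover have "(\<integral>x. F1 x \<partial>lebesgue_on \<Omega>) = (\<integral>x. F1 x \<partial>lborel)"
  proof (rule integral_lebesgue_on_support[OF sets_dom])
    show "F1 x = 0" if "x \<notin> \<Omega>" for x
    proof -
      have "x \<notin> K" using that K(2) ball by blast
      then show ?thesis using gK by (simp add: F1_def)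
    qed
  qed (use F1i in auto)
  moreover have "(\<integral>x. F2 x \<partial>lebesgue_on \<Omega>) = (\<integral>x. F2 x \<partial>lborel)"
  proof (rule integral_lebesgue_on_support[OF sets_dom])
    show "F2 x = 0" if "x \<notin> \<Omega>" for x
    proof -
      have "x \<notin> K" using that K(2) ball by blast
      then show ?thesis using K(3) by (simp add: F2_def)
    qed
  qed (use F2i in auto)
  ultimately show ?thesis by (simp add: F1_def F2_def g_def)
qed

text \<open>The test function is a smooth truncation of \<open>(w - v - \<epsilon>)\<^sub>+\<close>; its membership in \<open>W01p\<close> is seen by
  truncating the approximants of \<open>v\<close> instead.\<close>

lemma quad_comparison:
  assumes v: "v \<in> W01p \<Omega> p" and p: "p \<ge> 2 * real DIM('a)"
    and weak: "\<And>\<phi>. \<phi> \<in> W01p \<Omega> p \<Longrightarrow>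
      (\<integral>x. norm (weak_grad \<Omega> v x) powr (p - 2) * (weak_grad \<Omega> v x \<bullet> weak_grad \<Omega> \<phi> x) \<partial>lebesgue_on \<Omega>)
        = (\<integral>x. f x * \<phi> x \<partial>lebesgue_on \<Omega>)"
    and f: "continuous_on (closure \<Omega>) f"
    and A: "sym_op A" and r: "r > 0" and ball: "cball x0 r \<subseteq> \<Omega>"
    and nz: "\<And>x. x \<in> cball x0 r \<Longrightarrow> b + A (x - x0) \<noteq> 0"
    and sub: "\<And>x. x \<in> ball x0 r \<Longrightarrow> - quad_plap p A (b + A (x - x0)) < f x"
    and bdry: "\<And>x. x \<in> sphere x0 r \<Longrightarrow> quad c b A x0 x \<le> v x"
    and x: "x \<in> ball x0 r"
  shows "quad c b A x0 x \<le> v x"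
proof (rule ccontr)
  assume neg: "\<not> quad c b A x0 x \<le> v x"
  note h = half_bound[OF p]
  define w where "w = quad c b A x0"
  \<comment> \<open>Half of the assumed excess: \<open>w - \<epsilon> - v\<close> is still positive
    at \<open>x\<close>, and it is at most \<open>- \<epsilon>\<close> on the sphere.\<close>
  define \<epsilon> where "\<epsilon> = (w x - v x) / 2"
  have \<epsilon>: "\<epsilon> > 0" using neg by (simp add: \<epsilon>_def w_def)
  define U where "U = ball x0 r"
  have U: "open U" "U \<subseteq> \<Omega>" using ball by (auto simp: U_def)
  have wd: "(w has_derivative (\<lambda>h. (b + A (x - x0)) \<bullet> h)) (at x)" for x
    unfolding w_def by (rule quad_has_derivative[OF A])
  define g where "g x = b + A (x - x0)" for x
  have gw: "grad w x = g x" for x unfolding w_def g_def by (rule quad_grad[OF A])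
  have wdiff: "w differentiable (at x)" for x using wd by (auto simp: differentiable_def)
  have wc: "continuous_on S w" for S
    unfolding w_def using smooth_on_continuous[OF smooth_on_quad[OF A]] by blast
  have gc: "continuous_on S g" for S
    unfolding g_def by (intro continuous_intros continuous_on_compose2[OF sym_op_continuous[OF A, of UNIV]]) auto
  have cO: "compact (closure \<Omega>)" using bounded_dom by (simp add: compact_closure)
  have vc: "continuous_on (closure \<Omega>) v" by (rule W01p_mem(4)[OF v])
  have cbc: "cball x0 r \<subseteq> closure \<Omega>" using ball closure_subset by blast
  note wg = W01p_mem(2)[OF v]
  let ?G = "weak_grad \<Omega> v"
  obtain \<phi>0 where \<phi>0: "\<And>n. test_function \<Omega> (\<phi>0 n)" "uniform_limit (closure \<Omega>) \<phi>0 v sequentially"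
    "(\<lambda>n. Lp_norm \<Omega> p (\<lambda>x. grad (\<phi>0 n) x - ?G x)) \<longlonglongrightarrow> 0" using W01pD[OF v h(3)] by blast
  have "\<epsilon> / 2 > 0" using \<epsilon> by simp
  from uniform_limitD[OF \<phi>0(2) this] obtain N where N: "\<And>n x. n \<ge> N \<Longrightarrow> x \<in> closure \<Omega> \<Longrightarrow> dist (\<phi>0 n x) (v x) < \<epsilon> / 2"
    by (auto simp: eventually_sequentially)
  define \<phi> where "\<phi> n = \<phi>0 (n + N)" for n
  have \<phi>: "test_function \<Omega> (\<phi> n)" for n by (simp add: \<phi>_def \<phi>0)
  have \<phi>v: "\<bar>\<phi> n x - v x\<bar> < \<epsilon> / 2" if "x \<in> closure \<Omega>" for n x
    using N[of "n + N" x] that by (simp add: \<phi>_def dist_real_def)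
  have \<phi>u: "uniform_limit (closure \<Omega>) \<phi> v sequentially"
    unfolding \<phi>_def using filterlim_compose[OF \<phi>0(2) filterlim_add_const_nat_at_top[of N]] by simp
  have \<phi>g: "(\<lambda>n. Lp_norm \<Omega> p (\<lambda>x. grad (\<phi> n) x - ?G x)) \<longlonglongrightarrow> 0"
    unfolding \<phi>_def using LIMSEQ_ignore_initial_segment[OF \<phi>0(3), of N] .
  \<comment> \<open>The approximants lie within \<open>\<epsilon> / 2\<close> of \<open>v\<close>,
    so every truncation \<open>s (w - \<epsilon> - \<phi> n)\<close> vanishes on \<open>U\<close>
    outside this set. It does not depend on \<open>n\<close>, and \<open>w \<le> v\<close> on the
    sphere keeps it inside the open ball.\<close>
  define T where "T = {x \<in> cball x0 r. w x - v x \<ge> \<epsilon> / 2}"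
  have Tc: "compact T"
  proof -
    have "closed {x \<in> cball x0 r. \<epsilon> / 2 \<le> w x - v x}"
      by (rule continuous_on_closed_Collect_le) (intro continuous_intros wc continuous_on_subset[OF vc cbc] closed_cball)+
    moreover have "bounded T" by (rule bounded_subset[OF bounded_cball[of x0 r]]) (auto simp: T_def)
    ultimately show ?thesis unfolding compact_eq_bounded_closed T_def by blast
  qed
  have TU: "T \<subseteq> U"
  proof
    fix y assume y: "y \<in> T"
    have "y \<notin> sphere x0 r"
    proof
      assume "y \<in> sphere x0 r"
      then have "w y - v y \<le> 0" using bdry[of y] by (simp add: w_def)
      then show False using y \<epsilon> by (simp add: T_def)
    qed
    then show "y \<in> U" using y by (auto simp: T_def U_def)
  qed
  define s where "s = soft_pos 1"
  define s' where "s' = soft_pos' 1"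
  have sd: "(s has_real_derivative s' t) (at t)" for t unfolding s_def s'_def by (rule soft_pos_has_derivative) simp
  have s'b: "0 \<le> s' t" "s' t \<le> 1" for t unfolding s'_def using soft_pos'_bounds[of 1 t] by auto
  have s0: "s t = 0" if "t \<le> 0" for t using that by (simp add: s_def soft_pos_def)
  have spos: "s t > 0 \<longleftrightarrow> t > 0" "s t \<ge> 0" for t unfolding s_def using soft_pos_bounds(1,4)[of 1 t] by auto
  have slip: "\<bar>s t - s u\<bar> \<le> \<bar>t - u\<bar>" for t u
  proof -
    have "norm (s t - s u) \<le> 1 * norm (t - u)"
      by (rule field_differentiable_bound[of UNIV s s']) (use sd s'b in auto)
    then show ?thesis by simp
  qed
  have s'c: "isCont s' t" for t unfolding s'_def by (rule isCont_soft_pos') simp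
  define \<psi>n where "\<psi>n n x = (if x \<in> U then s (w x - \<epsilon> - \<phi> n x) else 0)" for n x
  define \<psi> where "\<psi> x = (if x \<in> U then s (w x - \<epsilon> - v x) else 0)" for x
  define Gn where "Gn n x = (if x \<in> U then s' (w x - \<epsilon> - \<phi> n x) *\<^sub>R (g x - grad (\<phi> n) x) else 0)" for n x
  define H where "H x = (if x \<in> U then s' (w x - \<epsilon> - v x) *\<^sub>R (g x - ?G x) else 0)" for x
  have zero: "s (w y - \<epsilon> - \<phi> n y) = 0" if "y \<in> U - T" for n y
  proof -
    have y: "y \<in> cball x0 r" "w y - v y < \<epsilon> / 2" using that by (auto simp: T_def U_def)
    then have "\<bar>\<phi> n y - v y\<bar> < \<epsilon> / 2" using \<phi>v cbc by blast
    then show ?thesis using y \<epsilon> by (intro s0) linarith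
  qed
  have \<psi>nt: "test_function \<Omega> (\<psi>n n)" for n
    unfolding \<psi>n_def
  proof (rule test_function_extend[OF U _ Tc TU zero])
    show "smooth_on U (\<lambda>x. s (w x - \<epsilon> - \<phi> n x))"
      unfolding s_def
    proof (rule smooth_on_soft_pos[OF _ U(1)])
      show "smooth_on U (\<lambda>x. w x - \<epsilon> - \<phi> n x)"
        using smooth_on_quad[OF A, of U c b x0] test_function_smooth[OF \<phi>, of n] Ck_on_subset[of _ UNIV "\<phi> n" U]
        unfolding smooth_on_def w_def by (auto intro!: Ck_on_diff U Ck_on_const)
    qed simp
  qed
  have \<psi>nK: "\<psi>n n y = 0" if "y \<notin> T" for n y
    using zero[of y n] that by (auto simp: \<psi>n_def)
  have gradn: "grad (\<psi>n n) y = Gn n y" for n y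
  proof (cases "y \<in> U")
    case True
    have d: "(\<lambda>x. w x - \<epsilon> - \<phi> n x) differentiable (at y)"
      using wdiff[of y] test_function_differentiable[OF \<phi>, of n y] by (intro derivative_intros) auto
    have "grad (\<lambda>x. w x - \<epsilon> - \<phi> n x) y = g y - grad (\<phi> n) y"
      by (rule grad_eq) (use grad_has_derivative[OF wdiff[of y]] grad_has_derivative[OF test_function_differentiable[OF \<phi>, of n y]] gw
        in \<open>auto intro!: derivative_eq_intros simp: inner_diff_left\<close>)
    then have "grad (\<lambda>x. s (w x - \<epsilon> - \<phi> n x)) y = Gn n y"
      using grad_compose[OF d sd] True by (simp add: Gn_def)
    moreover have "partial_deriv i (\<lambda>x. s (w x - \<epsilon> - \<phi> n x)) y = partial_deriv i (\<psi>n n) y" for i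
    proof (rule partial_deriv_cong(2)[OF U(1) True])
      show "(\<lambda>x. s (w x - \<epsilon> - \<phi> n x)) differentiable (at y)"
        using differentiable_chain_at[OF d, of s] sd by (auto simp: o_def real_differentiable_def)
    qed (simp add: \<psi>n_def)
    ultimately show ?thesis by (simp add: grad_def)
  next
    case False
    then have "grad (\<psi>n n) y = 0" using \<psi>nK TU by (intro grad_zero_outside[OF compact_imp_closed[OF Tc]]) auto
    then show ?thesis using False by (simp add: Gn_def)
  qed
  have \<psi>u: "uniform_limit (closure \<Omega>) \<psi>n \<psi> sequentially"
  proof (rule uniform_limitI)
    fix e :: real assume "e > 0"
    from uniform_limitD[OF \<phi>u this] show "\<forall>\<^sub>F n in sequentially. \<forall>x\<in>closure \<Omega>. dist (\<psi>n n x) (\<psi> x) < e"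
    proof eventually_elim
      case (elim n)
      show ?case
      proof
        fix y assume y: "y \<in> closure \<Omega>"
        have "\<bar>\<psi>n n y - \<psi> y\<bar> \<le> \<bar>\<phi> n y - v y\<bar>"
          using slip[of "w y - \<epsilon> - \<phi> n y" "w y - \<epsilon> - v y"] by (auto simp: \<psi>n_def \<psi>_def)
        then show "dist (\<psi>n n y) (\<psi> y) < e" using elim y by (auto simp: dist_real_def)
      qed
    qed
  qed
  have meas: "F \<in> borel_measurable (lebesgue_on \<Omega>)" if "continuous_on (closure \<Omega>) F" for F :: "'a \<Rightarrow> 'b::euclidean_space"
    using that sets_dom closure_subset by (intro continuous_imp_measurable_on_sets_lebesgue) (auto intro: continuous_on_subset)
  have Um: "U \<inter> \<Omega> \<in> sets (lebesgue_on \<Omega>)" using U sets_dom by (auto simp: sets_restrict_space)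
  have Umm: "(\<lambda>x. if x \<in> U then F x else 0) \<in> borel_measurable (lebesgue_on \<Omega>)"
    if F: "F \<in> borel_measurable (lebesgue_on \<Omega>)" for F :: "'a \<Rightarrow> 'b::euclidean_space"
  proof -
    have "(\<lambda>x. indicator (U \<inter> \<Omega>) x *\<^sub>R F x) \<in> borel_measurable (lebesgue_on \<Omega>)"
      using F Um by (intro borel_measurable_scaleR borel_measurable_indicator) auto
    then show ?thesis by (subst (asm) measurable_cong[where g = "\<lambda>x. if x \<in> U then F x else 0"]) (auto simp: indicator_def)
  qed
  have s'm: "s' \<in> borel_measurable borel"
    using s'c by (intro borel_measurable_continuous_onI continuous_at_imp_continuous_on) auto
  have wm: "w \<in> borel_measurable (lebesgue_on \<Omega>)" "g \<in> borel_measurable (lebesgue_on \<Omega>)" "v \<in> borel_measurable (lebesgue_on \<Omega>)"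
    "f \<in> borel_measurable (lebesgue_on \<Omega>)" "\<phi> n \<in> borel_measurable (lebesgue_on \<Omega>)" for n
    using meas[OF wc] meas[OF gc] meas[OF vc] meas[OF f] meas[OF test_function_continuous[OF \<phi>]] by auto
  note [measurable] = s'm wm
  have Gm[measurable]: "?G \<in> borel_measurable (lebesgue_on \<Omega>)" using wg by (simp add: Lp_mem_def)
  have gm[measurable]: "grad (\<phi> n) \<in> borel_measurable (lebesgue_on \<Omega>)" for n using meas[OF continuous_on_grad_test[OF \<phi>]] .
  have "bounded (g ` closure \<Omega>)" by (rule compact_imp_bounded[OF compact_continuous_image[OF gc cO]])
  then obtain Bg where Bg: "\<And>x. x \<in> closure \<Omega> \<Longrightarrow> norm (g x) \<le> Bg" by (auto simp: bounded_iff)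
  have gL: "Lp_mem \<Omega> p g" by (rule Lp_mem_bounded[OF lmeas wm(2), of Bg]) (use Bg closure_subset h in auto)
  have hL: "Lp_mem \<Omega> p (\<lambda>x. g x - ?G x)" using Lp_mem_diff[OF gL wg] h by simp
  have HL: "Lp_mem \<Omega> p H"
  proof (rule Lp_mem_dominated[OF _ hL])
    show "H \<in> borel_measurable (lebesgue_on \<Omega>)" unfolding H_def by (rule Umm) measurable
    show "AE x in lebesgue_on \<Omega>. norm (H x) \<le> norm (g x - ?G x)"
      using s'b by (intro AE_I2) (auto simp: H_def intro: mult_left_le_one_le)
  qed (use h in simp)
  have tL: "Lp_mem \<Omega> p (grad (\<psi>n n))" for n using test_function_Lp(2)[OF \<psi>nt] h by simp
  have Hlim: "(\<lambda>n. Lp_norm \<Omega> p (\<lambda>x. grad (\<psi>n n) x - H x)) \<longlonglongrightarrow> 0"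
  proof -
    \<comment> \<open>The error splits into the gradient error of the approximants, damped by the
      factor \<open>s'\<close> with values in the unit interval, and the error in that factor, which
      tends to 0 pointwise under a bound in L^p.\<close>
    define a where "a n x = (if x \<in> U then s' (w x - \<epsilon> - \<phi> n x) *\<^sub>R (?G x - grad (\<phi> n) x) else 0)" for n x
    define e where "e n x = (if x \<in> U then (s' (w x - \<epsilon> - \<phi> n x) - s' (w x - \<epsilon> - v x)) *\<^sub>R (g x - ?G x) else 0)" for n x
    have eq: "(\<lambda>x. grad (\<psi>n n) x - H x) = (\<lambda>x. a n x + e n x)" for n
      by (rule ext) (auto simp: gradn Gn_def H_def a_def e_def algebra_simps)
    have am: "a n \<in> borel_measurable (lebesgue_on \<Omega>)" for n unfolding a_def by (rule Umm) measurable
    have em: "e n \<in> borel_measurable (lebesgue_on \<Omega>)" for n unfolding e_def by (rule Umm) measurable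
    have dL: "Lp_mem \<Omega> p (\<lambda>x. grad (\<phi> n) x - ?G x)" for n
      using Lp_mem_diff[OF test_function_Lp(2)[OF \<phi>] wg] h by simp
    have ab: "AE x in lebesgue_on \<Omega>. norm (a n x) \<le> norm (grad (\<phi> n) x - ?G x)" for n
      using s'b by (intro AE_I2) (auto simp: a_def norm_minus_commute intro: mult_left_le_one_le)
    have eb: "norm (e n x) \<le> norm (g x - ?G x)" for n x
    proof -
      have "\<bar>s' (w x - \<epsilon> - \<phi> n x) - s' (w x - \<epsilon> - v x)\<bar> \<le> 1"
        using s'b[of "w x - \<epsilon> - \<phi> n x"] s'b[of "w x - \<epsilon> - v x"] by linarith
      then show ?thesis by (auto simp: e_def intro: mult_left_le_one_le)
    qed
    have aL: "Lp_mem \<Omega> p (a n)" for n by (rule Lp_mem_dominated[OF am dL _ ab]) (use h in simp)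
    have eL: "Lp_mem \<Omega> p (e n)" for n by (rule Lp_mem_dominated[OF em hL]) (use h eb in auto)
    have a0: "(\<lambda>n. Lp_norm \<Omega> p (a n)) \<longlonglongrightarrow> 0"
    proof (rule tendsto_sandwich[OF _ _ tendsto_const \<phi>g])
      show "\<forall>\<^sub>F n in sequentially. Lp_norm \<Omega> p (a n) \<le> Lp_norm \<Omega> p (\<lambda>x. grad (\<phi> n) x - ?G x)"
        using h by (intro always_eventually allI Lp_norm_mono_AE[OF am dL _ ab]) auto
    qed auto
    have e0: "(\<lambda>n. Lp_norm \<Omega> p (e n)) \<longlonglongrightarrow> 0"
    proof (rule Lp_dominated_convergence[OF em _ Lp_mem_integrable[OF hL]])
      show "AE x in lebesgue_on \<Omega>. (\<lambda>n. e n x) \<longlonglongrightarrow> 0"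
      proof (rule AE_I2)
        fix y assume "y \<in> space (lebesgue_on \<Omega>)"
        then have y: "y \<in> closure \<Omega>" using closure_subset by auto
        have l: "(\<lambda>n. w y - \<epsilon> - \<phi> n y) \<longlonglongrightarrow> w y - \<epsilon> - v y"
          by (intro tendsto_intros tendsto_uniform_limitI[OF \<phi>u y])
        have "(\<lambda>n. s' (w y - \<epsilon> - \<phi> n y)) \<longlonglongrightarrow> s' (w y - \<epsilon> - v y)" by (rule isCont_tendsto_compose[OF s'c l])
        then have "(\<lambda>n. (s' (w y - \<epsilon> - \<phi> n y) - s' (w y - \<epsilon> - v y)) *\<^sub>R (g y - ?G y)) \<longlonglongrightarrow> (s' (w y - \<epsilon> - v y) - s' (w y - \<epsilon> - v y)) *\<^sub>R (g y - ?G y)"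
          by (intro tendsto_intros)
        then show "(\<lambda>n. e n y) \<longlonglongrightarrow> 0" by (cases "y \<in> U") (auto simp: e_def)
      qed
    qed (use h eb in auto)
    show ?thesis unfolding eq
    proof (rule tendsto_sandwich[OF _ _ tendsto_const])
      show "(\<lambda>n. Lp_norm \<Omega> p (a n) + Lp_norm \<Omega> p (e n)) \<longlonglongrightarrow> 0" using tendsto_add[OF a0 e0] by simp
      show "\<forall>\<^sub>F n in sequentially. Lp_norm \<Omega> p (\<lambda>x. a n x + e n x) \<le> Lp_norm \<Omega> p (a n) + Lp_norm \<Omega> p (e n)"
        using Lp_norm_triangle[OF aL eL] h by (intro always_eventually allI) auto
    qed auto
  qed
  note W = W01pI[OF \<psi>nt \<psi>u HL Hlim h(4)]
  define F where "F x = (if x \<in> U then norm (g x) powr (p - 2) *\<^sub>R g x else 0)" for x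
  define L where "L x = (if x \<in> U then quad_plap p A (g x) else 0)" for x
  have FL: "F \<in> borel_measurable (lebesgue_on \<Omega>)" "L \<in> borel_measurable (lebesgue_on \<Omega>)"
  proof -
    show "F \<in> borel_measurable (lebesgue_on \<Omega>)" unfolding F_def by (rule Umm) measurable
    have "(\<lambda>x. A (g x)) \<in> borel_measurable (lebesgue_on \<Omega>)"
      by (rule meas) (auto intro!: continuous_on_compose2[OF sym_op_continuous[OF A, of UNIV] gc])
    note [measurable] = this
    show "L \<in> borel_measurable (lebesgue_on \<Omega>)" unfolding L_def quad_plap_def by (rule Umm) measurable
  qed
  have cc: "continuous_on (cball x0 r) (\<lambda>x. norm (g x) powr t)" for t
    using nz by (intro continuous_on_powr continuous_intros gc) (auto simp: g_def)
  have "compact ((\<lambda>x. norm (g x) powr (p - 2) *\<^sub>R g x) ` cball x0 r)"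
    by (intro compact_continuous_image continuous_intros cc gc compact_cball)
  from compact_imp_bounded[OF this] obtain B1 where "\<forall>y\<in>(\<lambda>x. norm (g x) powr (p - 2) *\<^sub>R g x) ` cball x0 r. norm y \<le> B1"
    unfolding bounded_iff ..
  then have B1: "norm (norm (g x) powr (p - 2) *\<^sub>R g x) \<le> B1" if "x \<in> cball x0 r" for x using that by blast
  have "compact ((\<lambda>x. quad_plap p A (g x)) ` cball x0 r)"
    unfolding quad_plap_def
    by (intro compact_continuous_image continuous_intros cc gc compact_cball continuous_on_compose2[OF sym_op_continuous[OF A, of UNIV] gc]) auto
  from compact_imp_bounded[OF this] obtain B2 where "\<forall>y\<in>(\<lambda>x. quad_plap p A (g x)) ` cball x0 r. norm y \<le> B2"
    unfolding bounded_iff ..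
  then have B2: "norm (quad_plap p A (g x)) \<le> B2" if "x \<in> cball x0 r" for x using that by blast
  have FB: "norm (F y) \<le> max B1 0" for y
    using B1[of y] by (cases "y \<in> U") (simp_all add: F_def U_def le_max_iff_disj del: norm_scaleR)
  have LB: "\<bar>L y\<bar> \<le> max B2 0" for y
    using B2[of y] by (cases "y \<in> U") (simp_all add: L_def U_def le_max_iff_disj)
  have \<psi>c: "continuous_on (closure \<Omega>) \<psi>" by (rule W01p_mem(4)[OF W(1)])
  have \<psi>L: "Lp_mem \<Omega> p \<psi>" and \<psi>nL: "Lp_mem \<Omega> p (\<psi>n n)" for n using W01p_mem(3)[OF W(1)] test_function_Lp(1)[OF \<psi>nt] h by auto
  have \<psi>nlim: "(\<lambda>n. Lp_norm \<Omega> p (\<lambda>x. \<psi>n n x - \<psi> x)) \<longlonglongrightarrow> 0"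
    by (rule Lp_norm_uniform_limit[OF _ \<psi>u]) (use test_function_continuous[OF \<psi>nt] h in auto)
  note t1 = integral_Lp_inner_tendsto[OF tL HL h(4) Hlim FL(1) FB]
  note t2 = integral_Lp_bounded_tendsto[OF \<psi>nL \<psi>L h(4) \<psi>nlim FL(2) LB]
  have "(\<integral>x. grad (\<psi>n n) x \<bullet> F x \<partial>lebesgue_on \<Omega>) = - (\<integral>x. \<psi>n n x * L x \<partial>lebesgue_on \<Omega>)" for n
  proof -
    have "(\<integral>x. grad (\<psi>n n) x \<bullet> F x \<partial>lebesgue_on \<Omega>) = (\<integral>x. norm (b + A (x - x0)) powr (p - 2) * ((b + A (x - x0)) \<bullet> grad (\<psi>n n) x) \<partial>lebesgue_on \<Omega>)"
      by (rule Bochner_Integration.integral_cong) (auto simp: F_def g_def gradn Gn_def inner_commute)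
    also have "\<dots> = - (\<integral>x. quad_plap p A (b + A (x - x0)) * \<psi>n n x \<partial>lebesgue_on \<Omega>)"
      by (rule quad_weak_form[OF A _ _ test_function_smooth[OF \<psi>nt] Tc _ \<psi>nK]) (use U TU nz in \<open>auto simp: U_def\<close>)
    also have "(\<integral>x. quad_plap p A (b + A (x - x0)) * \<psi>n n x \<partial>lebesgue_on \<Omega>) = (\<integral>x. \<psi>n n x * L x \<partial>lebesgue_on \<Omega>)"
      by (rule Bochner_Integration.integral_cong) (auto simp: L_def g_def \<psi>n_def)
    finally show ?thesis .
  qed
  then have e1: "(\<integral>x. H x \<bullet> F x \<partial>lebesgue_on \<Omega>) = - (\<integral>x. \<psi> x * L x \<partial>lebesgue_on \<Omega>)"
    using LIMSEQ_unique[OF t1(1)] tendsto_minus[OF t2(1)] by simp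
  have e2: "(\<integral>x. norm (?G x) powr (p - 2) * (?G x \<bullet> H x) \<partial>lebesgue_on \<Omega>) = (\<integral>x. f x * \<psi> x \<partial>lebesgue_on \<Omega>)"
  proof -
    have "(\<integral>x. norm (?G x) powr (p - 2) * (?G x \<bullet> H x) \<partial>lebesgue_on \<Omega>)
        = (\<integral>x. norm (?G x) powr (p - 2) * (?G x \<bullet> weak_grad \<Omega> \<psi> x) \<partial>lebesgue_on \<Omega>)"
    proof (rule integral_cong_AE)
      have [measurable]: "H \<in> borel_measurable (lebesgue_on \<Omega>)" "weak_grad \<Omega> \<psi> \<in> borel_measurable (lebesgue_on \<Omega>)"
        using HL W01p_mem(2)[OF W(1)] by (auto simp: Lp_mem_def)
      show "(\<lambda>x. norm (?G x) powr (p - 2) * (?G x \<bullet> H x)) \<in> borel_measurable (lebesgue_on \<Omega>)"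
        "(\<lambda>x. norm (?G x) powr (p - 2) * (?G x \<bullet> weak_grad \<Omega> \<psi> x)) \<in> borel_measurable (lebesgue_on \<Omega>)" by measurable
      show "AE x in lebesgue_on \<Omega>. norm (?G x) powr (p - 2) * (?G x \<bullet> H x) = norm (?G x) powr (p - 2) * (?G x \<bullet> weak_grad \<Omega> \<psi> x)"
        using W(2) by eventually_elim simp
    qed
    then show ?thesis using weak[OF W(1)] by simp
  qed
  have i2: "integrable (lebesgue_on \<Omega>) (\<lambda>x. norm (?G x) powr (p - 2) * (?G x \<bullet> H x))"
    by (rule Lp_flux_integrable[OF wg HL h(4)])
  have fi: "integrable (lebesgue_on \<Omega>) (\<lambda>x. \<psi> x * f x)"
  proof -
    have "bounded (f ` closure \<Omega>)" by (rule compact_imp_bounded[OF compact_continuous_image[OF f cO]])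
    then obtain Bf where Bf: "\<And>x. x \<in> closure \<Omega> \<Longrightarrow> \<bar>f x\<bar> \<le> Bf" by (auto simp: bounded_iff)
    show ?thesis
      by (rule integral_Lp_bounded_tendsto(2)[OF \<psi>nL \<psi>L h(4) \<psi>nlim wm(4), of Bf]) (use Bf closure_subset in auto)
  qed
  \<comment> \<open>Monotonicity of the flux, weighted by the nonnegative slope \<open>s'\<close>.
    The two weak formulations then express the same integral through the p-Laplacian of the
    quadratic and the source.\<close>
  have "0 \<le> (\<integral>x. H x \<bullet> F x - norm (?G x) powr (p - 2) * (?G x \<bullet> H x) \<partial>lebesgue_on \<Omega>)"
  proof (rule integral_nonneg_AE, rule AE_I2)
    fix y
    show "0 \<le> H y \<bullet> F y - norm (?G y) powr (p - 2) * (?G y \<bullet> H y)"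
    proof (cases "y \<in> U")
      case True
      have "H y \<bullet> F y - norm (?G y) powr (p - 2) * (?G y \<bullet> H y)
          = s' (w y - \<epsilon> - v y) * ((norm (g y) powr (p - 2) *\<^sub>R g y - norm (?G y) powr (p - 2) *\<^sub>R ?G y) \<bullet> (g y - ?G y))"
        using True by (simp add: H_def F_def inner_diff_left inner_diff_right inner_commute algebra_simps)
      then show ?thesis using p_flux_monotone[OF h(4), of "g y" "?G y"] s'b by simp
    qed (simp add: H_def F_def)
  qed
  also have "\<dots> = - (\<integral>x. \<psi> x * L x \<partial>lebesgue_on \<Omega>) - (\<integral>x. f x * \<psi> x \<partial>lebesgue_on \<Omega>)"
    using t1(2) i2 e1 e2 by simp
  also have "\<dots> = - (\<integral>x. (L x + f x) * \<psi> x \<partial>lebesgue_on \<Omega>)"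
    using t2(2) fi by (simp add: algebra_simps)
  finally have le0: "(\<integral>x. (L x + f x) * \<psi> x \<partial>lebesgue_on \<Omega>) \<le> 0" by simp
  have ge: "(L y + f y) * \<psi> y \<ge> 0" for y
    using sub[of y] spos(2) by (auto simp: \<psi>_def L_def g_def U_def intro!: mult_nonneg_nonneg)
  have int: "integrable (lebesgue_on \<Omega>) (\<lambda>x. (L x + f x) * \<psi> x)"
    using t2(2) fi by (simp add: algebra_simps)
  have "(\<integral>x. (L x + f x) * \<psi> x \<partial>lebesgue_on \<Omega>) = 0"
  proof (rule antisym[OF le0])
    show "0 \<le> (\<integral>x. (L x + f x) * \<psi> x \<partial>lebesgue_on \<Omega>)" by (rule integral_nonneg_AE, rule AE_I2, rule ge)
  qed
  then have "AE x in lebesgue_on \<Omega>. (L x + f x) * \<psi> x = 0"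
    using integral_nonneg_eq_0_iff_AE[OF int] ge by auto
  \<comment> \<open>The strict inequality \<open>sub\<close> makes the weight \<open>L + f\<close>
    positive on the ball, so the truncation itself has to vanish.\<close>
  then have "AE x in lebesgue_on \<Omega>. \<psi> x = 0"
  proof eventually_elim
    case (elim y)
    have "L y + f y > 0" if "y \<in> U" using sub[of y] that by (simp add: L_def g_def U_def)
    then show ?case using elim by (cases "y \<in> U") (auto simp: \<psi>_def)
  qed
  moreover have xU: "x \<in> U" using x by (simp add: U_def)
  ultimately have "\<psi> x = 0"
    using AE_zero_continuous[of \<psi> x] continuous_on_subset[OF \<psi>c closure_subset] U by blast
  moreover have "w x - \<epsilon> - v x > 0" using \<epsilon> by (simp add: \<epsilon>_def field_simps)
  ultimately show False using spos(1)[of "w x - \<epsilon> - v x"] xU by (simp add: \<psi>_def)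
qed

end

section \<open>Least energy solutions\<close>

lemma quad_plap_pos:
  assumes "trace_op A > 0" "g \<bullet> A g > 0" "p \<ge> 2" "g \<noteq> 0"
  shows "quad_plap p A g > 0"
  unfolding quad_plap_def using assms by (intro add_pos_nonneg mult_pos_pos mult_nonneg_nonneg) auto

text \<open>An isotropic Hessian with extra curvature along one direction. Hopf's argument and the
  kink of the distance function both use this shape.\<close>

lemma sym_op_rank_one:
  fixes e :: "'a::euclidean_space"
  shows "sym_op (\<lambda>h. (k * (e \<bullet> h)) *\<^sub>R e - l *\<^sub>R h)"
proof -
  have "linear (\<lambda>h. (k * (e \<bullet> h)) *\<^sub>R e - l *\<^sub>R h)"
    by (rule linearI) (auto simp: inner_add_right algebra_simps)
  then show ?thesis by (auto simp: sym_op_def inner_diff_left inner_diff_right inner_commute)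
qed

lemma trace_op_rank_one:
  fixes e :: "'a::euclidean_space"
  shows "trace_op (\<lambda>h. (k * (e \<bullet> h)) *\<^sub>R e - l *\<^sub>R h) = k * (e \<bullet> e) - l * real DIM('a)"
proof -
  have "trace_op (\<lambda>h. (k * (e \<bullet> h)) *\<^sub>R e - l *\<^sub>R h) = (\<Sum>i\<in>Basis. k * ((e \<bullet> i) * (e \<bullet> i))) - (\<Sum>i\<in>(Basis::'a set). l)"
    by (simp add: trace_op_def inner_diff_left sum_subtractf mult.assoc)
  also have "(\<Sum>i\<in>Basis. k * ((e \<bullet> i) * (e \<bullet> i))) = k * (e \<bullet> e)"
    by (simp add: euclidean_inner[of e e] sum_distrib_left)
  finally show ?thesis by simp
qed

context bdd_domain
begin

text \<open>Hopf's argument: the quadratic lies below a small multiple of \<open>u\<close> on a small sphere around a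
  point where the zero set is touched from outside by a ball, but is positive at the centre.\<close>

lemma strong_maximum_principle:
  assumes conn: "connected \<Omega>" and u: "u \<in> W01p \<Omega> p" and p: "p \<ge> 2 * real DIM('a)"
    and weak: "\<And>\<phi>. \<phi> \<in> W01p \<Omega> p \<Longrightarrow>
      (\<integral>x. norm (weak_grad \<Omega> u x) powr (p - 2) * (weak_grad \<Omega> u x \<bullet> weak_grad \<Omega> \<phi> x) \<partial>lebesgue_on \<Omega>)
        = (\<integral>x. f x * \<phi> x \<partial>lebesgue_on \<Omega>)"
    and f: "continuous_on (closure \<Omega>) f" "\<And>x. x \<in> \<Omega> \<Longrightarrow> f x \<ge> 0"
    and u0: "\<And>x. x \<in> closure \<Omega> \<Longrightarrow> u x \<ge> 0" and nz: "\<exists>x\<in>\<Omega>. u x \<noteq> 0" and x: "x \<in> \<Omega>"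
  shows "u x > 0"
proof (rule ccontr)
  assume "\<not> u x > 0"
  then have ux: "u x = 0" using u0[of x] x closure_subset by force
  have p2: "p \<ge> 2" using p DIM_positive[where 'a = 'a] by (simp add: order_trans[of 2 "2 * real DIM('a)" p] Suc_leI)
  have uc: "continuous_on (closure \<Omega>) u" by (rule W01p_mem(4)[OF u])
  have uO: "continuous_on \<Omega> u" using uc closure_subset continuous_on_subset by blast
  define Q where "Q = {y \<in> \<Omega>. u y > 0}"
  define Z where "Z = {y \<in> \<Omega>. u y = 0}"
  have QZ: "Q \<union> Z = \<Omega>" "Q \<inter> Z = {}" using u0 closure_subset by (force simp: Q_def Z_def less_le)+
  have Qo: "open Q"
  proof -
    have "Q = u -` {0<..} \<inter> \<Omega>" by (auto simp: Q_def)
    then show ?thesis using continuous_on_open_vimage[OF open_dom] uO by (metis open_greaterThan)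
  qed
  \<comment> \<open>Otherwise the zero set would be open as well and would disconnect the domain
    from \<open>Q\<close>.\<close>
  have "\<exists>z\<in>Z. z \<in> closure Q"
  proof (rule ccontr)
    assume c: "\<not> (\<exists>z\<in>Z. z \<in> closure Q)"
    then have "Z = \<Omega> \<inter> - closure Q" using QZ closure_subset[of Q] by blast
    then have "open Z" using open_dom by (simp add: open_Int open_Compl)
    moreover have "Z \<noteq> {}" using x ux by (auto simp: Z_def)
    moreover have "Q \<noteq> {}"
    proof -
      obtain y where "y \<in> \<Omega>" "u y \<noteq> 0" using nz by blast
      then have "y \<in> Q" using u0[of y] closure_subset by (force simp: Q_def)
      then show ?thesis by blast
    qed
    ultimately show False using connectedD[OF conn Qo, of Z] QZ by blast
  qed
  then obtain z where z: "z \<in> Z" "z \<in> closure Q" by blast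
  \<comment> \<open>A point \<open>y\<close> of positivity within \<open>d\<close> of
    \<open>z\<close> has a zero nearer than \<open>d\<close>, so the ball touching the zero set
    stays inside \<open>cball y d\<close> and hence in the domain.\<close>
  then obtain d where d: "d > 0" "ball z (2 * d) \<subseteq> \<Omega>"
    using open_dom open_contains_ball[of \<Omega>] unfolding Z_def
    by (metis (no_types, lifting) mem_Collect_eq mult_pos_pos half_gt_zero field_sum_of_halves mult_2)
  obtain y where y: "y \<in> Q" "dist y z < d" using closure_approachable z(2) d(1) by blast
  have cyd: "cball y d \<subseteq> \<Omega>"
  proof
    fix t assume "t \<in> cball y d"
    then have "dist z t < 2 * d" using y(2) dist_triangle[of z t y] by (auto simp: dist_commute)
    then show "t \<in> \<Omega>" using d by auto
  qed
  define Z' where "Z' = {t \<in> cball y d. u t \<le> 0}"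
  have "closed Z'" unfolding Z'_def
    by (rule continuous_on_closed_Collect_le) (use continuous_on_subset[OF uO cyd] in \<open>auto intro: continuous_intros\<close>)
  moreover have "bounded Z'" by (rule bounded_subset[OF bounded_cball[of y d]]) (auto simp: Z'_def)
  ultimately have Zc: "compact Z'" by (simp add: compact_eq_bounded_closed)
  have zZ: "z \<in> Z'" using z y by (auto simp: Z'_def Z_def)
  obtain x1 where x1: "x1 \<in> Z'" "\<And>t. t \<in> Z' \<Longrightarrow> dist y x1 \<le> dist y t"
    using distance_attains_inf[of Z' y] compact_imp_closed[OF Zc] zZ by blast
  define \<rho> where "\<rho> = dist y x1"
  have \<rho>d: "\<rho> < d" using x1(2)[OF zZ] y(2) by (simp add: \<rho>_def)
  have x1u: "u x1 \<le> 0" "x1 \<in> \<Omega>" using x1(1) cyd by (auto simp: Z'_def)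
  have \<rho>: "\<rho> > 0" using y(1) x1u by (auto simp: \<rho>_def Q_def)
  have ballpos: "u t > 0" if "dist y t < \<rho>" for t
  proof (rule ccontr)
    assume "\<not> u t > 0"
    then have "t \<in> Z'" using that \<rho>d by (auto simp: Z'_def)
    then show False using x1(2) that by (force simp: \<rho>_def)
  qed
  define e where "e = (y - x1) /\<^sub>R \<rho>"
  have e1: "norm e = 1" using \<rho> by (simp add: e_def \<rho>_def dist_norm)
  then have ee: "e \<bullet> e = 1" by (simp add: dot_square_norm)
  \<comment> \<open>The choice \<open>C = 1 / \<rho>\<close> makes the downward bending
    \<open>C * r\<^sup>2\<close> twice the largest gain \<open>r\<^sup>2 / (2 * \<rho>)\<close> of
    the linear term outside the touching ball. The choice of \<open>K\<close> gives trace 2 and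
    positive curvature \<open>2 * (K - C)\<close> along \<open>e\<close>, hence a positive
    p-Laplacian.\<close>
  define C where "C = 1 / \<rho>"
  have C: "C > 0" using \<rho> by (simp add: C_def)
  define K where "K = C * real DIM('a) + 1"
  have K: "K > C" "K > 0" using C by (auto simp: K_def Suc_leI intro: add_pos_pos order_le_less_trans[of C "C * real DIM('a)"])
  define A where "A h = (2 * K * (e \<bullet> h)) *\<^sub>R e - (2 * C) *\<^sub>R h" for h
  have A: "sym_op A" unfolding A_def[abs_def] by (rule sym_op_rank_one)
  have trA: "trace_op A > 0" unfolding A_def[abs_def] trace_op_rank_one ee by (simp add: K_def)
  define G where "G h = (e + A h) \<bullet> A (e + A h)" for h
  have "continuous_on UNIV G"
    unfolding G_def by (intro continuous_intros continuous_on_compose2[OF sym_op_continuous[OF A, of UNIV]] sym_op_continuous[OF A]) auto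
  moreover have "G 0 > 0"
  proof -
    have "G 0 = 2 * K - 2 * C"
      unfolding G_def linear_0[OF sym_opD(1)[OF A]] by (simp add: A_def inner_diff_right ee)
    then show ?thesis using K by simp
  qed
  ultimately obtain r0 where r0: "r0 > 0" "\<And>h. norm h < r0 \<Longrightarrow> G h > 0"
  proof -
    assume Gc: "continuous_on UNIV G" and G0: "G 0 > 0"
      and *: "\<And>r0. \<lbrakk>r0 > 0; \<And>h. norm h < r0 \<Longrightarrow> G h > 0\<rbrakk> \<Longrightarrow> thesis"
    have op: "open (G -` {0<..})" using Gc by (rule open_vimage[OF open_greaterThan])
    have z: "0 \<in> G -` {0<..}" using G0 by simp
    obtain r0 where r0: "r0 > 0" "ball 0 r0 \<subseteq> G -` {0<..}" using openE[OF op z] by metis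
    show thesis
    proof (rule *[OF r0(1)])
      fix h :: 'a assume "norm h < r0"
      then have "h \<in> ball 0 r0" by simp
      then show "G h > 0" using r0(2) by blast
    qed
  qed
  obtain r1 where r1: "r1 > 0" "cball x1 r1 \<subseteq> \<Omega>" using open_dom x1u(2) open_contains_cball by blast
  \<comment> \<open>The bounds involving \<open>K\<close> let the upward bending be absorbed:
    \<open>1 / (2 * K)\<close> serves points with negative component along \<open>e\<close>, the
    square root those with a positive one. Below \<open>r0\<close> the infinity Laplacian of the
    quadratic stays positive, and \<open>r1\<close> keeps the ball in the domain.\<close>
  define r where "r = min (min (r0 / 2) r1) (min (1 / (2 * K)) (min (sqrt (\<rho> / (2 * K))) 1))"
  have r: "r > 0" "r < r0" "r \<le> r1" "r \<le> 1 / (2 * K)" "r \<le> sqrt (\<rho> / (2 * K))"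
    using r0 r1 K \<rho> by (auto simp: r_def)
  have r2: "K * r \<le> 1 / 2" "K * r\<^sup>2 \<le> \<rho> / 2"
  proof -
    show "K * r \<le> 1 / 2" using mult_left_mono[OF r(4), of K] K by simp
    have "r\<^sup>2 \<le> (sqrt (\<rho> / (2 * K)))\<^sup>2" using r by (intro power_mono) auto
    then have "r\<^sup>2 \<le> \<rho> / (2 * K)" using \<rho> K by simp
    then show "K * r\<^sup>2 \<le> \<rho> / 2" using mult_left_mono[of "r\<^sup>2" "\<rho> / (2 * K)" K] K by simp
  qed
  \<comment> \<open>In units of \<open>X = r\<^sup>2 / \<rho>\<close>, the other terms of
    \<open>P\<close> on the sphere outside the touching ball add up to at most
    \<open>1/2 + 1/8 - 1\<close>, so a height of 1/8 still leaves \<open>P\<close> negative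
    there.\<close>
  define \<tau> where "\<tau> = r\<^sup>2 / (8 * \<rho>)"
  have \<tau>: "\<tau> > 0" using r \<rho> by (simp add: \<tau>_def)
  define P where "P t = quad \<tau> e A x1 t" for t
  have Pf: "P t = \<tau> + e \<bullet> (t - x1) + K * (e \<bullet> (t - x1))\<^sup>2 - C * (norm (t - x1))\<^sup>2" for t
  proof -
    have "(h \<bullet> A h) / 2 = K * (e \<bullet> h)\<^sup>2 - C * (norm h)\<^sup>2" for h
      unfolding A_def by (simp add: inner_diff_right dot_square_norm power2_eq_square inner_commute)
    then show ?thesis by (simp add: P_def quad_def)
  qed
  have out: "P t < 0" if t: "t \<in> sphere x1 r" and far: "dist y t \<ge> \<rho>" for t
  proof -
    define a where "a = e \<bullet> (t - x1)"
    have nr: "norm (t - x1) = r" using t by (simp add: dist_norm norm_minus_commute)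
    have ye: "y - x1 = \<rho> *\<^sub>R e" using \<rho> by (simp add: e_def)
    have "\<rho>\<^sup>2 \<le> (norm ((t - x1) - \<rho> *\<^sub>R e))\<^sup>2"
      using far \<rho> ye by (intro power_mono) (auto simp: dist_norm norm_minus_commute algebra_simps)
    also have "\<dots> = r\<^sup>2 - 2 * \<rho> * a + \<rho>\<^sup>2"
    proof -
      have "(norm (k - \<rho> *\<^sub>R e))\<^sup>2 = (norm k)\<^sup>2 - 2 * \<rho> * (e \<bullet> k) + \<rho>\<^sup>2" for k
        using ee by (simp add: power2_norm_eq_inner inner_diff_left inner_diff_right inner_commute power2_eq_square[of \<rho>])
      then show ?thesis by (simp add: nr a_def)
    qed
    finally have a1: "a \<le> r\<^sup>2 / (2 * \<rho>)" using \<rho> by (simp add: field_simps)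
    have a2: "\<bar>a\<bar> \<le> r" unfolding a_def using Cauchy_Schwarz_ineq2[of e "t - x1"] e1 nr by simp
    define X where "X = r\<^sup>2 / \<rho>"
    have Pa: "P t = \<tau> + a + K * a\<^sup>2 - X" by (simp add: Pf a_def nr C_def X_def)
    have X: "X > 0" "\<tau> = X / 8" "a \<le> X / 2" using r \<rho> a1 by (auto simp: X_def \<tau>_def)
    show ?thesis
    proof (cases "a \<le> 0")
      case True
      have "K * a\<^sup>2 \<le> - a"
      proof -
        have "K * \<bar>a\<bar> \<le> 1" using mult_left_mono[OF a2, of K] K r2 by linarith
        then have "(K * \<bar>a\<bar>) * \<bar>a\<bar> \<le> 1 * \<bar>a\<bar>" by (intro mult_right_mono) auto
        then show ?thesis using True by (simp add: power2_eq_square mult.assoc)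
      qed
      then show ?thesis unfolding Pa using X(1,2) by linarith
    next
      case False
      have "K * a\<^sup>2 \<le> a / 4"
      proof -
        have "K * a \<le> K * (r\<^sup>2 / (2 * \<rho>))" using a1 K by (intro mult_left_mono) auto
        also have "\<dots> \<le> 1 / 4" using r2(2) \<rho> by (simp add: field_simps)
        finally have "(K * a) * a \<le> (1 / 4) * a" using False by (intro mult_right_mono) auto
        then show ?thesis by (simp add: power2_eq_square mult.assoc)
      qed
      then show ?thesis unfolding Pa using X by linarith
    qed
  qed
  have Pc: "continuous_on S P" for S
    unfolding P_def using smooth_on_continuous[OF smooth_on_quad[OF A]] by blast
  have sphO: "sphere x1 r \<subseteq> \<Omega>" "cball x1 r \<subseteq> \<Omega>" using r1 r by auto
  have us: "u t \<ge> 0" if "t \<in> sphere x1 r" for t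
    using u0[of t] that sphO(1) closure_subset[of \<Omega>] by blast
  define S where "S = {t \<in> sphere x1 r. 0 \<le> P t}"
  \<comment> \<open>Where \<open>P\<close> is nonnegative the sphere lies in the open touching ball,
    so \<open>u\<close> has a positive minimum on that compact part; elsewhere \<open>m * P\<close>
    is negative and \<open>u\<close> is not.\<close>
  have "\<exists>m>0. \<forall>t\<in>sphere x1 r. m * P t \<le> u t"
  proof (cases "S = {}")
    case True
    have "1 * P t \<le> u t" if "t \<in> sphere x1 r" for t
    proof -
      have "t \<notin> S" using True by blast
      then have "P t < 0" using that by (simp add: S_def)
      then show ?thesis using us[OF that] by simp
    qed
    then show ?thesis by (intro exI[of _ 1]) auto
  next
    case False
    have "closed S" unfolding S_def
      by (rule continuous_on_closed_Collect_le) (auto intro: continuous_intros Pc)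
    moreover have "bounded S" by (rule bounded_subset[OF bounded_cball[of x1 r]]) (auto simp: S_def)
    ultimately have Sc: "compact S" by (simp add: compact_eq_bounded_closed)
    have SO: "S \<subseteq> \<Omega>" using sphO by (auto simp: S_def)
    obtain t1 where t1: "t1 \<in> S" "\<And>t. t \<in> S \<Longrightarrow> P t \<le> P t1" using continuous_attains_sup[OF Sc False Pc] by blast
    have near: "dist y t < \<rho>" if "t \<in> S" for t
      by (rule ccontr) (use out[of t] that in \<open>auto simp: S_def\<close>)
    obtain t2 where t2: "t2 \<in> S" "\<And>t. t \<in> S \<Longrightarrow> u t2 \<le> u t"
      using continuous_attains_inf[OF Sc False continuous_on_subset[OF uO SO]] by blast
    have u2: "u t2 > 0" using ballpos[OF near[OF t2(1)]] .
    have P1: "P t1 \<ge> 0" using t1(1) by (simp add: S_def)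
    define m where "m = u t2 / (P t1 + 1)"
    have m: "m > 0" using u2 P1 by (simp add: m_def)
    have "m * P t \<le> u t" if t: "t \<in> sphere x1 r" for t
    proof (cases "t \<in> S")
      case True
      have "m * P t \<le> m * (P t1 + 1)" using t1(2)[OF True] m by (intro mult_left_mono) auto
      also have "\<dots> = u t2" using P1 by (simp add: m_def)
      finally show ?thesis using t2(2)[OF True] by simp
    next
      case False
      then have "m * P t \<le> 0" using t m by (simp add: S_def mult_nonneg_nonpos)
      then show ?thesis using us[OF t] by simp
    qed
    then show ?thesis using m by blast
  qed
  then obtain m where m: "m > 0" "\<And>t. t \<in> sphere x1 r \<Longrightarrow> m * P t \<le> u t" by blast
  define B where "B h = m *\<^sub>R A h" for h
  have B: "sym_op B" using A unfolding B_def[abs_def] sym_op_def by (auto intro: linear_compose_scale_right)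
  have trB: "trace_op B = m * trace_op A" by (simp add: trace_op_def B_def sum_distrib_left)
  have quadB: "quad (m * \<tau>) (m *\<^sub>R e) B x1 t = m * P t" for t
    by (simp add: quad_def P_def B_def algebra_simps)
  have gB: "m *\<^sub>R e + B h = m *\<^sub>R (e + A h)" for h by (simp add: B_def scaleR_add_right)
  have GB: "(m *\<^sub>R e + B h) \<bullet> B (m *\<^sub>R e + B h) = m ^ 3 * G h" for h
    unfolding gB by (simp add: B_def G_def linear_cmul[OF sym_opD(1)[OF A]] power3_eq_cube)
  have Gpos: "G (t - x1) > 0" if "t \<in> cball x1 r" for t
    using that r by (intro r0(2)) (simp add: dist_norm norm_minus_commute)
  have gnz: "m *\<^sub>R e + B (t - x1) \<noteq> 0" if "t \<in> cball x1 r" for t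
    using Gpos[OF that] m by (auto simp: gB G_def)
  have "quad (m * \<tau>) (m *\<^sub>R e) B x1 x1 \<le> u x1"
  proof (rule quad_comparison[OF u p weak f(1) B r(1) sphO(2) gnz])
    fix t assume t: "t \<in> ball x1 r"
    then have tc: "t \<in> cball x1 r" by simp
    have "quad_plap p B (m *\<^sub>R e + B (t - x1)) > 0"
      using trA Gpos[OF tc] m p2 gnz[OF tc] by (intro quad_plap_pos) (auto simp: trB GB)
    moreover have "f t \<ge> 0" using tc sphO by (intro f(2)) auto
    ultimately show "- quad_plap p B (m *\<^sub>R e + B (t - x1)) < f t" by linarith
  qed (use m(2) quadB r in auto)
  then have "m * P x1 \<le> 0" unfolding quadB using x1u by simp
  moreover have "P x1 = \<tau>" by (simp add: Pf)
  ultimately show False using m \<tau> by (simp add: mult_le_0_iff)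
qed

text \<open>A rescaled minimiser of the Rayleigh quotient is a competitor for the least energy.\<close>

definition nehari_scale :: "real \<Rightarrow> real \<Rightarrow> real \<Rightarrow> real" where
  "nehari_scale p q \<mu> = (rayleigh p q powr p / \<mu>) powr (1 / (q - p))"

lemma continuous_on_signed_powr:
  fixes u :: "'a \<Rightarrow> real"
  assumes "continuous_on S u" "\<And>x. x \<in> S \<Longrightarrow> u x \<ge> 0" "q > 1"
  shows "continuous_on S (\<lambda>x. \<bar>u x\<bar> powr (q - 2) * u x)"
proof -
  have "continuous_on S (\<lambda>x. u x powr (q - 1))"
    using assms by (intro continuous_on_powr' continuous_on_const) auto
  moreover have "u x powr (q - 1) = \<bar>u x\<bar> powr (q - 2) * u x" if "x \<in> S" for x
    using assms(2)[OF that] by (cases "u x = 0") (auto simp: powr_diff power2_eq_square)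
  ultimately show ?thesis by (rule continuous_on_eq)
qed

text \<open>The factor \<open>s\<close> solves
  \<open>\<mu> * s powr (q - p) = \<Lambda> powr p\<close>, which converts the coefficient of the
  Euler-Lagrange equation into \<open>\<mu>\<close>. The strong maximum principle makes the result
  admissible as a competitor.\<close>

lemma exists_low_energy_solution:
  assumes conn: "connected \<Omega>" and p: "p \<ge> 2 * real DIM('a)" and q: "q > p" and \<mu>: "\<mu> > 0"
  shows "\<exists>w. positive_weak_solution \<Omega> p q \<mu> w \<and>
    Lp_norm \<Omega> p (weak_grad \<Omega> w) = nehari_scale p q \<mu> * rayleigh p q"
proof -
  note h = half_bound[OF p]
  have q1: "q > 1" using q h by simp
  define \<Lambda> where "\<Lambda> = rayleigh p q"
  have \<Lambda>: "\<Lambda> > 0" unfolding \<Lambda>_def by (rule rayleigh_pos[OF p q1])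
  obtain u where u: "u \<in> W01p \<Omega> p" "\<And>x. x \<in> closure \<Omega> \<Longrightarrow> u x \<ge> 0" "Lp_norm \<Omega> q u = 1"
    "Lp_norm \<Omega> p (weak_grad \<Omega> u) = rayleigh p q"
    using minimizer_exists[OF p q1] by blast
  note EL = Euler_Lagrange[OF p q1 u(1,3,4)]
  define s where "s = nehari_scale p q \<mu>"
  have s: "s > 0" using \<Lambda> \<mu> by (simp add: s_def nehari_scale_def \<Lambda>_def)
  have sq: "\<mu> * s powr (q - 1) = s powr (p - 1) * \<Lambda> powr p"
  proof -
    have "s powr (q - p) = \<Lambda> powr p / \<mu>"
      using q \<Lambda> \<mu> by (simp add: s_def nehari_scale_def powr_powr \<Lambda>_def)
    moreover have "s powr (q - 1) = s powr (p - 1) * s powr (q - p)" by (simp flip: powr_add)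
    ultimately show ?thesis using \<mu> by simp
  qed
  have uc: "continuous_on (closure \<Omega>) u" by (rule W01p_mem(4)[OF u(1)])
  have upos: "u x > 0" if x: "x \<in> \<Omega>" for x
  proof (rule strong_maximum_principle[OF conn u(1) p, where f = "\<lambda>x. \<Lambda> powr p * (\<bar>u x\<bar> powr (q - 2) * u x)"])
    fix \<phi> assume "\<phi> \<in> W01p \<Omega> p"
    from EL[OF this] show "(\<integral>x. norm (weak_grad \<Omega> u x) powr (p - 2) * (weak_grad \<Omega> u x \<bullet> weak_grad \<Omega> \<phi> x) \<partial>lebesgue_on \<Omega>)
        = (\<integral>x. \<Lambda> powr p * (\<bar>u x\<bar> powr (q - 2) * u x) * \<phi> x \<partial>lebesgue_on \<Omega>)"
      by (simp add: \<Lambda>_def mult.assoc)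
  next
    show "\<exists>x\<in>\<Omega>. u x \<noteq> 0"
    proof (rule ccontr)
      assume "\<not> (\<exists>x\<in>\<Omega>. u x \<noteq> 0)"
      then have "Lp_norm \<Omega> q u \<le> measure lebesgue \<Omega> powr (1 / q) * 0"
        using Lp_mem_continuous[OF uc, of q] q1 by (intro Lp_norm_le_sup) (auto simp: Lp_mem_def)
      then show False using u(3) by simp
    qed
    show "continuous_on (closure \<Omega>) (\<lambda>x. \<Lambda> powr p * (\<bar>u x\<bar> powr (q - 2) * u x))"
      by (intro continuous_on_mult_left continuous_on_signed_powr uc q1 u(2))
    show "0 \<le> \<Lambda> powr p * (\<bar>u x\<bar> powr (q - 2) * u x)" if "x \<in> \<Omega>" for x
    proof -
      have "u x \<ge> 0" using u(2)[of x] that closure_subset[of \<Omega>] by blast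
      then show ?thesis by simp
    qed
  qed (use u x in auto)
  \<comment> \<open>The zero summand gives the multiple of \<open>u\<close> the shape expected by
    \<open>W01p_add_cmult\<close>.\<close>
  define w where "w x = s * u x + 0 * u x" for x
  note W = W01p_add_cmult[OF u(1) u(1) h(3), of s 0, folded w_def]
  have Wm: "w \<in> W01p \<Omega> p" using W(1) by (simp add: w_def[abs_def])
  have wae: "AE x in lebesgue_on \<Omega>. weak_grad \<Omega> w x = s *\<^sub>R weak_grad \<Omega> u x"
    using W(2) unfolding w_def[abs_def] by eventually_elim simp
  have [measurable]: "weak_grad \<Omega> w \<in> borel_measurable (lebesgue_on \<Omega>)" "weak_grad \<Omega> u \<in> borel_measurable (lebesgue_on \<Omega>)"
    using W01p_mem(2)[OF Wm] W01p_mem(2)[OF u(1)] by (auto simp: Lp_mem_def)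
  have "weak_solution \<Omega> p q \<mu> w"
    unfolding weak_solution_def
  proof (intro conjI ballI Wm)
    fix \<phi> assume \<phi>: "\<phi> \<in> W01p \<Omega> p"
    have [measurable]: "weak_grad \<Omega> \<phi> \<in> borel_measurable (lebesgue_on \<Omega>)"
      using W01p_mem(2)[OF \<phi>] by (auto simp: Lp_mem_def)
    have "(\<integral>x. norm (weak_grad \<Omega> w x) powr (p - 2) * (weak_grad \<Omega> w x \<bullet> weak_grad \<Omega> \<phi> x) \<partial>lebesgue_on \<Omega>)
      = (\<integral>x. s powr (p - 1) * (norm (weak_grad \<Omega> u x) powr (p - 2) * (weak_grad \<Omega> u x \<bullet> weak_grad \<Omega> \<phi> x)) \<partial>lebesgue_on \<Omega>)"
    proof (rule integral_cong_AE)
      show "AE x in lebesgue_on \<Omega>. norm (weak_grad \<Omega> w x) powr (p - 2) * (weak_grad \<Omega> w x \<bullet> weak_grad \<Omega> \<phi> x)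
        = s powr (p - 1) * (norm (weak_grad \<Omega> u x) powr (p - 2) * (weak_grad \<Omega> u x \<bullet> weak_grad \<Omega> \<phi> x))"
        using wae
      proof eventually_elim
        case (elim x)
        have "s powr (p - 1) = s powr (p - 2) * s" using s by (simp add: powr_diff power2_eq_square)
        then show ?case using s unfolding elim by (simp add: powr_mult)
      qed
    qed measurable
    also have "\<dots> = s powr (p - 1) * (\<Lambda> powr p * (\<integral>x. \<bar>u x\<bar> powr (q - 2) * u x * \<phi> x \<partial>lebesgue_on \<Omega>))"
      using EL[OF \<phi>] by (simp add: \<Lambda>_def)
    also have "\<dots> = \<mu> * (s powr (q - 1) * (\<integral>x. \<bar>u x\<bar> powr (q - 2) * u x * \<phi> x \<partial>lebesgue_on \<Omega>))"
      using sq by (simp add: mult.assoc[symmetric])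
    also have "s powr (q - 1) * (\<integral>x. \<bar>u x\<bar> powr (q - 2) * u x * \<phi> x \<partial>lebesgue_on \<Omega>)
        = (\<integral>x. \<bar>w x\<bar> powr (q - 2) * w x * \<phi> x \<partial>lebesgue_on \<Omega>)"
    proof -
      have "s powr (q - 1) = s powr (q - 2) * s" using s by (simp add: powr_diff power2_eq_square)
      then have "\<bar>w x\<bar> powr (q - 2) * w x * \<phi> x = s powr (q - 1) * (\<bar>u x\<bar> powr (q - 2) * u x * \<phi> x)" for x
        using s by (simp add: w_def abs_mult powr_mult)
      then have "(\<integral>x. \<bar>w x\<bar> powr (q - 2) * w x * \<phi> x \<partial>lebesgue_on \<Omega>)
          = (\<integral>x. s powr (q - 1) * (\<bar>u x\<bar> powr (q - 2) * u x * \<phi> x) \<partial>lebesgue_on \<Omega>)" by presburger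
      then show ?thesis by simp
    qed
    finally show "(\<integral>x. norm (weak_grad \<Omega> w x) powr (p - 2) * (weak_grad \<Omega> w x \<bullet> weak_grad \<Omega> \<phi> x) \<partial>lebesgue_on \<Omega>)
      = \<mu> * (\<integral>x. \<bar>w x\<bar> powr (q - 2) * w x * \<phi> x \<partial>lebesgue_on \<Omega>)" .
  qed
  then have "positive_weak_solution \<Omega> p q \<mu> w"
    using upos s by (simp add: positive_weak_solution_def w_def)
  moreover have "Lp_norm \<Omega> p (weak_grad \<Omega> w) = s * \<Lambda>"
  proof -
    have "Lp_norm \<Omega> p (weak_grad \<Omega> w) = Lp_norm \<Omega> p (\<lambda>x. s *\<^sub>R weak_grad \<Omega> u x)"
      by (rule Lp_norm_cong_AE) (use wae in \<open>measurable, eventually_elim, simp\<close>)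
    then show ?thesis using s h u(4) Lp_norm_scale[of p \<Omega> s "weak_grad \<Omega> u"] by (simp add: \<Lambda>_def)
  qed
  ultimately show ?thesis by (auto simp: s_def \<Lambda>_def)
qed

text \<open>Testing the equation with \<open>v\<close> itself gives the identity that defines the
  Nehari manifold, and the energy becomes a function of the gradient norm alone.\<close>

lemma weak_solution_energy:
  assumes v: "weak_solution \<Omega> p q \<mu> v" and p: "p > 0" and q: "q > 0"
  shows "energy \<Omega> p q \<mu> v = (1 / p - 1 / q) * Lp_norm \<Omega> p (weak_grad \<Omega> v) powr p"
proof -
  have "(\<integral>x. norm (weak_grad \<Omega> v x) powr (p - 2) * (weak_grad \<Omega> v x \<bullet> weak_grad \<Omega> v x) \<partial>lebesgue_on \<Omega>)
        = \<mu> * (\<integral>x. \<bar>v x\<bar> powr (q - 2) * v x * v x \<partial>lebesgue_on \<Omega>)"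
    using v by (auto simp: weak_solution_def)
  moreover have "norm a powr (p - 2) * (a \<bullet> a) = norm a powr p" for a :: 'a
    by (cases "a = 0") (auto simp: powr_diff power2_norm_eq_inner[symmetric])
  moreover have "\<bar>a\<bar> powr (q - 2) * a * a = norm a powr q" for a :: real
    by (cases "a = 0") (auto simp: powr_diff power2_eq_square mult.assoc)
  ultimately have "Lp_norm \<Omega> p (weak_grad \<Omega> v) powr p = \<mu> * Lp_norm \<Omega> q v powr q"
    using p q by (simp add: Lp_norm_powr)
  then show ?thesis by (simp add: energy_def algebra_simps)
qed

text \<open>For \<open>p < q\<close> the factor \<open>1 / p - 1 / q\<close> is positive, so among
  weak solutions lower energy means smaller gradient norm.\<close>

lemma least_energy_gradient_bound:
  assumes conn: "connected \<Omega>" and p: "p \<ge> 2 * real DIM('a)" and q: "q > p" and \<mu>: "\<mu> > 0"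
    and v: "positive_least_energy_solution \<Omega> p q \<mu> v"
  shows "Lp_norm \<Omega> p (weak_grad \<Omega> v) \<le> nehari_scale p q \<mu> * rayleigh p q"
proof -
  note h = half_bound[OF p]
  obtain w where w: "positive_weak_solution \<Omega> p q \<mu> w"
    "Lp_norm \<Omega> p (weak_grad \<Omega> w) = nehari_scale p q \<mu> * rayleigh p q"
    using exists_low_energy_solution[OF conn p q \<mu>] by blast
  have "energy \<Omega> p q \<mu> v \<le> energy \<Omega> p q \<mu> w" using v w(1) by (simp add: positive_least_energy_solution_def)
  then have "(1 / p - 1 / q) * Lp_norm \<Omega> p (weak_grad \<Omega> v) powr p \<le> (1 / p - 1 / q) * Lp_norm \<Omega> p (weak_grad \<Omega> w) powr p"
    using v w(1) h q by (simp add: positive_least_energy_solution_def positive_weak_solution_def weak_solution_energy)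
  moreover have "1 / p - 1 / q > 0" using h q by (simp add: divide_strict_left_mono)
  ultimately have le: "Lp_norm \<Omega> p (weak_grad \<Omega> v) powr p \<le> Lp_norm \<Omega> p (weak_grad \<Omega> w) powr p" by simp
  show ?thesis unfolding w(2)[symmetric]
  proof (rule ccontr)
    assume "\<not> Lp_norm \<Omega> p (weak_grad \<Omega> v) \<le> Lp_norm \<Omega> p (weak_grad \<Omega> w)"
    then have "Lp_norm \<Omega> p (weak_grad \<Omega> w) powr p < Lp_norm \<Omega> p (weak_grad \<Omega> v) powr p"
      using h by (intro powr_less_mono2) auto
    then show False using le by simp
  qed
qed

text \<open>The competitor is the cone of height \<open>R\<close> and slope 1 over the ball, made
  smooth at the tip and at the rim. Its gradient has norm at most 1, and it exceeds
  \<open>R - \<kappa>\<close> up to equality on a small ball of measure \<open>V\<close>. Since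
  \<open>V\<close> is fixed before \<open>p\<close> and \<open>q\<close>, its power tends to 1 as
  \<open>q\<close> grows.\<close>

lemma rayleigh_upper_bound:
  assumes R: "R > 0" "cball x0 R \<subseteq> \<Omega>" and \<kappa>: "0 < \<kappa>" "\<kappa> < R"
  shows "\<exists>V>0. \<forall>p>1. \<forall>q>1. rayleigh p q \<le> measure lebesgue \<Omega> powr (1 / p) / ((R - \<kappa>) * V powr (1 / q))"
proof -
  \<comment> \<open>Height is lost three times by at most \<open>s\<close>: by the radius of the
    small ball, by rounding the tip and by \<open>soft_pos\<close>.\<close>
  define s where "s = \<kappa> / 3"
  have s: "s > 0" using \<kappa> by (simp add: s_def)
  define Q where "Q = quad (s\<^sup>2) 0 (\<lambda>h. 2 *\<^sub>R h) x0"
  have A: "sym_op (\<lambda>h::'a. 2 *\<^sub>R h)" by (auto simp: sym_op_def intro: linearI simp: algebra_simps)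
  have Qe: "Q x = s\<^sup>2 + (norm (x - x0))\<^sup>2" for x by (simp add: Q_def quad_def power2_norm_eq_inner)
  have Qp: "Q x > 0" for x using s by (simp add: Qe add_pos_nonneg)
  define m where "m x = Q x powr (1 / 2)" for x
  have me: "m x = sqrt (Q x)" for x using Qp[of x] by (simp add: m_def powr_half_sqrt)
  have ms: "smooth_on UNIV m"
    unfolding m_def using Qp by (intro smooth_on_powr) (auto simp: Q_def intro: smooth_on_quad[OF A])
  have md: "m differentiable (at x)" for x using smooth_on_differentiable[OF ms] by simp
  have mg: "norm (grad m x) \<le> 1" for x
  proof -
    have "(sqrt has_real_derivative inverse (sqrt (Q x)) / 2) (at (Q x))" using Qp[of x] by (rule DERIV_real_sqrt)
    from grad_compose[OF smooth_on_differentiable[OF smooth_on_quad[OF A, of UNIV "s\<^sup>2" 0 x0], of x] this[unfolded Q_def]]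
    have "grad (\<lambda>x. sqrt (Q x)) x = (inverse (sqrt (Q x)) / 2) *\<^sub>R (2 *\<^sub>R (x - x0))"
      by (simp add: Q_def quad_grad[OF A])
    moreover have "m = (\<lambda>x. sqrt (Q x))" using me by blast
    ultimately have "grad m x = (inverse (sqrt (Q x)) / 2) *\<^sub>R (2 *\<^sub>R (x - x0))" by (simp only:)
    also have "\<dots> = inverse (sqrt (Q x)) *\<^sub>R (x - x0)" by simp
    finally have "norm (grad m x) = \<bar>inverse (sqrt (Q x))\<bar> * norm (x - x0)" by (simp only: norm_scaleR)
    also have "\<bar>inverse (sqrt (Q x))\<bar> = inverse (sqrt (Q x))" using Qp[of x] by simp
    also have "inverse (sqrt (Q x)) * norm (x - x0) = norm (x - x0) / sqrt (Q x)" by (simp only: divide_inverse mult.commute)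
    finally have "norm (grad m x) = norm (x - x0) / sqrt (Q x)" .
    moreover have "norm (x - x0) \<le> sqrt (Q x)" by (rule real_le_rsqrt) (simp add: Qe)
    ultimately show ?thesis using Qp[of x] by simp
  qed
  define g where "g x = soft_pos s (R - m x)" for x
  have gs: "smooth_on UNIV g"
    unfolding g_def
    by (rule smooth_on_soft_pos[OF s open_UNIV]) (use ms in \<open>auto simp: smooth_on_def intro!: Ck_on_diff Ck_on_const\<close>)
  have gt: "test_function \<Omega> g"
    unfolding test_function_def
  proof (intro conjI exI)
    show "smooth_on UNIV g" by (rule gs)
    show "compact (cball x0 R)" by simp
    show "\<forall>x. x \<notin> cball x0 R \<longrightarrow> g x = 0"
    proof (intro allI impI)
      fix x assume "x \<notin> cball x0 R"
      then have "norm (x - x0) \<ge> R" by (simp add: dist_norm norm_minus_commute)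
      moreover have "norm (x - x0) \<le> m x" unfolding me by (rule real_le_rsqrt) (simp add: Qe)
      ultimately show "g x = 0" by (simp add: g_def soft_pos_def)
    qed
  qed (rule R(2))
  have gg: "norm (grad g x) \<le> 1" for x
  proof -
    have d: "(\<lambda>x. R - m x) differentiable (at x)" using md[of x] by (intro derivative_intros)
    have "grad (\<lambda>x. R - m x) x = - grad m x"
      by (rule grad_eq) (use grad_has_derivative[OF md[of x]] in \<open>auto intro!: derivative_eq_intros\<close>)
    then have "grad g x = soft_pos' s (R - m x) *\<^sub>R (- grad m x)"
      unfolding g_def using grad_compose[OF d soft_pos_has_derivative[OF s]] by simp
    then have "norm (grad g x) = soft_pos' s (R - m x) * norm (grad m x)" using soft_pos'_bounds[OF s] by simp
    also have "\<dots> \<le> 1 * 1" using soft_pos'_bounds[OF s] mg by (intro mult_mono) auto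
    finally show ?thesis by simp
  qed
  define V where "V = measure lebesgue (ball x0 s)"
  have V: "V > 0" using s by (simp add: V_def content_ball_pos)
  have bO: "ball x0 s \<subseteq> \<Omega>" using R(2) \<kappa> by (auto simp: s_def)
  have glow: "g x \<ge> R - \<kappa>" if "x \<in> ball x0 s" for x
  proof -
    have "norm (x - x0) \<le> s" using that by (simp add: dist_norm norm_minus_commute)
    then have "m x \<le> s + norm (x - x0)" unfolding me
      using s by (intro real_le_lsqrt) (auto simp: Qe power2_eq_square algebra_simps)
    then have "m x \<le> 2 * s" using \<open>norm (x - x0) \<le> s\<close> by simp
    then show ?thesis using soft_pos_bounds(2)[OF s, of "R - m x"] by (simp add: g_def s_def)
  qed
  have "rayleigh p q \<le> measure lebesgue \<Omega> powr (1 / p) / ((R - \<kappa>) * V powr (1 / q))" if p: "p > 1" and q: "q > 1" for p q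
  proof -
    have gL: "Lp_mem \<Omega> q g" "Lp_mem \<Omega> p (grad g)" using test_function_Lp[OF gt] p q by auto
    have up: "Lp_norm \<Omega> p (grad g) \<le> measure lebesgue \<Omega> powr (1 / p)"
    proof -
      have "Lp_norm \<Omega> p (\<lambda>x. norm (grad g x)) \<le> measure lebesgue \<Omega> powr (1 / p) * 1"
        by (rule Lp_norm_le_sup) (use gL gg p in \<open>auto simp: Lp_mem_def\<close>)
      then show ?thesis by (simp add: Lp_norm_def)
    qed
    have low: "(R - \<kappa>) * V powr (1 / q) \<le> Lp_norm \<Omega> q g"
    proof -
      have "(R - \<kappa>) powr q * V = (\<integral>x. (R - \<kappa>) powr q * indicator (ball x0 s) x \<partial>lebesgue_on \<Omega>)"
        using bO sets_dom by (simp add: V_def measure_restrict_space Int_absorb2)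
      also have "\<dots> \<le> (\<integral>x. norm (g x) powr q \<partial>lebesgue_on \<Omega>)"
      proof (rule integral_mono)
        show "integrable (lebesgue_on \<Omega>) (\<lambda>x. (R - \<kappa>) powr q * indicator (ball x0 s) x)"
          using bO sets_dom finite_measure.emeasure_finite[OF finite_measure_dom, of "ball x0 s"]
          by (intro integrable_mult_right integrable_real_indicator) (auto simp: sets_restrict_space_iff less_top[symmetric])
        show "integrable (lebesgue_on \<Omega>) (\<lambda>x. norm (g x) powr q)" using gL(1) by (simp add: Lp_mem_def)
        show "(R - \<kappa>) powr q * indicator (ball x0 s) x \<le> norm (g x) powr q" for x
        proof (cases "x \<in> ball x0 s")
          case True
          then show ?thesis using glow[OF True] \<kappa> q by (auto intro: powr_mono2)
        qed simp
      qed
      also have "\<dots> = Lp_norm \<Omega> q g powr q" using q by (simp add: Lp_norm_powr)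
      finally have "((R - \<kappa>) powr q * V) powr (1 / q) \<le> (Lp_norm \<Omega> q g powr q) powr (1 / q)"
        using q V by (intro powr_mono2) auto
      then show ?thesis using q \<kappa> V by (simp add: powr_mult powr_powr)
    qed
    have pos: "(R - \<kappa>) * V powr (1 / q) > 0" using V \<kappa> by simp
    have "rayleigh p q \<ge> 0"
      unfolding rayleigh_def using exists_test_function[of q] q by (intro cInf_greatest) auto
    then have "rayleigh p q * ((R - \<kappa>) * V powr (1 / q)) \<le> measure lebesgue \<Omega> powr (1 / p)"
      using rayleigh_le[OF gt, of p q] up low mult_left_mono[OF low, of "rayleigh p q"] by linarith
    then show ?thesis using pos by (simp add: field_simps)
  qed
  then show ?thesis using V by blast
qed

end

section \<open>The distance to the boundary\<close>

text \<open>With \<open>s\<close> the right-hand side, \<open>2 * \<rho> * s\<close> equals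
  \<open>\<rho>\<^sup>2\<close> plus the square of the norm on the left, so the claim is the
  inequality between arithmetic and geometric mean.\<close>

lemma norm_add_le_quadratic:
  fixes e h :: "'a::euclidean_space"
  assumes e: "norm e = 1" and \<rho>: "\<rho> > 0"
  shows "norm (\<rho> *\<^sub>R e + h) \<le> \<rho> + e \<bullet> h + (norm h)\<^sup>2 / (2 * \<rho>)"
proof -
  define s where "s = \<rho> + e \<bullet> h + (norm h)\<^sup>2 / (2 * \<rho>)"
  have ee: "e \<bullet> e = 1" using e by (simp add: dot_square_norm)
  have sq: "(norm (\<rho> *\<^sub>R e + h))\<^sup>2 = \<rho>\<^sup>2 + 2 * \<rho> * (e \<bullet> h) + (norm h)\<^sup>2"
    using ee by (simp add: power2_norm_eq_inner inner_add_left inner_add_right inner_commute power2_eq_square[of \<rho>])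
  have "2 * \<rho> * s = \<rho>\<^sup>2 + (norm (\<rho> *\<^sub>R e + h))\<^sup>2"
    unfolding sq using \<rho> by (simp add: s_def field_simps power2_eq_square)
  moreover have "\<rho>\<^sup>2 + n\<^sup>2 \<ge> 2 * \<rho> * n" for n :: real using zero_le_power2[of "\<rho> - n"] by (simp add: power2_diff)
  ultimately have "2 * \<rho> * norm (\<rho> *\<^sub>R e + h) \<le> 2 * \<rho> * s" by metis
  then show ?thesis using \<rho> by (simp add: s_def)
qed

context bdd_domain
begin

abbreviation d :: "'a \<Rightarrow> real" where "d \<equiv> bdist \<Omega>"

lemma frontier_nonempty: "frontier \<Omega> \<noteq> {}"
proof -
  have "\<Omega> \<noteq> UNIV" using bounded_dom not_bounded_UNIV by auto
  then show ?thesis using nonempty_dom frontier_not_empty by blast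
qed

lemma d_lipschitz: "\<bar>d x - d y\<bar> \<le> dist x y"
  unfolding bdist_def by (rule infdist_triangle_abs)

lemma d_nonneg: "d x \<ge> 0"
  unfolding bdist_def by (rule infdist_nonneg)

lemma d_continuous: "continuous_on S d"
  unfolding bdist_def by (intro continuous_intros)

lemma d_le: "y \<in> frontier \<Omega> \<Longrightarrow> d x \<le> dist x y"
  unfolding bdist_def by (rule infdist_le)

lemma nearest_point: obtains y where "y \<in> frontier \<Omega>" "d x = dist x y"
  using infdist_attains_inf[OF frontier_closed frontier_nonempty, of x] unfolding bdist_def by metis

lemma d_frontier: "x \<in> frontier \<Omega> \<Longrightarrow> d x = 0"
  unfolding bdist_def by (rule infdist_zero)

lemma d_pos: "x \<in> \<Omega> \<Longrightarrow> d x > 0"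
  by (metis nearest_point frontier_disjoint zero_less_dist_iff)

lemma d_pos_closure: "x \<in> closure \<Omega> \<Longrightarrow> d x > 0 \<Longrightarrow> x \<in> \<Omega>"
  using d_frontier[of x] open_dom by (auto simp: frontier_def interior_open)

lemma ball_subset_dom: "x \<in> \<Omega> \<Longrightarrow> ball x (d x) \<subseteq> \<Omega>"
proof (rule ccontr)
  assume x: "x \<in> \<Omega>" and "\<not> ball x (d x) \<subseteq> \<Omega>"
  moreover have "x \<in> ball x (d x) \<inter> \<Omega>" using d_pos[OF x] x by simp
  ultimately have "ball x (d x) \<inter> frontier \<Omega> \<noteq> {}"
    using connected_Int_frontier[OF connected_ball, of x "d x" \<Omega>] by blast
  then obtain y where "y \<in> frontier \<Omega>" "dist x y < d x" by auto
  then show False using d_le[of y x] by simp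
qed

definition inrad :: real where "inrad = Linf_norm \<Omega> d"

text \<open>The norm in \<open>max_set\<close> is an essential supremum. For the continuous function
  \<open>d\<close> it is a maximum: a smaller value would make \<open>max (d x - r) 0\<close> vanish
  almost everywhere, hence everywhere, although it is positive at the maximum point.\<close>

lemma inradius:
  obtains xm where "xm \<in> \<Omega>" "d xm = inrad" "inrad > 0" "\<And>x. x \<in> closure \<Omega> \<Longrightarrow> d x \<le> inrad"
proof -
  have "compact (closure \<Omega>)" "closure \<Omega> \<noteq> {}" using bounded_dom nonempty_dom by (auto simp: compact_closure)
  then obtain xm where xm: "xm \<in> closure \<Omega>" "\<And>x. x \<in> closure \<Omega> \<Longrightarrow> d x \<le> d xm"
    using continuous_attains_sup[OF _ _ d_continuous] by metis
  obtain x0 where x0: "x0 \<in> \<Omega>" using nonempty_dom by blast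
  have pos: "d xm > 0" using d_pos[OF x0] xm(2)[of x0] x0 closure_subset[of \<Omega>] by fastforce
  have xmO: "xm \<in> \<Omega>" using d_pos_closure[OF xm(1) pos] .
  let ?M = "lebesgue_on \<Omega>"
  have dm: "d \<in> borel_measurable ?M"
    using d_continuous sets_dom by (intro borel_measurable_continuous_lebesgue_on) auto
  then have m: "(\<lambda>x. ereal (norm (d x))) \<in> borel_measurable ?M" by measurable
  have up: "esssup ?M (\<lambda>x. ereal (norm (d x))) \<le> ereal (d xm)"
  proof (rule esssup_I[OF m], rule AE_I2)
    fix x assume "x \<in> space ?M"
    then have "x \<in> closure \<Omega>" using closure_subset by auto
    then show "ereal (norm (d x)) \<le> ereal (d xm)" using xm(2) d_nonneg by simp
  qed
  moreover have "\<not> esssup ?M (\<lambda>x. ereal (norm (d x))) < ereal (d xm)"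
  proof
    assume lt: "esssup ?M (\<lambda>x. ereal (norm (d x))) < ereal (d xm)"
    then obtain r where r: "esssup ?M (\<lambda>x. ereal (norm (d x))) < ereal r" "ereal r < ereal (d xm)"
      using ereal_dense2 by blast
    have "AE x in ?M. ereal (norm (d x)) \<le> esssup ?M (\<lambda>x. ereal (norm (d x)))" by (rule esssup_AE)
    then have "AE x in ?M. max (d x - r) 0 = 0"
    proof eventually_elim
      case (elim x)
      then have "ereal (norm (d x)) < ereal r" using r(1) by (rule le_less_trans)
      then show ?case using d_nonneg[of x] by simp
    qed
    then have "max (d xm - r) 0 = 0"
      by (rule AE_zero_continuous[rotated]) (auto intro!: xmO continuous_intros d_continuous)
    then show False using r(2) by simp
  qed
  ultimately have "esssup ?M (\<lambda>x. ereal (norm (d x))) = ereal (d xm)" by (simp add: order.order_iff_strict)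
  then have "inrad = d xm" by (simp add: inrad_def Linf_norm_def)
  then show ?thesis using that[of xm] xmO pos xm(2) by simp
qed

lemma max_set_iff: "x \<in> max_set \<Omega> \<longleftrightarrow> x \<in> \<Omega> \<and> d x = inrad"
  by (simp add: max_set_def inrad_def)

text \<open>From \<open>z\<close> towards a nearest boundary point, \<open>d\<close> decreases at
  exactly unit speed: that boundary point bounds it from above and the Lipschitz property from
  below. The opposite direction is the required one.\<close>

lemma directional_derivative_unit:
  assumes z: "z \<in> \<Omega>" and g: "(d has_derivative g) (at z)"
  obtains k where "norm k = 1" "g k = 1"
proof -
  obtain y where y: "y \<in> frontier \<Omega>" "d z = dist z y" by (rule nearest_point)
  define \<rho> where "\<rho> = d z"
  have \<rho>: "\<rho> > 0" using d_pos[OF z] by (simp add: \<rho>_def)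
  define k where "k = (z - y) /\<^sub>R \<rho>"
  have k1: "norm k = 1" using \<rho> y by (simp add: k_def \<rho>_def dist_norm)
  have yz: "y = z - \<rho> *\<^sub>R k" using \<rho> by (simp add: k_def)
  interpret g: linear g using g by (rule has_derivative_linear)
  have ray: "d (z - t *\<^sub>R k) = \<rho> - t" if t: "0 \<le> t" "t \<le> \<rho>" for t
  proof (rule antisym)
    have "d (z - t *\<^sub>R k) \<le> dist (z - t *\<^sub>R k) y" by (rule d_le[OF y(1)])
    also have "\<dots> = norm ((\<rho> - t) *\<^sub>R k)" by (simp add: yz dist_norm algebra_simps)
    also have "\<dots> = \<rho> - t" using t k1 by simp
    finally show "d (z - t *\<^sub>R k) \<le> \<rho> - t" .
    have "dist z (z - t *\<^sub>R k) = t" using t k1 by (simp add: dist_norm)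
    then show "\<rho> - t \<le> d (z - t *\<^sub>R k)" using d_lipschitz[of z "z - t *\<^sub>R k"] by (simp add: \<rho>_def)
  qed
  have "((\<lambda>t. d (z - t *\<^sub>R k)) has_derivative (\<lambda>s. g (- (s *\<^sub>R k)))) (at 0)"
    by (rule has_derivative_compose[of "\<lambda>t. z - t *\<^sub>R k" "\<lambda>s. - (s *\<^sub>R k)"]) (use g in \<open>auto intro!: derivative_eq_intros\<close>)
  then have "((\<lambda>t. d (z - t *\<^sub>R k)) has_real_derivative - g k) (at 0)"
    unfolding has_field_derivative_def by (rule has_derivative_eq_rhs) (auto simp: g.neg g.scaleR)
  then have lim1: "((\<lambda>t. (d (z - t *\<^sub>R k) - d z) / t) \<longlongrightarrow> - g k) (at_right 0)"
    by (simp add: DERIV_def filterlim_at_split)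
  have "\<forall>\<^sub>F t in at_right 0. (d (z - t *\<^sub>R k) - d z) / t = - 1"
  proof -
    have "\<forall>\<^sub>F t in at_right 0. t \<in> {0<..<\<rho>}" by (rule eventually_at_right_real[OF \<rho>])
    then show ?thesis by eventually_elim (use ray in \<open>auto simp: \<rho>_def\<close>)
  qed
  then have lim2: "((\<lambda>t. (d (z - t *\<^sub>R k) - d z) / t) \<longlongrightarrow> - 1) (at_right 0)" by (rule tendsto_eventually)
  have "- g k = - 1" by (rule tendsto_unique[OF _ lim1 lim2]) simp
  then show ?thesis using that[OF k1] by simp
qed

text \<open>At an interior maximum a derivative would be zero, yet it takes the value 1 in some unit
  direction.\<close>

lemma max_set_subset_singular: "max_set \<Omega> \<subseteq> singular_set \<Omega>"
proof
  fix x assume "x \<in> max_set \<Omega>"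
  then have x: "x \<in> \<Omega>" "d x = inrad" by (auto simp: max_set_iff)
  have "\<not> d differentiable (at x)"
  proof
    assume "d differentiable (at x)"
    then obtain g where g: "(d has_derivative g) (at x)" by (auto simp: differentiable_def)
    obtain k where k: "norm k = 1" "g k = 1" by (rule directional_derivative_unit[OF x(1) g])
    have "g = (\<lambda>h. 0)"
    proof (rule differential_zero_maxmin[OF x(1) open_dom g])
      have "\<forall>y\<in>\<Omega>. d y \<le> d x" unfolding x(2) using inradius closure_subset[of \<Omega>] by (metis subsetD)
      then show "(\<forall>y\<in>\<Omega>. d y \<le> d x) \<or> (\<forall>y\<in>\<Omega>. d x \<le> d y)" ..
    qed
    then show False using k by simp
  qed
  then show "x \<in> singular_set \<Omega>" using x by (simp add: singular_set_def)
qed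

text \<open>From above, \<open>d\<close> is bounded by the distance to \<open>y\<close>, with an
  explicit quadratic error. From below, compactness of the boundary is used: nearest points of
  \<open>x + h\<close> are seen from \<open>x\<close> in almost the same direction as
  \<open>y\<close>.\<close>

lemma unique_nearest_differentiable:
  assumes x: "x \<in> \<Omega>" and y: "y \<in> frontier \<Omega>" "d x = dist x y"
    and uniq: "\<And>y'. y' \<in> frontier \<Omega> \<Longrightarrow> d x = dist x y' \<Longrightarrow> y' = y"
  shows "d differentiable (at x)"
proof -
  define \<rho> where "\<rho> = d x"
  have \<rho>: "\<rho> > 0" using d_pos[OF x] by (simp add: \<rho>_def)
  define u where "u y' = (x - y') /\<^sub>R dist x y'" for y'
  define e where "e = u y"
  have fd: "dist x y' \<ge> \<rho>" if "y' \<in> frontier \<Omega>" for y' using d_le[OF that] by (simp add: \<rho>_def)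
  have u1: "norm (u y') = 1" if "y' \<in> frontier \<Omega>" for y'
  proof -
    have "dist x y' > 0" using fd[OF that] \<rho> by linarith
    then show ?thesis by (simp add: u_def dist_norm)
  qed
  have e1: "norm e = 1" using u1[OF y(1)] by (simp add: e_def)
  have xy: "x - y = \<rho> *\<^sub>R e" using \<rho> y(2) by (simp add: e_def u_def \<rho>_def)
  have up: "d (x + h) - d x - e \<bullet> h \<le> (norm h)\<^sup>2 / (2 * \<rho>)" for h
  proof -
    have "d (x + h) \<le> norm (x + h - y)" using d_le[OF y(1)] by (simp add: dist_norm)
    also have "x + h - y = \<rho> *\<^sub>R e + h" using xy by (simp add: algebra_simps)
    also have "norm (\<rho> *\<^sub>R e + h) \<le> \<rho> + e \<bullet> h + (norm h)\<^sup>2 / (2 * \<rho>)" by (rule norm_add_le_quadratic[OF e1 \<rho>])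
    finally show ?thesis by (simp add: \<rho>_def)
  qed
  have cF: "compact (frontier \<Omega>)" using bounded_dom by (simp add: compact_frontier_bounded)
  have low: "\<exists>\<delta>>0. \<forall>h. norm h < \<delta> \<longrightarrow> d (x + h) - d x - e \<bullet> h \<ge> - \<epsilon> * norm h" if \<epsilon>: "\<epsilon> > 0" for \<epsilon>
  proof -
    \<comment> \<open>The boundary points seen from \<open>x\<close> in a direction off by at least
      \<open>\<epsilon>\<close>. They form a compact set without nearest points, so their distance
      exceeds \<open>\<rho>\<close> by some \<open>2 * \<delta>\<close>; a shift of \<open>x\<close>
      by less than \<open>\<delta>\<close> cannot make any of them nearest.\<close>
    define F where "F = {y' \<in> frontier \<Omega>. \<epsilon> \<le> norm (u y' - e)}"
    have "continuous_on (frontier \<Omega>) (\<lambda>y'. norm (u y' - e))"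
      unfolding u_def using fd \<rho> by (intro continuous_intros) force
    then have "closed F" unfolding F_def
      by (rule continuous_on_closed_Collect_le[OF continuous_on_const _ frontier_closed])
    moreover have "bounded F" using compact_imp_bounded[OF cF] by (rule bounded_subset) (auto simp: F_def)
    ultimately have Fc: "compact F" by (simp add: compact_eq_bounded_closed)
    have "\<exists>\<delta>>0. \<forall>y'\<in>F. dist x y' \<ge> \<rho> + 2 * \<delta>"
    proof (cases "F = {}")
      case False
      obtain y1 where y1: "y1 \<in> F" "\<And>y'. y' \<in> F \<Longrightarrow> dist x y1 \<le> dist x y'"
        using distance_attains_inf[OF compact_imp_closed[OF Fc] False, of x] by blast
      have "dist x y1 \<noteq> \<rho>"
      proof
        assume "dist x y1 = \<rho>"
        then have "y1 = y" using uniq[of y1] y1(1) by (simp add: F_def \<rho>_def)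
        then show False using y1(1) \<epsilon> by (simp add: F_def e_def)
      qed
      then have "dist x y1 > \<rho>" using fd[of y1] y1(1) by (simp add: F_def less_le)
      moreover have "\<rho> + 2 * ((dist x y1 - \<rho>) / 2) = dist x y1" by (simp add: field_simps)
      ultimately show ?thesis using y1(2) by (intro exI[of _ "(dist x y1 - \<rho>) / 2"]) simp
    qed (auto intro: exI[of _ 1])
    then obtain \<delta> where \<delta>: "\<delta> > 0" "\<And>y'. y' \<in> F \<Longrightarrow> dist x y' \<ge> \<rho> + 2 * \<delta>" by blast
    have "d (x + h) - d x - e \<bullet> h \<ge> - \<epsilon> * norm h" if h: "norm h < \<delta>" for h
    proof -
      obtain y' where y': "y' \<in> frontier \<Omega>" "d (x + h) = dist (x + h) y'" by (rule nearest_point)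
      have "dist x y' \<le> norm h + dist (x + h) y'"
        using dist_triangle[of x y' "x + h"] by (simp add: dist_norm)
      also have "dist (x + h) y' \<le> \<rho> + norm h"
        using d_lipschitz[of "x + h" x] y'(2) by (simp add: \<rho>_def dist_norm)
      finally have "dist x y' < \<rho> + 2 * \<delta>" using h by simp
      then have "y' \<notin> F" using \<delta>(2) by force
      then have small: "norm (u y' - e) < \<epsilon>" using y'(1) by (simp add: F_def)
      have "u y' \<bullet> (x - y') = dist x y'"
      proof -
        have "norm (x - y') > 0" using fd[OF y'(1)] \<rho> unfolding dist_norm by linarith
        then show ?thesis by (simp add: u_def dist_norm power2_norm_eq_inner[symmetric] power2_eq_square)
      qed
      then have "dist x y' + u y' \<bullet> h = u y' \<bullet> (x + h - y')" by (simp add: inner_diff_right inner_add_right)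
      also have "\<dots> \<le> norm (u y') * norm (x + h - y')" by (rule norm_cauchy_schwarz)
      also have "\<dots> = d (x + h)" using u1[OF y'(1)] y'(2) by (simp add: dist_norm)
      finally have "d (x + h) - d x - e \<bullet> h \<ge> (u y' - e) \<bullet> h"
        using fd[OF y'(1)] by (simp add: \<rho>_def inner_diff_left)
      moreover have "(u y' - e) \<bullet> h \<ge> - (\<epsilon> * norm h)"
        using Cauchy_Schwarz_ineq2[of "u y' - e" h] mult_right_mono[OF less_imp_le[OF small], of "norm h"] by auto
      ultimately show ?thesis by linarith
    qed
    then show ?thesis using \<delta>(1) by blast
  qed
  have "(d has_derivative (\<lambda>h. e \<bullet> h)) (at x)"
    unfolding has_derivative_at_alt
  proof (intro conjI allI impI)
    show "bounded_linear (\<lambda>h. e \<bullet> h)" by (rule bounded_linear_inner_right)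
    fix \<epsilon> :: real assume \<epsilon>: "\<epsilon> > 0"
    obtain \<delta> where \<delta>: "\<delta> > 0" "\<And>h. norm h < \<delta> \<Longrightarrow> d (x + h) - d x - e \<bullet> h \<ge> - \<epsilon> * norm h" using low[OF \<epsilon>] by blast
    define \<delta>' where "\<delta>' = min \<delta> (2 * \<rho> * \<epsilon>)"
    have "norm (d y' - d x - e \<bullet> (y' - x)) \<le> \<epsilon> * norm (y' - x)" if "norm (y' - x) < \<delta>'" for y'
    proof -
      define h where "h = y' - x"
      have h: "norm h < \<delta>" "norm h \<le> 2 * \<rho> * \<epsilon>" "y' = x + h" using that by (auto simp: h_def \<delta>'_def)
      have "(norm h)\<^sup>2 / (2 * \<rho>) \<le> (2 * \<rho> * \<epsilon>) * norm h / (2 * \<rho>)"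
        using h(2) \<rho> by (intro divide_right_mono) (auto simp: power2_eq_square intro: mult_right_mono)
      also have "\<dots> = \<epsilon> * norm h" using \<rho> by simp
      finally show ?thesis using up[of h] \<delta>(2)[OF h(1)] unfolding h(3) by (auto simp: abs_le_iff)
    qed
    moreover have "\<delta>' > 0" using \<delta> \<rho> \<epsilon> by (simp add: \<delta>'_def)
    ultimately show "\<exists>d>0. \<forall>y. norm (y - x) < d \<longrightarrow> norm (bdist \<Omega> y - bdist \<Omega> x - e \<bullet> (y - x)) \<le> \<epsilon> * norm (y - x)" by blast
  qed
  then show ?thesis by (auto simp: differentiable_def)
qed

text \<open>At a point with two nearest boundary points, \<open>d\<close> has a concave kink, so quadratics touching
  it from above can be made as concave as we like in the direction of the kink. Their gradient is chosen
  not to be orthogonal to that direction.\<close>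

lemma subsolution_bdist_differentiable:
  assumes D: "open D" "D \<subseteq> \<Omega>" and x: "x \<in> D" and c: "c > 0" and sub: "viscosity_subsolution D u"
    and u: "\<And>y. y \<in> D \<Longrightarrow> u y = c * d y"
  shows "d differentiable (at x)"
proof (rule ccontr)
  assume nd: "\<not> d differentiable (at x)"
  have xO: "x \<in> \<Omega>" using x D by blast
  obtain y1 where y1: "y1 \<in> frontier \<Omega>" "d x = dist x y1" by (rule nearest_point)
  obtain y2 where y2: "y2 \<in> frontier \<Omega>" "d x = dist x y2" "y2 \<noteq> y1"
    using unique_nearest_differentiable[OF xO y1] nd by blast
  define \<rho> where "\<rho> = d x"
  have \<rho>: "\<rho> > 0" using d_pos[OF xO] by (simp add: \<rho>_def)
  define e1 where "e1 = (x - y1) /\<^sub>R \<rho>"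
  define e2 where "e2 = (x - y2) /\<^sub>R \<rho>"
  have n1: "norm e1 = 1" and n2: "norm e2 = 1" using \<rho> y1 y2 by (auto simp: e1_def e2_def \<rho>_def dist_norm)
  have xy1: "x - y1 = \<rho> *\<^sub>R e1" and xy2: "x - y2 = \<rho> *\<^sub>R e2" using \<rho> by (auto simp: e1_def e2_def)
  have ee: "e1 \<bullet> e1 = 1" "e2 \<bullet> e2 = 1" using n1 n2 by (simp_all add: dot_square_norm)
  have "e1 \<noteq> e2" using y2(3) \<rho> by (auto simp: e1_def e2_def)
  then have "(e1 - e2) \<bullet> (e1 - e2) > 0" by simp
  then have e12: "e1 \<bullet> e2 < 1" by (simp add: inner_diff_left inner_diff_right ee inner_commute)
  define f where "f = e1 - e2"
  \<comment> \<open>Unequal weights are essential. Since \<open>e1\<close> and \<open>e2\<close>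
    have the same length, their midpoint is orthogonal to \<open>f\<close>, and the concavity in
    direction \<open>f\<close> would not show in the infinity Laplacian.\<close>
  define a where "a = (1/4) *\<^sub>R e1 + (3/4) *\<^sub>R e2"
  have fa: "f \<bullet> a = (e1 \<bullet> e2 - 1) / 2"
    by (simp add: f_def a_def inner_diff_left inner_diff_right inner_add_right inner_add_left ee inner_commute[of e2 e1])
       (simp add: field_simps)
  define \<gamma> where "\<gamma> = (f \<bullet> a)\<^sup>2"
  have \<gamma>: "\<gamma> > 0" using e12 by (simp add: \<gamma>_def fa)
  have a1: "norm a \<le> 1"
    unfolding a_def using norm_triangle_ineq[of "(1/4) *\<^sub>R e1" "(3/4) *\<^sub>R e2"] n1 n2 by simp
  \<comment> \<open>Twice the coefficient \<open>1 / (2 * \<rho>)\<close> of the quadratic error in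
    the upper bounds for \<open>d\<close>, so that the touching is strict.\<close>
  define C where "C = 1 / \<rho>"
  have C: "C > 0" using \<rho> by (simp add: C_def)
  \<comment> \<open>Then \<open>K * \<gamma> = C + \<gamma>\<close> exceeds
    \<open>C * (a \<bullet> a)\<close>, which makes the infinity Laplacian negative.\<close>
  define K where "K = C / \<gamma> + 1"
  have K: "K > 0" using C \<gamma> by (simp add: K_def add_pos_pos)
  define A where "A h = (- 2 * K * (f \<bullet> h)) *\<^sub>R f - (- 2 * C) *\<^sub>R h" for h
  define B where "B h = (- 2 * c * K * (f \<bullet> h)) *\<^sub>R f - (- 2 * c * C) *\<^sub>R h" for h
  have B: "sym_op B" unfolding B_def[abs_def] by (rule sym_op_rank_one)
  have BA: "B h = c *\<^sub>R A h" for h by (simp add: A_def B_def scaleR_diff_right scaleR_add_right mult_ac)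
  obtain r where r: "r > 0" "ball x r \<subseteq> D" using D(1) x by (rule openE)
  \<comment> \<open>As \<open>norm f \<le> 2\<close>, this radius bounds
    \<open>K * (f \<bullet> h)\<^sup>2\<close> by a quarter of
    \<open>\<bar>f \<bullet> h\<bar>\<close>, which is what the kink provides.\<close>
  define s where "s = min r (1 / (8 * K))"
  have s: "s > 0" "s \<le> r" "s \<le> 1 / (8 * K)" using r K by (auto simp: s_def)
  define \<phi> where "\<phi> = quad (c * \<rho>) (c *\<^sub>R a) B x"
  have \<phi>e: "\<phi> (x + h) = c * (\<rho> + a \<bullet> h - K * (f \<bullet> h)\<^sup>2 + C * (norm h)\<^sup>2)" for h
  proof -
    have 1: "(h \<bullet> A h) / 2 = C * (norm h)\<^sup>2 - K * (f \<bullet> h)\<^sup>2"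
      unfolding A_def by (simp add: inner_diff_right inner_add_right dot_square_norm power2_eq_square inner_commute)
    have "\<phi> (x + h) = c * (\<rho> + a \<bullet> h + (h \<bullet> A h) / 2)" by (simp add: \<phi>_def quad_def BA algebra_simps)
    then show ?thesis unfolding 1 by (simp add: algebra_simps)
  qed
  have touch: "\<phi> y - u y > 0" if y: "y \<in> ball x s - {x}" for y
  proof -
    define h where "h = y - x"
    have yh: "y = x + h" and h0: "h \<noteq> 0" and hs: "norm h < s" using y by (auto simp: h_def dist_norm norm_minus_commute)
    have dh: "d y \<le> \<rho> + e \<bullet> h + (norm h)\<^sup>2 / (2 * \<rho>)"
      if "y' \<in> frontier \<Omega>" "x - y' = \<rho> *\<^sub>R e" "norm e = 1" for e y'
    proof -
      have "d y \<le> norm (y - y')" using d_le[OF that(1), of y] by (simp add: dist_norm)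
      also have "y - y' = \<rho> *\<^sub>R e + h" using that(2) yh by (simp add: algebra_simps)
      also have "norm (\<rho> *\<^sub>R e + h) \<le> \<rho> + e \<bullet> h + (norm h)\<^sup>2 / (2 * \<rho>)" by (rule norm_add_le_quadratic[OF that(3) \<rho>])
      finally show ?thesis .
    qed
    have "d y \<le> \<rho> + min (e1 \<bullet> h) (e2 \<bullet> h) + (norm h)\<^sup>2 / (2 * \<rho>)"
      using dh[OF y1(1) xy1 n1] dh[OF y2(1) xy2 n2] by (auto simp: min_def)
    moreover have "min (e1 \<bullet> h) (e2 \<bullet> h) \<le> a \<bullet> h - (1/4) * \<bar>f \<bullet> h\<bar>"
    proof -
      \<comment> \<open>The kink in numbers: the minimum lies below a weighted mean by at least the
        smaller weight times the gap.\<close>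
      have "min \<alpha> \<beta> \<le> (1/4) * \<alpha> + (3/4) * \<beta> - (1/4) * \<bar>\<alpha> - \<beta>\<bar>" for \<alpha> \<beta> :: real
      proof (cases "\<alpha> \<le> \<beta>")
        case True
        then have "min \<alpha> \<beta> = \<alpha>" "\<bar>\<alpha> - \<beta>\<bar> = \<beta> - \<alpha>" by auto
        moreover have "\<alpha> \<le> (1/4) * \<alpha> + (3/4) * \<beta> - (1/4) * (\<beta> - \<alpha>)" using True by (simp add: field_simps)
        ultimately show ?thesis by (simp only:)
      next
        case False
        then have "min \<alpha> \<beta> = \<beta>" "\<bar>\<alpha> - \<beta>\<bar> = \<alpha> - \<beta>" by auto
        moreover have "\<beta> \<le> (1/4) * \<alpha> + (3/4) * \<beta> - (1/4) * (\<alpha> - \<beta>)" by (simp add: field_simps)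
        ultimately show ?thesis by (simp only:)
      qed
      from this[of "e1 \<bullet> h" "e2 \<bullet> h"] show ?thesis
        by (simp add: a_def f_def inner_add_left inner_diff_left)
    qed
    moreover have "K * (f \<bullet> h)\<^sup>2 \<le> (1/4) * \<bar>f \<bullet> h\<bar>"
    proof -
      have "norm f \<le> 2" unfolding f_def using norm_triangle_ineq4[of e1 e2] n1 n2 by simp
      then have "\<bar>f \<bullet> h\<bar> \<le> 2 * s"
        using Cauchy_Schwarz_ineq2[of f h] hs mult_mono[of "norm f" 2 "norm h" s] by simp
      then have "K * \<bar>f \<bullet> h\<bar> \<le> K * (2 * (1 / (8 * K)))" using s K by (intro mult_left_mono) auto
      then have "K * \<bar>f \<bullet> h\<bar> \<le> 1 / 4" using K by simp
      then have "(K * \<bar>f \<bullet> h\<bar>) * \<bar>f \<bullet> h\<bar> \<le> (1 / 4) * \<bar>f \<bullet> h\<bar>" by (intro mult_right_mono) auto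
      then show ?thesis by (simp add: power2_eq_square mult.assoc)
    qed
    moreover have "(norm h)\<^sup>2 / (2 * \<rho>) < C * (norm h)\<^sup>2" using h0 \<rho> by (simp add: C_def field_simps)
    ultimately have "d y < \<rho> + a \<bullet> h - K * (f \<bullet> h)\<^sup>2 + C * (norm h)\<^sup>2" by linarith
    then have "c * d y < \<phi> y" unfolding yh \<phi>e using c by simp
    moreover have "y \<in> D" using y r s by auto
    ultimately show ?thesis using u by simp
  qed
  have "\<phi> x - u x = 0" using \<phi>e[of 0] u[OF x] by (simp add: \<rho>_def)
  moreover have "ball x s \<subseteq> D" using r s by auto
  moreover have "Ck_on 2 (ball x s) \<phi>" using smooth_on_quad[OF B] unfolding \<phi>_def smooth_on_def by blast
  ultimately have "- infinity_laplacian \<phi> x \<le> 0"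
    using sub x s(1) touch unfolding viscosity_subsolution_def by blast
  moreover have "infinity_laplacian \<phi> x = c ^ 3 * (2 * C * (a \<bullet> a) - 2 * K * \<gamma>)"
    unfolding \<phi>_def infinity_laplacian_quad[OF B]
    by (simp add: linear_0[OF sym_opD(1)[OF B]] linear_cmul[OF sym_opD(1)[OF B]] BA A_def \<gamma>_def inner_diff_right inner_add_right
        power3_eq_cube power2_eq_square inner_commute algebra_simps)
  moreover have "2 * C * (a \<bullet> a) - 2 * K * \<gamma> < 0"
  proof -
    have "a \<bullet> a \<le> 1" using a1 by (simp add: dot_square_norm power_le_one)
    then have "2 * C * (a \<bullet> a) \<le> 2 * C" using C by simp
    moreover have "K * \<gamma> = C + \<gamma>" using \<gamma> by (simp add: K_def field_simps)
    ultimately show ?thesis using \<gamma> by simp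
  qed
  ultimately show False using c by (simp add: zero_le_mult_iff)
qed

text \<open>Following an almost steepest ascent of \<open>d\<close> from \<open>x\<close> one can only stop in the maximum set.\<close>

lemma max_set_reached:
  assumes sing: "max_set \<Omega> = singular_set \<Omega>" and x: "x \<in> \<Omega>"
  shows "\<exists>m\<in>max_set \<Omega>. dist x m \<le> inrad - d x"
proof -
  obtain xm where xm: "xm \<in> \<Omega>" "d xm = inrad" "inrad > 0" "\<And>x. x \<in> closure \<Omega> \<Longrightarrow> d x \<le> inrad" using inradius by blast
  have xc: "x \<in> closure \<Omega>" using x closure_subset by blast
  have near: "\<exists>m\<in>max_set \<Omega>. dist x m \<le> (inrad - d x) / (1 - \<epsilon>)" if \<epsilon>: "0 < \<epsilon>" "\<epsilon> < 1" for \<epsilon>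
  proof -
    \<comment> \<open>The points at which \<open>d\<close> has risen from \<open>x\<close> with
      average slope at least \<open>1 - \<epsilon>\<close>. Where \<open>d\<close> is differentiable
      a short step of slope almost 1 stays in this set, so a highest point of it has to be
      singular.\<close>
    define Z where "Z = {z \<in> closure \<Omega>. d x + (1 - \<epsilon>) * dist x z \<le> d z}"
    have "closed Z" unfolding Z_def
      by (rule continuous_on_closed_Collect_le) (auto intro!: continuous_intros d_continuous)
    moreover have "bounded Z" by (rule bounded_subset[OF bounded_closure[OF bounded_dom]]) (auto simp: Z_def)
    ultimately have Zc: "compact Z" by (simp add: compact_eq_bounded_closed)
    have xZ: "x \<in> Z" using xc by (simp add: Z_def)
    obtain z where z: "z \<in> Z" "\<And>z'. z' \<in> Z \<Longrightarrow> d z' \<le> d z"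
      using continuous_attains_sup[OF Zc _ d_continuous] xZ by blast
    have zO: "z \<in> \<Omega>" using z(1) z(2)[OF xZ] d_pos[OF x] by (intro d_pos_closure) (auto simp: Z_def)
    have "z \<in> max_set \<Omega>"
    proof (rule ccontr)
      assume "z \<notin> max_set \<Omega>"
      then have "d differentiable (at z)" using sing zO by (auto simp: singular_set_def)
      then obtain g where g: "(d has_derivative g) (at z)" by (auto simp: differentiable_def)
      obtain k where k: "norm k = 1" "g k = 1" by (rule directional_derivative_unit[OF zO g])
      interpret g: linear g using g by (rule has_derivative_linear)
      obtain r where r: "r > 0" "ball z r \<subseteq> \<Omega>" using open_dom zO by (rule openE)
      obtain \<delta> where \<delta>: "\<delta> > 0" "\<And>y. norm (y - z) < \<delta> \<Longrightarrow> norm (d y - d z - g (y - z)) \<le> \<epsilon> * norm (y - z)"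
        using g \<epsilon>(1) unfolding has_derivative_at_alt by blast
      define t where "t = min r \<delta> / 2"
      have t: "t > 0" "t < r" "t < \<delta>" using r \<delta> by (auto simp: t_def min_def)
      define z' where "z' = z + t *\<^sub>R k"
      have nz: "norm (z' - z) = t" using t k by (simp add: z'_def)
      have "g (z' - z) = t" using k by (simp add: z'_def g.scaleR)
      then have dz: "d z' \<ge> d z + (1 - \<epsilon>) * t" using \<delta>(2)[of z'] nz t by (simp add: algebra_simps abs_le_iff)
      have z'O: "z' \<in> \<Omega>" using r t nz by (intro subsetD[OF r(2)]) (simp add: dist_norm norm_minus_commute)
      have "dist x z' \<le> dist x z + t" using dist_triangle[of x z' z] nz by (simp add: dist_norm norm_minus_commute)
      then have "(1 - \<epsilon>) * dist x z' \<le> (1 - \<epsilon>) * (dist x z + t)" using \<epsilon> by (intro mult_left_mono) auto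
      then have "d x + (1 - \<epsilon>) * dist x z' \<le> d x + (1 - \<epsilon>) * dist x z + (1 - \<epsilon>) * t" by (simp add: algebra_simps)
      also have "\<dots> \<le> d z'" using z(1) dz by (simp add: Z_def)
      finally have "z' \<in> Z" using z'O closure_subset by (auto simp: Z_def)
      then have "d z' \<le> d z" by (rule z(2))
      moreover have "(1 - \<epsilon>) * t > 0" using t \<epsilon> by simp
      ultimately show False using dz by linarith
    qed
    moreover have "dist x z \<le> (inrad - d x) / (1 - \<epsilon>)"
      using z(1) xm(4)[of z] \<epsilon> by (simp add: Z_def field_simps)
    ultimately show ?thesis by blast
  qed
  have "closed (max_set \<Omega>)"
  proof -
    have "max_set \<Omega> = {y \<in> closure \<Omega>. inrad \<le> d y}"
      using xm closure_subset[of \<Omega>] d_pos_closure unfolding set_eq_iff max_set_iff by (auto intro: antisym)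
    then show ?thesis by (simp add: continuous_on_closed_Collect_le[OF continuous_on_const d_continuous closed_closure])
  qed
  moreover have ne: "max_set \<Omega> \<noteq> {}" using xm by (auto simp: max_set_iff)
  \<comment> \<open>A point of the maximum set nearest to \<open>x\<close> serves all
    \<open>\<epsilon>\<close> at once, so the estimate survives the limit
    \<open>\<epsilon> \<rightarrow> 0\<close>.\<close>
  ultimately obtain m where m: "m \<in> max_set \<Omega>" "\<And>m'. m' \<in> max_set \<Omega> \<Longrightarrow> dist x m \<le> dist x m'"
    using distance_attains_inf by blast
  have "((\<lambda>\<epsilon>. (inrad - d x) / (1 - \<epsilon>)) \<longlongrightarrow> (inrad - d x) / (1 - 0)) (at_right 0)"
    by (intro tendsto_intros) auto
  moreover have "\<forall>\<^sub>F \<epsilon> in at_right 0. dist x m \<le> (inrad - d x) / (1 - \<epsilon>)"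
  proof -
    have "\<forall>\<^sub>F \<epsilon> in at_right 0. \<epsilon> \<in> {0<..<(1::real)}" by (rule eventually_at_right_real) simp
    then show ?thesis
    proof eventually_elim
      case (elim \<epsilon>)
      then obtain m' where "m' \<in> max_set \<Omega>" "dist x m' \<le> (inrad - d x) / (1 - \<epsilon>)" using near by force
      then show ?case using m(2)[of m'] by simp
    qed
  qed
  ultimately have "dist x m \<le> (inrad - d x) / (1 - 0)" by (rule tendsto_lowerbound) simp
  then show ?thesis using m(1) by auto
qed

end

section \<open>Viscosity limits\<close>

text \<open>Only the quadratic form of the second derivative enters the Taylor expansion and the
  infinity Laplacian, so its symmetric part can stand for it and symmetry of mixed derivatives need
  not be discussed.\<close>

lemma sym_part:
  fixes L :: "'a::euclidean_space \<Rightarrow> 'a"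
  assumes L: "linear L"
  obtains A where "sym_op A" "\<And>h. h \<bullet> A h = h \<bullet> L h"
proof
  define A where "A h = (1/2) *\<^sub>R (L h + adjoint L h)" for h
  have lA: "linear (adjoint L)" by (rule adjoint_linear[OF L])
  have adj: "x \<bullet> adjoint L y = L x \<bullet> y" for x y by (rule adjoint_works[OF L])
  have "linear A"
    by (rule linearI) (auto simp: A_def linear_add[OF L] linear_add[OF lA] linear_cmul[OF L] linear_cmul[OF lA] algebra_simps)
  moreover have "A h \<bullet> k = h \<bullet> A k" for h k
    using adj[of k h] adj[of h k] by (simp add: A_def inner_add_left inner_add_right inner_commute[of "adjoint L h" k] inner_commute[of "L k" h])
  ultimately show "sym_op A" by (simp add: sym_op_def)
  show "h \<bullet> A h = h \<bullet> L h" for h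
    using adj[of h h] by (simp add: A_def inner_add_right inner_commute[of "L h" h])
qed

text \<open>The mean value theorem along the segment from \<open>x0\<close> reduces the remainder to
  the first-order error of the gradient of \<open>\<phi>\<close> at \<open>x0\<close>, paired with
  \<open>h\<close>.\<close>

lemma C2_Taylor:
  fixes \<phi> :: "'a::euclidean_space \<Rightarrow> real"
  assumes C2: "Ck_on 2 (ball x0 r) \<phi>" and r: "r > 0"
  obtains A where "sym_op A" "grad \<phi> x0 \<bullet> A (grad \<phi> x0) = infinity_laplacian \<phi> x0"
    "\<And>\<kappa>. \<kappa> > 0 \<Longrightarrow> \<exists>\<delta>>0. \<forall>h. norm h < \<delta> \<longrightarrow> \<bar>\<phi> (x0 + h) - quad (\<phi> x0) (grad \<phi> x0) A x0 (x0 + h)\<bar> \<le> \<kappa> * (norm h)\<^sup>2"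
proof -
  have C2': "Ck_on (Suc (Suc 0)) (ball x0 r) \<phi>" using C2 by (simp add: numeral_2_eq_2)
  have d1: "\<phi> differentiable (at x)" if "x \<in> ball x0 r" for x using C2' that by simp
  have d2: "partial_deriv i \<phi> differentiable (at x0)" if "i \<in> Basis" for i
    using C2' that r by simp
  define b where "b = grad \<phi> x0"
  define L where "L h = (\<Sum>i\<in>Basis. (grad (partial_deriv i \<phi>) x0 \<bullet> h) *\<^sub>R i)" for h
  have L: "linear L"
    by (rule linearI) (auto simp: L_def inner_add_right scaleR_add_left sum.distrib scaleR_sum_right)
  have gd: "(grad \<phi> has_derivative L) (at x0)"
  proof -
    have "((\<lambda>x. \<Sum>i\<in>Basis. partial_deriv i \<phi> x *\<^sub>R i) has_derivative L) (at x0)"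
      unfolding L_def by (intro has_derivative_sum has_derivative_scaleR_left grad_has_derivative d2)
    moreover have "grad \<phi> = (\<lambda>x. \<Sum>i\<in>Basis. partial_deriv i \<phi> x *\<^sub>R i)" by (rule ext) (simp add: grad_def)
    ultimately show ?thesis by simp
  qed
  obtain A where A: "sym_op A" "\<And>h. h \<bullet> A h = h \<bullet> L h" using sym_part[OF L] by blast
  have bLb: "b \<bullet> A b = infinity_laplacian \<phi> x0"
  proof -
    have "b \<bullet> L b = (\<Sum>i\<in>Basis. (b \<bullet> i) * (grad (partial_deriv i \<phi>) x0 \<bullet> b))"
      by (simp add: L_def inner_sum_right mult.commute)
    also have "\<dots> = (\<Sum>i\<in>Basis. \<Sum>j\<in>Basis. partial_deriv i \<phi> x0 * partial_deriv j \<phi> x0 * partial_deriv j (partial_deriv i \<phi>) x0)"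
    proof (rule sum.cong[OF refl])
      fix i :: 'a assume i: "i \<in> Basis"
      have "grad (partial_deriv i \<phi>) x0 \<bullet> b = (\<Sum>j\<in>Basis. partial_deriv j (partial_deriv i \<phi>) x0 * partial_deriv j \<phi> x0)"
        by (subst euclidean_inner) (simp add: b_def grad_inner_Basis)
      then show "(b \<bullet> i) * (grad (partial_deriv i \<phi>) x0 \<bullet> b) = (\<Sum>j\<in>Basis. partial_deriv i \<phi> x0 * partial_deriv j \<phi> x0 * partial_deriv j (partial_deriv i \<phi>) x0)"
        using i by (simp add: b_def grad_inner_Basis sum_distrib_left mult_ac)
    qed
    finally show ?thesis by (simp add: A(2) infinity_laplacian_def)
  qed
  have T: "\<exists>\<delta>>0. \<forall>h. norm h < \<delta> \<longrightarrow> \<bar>\<phi> (x0 + h) - quad (\<phi> x0) b A x0 (x0 + h)\<bar> \<le> \<kappa> * (norm h)\<^sup>2" if \<kappa>: "\<kappa> > 0" for \<kappa>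
  proof -
    obtain \<delta>0 where \<delta>0: "\<delta>0 > 0" "\<And>y. norm (y - x0) < \<delta>0 \<Longrightarrow> norm (grad \<phi> y - grad \<phi> x0 - L (y - x0)) \<le> \<kappa> * norm (y - x0)"
      using gd \<kappa> unfolding has_derivative_at_alt by blast
    define \<delta> where "\<delta> = min \<delta>0 r"
    have "\<bar>\<phi> (x0 + h) - quad (\<phi> x0) b A x0 (x0 + h)\<bar> \<le> \<kappa> * (norm h)\<^sup>2" if h: "norm h < \<delta>" for h
    proof -
      define g where "g t = \<phi> (x0 + t *\<^sub>R h) - quad (\<phi> x0) b A x0 (x0 + t *\<^sub>R h)" for t
      define g' where "g' t = (grad \<phi> (x0 + t *\<^sub>R h) - (b + A (t *\<^sub>R h))) \<bullet> h" for t
      have th: "norm (t *\<^sub>R h) < \<delta>" "norm (t *\<^sub>R h) \<le> norm h" if "0 \<le> t" "t \<le> 1" for t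
        using that h mult_right_mono[of t 1 "norm h"] by auto
      have dg: "(g has_real_derivative g' t) (at t)" if t: "0 \<le> t" "t \<le> 1" for t
      proof -
        have inb: "x0 + t *\<^sub>R h \<in> ball x0 r" using th(1)[OF t] by (simp add: dist_norm \<delta>_def)
        have l: "((\<lambda>t. x0 + t *\<^sub>R h) has_derivative (\<lambda>s. s *\<^sub>R h)) (at t)" by (auto intro!: derivative_eq_intros)
        have "(g has_derivative (\<lambda>s. grad \<phi> (x0 + t *\<^sub>R h) \<bullet> (s *\<^sub>R h) - (b + A (x0 + t *\<^sub>R h - x0)) \<bullet> (s *\<^sub>R h))) (at t)"
          unfolding g_def
          by (intro has_derivative_diff has_derivative_compose[OF l grad_has_derivative[OF d1[OF inb]]]
              has_derivative_compose[OF l quad_has_derivative[OF A(1)]])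
        then show ?thesis unfolding has_field_derivative_def
          by (rule has_derivative_eq_rhs) (auto simp: g'_def inner_diff_left algebra_simps)
      qed
      obtain z where z: "0 < z" "z < 1" "g 1 - g 0 = (1 - 0) * g' z"
        using MVT2[of 0 1 g g'] dg by auto
      have "g' z = (grad \<phi> (x0 + z *\<^sub>R h) - grad \<phi> x0 - L (z *\<^sub>R h)) \<bullet> h"
      proof -
        have "A (z *\<^sub>R h) \<bullet> h = z * (h \<bullet> A h)" using linear_cmul[OF sym_opD(1)[OF A(1)]] by (simp add: inner_commute)
        moreover have "L (z *\<^sub>R h) \<bullet> h = z * (h \<bullet> L h)" using linear_cmul[OF L] by (simp add: inner_commute)
        ultimately show ?thesis by (simp add: g'_def b_def A(2) inner_diff_left inner_add_left)
      qed
      also have "\<bar>\<dots>\<bar> \<le> norm (grad \<phi> (x0 + z *\<^sub>R h) - grad \<phi> x0 - L (z *\<^sub>R h)) * norm h"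
        by (rule Cauchy_Schwarz_ineq2)
      also have "\<dots> \<le> (\<kappa> * norm (z *\<^sub>R h)) * norm h"
        using \<delta>0(2)[of "x0 + z *\<^sub>R h"] th(1)[of z] z by (intro mult_right_mono) (auto simp: \<delta>_def)
      also have "\<dots> \<le> (\<kappa> * norm h) * norm h"
        using th(2)[of z] z \<kappa> by (intro mult_right_mono mult_left_mono) auto
      finally have "\<bar>g 1 - g 0\<bar> \<le> \<kappa> * (norm h)\<^sup>2" using z(3) by (simp add: power2_eq_square mult.assoc)
      moreover have "g 0 = 0" by (simp add: g_def quad_def linear_0[OF sym_opD(1)[OF A(1)]])
      ultimately show ?thesis by (simp add: g_def)
    qed
    moreover have "\<delta> > 0" using \<delta>0 r by (simp add: \<delta>_def)
    ultimately show ?thesis by blast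
  qed
  show thesis by (rule that[OF A(1)]) (use bLb T in \<open>auto simp: b_def\<close>)
qed

lemma infinity_laplacian_uminus:
  fixes \<phi> :: "'a::euclidean_space \<Rightarrow> real"
  assumes C2: "Ck_on 2 (ball x0 r) \<phi>" and r: "r > 0"
  shows "infinity_laplacian (\<lambda>x. - \<phi> x) x0 = - infinity_laplacian \<phi> x0" "Ck_on 2 (ball x0 r) (\<lambda>x. - \<phi> x)"
proof -
  have C2': "Ck_on (Suc (Suc 0)) (ball x0 r) \<phi>" using C2 by (simp add: numeral_2_eq_2)
  show "Ck_on 2 (ball x0 r) (\<lambda>x. - \<phi> x)" using Ck_on_cmult[OF open_ball C2, of "- 1"] by simp
  have d1: "\<phi> differentiable (at x)" if "x \<in> ball x0 r" for x using C2' that by simp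
  have d2: "partial_deriv i \<phi> differentiable (at x0)" if "i \<in> Basis" for i
    using C2' that r by simp
  have neg: "partial_deriv i (\<lambda>x. - f x) x = - partial_deriv i f x" if "f differentiable (at x)" for f :: "'a \<Rightarrow> real" and i x
    by (rule partial_deriv_eq[OF has_derivative_minus[OF grad_has_derivative[OF that], THEN has_derivative_eq_rhs]])
       (auto simp: partial_deriv_eq[OF grad_has_derivative[OF that]])
  have 1: "partial_deriv i (\<lambda>x. - \<phi> x) x = - partial_deriv i \<phi> x" if "x \<in> ball x0 r" for i x
    by (rule neg[OF d1[OF that]])
  have 2: "partial_deriv j (partial_deriv i (\<lambda>x. - \<phi> x)) x0 = - partial_deriv j (partial_deriv i \<phi>) x0" if i: "i \<in> Basis" for i j
  proof -
    have d: "(\<lambda>x. - partial_deriv i \<phi> x) differentiable (at x0)" using d2[OF i] by (rule differentiable_minus)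
    have "partial_deriv j (\<lambda>x. - partial_deriv i \<phi> x) x0 = partial_deriv j (partial_deriv i (\<lambda>x. - \<phi> x)) x0"
      by (rule partial_deriv_cong(2)[OF open_ball[of x0 r] _ _ d]) (use 1 r in auto)
    then show ?thesis using neg[OF d2[OF i]] by simp
  qed
  have x0: "x0 \<in> ball x0 r" using r by simp
  show "infinity_laplacian (\<lambda>x. - \<phi> x) x0 = - infinity_laplacian \<phi> x0"
    unfolding infinity_laplacian_def sum_negf[symmetric]
    by (intro sum.cong refl) (simp add: 1[OF x0] 2)
qed

lemma viscosity_subsolution_uminus:
  assumes "viscosity_supersolution D (\<lambda>x. - u x)"
  shows "viscosity_subsolution D u"
  unfolding viscosity_subsolution_def
proof (intro conjI ballI allI impI)
  show "continuous_on D u"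
    using continuous_on_minus[of D "\<lambda>x. - u x"] assms by (simp add: viscosity_supersolution_def)
  fix x0 r \<phi> assume x0: "x0 \<in> D" and r: "r > (0::real)"
    and a: "ball x0 r \<subseteq> D \<and> Ck_on 2 (ball x0 r) \<phi> \<and> (\<forall>x\<in>ball x0 r - {x0}. 0 < \<phi> x - u x) \<and> \<phi> x0 - u x0 = 0"
  note n = infinity_laplacian_uminus[OF _ r, of x0 \<phi>]
  have "ball x0 r \<subseteq> D \<and> Ck_on 2 (ball x0 r) (\<lambda>x. - \<phi> x) \<and> (\<forall>x\<in>ball x0 r - {x0}. - \<phi> x - - u x < 0) \<and> - \<phi> x0 - - u x0 = 0"
    using a n(2) by force
  then have "0 \<le> - infinity_laplacian (\<lambda>x. - \<phi> x) x0"
    using assms x0 r unfolding viscosity_supersolution_def by blast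
  then show "- infinity_laplacian \<phi> x0 \<le> 0" using n(1) a by simp
qed

context bdd_domain
begin

text \<open>Perturbing the Taylor polynomial of a touching function makes it a strict subsolution of the
  \<open>p\<close>-Laplace equation for large \<open>p\<close>, uniformly on a ball, so it can be compared with \<open>v n\<close>.\<close>

lemma viscosity_supersolution_limit:
  assumes D: "open D" "D \<subseteq> \<Omega>" and V: "continuous_on (closure \<Omega>) V"
    and v: "\<And>n. v n \<in> W01p \<Omega> (P n)" and P: "\<And>n. P n \<ge> 2 * real DIM('a)" and dim: "DIM('a) \<ge> 2"
    and Plim: "filterlim P at_top sequentially"
    and lim: "uniform_limit (closure \<Omega>) v V sequentially"
    and weak: "\<And>n \<phi>. \<phi> \<in> W01p \<Omega> (P n) \<Longrightarrow>
      (\<integral>x. norm (weak_grad \<Omega> (v n) x) powr (P n - 2) * (weak_grad \<Omega> (v n) x \<bullet> weak_grad \<Omega> \<phi> x) \<partial>lebesgue_on \<Omega>)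
        = (\<integral>x. f n x * \<phi> x \<partial>lebesgue_on \<Omega>)"
    and fc: "\<And>n. continuous_on (closure \<Omega>) (f n)"
    and src: "\<And>x c. x \<in> D \<Longrightarrow> 0 < c \<Longrightarrow> c < 1 \<Longrightarrow>
      \<exists>\<rho>>0. \<forall>\<^sub>F n in sequentially. \<forall>y\<in>cball x \<rho>. y \<in> \<Omega> \<longrightarrow> - (c powr P n) \<le> f n y"
  shows "viscosity_supersolution D V"
  unfolding viscosity_supersolution_def
proof (intro conjI ballI allI impI)
  show "continuous_on D V" by (rule continuous_on_subset[OF V order_trans[OF D(2) closure_subset]])
  fix x0 r \<phi> assume x0: "x0 \<in> D" and r: "r > (0::real)"
    and a: "ball x0 r \<subseteq> D \<and> Ck_on 2 (ball x0 r) \<phi> \<and> (\<forall>x\<in>ball x0 r - {x0}. \<phi> x - V x < 0) \<and> \<phi> x0 - V x0 = 0"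
  show "0 \<le> - infinity_laplacian \<phi> x0"
  proof (rule ccontr)
    assume neg: "\<not> 0 \<le> - infinity_laplacian \<phi> x0"
    have C2: "Ck_on 2 (ball x0 r) \<phi>" using a by blast
    define b where "b = grad \<phi> x0"
    obtain A0 where A0: "sym_op A0" "b \<bullet> A0 b = infinity_laplacian \<phi> x0"
      and Tay: "\<And>\<kappa>. \<kappa> > 0 \<Longrightarrow> \<exists>\<delta>>0. \<forall>h. norm h < \<delta> \<longrightarrow> \<bar>\<phi> (x0 + h) - quad (\<phi> x0) b A0 x0 (x0 + h)\<bar> \<le> \<kappa> * (norm h)\<^sup>2"
      by (rule C2_Taylor[OF C2 r, folded b_def]) (rule that; assumption?)
    have pos: "b \<bullet> A0 b > 0" using neg A0(2) by simp
    then have b: "b \<noteq> 0" by auto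
    have bb: "b \<bullet> b > 0" using b by simp
    \<comment> \<open>Subtracting \<open>2 * \<kappa>\<close> from the Hessian removes exactly half
      of \<open>b \<bullet> A0 b\<close>, so the infinity Laplacian stays positive while the
      quadratic falls strictly below \<open>\<phi>\<close> around \<open>x0\<close>.\<close>
    define \<kappa> where "\<kappa> = (b \<bullet> A0 b) / (4 * (b \<bullet> b))"
    have \<kappa>: "\<kappa> > 0" using pos bb by (simp add: \<kappa>_def)
    define A where "A h = A0 h - (2 * \<kappa>) *\<^sub>R h" for h
    have linA: "linear A" using sym_opD(1)[OF A0(1)] unfolding A_def
      by (intro linear_compose_sub linear_compose_scale_right linear_ident) (auto simp: linear_id[unfolded id_def])
    have A: "sym_op A" using linA sym_opD(2)[OF A0(1)]
      by (auto simp: sym_op_def A_def inner_diff_left inner_diff_right inner_commute)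
    define G where "G h = (b + A h) \<bullet> A (b + A h)" for h
    define \<gamma> where "\<gamma> = G 0 / 2"
    have \<gamma>: "\<gamma> > 0"
    proof -
      have "G 0 = b \<bullet> A0 b - 2 * \<kappa> * (b \<bullet> b)" unfolding G_def linear_0[OF linA] by (simp add: A_def inner_diff_right)
      also have "\<dots> = (b \<bullet> A0 b) / 2" using bb by (simp add: \<kappa>_def field_simps)
      finally show ?thesis using pos by (simp add: \<gamma>_def)
    qed
    have Ac: "continuous_on UNIV A" by (rule sym_op_continuous[OF A])
    have "continuous_on UNIV G"
      unfolding G_def by (intro continuous_intros continuous_on_compose2[OF Ac] Ac) auto
    then have op1: "open (G -` {\<gamma><..})" by (rule open_vimage[OF open_greaterThan])
    have "continuous_on UNIV (\<lambda>h. norm (b + A h))" by (intro continuous_intros Ac)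
    then have op2: "open ((\<lambda>h. norm (b + A h)) -` {norm b / 2<..<2 * norm b})" by (rule open_vimage[OF open_greaterThanLessThan])
    have "0 \<in> G -` {\<gamma><..} \<inter> (\<lambda>h. norm (b + A h)) -` {norm b / 2<..<2 * norm b}"
      using \<gamma> b linear_0[OF linA] by (simp add: \<gamma>_def)
    then obtain \<delta>1 where \<delta>1: "\<delta>1 > 0" "ball 0 \<delta>1 \<subseteq> G -` {\<gamma><..} \<inter> (\<lambda>h. norm (b + A h)) -` {norm b / 2<..<2 * norm b}"
      using openE[OF open_Int[OF op1 op2]] by metis
    have G1: "G h > \<gamma>" "norm (b + A h) > norm b / 2" "norm (b + A h) < 2 * norm b" if "norm h < \<delta>1" for h
    proof -
      have "h \<in> ball 0 \<delta>1" using that by simp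
      then have "h \<in> G -` {\<gamma><..} \<inter> (\<lambda>h. norm (b + A h)) -` {norm b / 2<..<2 * norm b}" using \<delta>1(2) by blast
      then show "G h > \<gamma>" "norm (b + A h) > norm b / 2" "norm (b + A h) < 2 * norm b" by auto
    qed
    have "\<kappa> / 2 > 0" using \<kappa> by simp
    from Tay[OF this] obtain \<delta>2 where \<delta>2: "\<delta>2 > 0"
      "\<And>h. norm h < \<delta>2 \<Longrightarrow> \<bar>\<phi> (x0 + h) - quad (\<phi> x0) b A0 x0 (x0 + h)\<bar> \<le> (\<kappa> / 2) * (norm h)\<^sup>2" by blast
    \<comment> \<open>A lower bound for the gradient on the ball, capped at 1 so that
      \<open>\<beta> powr p \<le> \<beta> powr (p - 4)\<close>. The source is then bounded with
      \<open>c = \<beta> / 2\<close>, which makes the differential inequality strict.\<close>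
    define \<beta> where "\<beta> = min (norm b / 2) 1"
    have \<beta>: "0 < \<beta>" "\<beta> \<le> 1" "\<beta> \<le> norm b / 2" using b by (auto simp: \<beta>_def)
    obtain \<rho>1 where \<rho>1: "\<rho>1 > 0" and ev1: "\<forall>\<^sub>F n in sequentially. \<forall>y\<in>cball x0 \<rho>1. y \<in> \<Omega> \<longrightarrow> - ((\<beta> / 2) powr P n) \<le> f n y"
      using src[OF x0, of "\<beta> / 2"] \<beta> by auto
    define \<rho> where "\<rho> = min (min \<delta>1 \<delta>2) (min r \<rho>1) / 2"
    have \<rho>: "\<rho> > 0" "\<rho> < \<delta>1" "\<rho> < \<delta>2" "\<rho> < r" "\<rho> < \<rho>1" using \<delta>1(1) \<delta>2(1) r \<rho>1 by (auto simp: \<rho>_def min_def)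
    \<comment> \<open>On the sphere the modified quadratic lies at least
      \<open>\<kappa> * \<rho>\<^sup>2 / 2 = 2 * m\<close> below \<open>V\<close>, after deducting
      the Taylor error. Raising it by \<open>m\<close> leaves \<open>m\<close> for the uniform error
      of \<open>v n\<close>, yet puts it \<open>m\<close> above \<open>V\<close> at the
      centre.\<close>
    define m where "m = \<kappa> * \<rho>\<^sup>2 / 4"
    have m: "m > 0" using \<kappa> \<rho> by (simp add: m_def)
    have cb: "cball x0 \<rho> \<subseteq> \<Omega>" using a D(2) \<rho> by (force simp: subset_iff)
    have w0: "\<phi> x0 = V x0" using a by simp
    have bdry: "quad (V x0) b A x0 y + 2 * m \<le> V y" if y: "y \<in> sphere x0 \<rho>" for y
    proof -
      define h where "h = y - x0"
      have nh: "norm h = \<rho>" and yh: "y = x0 + h" using y by (auto simp: h_def dist_norm norm_minus_commute)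
      have "quad (V x0) b A x0 y = quad (\<phi> x0) b A0 x0 y - \<kappa> * (norm h)\<^sup>2"
        by (simp add: quad_def A_def w0 yh inner_diff_right power2_norm_eq_inner field_simps)
      moreover have "quad (\<phi> x0) b A0 x0 y \<le> \<phi> y + (\<kappa> / 2) * (norm h)\<^sup>2"
      proof -
        have "\<bar>\<phi> (x0 + h) - quad (\<phi> x0) b A0 x0 (x0 + h)\<bar> \<le> (\<kappa> / 2) * (norm h)\<^sup>2"
          by (rule \<delta>2(2)) (use nh \<rho> in simp)
        then show ?thesis unfolding yh by linarith
      qed
      moreover have "y \<in> ball x0 r - {x0}" using y \<rho> by auto
      then have "\<phi> y < V y" using a by force
      moreover have "\<kappa> * (norm h)\<^sup>2 = 4 * m" by (simp add: m_def nh)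
      ultimately show ?thesis by (simp add: algebra_simps)
    qed
    have ev2: "\<forall>\<^sub>F n in sequentially. \<forall>x\<in>closure \<Omega>. dist (v n x) (V x) < m" by (rule uniform_limitD[OF lim m])
    \<comment> \<open>Beyond this exponent the infinity Laplacian part, at least
      \<open>(p - 2) * \<gamma>\<close>, outweighs the trace part by 1; \<open>p \<ge> 4\<close>
      keeps the exponent \<open>p - 4\<close> nonnegative, so that powers are monotone in the
      gradient norm.\<close>
    define T where "T = max 4 (2 + (1 + (2 * norm b)\<^sup>2 * \<bar>trace_op A\<bar>) / \<gamma>)"
    have ev3: "\<forall>\<^sub>F n in sequentially. P n \<ge> T" using Plim by (simp add: filterlim_at_top)
    have "\<forall>\<^sub>F n in sequentially. False"
      using ev1 ev2 ev3
    proof eventually_elim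
      case (elim n)
      let ?p = "P n"
      have p4: "?p \<ge> 4" and pT: "(?p - 2) * \<gamma> \<ge> 1 + (2 * norm b)\<^sup>2 * \<bar>trace_op A\<bar>"
      proof -
        show "?p \<ge> 4" using elim(3) by (simp add: T_def)
        have "?p - 2 \<ge> (1 + (2 * norm b)\<^sup>2 * \<bar>trace_op A\<bar>) / \<gamma>" using elim(3) by (simp add: T_def)
        then show "(?p - 2) * \<gamma> \<ge> 1 + (2 * norm b)\<^sup>2 * \<bar>trace_op A\<bar>" using \<gamma> by (simp add: pos_divide_le_eq)
      qed
      have plap: "quad_plap ?p A (b + A h) > (\<beta> / 2) powr ?p" if h: "norm h < \<delta>1" for h
      proof -
        define g where "g = b + A h"
        have g: "g \<bullet> A g > \<gamma>" "norm g > norm b / 2" "norm g < 2 * norm b" using G1[OF h] by (auto simp: G_def g_def)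
        have "norm b / 2 > 0" using b by simp
        then have gpos: "norm g > 0" using g(2) by linarith
        have "norm g powr (?p - 2) = norm g powr (?p - 4) * (norm g)\<^sup>2"
        proof -
          have "norm g powr (?p - 2) = norm g powr (?p - 4) * norm g powr 2" by (subst powr_add[symmetric]) simp
          then show ?thesis using gpos by simp
        qed
        then have eq: "quad_plap ?p A g = norm g powr (?p - 4) * ((norm g)\<^sup>2 * trace_op A + (?p - 2) * (g \<bullet> A g))"
          by (simp add: quad_plap_def algebra_simps)
        have "(norm g)\<^sup>2 * \<bar>trace_op A\<bar> \<le> (2 * norm b)\<^sup>2 * \<bar>trace_op A\<bar>"
          using g(3) by (intro mult_right_mono power_mono) auto
        then have "(norm g)\<^sup>2 * trace_op A \<ge> - ((2 * norm b)\<^sup>2 * \<bar>trace_op A\<bar>)"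
        proof -
          have "- \<bar>trace_op A\<bar> \<le> trace_op A" by simp
          then have "(norm g)\<^sup>2 * - \<bar>trace_op A\<bar> \<le> (norm g)\<^sup>2 * trace_op A" by (intro mult_left_mono) auto
          then show ?thesis using \<open>(norm g)\<^sup>2 * \<bar>trace_op A\<bar> \<le> (2 * norm b)\<^sup>2 * \<bar>trace_op A\<bar>\<close> by simp
        qed
        moreover have "(?p - 2) * (g \<bullet> A g) \<ge> (?p - 2) * \<gamma>" using g(1) p4 by (intro mult_left_mono) auto
        ultimately have ge1: "(norm g)\<^sup>2 * trace_op A + (?p - 2) * (g \<bullet> A g) \<ge> 1" using pT by linarith
        have "norm g powr (?p - 4) * ((norm g)\<^sup>2 * trace_op A + (?p - 2) * (g \<bullet> A g)) \<ge> norm g powr (?p - 4) * 1"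
          using ge1 by (intro mult_left_mono) auto
        moreover have "\<beta> powr ?p \<le> \<beta> powr (?p - 4)" using \<beta> by (intro powr_mono') auto
        moreover have "\<beta> powr (?p - 4) \<le> norm g powr (?p - 4)" using \<beta> g(2) p4 by (intro powr_mono2) auto
        moreover have "(\<beta> / 2) powr ?p < \<beta> powr ?p" using \<beta> p4 by (intro powr_less_mono2) auto
        ultimately show ?thesis unfolding g_def[symmetric] eq by linarith
      qed
      have "quad (V x0 + m) b A x0 x0 \<le> v n x0"
      proof (rule quad_comparison[OF v P weak fc A \<rho>(1) cb])
        fix y assume y: "y \<in> cball x0 \<rho>"
        then have "norm (y - x0) < \<delta>1" using \<rho> by (simp add: dist_norm norm_minus_commute)
        from G1(2)[OF this] b show "b + A (y - x0) \<noteq> 0" by auto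
      next
        fix y assume y: "y \<in> ball x0 \<rho>"
        then have "norm (y - x0) < \<delta>1" using \<rho> by (simp add: dist_norm norm_minus_commute)
        from plap[OF this] have "quad_plap ?p A (b + A (y - x0)) > (\<beta> / 2) powr ?p" .
        moreover have "y \<in> cball x0 \<rho>1" "y \<in> \<Omega>" using y \<rho> cb by auto
        then have "- ((\<beta> / 2) powr ?p) \<le> f n y" using elim(1) by blast
        ultimately show "- quad_plap ?p A (b + A (y - x0)) < f n y" by linarith
      next
        fix y assume y: "y \<in> sphere x0 \<rho>"
        then have "y \<in> cball x0 \<rho>" by auto
        then have "y \<in> closure \<Omega>" using cb closure_subset by blast
        then have "\<bar>v n y - V y\<bar> < m" using elim(2) by (auto simp: dist_real_def)
        moreover have "quad (V x0 + m) b A x0 y = quad (V x0) b A x0 y + m" by (simp add: quad_def)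
        ultimately show "quad (V x0 + m) b A x0 y \<le> v n y" using bdry[OF y] by linarith
      qed (use \<rho> in auto)
      moreover have "quad (V x0 + m) b A x0 x0 = V x0 + m" by (simp add: quad_def)
      moreover have "x0 \<in> closure \<Omega>" using x0 D(2) closure_subset by blast
      then have "\<bar>v n x0 - V x0\<bar> < m" using elim(2) by (auto simp: dist_real_def)
      ultimately show False by linarith
    qed
    then show False by simp
  qed
qed

end

section \<open>Lipschitz functions\<close>

text \<open>Convex combinations of the tail from \<open>m\<close> on with dyadic weights. Midpoints
  are all that the parallelogram law asks for, and they preserve norm bounds as well as closeness of
  linear functionals to a limit.\<close>

inductive mid_closure :: "(nat \<Rightarrow> 'a \<Rightarrow> 'b::real_vector) \<Rightarrow> nat \<Rightarrow> ('a \<Rightarrow> 'b) \<Rightarrow> bool" for F m where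
  base: "n \<ge> m \<Longrightarrow> mid_closure F m (F n)"
| midpoint: "mid_closure F m f \<Longrightarrow> mid_closure F m g \<Longrightarrow> mid_closure F m (\<lambda>x. (f x + g x) /\<^sub>R 2)"

lemma mid_closure_mono:
  assumes "mid_closure F m f" "k \<le> m" shows "mid_closure F k f"
  using assms(1)
proof induction
  case (base n)
  then show ?case using assms(2) by (intro mid_closure.base) simp
next
  case (midpoint f g)
  show ?case by (rule mid_closure.midpoint[OF midpoint(3,4)])
qed

context bdd_domain
begin

lemma Linf_memI:
  assumes "f \<in> borel_measurable (lebesgue_on \<Omega>)" "AE x in lebesgue_on \<Omega>. norm (f x) \<le> B"
  shows "Linf_mem \<Omega> f"
proof -
  have "esssup (lebesgue_on \<Omega>) (\<lambda>x. ereal (norm (f x))) \<le> ereal B"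
    by (rule esssup_I) (use assms in auto)
  then have "esssup (lebesgue_on \<Omega>) (\<lambda>x. ereal (norm (f x))) < \<infinity>" by (rule le_less_trans) simp
  then show ?thesis using assms by (simp add: Linf_mem_def)
qed

text \<open>Near-minimisers of the norm over midpoint-closed tails form a Cauchy sequence, by the
  parallelogram law; this replaces weak compactness of bounded sets.\<close>

lemma mid_closure_Cauchy:
  fixes F :: "nat \<Rightarrow> 'a \<Rightarrow> 'a"
  assumes F: "\<And>n. Lp_mem \<Omega> 2 (F n)"
    and C: "\<And>n. Lp_norm \<Omega> 2 (F n) \<le> C"
  shows "\<exists>f G. (\<forall>n. mid_closure F n (f n)) \<and> Lp_mem \<Omega> 2 G \<and> (\<lambda>n. Lp_norm \<Omega> 2 (\<lambda>x. f n x - G x)) \<longlonglongrightarrow> 0"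
proof -
  have L: "Lp_mem \<Omega> 2 f" if "mid_closure F m f" for m f
    using that by induction (auto intro!: F Lp_mem_scale Lp_mem_add)
  \<comment> \<open>The infimum over the tail from \<open>m\<close> on. It increases with
    \<open>m\<close> and is bounded by \<open>C\<close>, so it converges; near-minimisers of late
    tails then have almost the norm that their midpoints cannot undercut.\<close>
  define D where "D m = Inf {Lp_norm \<Omega> 2 f | f. mid_closure F m f}" for m
  have bdd: "bdd_below {Lp_norm \<Omega> 2 f | f. mid_closure F m f}" for m by (auto intro!: bdd_belowI[where m = 0])
  have ne: "{Lp_norm \<Omega> 2 f | f. mid_closure F m f} \<noteq> {}" for m using base[of m m F] by blast
  have Dle: "D m \<le> Lp_norm \<Omega> 2 f" if "mid_closure F m f" for m f
    unfolding D_def using that by (intro cInf_lower bdd) auto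
  have D0: "D m \<ge> 0" for m unfolding D_def by (rule cInf_greatest[OF ne]) auto
  have Dmono: "D k \<le> D m" if "k \<le> m" for k m
    unfolding D_def using that by (intro cInf_superset_mono ne bdd) (auto intro: mid_closure_mono)
  have DC: "D m \<le> C" for m using Dle[OF base[of m m F]] C[of m] by simp
  have "incseq D" using Dmono by (simp add: incseq_def)
  then obtain d where d: "D \<longlonglongrightarrow> d" "\<And>i. D i \<le> d" using incseq_convergent[of D C] DC by auto
  have d0: "d \<ge> 0" using d(2)[of 0] D0[of 0] by linarith
  have "\<exists>f. mid_closure F m f \<and> Lp_norm \<Omega> 2 f < D m + 1 / Suc m" for m
  proof -
    have "Inf {Lp_norm \<Omega> 2 f | f. mid_closure F m f} < D m + 1 / Suc m" by (simp add: D_def)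
    then show ?thesis using cInf_less_iff[OF ne bdd] by blast
  qed
  then obtain f where f: "\<And>m. mid_closure F m (f m)" "\<And>m. Lp_norm \<Omega> 2 (f m) < D m + 1 / Suc m" by metis
  have cauchy: "\<exists>N. \<forall>m\<ge>N. \<forall>n\<ge>N. Lp_norm \<Omega> 2 (\<lambda>x. f m x - f n x) < e" if e: "e > 0" for e
  proof -
    have "(\<lambda>M. (d + 1 / Suc M)\<^sup>2 - (D M)\<^sup>2) \<longlonglongrightarrow> (d + 0)\<^sup>2 - d\<^sup>2"
      by (intro tendsto_intros LIMSEQ_Suc[OF lim_1_over_n] d(1))
    then have "\<forall>\<^sub>F M in sequentially. (d + 1 / Suc M)\<^sup>2 - (D M)\<^sup>2 < (e / 2)\<^sup>2"
      using e by (intro order_tendstoD(2)) auto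
    then obtain M where M: "(d + 1 / Suc M)\<^sup>2 - (D M)\<^sup>2 < (e / 2)\<^sup>2" by (auto simp: eventually_sequentially)
    have small: "Lp_norm \<Omega> 2 (f m) \<le> d + 1 / Suc M" if "m \<ge> M" for m
    proof -
      have "1 / real (Suc m) \<le> 1 / real (Suc M)" using that by (simp add: frac_le)
      then show ?thesis using f(2)[of m] d(2)[of m] by linarith
    qed
    have pw: "x powr 2 = x\<^sup>2" if "x \<ge> 0" for x :: real using that by simp
    show ?thesis
    proof (intro exI allI impI)
      fix m n assume mn: "M \<le> m" "M \<le> n"
      have mem: "mid_closure F M (\<lambda>x. (f m x + f n x) /\<^sub>R 2)"
        by (intro midpoint mid_closure_mono[OF f(1)] mn)
      define X where "X = Lp_norm \<Omega> 2 (\<lambda>x. f m x - f n x)"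
      have half: "Lp_norm \<Omega> 2 (\<lambda>x. (f m x - f n x) /\<^sub>R 2) = X / 2"
        unfolding X_def by (subst Lp_norm_scale) auto
      have "Lp_norm \<Omega> 2 (\<lambda>x. (f m x + f n x) /\<^sub>R 2) powr 2 + Lp_norm \<Omega> 2 (\<lambda>x. (f m x - f n x) /\<^sub>R 2) powr 2
          \<le> (Lp_norm \<Omega> 2 (f m) powr 2 + Lp_norm \<Omega> 2 (f n) powr 2) / 2"
        by (rule Clarkson_integral[OF L[OF f(1)] L[OF f(1)]]) simp
      then have c1: "(Lp_norm \<Omega> 2 (\<lambda>x. (f m x + f n x) /\<^sub>R 2))\<^sup>2 + (X / 2)\<^sup>2
          \<le> ((Lp_norm \<Omega> 2 (f m))\<^sup>2 + (Lp_norm \<Omega> 2 (f n))\<^sup>2) / 2"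
        by (simp only: pw[OF Lp_norm_nonneg] half[symmetric])
      have c2: "(Lp_norm \<Omega> 2 (f m))\<^sup>2 \<le> (d + 1 / Suc M)\<^sup>2" "(Lp_norm \<Omega> 2 (f n))\<^sup>2 \<le> (d + 1 / Suc M)\<^sup>2"
        using small[OF mn(1)] small[OF mn(2)] by (auto intro!: power_mono)
      have c3: "(D M)\<^sup>2 \<le> (Lp_norm \<Omega> 2 (\<lambda>x. (f m x + f n x) /\<^sub>R 2))\<^sup>2"
        using Dle[OF mem] D0 by (intro power_mono)
      have comb: "b < c" if "a + b \<le> (s + t) / 2" "s \<le> z" "t \<le> z" "y \<le> a" "z - y < c" for a b c s t y z :: real
      proof -
        have "(s + t) / 2 \<le> z" using that(2,3) by (simp add: field_simps)
        then show ?thesis using that(1,4,5) by linarith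
      qed
      have "(X / 2)\<^sup>2 < (e / 2)\<^sup>2" by (rule comb[OF c1 c2 c3 M])
      then have "X / 2 < e / 2" by (rule power2_less_imp_less) (use e in simp)
      then show "Lp_norm \<Omega> 2 (\<lambda>x. f m x - f n x) < e" by (simp add: X_def)
    qed
  qed
  obtain G where "Lp_mem \<Omega> 2 G" "(\<lambda>n. Lp_norm \<Omega> 2 (\<lambda>x. f n x - G x)) \<longlonglongrightarrow> 0"
    using Lp_complete[OF lmeas L[OF f(1)] _ cauchy] by auto
  then show ?thesis using f(1) by blast
qed

text \<open>A segment leaving the domain crosses the boundary, where \<open>u\<close> vanishes, so
  the constant is preserved on the whole space.\<close>

lemma zero_extension_lipschitz:
  fixes u :: "'a \<Rightarrow> real"
  assumes u: "\<And>x y. x \<in> closure \<Omega> \<Longrightarrow> y \<in> closure \<Omega> \<Longrightarrow> \<bar>u x - u y\<bar> \<le> L * dist x y"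
    and fr: "\<And>x. x \<in> frontier \<Omega> \<Longrightarrow> u x = 0" and L: "L \<ge> 0"
  shows "\<bar>(if x \<in> \<Omega> then u x else 0) - (if y \<in> \<Omega> then u y else 0)\<bar> \<le> L * dist x y"
proof -
  have one: "\<bar>u x\<bar> \<le> L * dist x y" if "x \<in> \<Omega>" "y \<notin> \<Omega>" for x y
  proof -
    have "closed_segment x y \<inter> frontier \<Omega> \<noteq> {}"
      by (rule connected_Int_frontier) (use that in auto)
    then obtain z where z: "z \<in> closed_segment x y" "z \<in> frontier \<Omega>" by blast
    have "\<bar>u x - u z\<bar> \<le> L * dist x z" using u[of x z] that z(2) closure_subset by (auto simp: frontier_def)
    also have "\<dots> \<le> L * dist x y" using L dist_in_closed_segment[OF z(1)] by (intro mult_left_mono) (auto simp: dist_commute)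
    finally show ?thesis using fr[OF z(2)] by simp
  qed
  show ?thesis
    using one[of x y] one[of y x] u[of x y] closure_subset[of \<Omega>] L by (auto simp: dist_commute)
qed

text \<open>No pointwise derivative of \<open>u\<close> is used. The difference quotients of the
  zero extension are uniformly bounded and converge to the distributional gradient when tested;
  suitable midpoint combinations converge in L^2 as well, and their limit inherits both the bound
  and the tested values.\<close>

lemma W1inf_lipschitz:
  fixes u :: "'a \<Rightarrow> real"
  assumes u: "\<And>x y. x \<in> closure \<Omega> \<Longrightarrow> y \<in> closure \<Omega> \<Longrightarrow> \<bar>u x - u y\<bar> \<le> L * dist x y"
    and fr: "\<And>x. x \<in> frontier \<Omega> \<Longrightarrow> u x = 0" and L: "L \<ge> 0" and uc: "continuous_on (closure \<Omega>) u"
  shows "u \<in> W1inf \<Omega>"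
proof -
  define w where "w x = (if x \<in> \<Omega> then u x else 0)" for x
  have wl: "\<bar>w x - w y\<bar> \<le> L * dist x y" for x y
    unfolding w_def by (rule zero_extension_lipschitz[OF u fr L])
  have w0: "w x = 0" if "x \<notin> \<Omega>" for x using that by (simp add: w_def)
  have "L-lipschitz_on UNIV w" using wl L by (intro lipschitz_onI) (auto simp: dist_real_def)
  then have wc: "continuous_on UNIV w" by (rule lipschitz_on_continuous_on)
  \<comment> \<open>The forward difference quotients in all coordinate directions, assembled into a
    vector field.\<close>
  define F where "F n x = (\<Sum>b\<in>Basis. ((w (x + (1 / Suc n) *\<^sub>R b) - w x) * Suc n) *\<^sub>R b)" for n and x :: 'a
  have Fb: "F n x \<bullet> b = (w (x + (1 / Suc n) *\<^sub>R b) - w x) * Suc n" if "b \<in> Basis" for n x b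
    using that by (simp add: F_def inner_sum_left_Basis)
  have Fbd1: "\<bar>F n x \<bullet> b\<bar> \<le> L" if b: "b \<in> Basis" for n x b
  proof -
    have "\<bar>w (x + (1 / Suc n) *\<^sub>R b) - w x\<bar> \<le> L * (1 / Suc n)"
      using wl[of "x + (1 / Suc n) *\<^sub>R b" x] b by (simp add: dist_norm)
    then have "\<bar>w (x + (1 / Suc n) *\<^sub>R b) - w x\<bar> * Suc n \<le> L * (1 / Suc n) * Suc n" by (intro mult_right_mono) auto
    then show ?thesis using Fb[OF b] by (simp add: abs_mult)
  qed
  define B where "B = L * real DIM('a)"
  have Fbd: "norm (F n x) \<le> B" for n x
  proof -
    have "norm (F n x) \<le> (\<Sum>b\<in>Basis. \<bar>F n x \<bullet> b\<bar>)" by (rule norm_le_l1)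
    also have "\<dots> \<le> (\<Sum>b\<in>(Basis::'a set). L)" by (intro sum_mono Fbd1)
    finally show ?thesis by (simp add: B_def mult.commute)
  qed
  have Fc: "continuous_on UNIV (F n)" for n
    unfolding F_def by (intro continuous_intros continuous_on_compose2[OF wc] wc) auto
  have Fm: "F n \<in> borel_measurable (lebesgue_on \<Omega>)" for n
    by (rule borel_measurable_continuous_lebesgue_on[OF Fc sets_dom])
  have FL: "Lp_mem \<Omega> 2 (F n)" for n by (rule Lp_mem_bounded[OF lmeas Fm, of _ B]) (use Fbd in auto)
  have FC: "Lp_norm \<Omega> 2 (F n) \<le> measure lebesgue \<Omega> powr (1 / 2) * B" for n
  proof -
    have "Lp_norm \<Omega> 2 (\<lambda>x. norm (F n x)) \<le> measure lebesgue \<Omega> powr (1 / 2) * B"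
    proof (rule Lp_norm_le_sup)
      show "(\<lambda>x. norm (F n x)) \<in> borel_measurable (lebesgue_on \<Omega>)" using Fm by measurable
    qed (use Fbd L in \<open>auto simp: B_def\<close>)
    then show ?thesis by (simp add: Lp_norm_def)
  qed
  obtain f G where f: "\<And>n. mid_closure F n (f n)" and G: "Lp_mem \<Omega> 2 G" "(\<lambda>n. Lp_norm \<Omega> 2 (\<lambda>x. f n x - G x)) \<longlonglongrightarrow> 0"
    using mid_closure_Cauchy[of F, OF FL FC] by blast
  have midL: "Lp_mem \<Omega> 2 g" "norm (g x) \<le> B" if "mid_closure F m g" for m g x
  proof -
    show "Lp_mem \<Omega> 2 g" using that by induction (auto intro!: FL Lp_mem_scale Lp_mem_add)
    show "norm (g x) \<le> B" using that
    proof induction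
      case (midpoint f g)
      then show ?case using norm_triangle_ineq[of "f x" "g x"] by simp
    qed (rule Fbd)
  qed
  obtain r :: "nat \<Rightarrow> nat" where r: "AE x in lebesgue_on \<Omega>. (\<lambda>n. f (r n) x) \<longlonglongrightarrow> G x"
    using Lp_AE_subseq[OF midL(1)[OF f] G(1) _ G(2)] by auto
  have Gbd: "AE x in lebesgue_on \<Omega>. norm (G x) \<le> B"
    using r by eventually_elim (rule LIMSEQ_le_const2[OF tendsto_norm], assumption, use midL(2)[OF f] in blast)
  have wm: "w \<in> borel_measurable (lebesgue_on \<Omega>)" by (rule borel_measurable_continuous_lebesgue_on[OF wc sets_dom])
  have FlimT: "(\<lambda>n. \<integral>x. (F n x \<bullet> b) * \<psi> x \<partial>lebesgue_on \<Omega>) \<longlonglongrightarrow> - (\<integral>x. w x * partial_deriv b \<psi> x \<partial>lebesgue_on \<Omega>)"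
    if \<psi>: "test_function \<Omega> \<psi>" and b: "b \<in> Basis" for \<psi> b
  proof -
    obtain M where M: "M > 0" "\<And>x. \<bar>\<psi> x\<bar> \<le> M" "\<And>x. norm (grad \<psi> x) \<le> M" using \<psi> by (rule test_function_bounded) blast
    obtain K where K: "compact K" "K \<subseteq> \<Omega>" "\<And>x. x \<notin> K \<Longrightarrow> \<psi> x = 0" using \<psi> by (rule test_functionE) blast
    have pc: "continuous_on S \<psi>" for S by (rule test_function_continuous[OF \<psi>])
    have dl: "((\<lambda>t. \<psi> (x + t *\<^sub>R b)) has_real_derivative partial_deriv b \<psi> (x + t *\<^sub>R b)) (at t)" for x t
    proof -
      have "((\<lambda>t. \<psi> (x + t *\<^sub>R b)) has_derivative (\<lambda>h. grad \<psi> (x + t *\<^sub>R b) \<bullet> (h *\<^sub>R b))) (at t)"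
        by (rule has_derivative_compose[OF _ grad_has_derivative[OF test_function_differentiable[OF \<psi>]]]) (auto intro!: derivative_eq_intros)
      then show ?thesis
        using b by (simp add: has_field_derivative_def grad_inner_Basis mult_commute_abs)
    qed
    \<comment> \<open>The difference quotient of \<open>\<psi>\<close> with backward step but
      positive factor, so its limit is minus the partial derivative.\<close>
    define E where "E n x = (\<psi> (x + (- (1 / Suc n)) *\<^sub>R b) - \<psi> x) * Suc n" for n x
    have Elim: "(\<lambda>n. E n x) \<longlonglongrightarrow> - partial_deriv b \<psi> x" for x
    proof -
      have "((\<lambda>h. (\<psi> (x + h *\<^sub>R b) - \<psi> x) / h) \<longlongrightarrow> partial_deriv b \<psi> x) (at 0)"
        using dl[of x 0] by (simp add: DERIV_def)
      then have "(\<lambda>n. (\<psi> (x + (- (1 / Suc n)) *\<^sub>R b) - \<psi> x) / (- (1 / Suc n))) \<longlonglongrightarrow> partial_deriv b \<psi> x"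
      proof (rule filterlim_compose)
        have "(\<lambda>n. - (1 / real (Suc n))) \<longlonglongrightarrow> - 0" by (intro tendsto_minus LIMSEQ_Suc[OF lim_1_over_n])
        then show "filterlim (\<lambda>n. - (1 / real (Suc n))) (at 0) sequentially" by (intro filterlim_atI) auto
      qed
      from tendsto_minus[OF this] show ?thesis by (simp add: E_def)
    qed
    have Ebd: "\<bar>E n x\<bar> \<le> M" for n x
    proof -
      have "- (1 / Suc n) < (0::real)" by simp
      from MVT2[OF this, of "\<lambda>t. \<psi> (x + t *\<^sub>R b)" "\<lambda>t. partial_deriv b \<psi> (x + t *\<^sub>R b)"] dl
      obtain z where "\<psi> (x + 0 *\<^sub>R b) - \<psi> (x + (- (1 / Suc n)) *\<^sub>R b) = (0 - (- (1 / Suc n))) * partial_deriv b \<psi> (x + z *\<^sub>R b)"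
        by blast
      then have "\<psi> x - \<psi> (x + (- (1 / Suc n)) *\<^sub>R b) = (1 / Suc n) * partial_deriv b \<psi> (x + z *\<^sub>R b)" by simp
      then have "E n x = - partial_deriv b \<psi> (x + z *\<^sub>R b)" by (simp add: E_def field_simps)
      then show ?thesis using grad_inner_Basis[OF b, of \<psi> "x + z *\<^sub>R b"] Basis_le_norm[OF b, of "grad \<psi> (x + z *\<^sub>R b)"] M(3)[of "x + z *\<^sub>R b"] by simp
    qed
    have int: "integrable lborel h" if "continuous_on UNIV h" "\<And>x. x \<notin> S \<Longrightarrow> h x = 0" "compact S" for h :: "'a \<Rightarrow> real" and S
    proof -
      have "integrable lborel (\<lambda>x. indicator S x *\<^sub>R h x)"
        using that by (intro borel_integrable_compact) (auto intro: continuous_on_subset)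
      moreover have "(\<lambda>x. indicator S x *\<^sub>R h x) = h" by (rule ext) (use that(2) in \<open>auto simp: indicator_def\<close>)
      ultimately show ?thesis by simp
    qed
    \<comment> \<open>Discrete integration by parts: translation of the integral moves the
      difference from \<open>w\<close> to \<open>\<psi>\<close>.\<close>
    have swap: "(\<integral>x. (F n x \<bullet> b) * \<psi> x \<partial>lebesgue_on \<Omega>) = (\<integral>x. w x * E n x \<partial>lebesgue_on \<Omega>)" for n
    proof -
      define t where "t = 1 / real (Suc n)"
      have cs: "continuous_on UNIV (\<lambda>x. h (x + s *\<^sub>R b))" if "continuous_on UNIV h" for s and h :: "'a \<Rightarrow> real"
        by (intro continuous_on_compose2[OF that] continuous_intros) auto
      have cc: "compact (closure \<Omega>)" using bounded_dom by (simp add: compact_closure)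
      have wcl: "w x = 0" if "x \<notin> closure \<Omega>" for x using that closure_subset w0 by blast
      have i1: "integrable lborel (\<lambda>x. w (x + t *\<^sub>R b) * \<psi> x)"
        by (rule int[OF _ _ K(1)]) (use K(3) in \<open>auto intro!: continuous_on_mult cs wc pc\<close>)
      have i2: "integrable lborel (\<lambda>x. w x * \<psi> x)"
        by (rule int[OF _ _ K(1)]) (use K(3) in \<open>auto intro!: continuous_on_mult wc pc\<close>)
      have i3: "integrable lborel (\<lambda>x. w x * \<psi> (x + (- t) *\<^sub>R b))"
        by (rule int[OF continuous_on_mult[OF wc cs[OF pc]] _ cc]) (simp add: wcl)
      have "(\<integral>x. w x * \<psi> (x + (- t) *\<^sub>R b) \<partial>lborel) = (\<integral>x. w x * \<psi> (x + (- t) *\<^sub>R b) \<partial>distr lborel borel ((+) (t *\<^sub>R b)))"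
        by (simp add: lborel_distr_plus)
      also have "\<dots> = (\<integral>x. w (t *\<^sub>R b + x) * \<psi> (t *\<^sub>R b + x + (- t) *\<^sub>R b) \<partial>lborel)"
        using i3 by (intro integral_distr) auto
      also have "\<dots> = (\<integral>x. w (x + t *\<^sub>R b) * \<psi> x \<partial>lborel)" by (simp add: add.commute)
      finally have sh: "(\<integral>x. w x * \<psi> (x + (- t) *\<^sub>R b) \<partial>lborel) = (\<integral>x. w (x + t *\<^sub>R b) * \<psi> x \<partial>lborel)" .
      have "(\<integral>x. (F n x \<bullet> b) * \<psi> x \<partial>lebesgue_on \<Omega>) = (\<integral>x. (F n x \<bullet> b) * \<psi> x \<partial>lborel)"
      proof (rule integral_lebesgue_on_support[OF sets_dom])
        show "(F n x \<bullet> b) * \<psi> x = 0" if "x \<notin> \<Omega>" for x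
          using test_function_zero(1)[OF \<psi> that] by simp
        show "(\<lambda>x. (F n x \<bullet> b) * \<psi> x) \<in> borel_measurable borel"
          by (intro borel_measurable_continuous_onI continuous_intros Fc pc)
      qed
      also have "\<dots> = (\<integral>x. (w (x + t *\<^sub>R b) * \<psi> x - w x * \<psi> x) * Suc n \<partial>lborel)"
        by (intro Bochner_Integration.integral_cong refl) (simp only: Fb[OF b] t_def algebra_simps)
      also have "\<dots> = (\<integral>x. (w x * \<psi> (x + (- t) *\<^sub>R b) - w x * \<psi> x) * Suc n \<partial>lborel)"
        by (simp only: integral_mult_left_zero Bochner_Integration.integral_diff[OF i1 i2] Bochner_Integration.integral_diff[OF i3 i2] sh)
      also have "\<dots> = (\<integral>x. w x * E n x \<partial>lborel)"
        by (intro Bochner_Integration.integral_cong refl) (simp only: E_def t_def algebra_simps)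
      also have "\<dots> = (\<integral>x. w x * E n x \<partial>lebesgue_on \<Omega>)"
      proof (rule integral_lebesgue_on_support[OF sets_dom, symmetric])
        show "w x * E n x = 0" if "x \<notin> \<Omega>" for x using w0[OF that] by simp
        show "(\<lambda>x. w x * E n x) \<in> borel_measurable borel" unfolding E_def
          by (intro borel_measurable_continuous_onI continuous_on_mult continuous_on_diff continuous_on_const wc pc cs)
      qed
      finally show ?thesis .
    qed
    interpret finite_measure "lebesgue_on \<Omega>" by (rule finite_measure_dom)
    have "compact (closure \<Omega>)" using bounded_dom by (simp add: compact_closure)
    then have "bounded (w ` closure \<Omega>)" by (intro compact_imp_bounded compact_continuous_image continuous_on_subset[OF wc]) auto
    then obtain Bw where Bw: "\<forall>y\<in>w ` closure \<Omega>. norm y \<le> Bw" unfolding bounded_iff ..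
    have Em: "E n \<in> borel_measurable (lebesgue_on \<Omega>)" for n
      unfolding E_def
      by (intro borel_measurable_continuous_lebesgue_on sets_dom continuous_intros continuous_on_compose2[OF pc[of UNIV]] pc) auto
    have pm: "partial_deriv b \<psi> \<in> borel_measurable (lebesgue_on \<Omega>)"
      by (rule borel_measurable_continuous_lebesgue_on[OF smooth_on_continuous[OF smooth_on_partial_deriv[OF test_function_smooth[OF \<psi>] b]] sets_dom])
    have "(\<lambda>n. \<integral>x. w x * E n x \<partial>lebesgue_on \<Omega>) \<longlonglongrightarrow> (\<integral>x. w x * (- partial_deriv b \<psi> x) \<partial>lebesgue_on \<Omega>)"
    proof (rule integral_dominated_convergence[where w = "\<lambda>x. Bw * M"])
      show "AE x in lebesgue_on \<Omega>. norm (w x * E n x) \<le> Bw * M" for n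
      proof (rule AE_I2)
        fix x assume "x \<in> space (lebesgue_on \<Omega>)"
        then have "\<bar>w x\<bar> \<le> Bw" using Bw closure_subset[of \<Omega>] by auto
        then show "norm (w x * E n x) \<le> Bw * M" using Ebd[of n x] M(1) by (simp add: abs_mult mult_mono')
      qed
      show "AE x in lebesgue_on \<Omega>. (\<lambda>n. w x * E n x) \<longlonglongrightarrow> w x * - partial_deriv b \<psi> x"
        by (intro AE_I2 tendsto_mult tendsto_const Elim)
    qed (use wm Em pm in auto)
    then show ?thesis unfolding swap by simp
  qed
  have hw: "has_weak_gradient \<Omega> u G"
    unfolding has_weak_gradient_def
  proof (intro conjI allI impI ballI)
    show "locally_integrable \<Omega> u" using uc closure_subset by (intro locally_integrable_continuous) (auto intro: continuous_on_subset)
    show "locally_integrable \<Omega> G" by (rule locally_integrable_Lp[OF G(1)]) simp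
    fix \<psi> :: "'a \<Rightarrow> real" and b :: 'a assume \<psi>: "test_function \<Omega> \<psi>" and b: "b \<in> Basis"
    obtain M where M: "M > 0" "\<And>x. \<bar>\<psi> x\<bar> \<le> M" "\<And>x. norm (grad \<psi> x) \<le> M" using \<psi> by (rule test_function_bounded) blast
    have pm: "\<psi> \<in> borel_measurable (lebesgue_on \<Omega>)"
      by (rule borel_measurable_continuous_lebesgue_on[OF test_function_continuous[OF \<psi>] sets_dom])
    have bm: "(\<lambda>x. \<psi> x *\<^sub>R b) \<in> borel_measurable (lebesgue_on \<Omega>)" "norm (\<psi> x *\<^sub>R b) \<le> M" for x
      using pm M(2)[of x] b by auto
    define I where "I g = (\<integral>x. g x \<bullet> (\<psi> x *\<^sub>R b) \<partial>lebesgue_on \<Omega>)" for g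
    have Ii: "integrable (lebesgue_on \<Omega>) (\<lambda>x. g x \<bullet> (\<psi> x *\<^sub>R b))" if "Lp_mem \<Omega> 2 g" for g
      by (rule integral_Lp_inner_tendsto(2)[of 2 "\<lambda>_. g" g, OF that that _ _ bm]) (auto simp: Lp_norm_def)
    define l where "l = - (\<integral>x. w x * partial_deriv b \<psi> x \<partial>lebesgue_on \<Omega>)"
    have Fl: "(\<lambda>n. I (F n)) \<longlonglongrightarrow> l" using FlimT[OF \<psi> b] by (simp add: I_def l_def mult.commute)
    have fl: "(\<lambda>n. I (f n)) \<longlonglongrightarrow> l"
    proof (rule LIMSEQ_I)
      fix e :: real assume "e > 0"
      then obtain N where N: "\<And>n. n \<ge> N \<Longrightarrow> \<bar>I (F n) - l\<bar> < e" using LIMSEQ_D[OF Fl] by auto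
      \<comment> \<open>\<open>I\<close> is linear and closeness to \<open>l\<close> is a convex
        condition, so it passes from the tail of \<open>F\<close> to its midpoint closure, which
        contains the late \<open>f n\<close>.\<close>
      have "\<bar>I g - l\<bar> < e" if "mid_closure F N g" for g
        using that
      proof induction
        case (midpoint g h)
        have "I (\<lambda>x. (g x + h x) /\<^sub>R 2) = (I g + I h) / 2"
          using Ii[OF midL(1)[OF midpoint(1)]] Ii[OF midL(1)[OF midpoint(2)]] by (simp add: I_def inner_add_left distrib_left)
        then show ?case using midpoint(3,4) by (simp add: abs_less_iff field_simps)
      qed (rule N)
      then show "\<exists>no. \<forall>n\<ge>no. norm (I (f n) - l) < e"
        using mid_closure_mono[OF f] by (intro exI[of _ N]) auto
    qed
    have "(\<lambda>n. I (f n)) \<longlonglongrightarrow> I G"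
      unfolding I_def by (rule integral_Lp_inner_tendsto(1)[OF midL(1)[OF f] G(1) _ G(2) bm]) simp
    then have "I G = l" using fl LIMSEQ_unique by blast
    moreover have "(\<integral>x. w x * partial_deriv b \<psi> x \<partial>lebesgue_on \<Omega>) = (\<integral>x. u x * partial_deriv b \<psi> x \<partial>lebesgue_on \<Omega>)"
      by (rule Bochner_Integration.integral_cong) (auto simp: w_def)
    ultimately show "(\<integral>x. u x * partial_deriv b \<psi> x \<partial>lebesgue_on \<Omega>) = - (\<integral>x. (G x \<bullet> b) * \<psi> x \<partial>lebesgue_on \<Omega>)"
      by (simp add: I_def l_def mult.commute)
  qed
  have "compact (closure \<Omega>)" using bounded_dom by (simp add: compact_closure)
  then have "bounded (u ` closure \<Omega>)" by (intro compact_imp_bounded compact_continuous_image uc)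
  then obtain Bu where Bu: "\<forall>y\<in>u ` closure \<Omega>. norm y \<le> Bu" unfolding bounded_iff ..
  have "Linf_mem \<Omega> u"
  proof (rule Linf_memI[OF _ AE_I2])
    show "u \<in> borel_measurable (lebesgue_on \<Omega>)" using Lp_mem_continuous[OF uc, of 2] by (simp add: Lp_mem_def)
    show "norm (u x) \<le> Bu" if "x \<in> space (lebesgue_on \<Omega>)" for x
      using that Bu subsetD[OF closure_subset, of x \<Omega>] by simp
  qed
  moreover have "Linf_mem \<Omega> G" by (rule Linf_memI[OF _ Gbd]) (use G(1) in \<open>simp add: Lp_mem_def\<close>)
  ultimately show ?thesis unfolding W1inf_def using hw by blast
qed

end

section \<open>The limit\<close>

lemma powr_at_top_0:
  fixes \<delta> :: real
  assumes "0 < \<delta>" "\<delta> < 1" "filterlim g at_top F"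
  shows "((\<lambda>x. \<delta> powr g x) \<longlongrightarrow> 0) F"
proof -
  have "filterlim (\<lambda>x. ln \<delta> * g x) at_bot F"
    by (rule filterlim_tendsto_neg_mult_at_bot[OF tendsto_const _ assms(3)]) (use assms in simp)
  then have "((\<lambda>x. exp (ln \<delta> * g x)) \<longlongrightarrow> 0) F" by (rule filterlim_compose[OF exp_at_bot])
  then show ?thesis using assms(1) by (simp add: powr_def mult.commute)
qed

lemma tendsto_powr_inverse_at_top:
  fixes a :: real
  assumes "a > 0" "filterlim g at_top F"
  shows "((\<lambda>x. a powr (1 / g x)) \<longlongrightarrow> 1) F"
proof -
  have "((\<lambda>x. a powr inverse (g x)) \<longlongrightarrow> a powr 0) F"
    by (intro tendsto_powr tendsto_const tendsto_inverse_0_at_top assms) (use assms in simp)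
  then show ?thesis using assms(1) by (simp add: inverse_eq_divide)
qed

lemma superlinear_exponent:
  fixes q :: "real \<Rightarrow> real"
  assumes "filterlim (\<lambda>p. q p / p) at_top at_top"
  shows "eventually (\<lambda>p. q p > p) at_top" "filterlim q at_top at_top" "((\<lambda>p. q p / (q p - p)) \<longlongrightarrow> 1) at_top"
proof -
  have "eventually (\<lambda>p. q p / p > 1) at_top" using assms by (simp add: filterlim_at_top_dense)
  then show 1: "eventually (\<lambda>p. q p > p) at_top"
    using eventually_gt_at_top[of 0] by eventually_elim (simp add: field_simps)
  show "filterlim q at_top at_top"
    by (rule filterlim_at_top_mono[OF filterlim_ident eventually_mono[OF 1]]) simp
  have "((\<lambda>p. 1 / (1 - inverse (q p / p))) \<longlongrightarrow> 1 / (1 - 0)) at_top"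
    by (intro tendsto_intros tendsto_inverse_0_at_top assms) simp
  moreover have "eventually (\<lambda>p. 1 / (1 - inverse (q p / p)) = q p / (q p - p)) at_top"
    using 1 eventually_gt_at_top[of 0] by eventually_elim (simp add: field_simps)
  ultimately show "((\<lambda>p. q p / (q p - p)) \<longlongrightarrow> 1) at_top"
    using tendsto_cong[of "\<lambda>p. 1 / (1 - inverse (q p / p))" "\<lambda>p. q p / (q p - p)" at_top 1] by simp
qed

text \<open>Since \<open>q p / p \<rightarrow> \<infinity>\<close>, the source is smaller than every exponential \<open>c\<^sup>p\<close> wherever the
  solution stays below \<open>1 / \<Theta>\<close>.\<close>

lemma source_decay:
  fixes q \<mu> :: "real \<Rightarrow> real"
  assumes q_lim: "filterlim (\<lambda>p. q p / p) at_top at_top"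
    and mu: "eventually (\<lambda>p. \<mu> p > 0) at_top"
    and mu_lim: "((\<lambda>p. \<mu> p powr (1 / q p)) \<longlongrightarrow> \<Theta>) at_top" and Theta: "\<Theta> > 0"
    and w: "0 \<le> w" "w < inverse \<Theta>" and c: "0 < c" "c < 1"
  shows "\<exists>w'>w. \<forall>\<^sub>F p in at_top. \<forall>s. 0 \<le> s \<longrightarrow> s \<le> w' \<longrightarrow> \<mu> p * (\<bar>s\<bar> powr (q p - 2) * s) \<le> c powr p"
proof -
  \<comment> \<open>Room is left on both sides: \<open>w'\<close> above \<open>w\<close> allows for
    a neighbourhood, and below \<open>1 / \<Theta>\<close> it admits a base
    \<open>\<delta> < 1\<close> for the q-th power. Since \<open>q p / p\<close> diverges,
    \<open>\<delta> powr q p\<close> is below every exponential in \<open>p\<close>.\<close>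
  obtain w' where w': "w < w'" "w' < inverse \<Theta>" using dense[OF w(2)] by blast
  have w0: "w' > 0" using w w' by linarith
  have "\<Theta> * w' < 1" using w'(2) Theta by (simp add: field_simps)
  then obtain \<delta> where \<delta>: "\<Theta> * w' < \<delta>" "\<delta> < 1" using dense by blast
  have \<delta>0: "\<delta> > 0" using \<delta>(1) mult_pos_pos[OF Theta w0] by linarith
  note q = superlinear_exponent[OF q_lim]
  have "((\<lambda>p. \<mu> p powr (1 / q p) * w') \<longlongrightarrow> \<Theta> * w') at_top" by (intro tendsto_intros mu_lim)
  then have e1: "eventually (\<lambda>p. \<mu> p powr (1 / q p) * w' < \<delta>) at_top" by (rule order_tendstoD(2)[OF _ \<delta>(1)])
  have e2: "eventually (\<lambda>p. \<delta> powr (q p / p) < c / 2) at_top"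
    by (rule order_tendstoD(2)[OF powr_at_top_0[OF \<delta>0 \<delta>(2) q_lim]]) (use c in simp)
  \<comment> \<open>The source carries the exponent \<open>q p - 1\<close>, hence a division by
    \<open>w'\<close>; the factor 1/2 spared in \<open>c / 2\<close> pays for it.\<close>
  have e3: "eventually (\<lambda>p. (1 / 2) powr p < w') at_top"
    by (rule order_tendstoD(2)[OF powr_at_top_0[OF _ _ filterlim_ident] w0]) auto
  have "\<forall>\<^sub>F p in at_top. \<forall>s. 0 \<le> s \<longrightarrow> s \<le> w' \<longrightarrow> \<mu> p * (\<bar>s\<bar> powr (q p - 2) * s) \<le> c powr p"
    using e1 e2 e3 q(1) mu eventually_gt_at_top[of 1]
  proof eventually_elim
    case (elim p)
    define m where "m = \<mu> p powr (1 / q p)"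
    have q1: "q p > 1" using elim by simp
    have m: "m powr q p = \<mu> p" "m \<ge> 0" using q1 elim by (auto simp: m_def powr_powr)
    have "(m * w') powr q p \<le> \<delta> powr q p" using elim m w0 q1 by (intro powr_mono2) (auto simp: m_def)
    also have "\<dots> = (\<delta> powr (q p / p)) powr p" using elim by (simp add: powr_powr)
    also have "\<dots> \<le> (c / 2) powr p" using elim by (intro powr_mono2) auto
    also have "\<dots> = c powr p * (1 / 2) powr p" using c by (simp flip: powr_mult)
    also have "\<dots> \<le> c powr p * w'" using elim by (intro mult_left_mono) auto
    finally have le: "\<mu> p * w' powr q p \<le> c powr p * w'" using m w0 by (simp add: powr_mult)
    have "\<mu> p * w' powr (q p - 1) = \<mu> p * w' powr q p / w'" using w0 by (simp add: powr_diff)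
    also have "\<dots> \<le> c powr p" using le w0 by (simp add: divide_le_eq)
    finally have le': "\<mu> p * w' powr (q p - 1) \<le> c powr p" .
    show ?case
    proof (intro allI impI)
      fix s :: real assume s: "0 \<le> s" "s \<le> w'"
      have "\<bar>s\<bar> powr (q p - 2) * s = s powr (q p - 1)"
        using s by (cases "s = 0") (auto simp: powr_diff power2_eq_square)
      also have "\<dots> \<le> w' powr (q p - 1)" using s q1 by (intro powr_mono2) auto
      finally have "\<mu> p * (\<bar>s\<bar> powr (q p - 2) * s) \<le> \<mu> p * w' powr (q p - 1)"
        using elim by (intro mult_left_mono) auto
      then show "\<mu> p * (\<bar>s\<bar> powr (q p - 2) * s) \<le> c powr p" using le' by linarith
    qed
  qed
  then show ?thesis using w'(1) by blast
qed

context bdd_domain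
begin

text \<open>If \<open>U\<close> bounds the Rayleigh infimum, scale and infimum combine to
  \<open>U / \<mu> powr (1 / q)\<close> raised to \<open>q / (q - p)\<close>. The exponent tends to
  1, and the base to a value that can be brought arbitrarily close to
  \<open>1 / (\<Theta> * inrad)\<close>.\<close>

lemma least_energy_gradient_limit:
  assumes conn: "connected \<Omega>"
    and mu: "\<And>p. p > real DIM('a) \<Longrightarrow> \<mu> p > 0"
    and q_lim: "filterlim (\<lambda>p. q p / p) at_top at_top"
    and mu_lim: "((\<lambda>p. \<mu> p powr (1 / q p)) \<longlongrightarrow> \<Theta>) at_top" and Theta: "\<Theta> > 0"
    and v: "eventually (\<lambda>p. positive_least_energy_solution \<Omega> p (q p) (\<mu> p) (v p)) at_top"
    and L: "L > 1 / (\<Theta> * inrad)"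
  shows "eventually (\<lambda>p. Lp_norm \<Omega> p (weak_grad \<Omega> (v p)) \<le> L) at_top"
proof -
  obtain xm where xm: "xm \<in> \<Omega>" "d xm = inrad" "inrad > 0" by (rule inradius)
  note q = superlinear_exponent[OF q_lim]
  have L0: "L > 0" using L mult_pos_pos[OF Theta xm(3)] by (meson less_trans zero_less_divide_1_iff)
  \<comment> \<open>The cone height for which the limiting bound would equal \<open>L\<close>. It is
    below the inradius, and a quarter of the gap serves as \<open>\<kappa>\<close>, so that the
    height \<open>R - \<kappa>\<close> remains above \<open>a\<close>.\<close>
  define a where "a = 1 / (L * \<Theta>)"
  have a: "0 < a" "a < inrad" using L L0 Theta xm(3) by (auto simp: a_def field_simps)
  define \<kappa> where "\<kappa> = (inrad - a) / 4"
  define R where "R = inrad - \<kappa>"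
  have k4: "4 * \<kappa> = inrad - a" by (simp add: \<kappa>_def)
  have R: "0 < \<kappa>" "\<kappa> < R" "R > 0" "R < d xm" "a < R - \<kappa>" using a k4 xm(2) unfolding R_def by linarith+
  have "cball xm R \<subseteq> \<Omega>" using ball_subset_dom[OF xm(1)] R(4) by force
  then obtain V where V: "V > 0"
    "\<And>p q. p > 1 \<Longrightarrow> q > 1 \<Longrightarrow> rayleigh p q \<le> measure lebesgue \<Omega> powr (1 / p) / ((R - \<kappa>) * V powr (1 / q))"
    using rayleigh_upper_bound[OF R(3) _ R(1,2)] by blast
  \<comment> \<open>The added 1 makes the base visibly positive, so its power \<open>1 / p\<close>
    tends to 1.\<close>
  define m where "m = measure lebesgue \<Omega> + 1"
  have m0: "m > 0" "measure lebesgue \<Omega> \<le> m" by (auto simp: m_def add_nonneg_pos)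
  define U where "U p = m powr (1 / p) / ((R - \<kappa>) * V powr (1 / q p))" for p
  have U0: "U p > 0" for p using R V m0 by (simp add: U_def)
  have Ulim: "(U \<longlongrightarrow> 1 / ((R - \<kappa>) * 1)) at_top"
    unfolding U_def using R(2)
    by (intro tendsto_divide tendsto_mult tendsto_const tendsto_powr_inverse_at_top m0 V(1) q(2) filterlim_ident) simp
  have "((\<lambda>p. (U p / \<mu> p powr (1 / q p)) powr (q p / (q p - p))) \<longlongrightarrow> (1 / ((R - \<kappa>) * 1) / \<Theta>) powr 1) at_top"
    using R(2) Theta by (intro tendsto_powr tendsto_divide Ulim mu_lim q(3)) auto
  moreover have "(1 / ((R - \<kappa>) * 1) / \<Theta>) powr 1 < L"
    using R(2,5) Theta L0 by (simp add: a_def field_simps)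
  ultimately have "eventually (\<lambda>p. (U p / \<mu> p powr (1 / q p)) powr (q p / (q p - p)) < L) at_top"
    by (rule order_tendstoD(2))
  then show ?thesis
    using v q(1) eventually_ge_at_top[of "2 * real DIM('a)"]
  proof eventually_elim
    case (elim p)
    note h = half_bound[OF elim(4)]
    have mp: "\<mu> p > 0" using mu h by simp
    let ?\<Lambda> = "rayleigh p (q p)"
    have "?\<Lambda> \<le> measure lebesgue \<Omega> powr (1 / p) / ((R - \<kappa>) * V powr (1 / q p))"
      using V(2) h elim by simp
    also have "\<dots> \<le> U p" unfolding U_def
      using m0 h R V(1) by (intro divide_right_mono powr_mono2 mult_nonneg_nonneg) auto
    finally have le: "?\<Lambda> \<le> U p" .
    have l0: "?\<Lambda> \<ge> 0" using rayleigh_pos[OF elim(4)] elim h by (simp add: less_imp_le)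
    have "Lp_norm \<Omega> p (weak_grad \<Omega> (v p)) \<le> nehari_scale p (q p) (\<mu> p) * ?\<Lambda>"
      by (rule least_energy_gradient_bound[OF conn elim(4,3) mp elim(2)])
    also have "\<dots> \<le> (U p powr p / \<mu> p) powr (1 / (q p - p)) * U p"
      unfolding nehari_scale_def using le l0 mp elim h
      by (intro mult_mono powr_mono2 divide_right_mono) auto
    also have "\<dots> = (U p / \<mu> p powr (1 / q p)) powr (q p / (q p - p))"
    proof -
      have qp: "q p - p > 0" "q p > 0" using elim h by auto
      \<comment> \<open>Both sides are positive, so logarithms may be compared; the identity behind
        it is \<open>p / (q - p) + 1 = q / (q - p)\<close>.\<close>
      have "ln ((U p powr p / \<mu> p) powr (1 / (q p - p)) * U p) = (p * ln (U p) - ln (\<mu> p)) / (q p - p) + ln (U p)"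
        using U0[of p] mp by (simp add: ln_mult ln_div ln_powr)
      also have "\<dots> = q p / (q p - p) * (ln (U p) - ln (\<mu> p) / q p)" using qp by (simp add: field_simps)
      also have "\<dots> = ln ((U p / \<mu> p powr (1 / q p)) powr (q p / (q p - p)))"
        using U0[of p] mp by (simp add: ln_mult ln_div ln_powr)
      finally show ?thesis using U0[of p] mp by (subst (asm) ln_inj_iff) auto
    qed
    finally show ?case using elim(1) by linarith
  qed
qed

text \<open>For a fixed half-side \<open>s\<close> of the Morrey cube the constant tends to
  \<open>dist x y + 2 * N * s\<close> as the exponent grows; \<open>s\<close> is sent to 0 only
  after that limit.\<close>

lemma limit_lipschitz:
  assumes f: "\<And>n. f n \<in> W01p \<Omega> (P n)" and P: "\<And>n. P n \<ge> 2 * real DIM('a)"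
    and P_lim: "filterlim P at_top sequentially"
    and lim: "uniform_limit (closure \<Omega>) f g sequentially" and l0: "l \<ge> 0"
    and grad: "\<And>L. L > l \<Longrightarrow> eventually (\<lambda>n. Lp_norm \<Omega> (P n) (weak_grad \<Omega> (f n)) \<le> L) sequentially"
    and xy: "x \<in> closure \<Omega>" "y \<in> closure \<Omega>"
  shows "\<bar>g x - g y\<bar> \<le> l * dist x y"
proof -
  let ?N = "real DIM('a)"
  have le: "\<bar>g x - g y\<bar> \<le> (dist x y + 2 * ?N * s) * (l + s)" if s: "s > 0" for s
  proof (rule tendsto_le[OF sequentially_bot])
    have "(\<lambda>n. ?N * inverse (P n)) \<longlonglongrightarrow> ?N * 0" by (intro tendsto_intros tendsto_inverse_0_at_top P_lim)
    then have z: "(\<lambda>n. ?N / P n) \<longlonglongrightarrow> 0" by (simp add: divide_inverse)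
    have "(\<lambda>n. (dist x y + 2 * ?N * s / (1 - ?N / P n)) * (2 * s) powr (- (?N / P n)) * (l + s))
        \<longlonglongrightarrow> (dist x y + 2 * ?N * s / (1 - 0)) * (2 * s) powr (- 0) * (l + s)"
      using s by (intro tendsto_intros z) auto
    then show "(\<lambda>n. morrey (P n) s (dist x y) * (l + s)) \<longlonglongrightarrow> (dist x y + 2 * ?N * s) * (l + s)"
      using s by (simp add: morrey_def)
    show "(\<lambda>n. \<bar>f n x - f n y\<bar>) \<longlonglongrightarrow> \<bar>g x - g y\<bar>"
      by (intro tendsto_intros tendsto_uniform_limitI[OF lim] xy)
    have "eventually (\<lambda>n. Lp_norm \<Omega> (P n) (weak_grad \<Omega> (f n)) \<le> l + s) sequentially" using grad s by simp
    then show "\<forall>\<^sub>F n in sequentially. \<bar>f n x - f n y\<bar> \<le> morrey (P n) s (dist x y) * (l + s)"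
    proof eventually_elim
      case (elim n)
      note p = half_bound(3)[OF P[of n]]
      have "\<bar>f n x - f n y\<bar> \<le> morrey (P n) s (dist x y) * Lp_norm \<Omega> (P n) (weak_grad \<Omega> (f n))"
        by (rule Morrey_W01p(1)[OF f p xy s])
      also have "\<dots> \<le> morrey (P n) s (dist x y) * (l + s)"
        using elim s p by (intro mult_left_mono morrey_nonneg) auto
      finally show ?case .
    qed
  qed
  have "((\<lambda>s. (dist x y + 2 * ?N * s) * (l + s)) \<longlongrightarrow> (dist x y + 2 * ?N * 0) * (l + 0)) (at_right 0)"
    by (intro tendsto_intros)
  then have "((\<lambda>s. (dist x y + 2 * ?N * s) * (l + s)) \<longlongrightarrow> l * dist x y) (at_right 0)" by (simp add: mult.commute)
  then show ?thesis
    by (rule tendsto_lowerbound) (use le in \<open>auto simp: eventually_at_right_field intro: exI[of _ 1]\<close>)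
qed

text \<open>The viscosity inequality is proved once, for supersolutions, and applied to the
  solutions and to their negatives. The two cases differ only in the sign of the source.\<close>

theorem limit_exists:
  assumes dim: "DIM('a) \<ge> 2" and conn: "connected \<Omega>"
    and mu: "\<And>p. p > real DIM('a) \<Longrightarrow> \<mu> p > 0"
    and q_lim: "filterlim (\<lambda>p. q p / p) at_top at_top"
    and mu_lim: "((\<lambda>p. \<mu> p powr (1 / q p)) \<longlongrightarrow> \<Theta>) at_top" and Theta: "\<Theta> > 0"
    and v: "eventually (\<lambda>p. positive_least_energy_solution \<Omega> p (q p) (\<mu> p) (v p)) at_top"
    and P_lim: "filterlim P at_top sequentially"
  shows "\<exists>r g. strict_mono (r :: nat \<Rightarrow> nat) \<and> uniform_limit (closure \<Omega>) (\<lambda>n. v (P (r n))) g sequentially \<and>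
    continuous_on (closure \<Omega>) g \<and> (\<forall>x\<in>frontier \<Omega>. g x = 0) \<and>
    (\<forall>x\<in>closure \<Omega>. \<forall>y\<in>closure \<Omega>. \<bar>g x - g y\<bar> \<le> 1 / (\<Theta> * inrad) * dist x y) \<and>
    infinity_harmonic (\<Omega> - {x \<in> \<Omega>. g x = inverse \<Theta>}) g"
proof -
  define l where "l = 1 / (\<Theta> * inrad)"
  have l0: "l \<ge> 0" using Theta inradius unfolding l_def by (metis less_imp_le mult_pos_pos zero_less_divide_1_iff)
  have grad: "eventually (\<lambda>p. Lp_norm \<Omega> p (weak_grad \<Omega> (v p)) \<le> L) at_top" if "L > l" for L
    by (rule least_energy_gradient_limit[OF conn mu q_lim mu_lim Theta v]) (use that in \<open>simp_all add: l_def\<close>)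
  \<comment> \<open>All properties that hold for large \<open>p\<close> are collected, so that one
    shift of the sequence provides them for every index.\<close>
  define good where "good p \<longleftrightarrow> p \<ge> 2 * real DIM('a) \<and> q p > p \<and> positive_least_energy_solution \<Omega> p (q p) (\<mu> p) (v p)
    \<and> Lp_norm \<Omega> p (weak_grad \<Omega> (v p)) \<le> l + 1" for p
  have "eventually good at_top"
    unfolding good_def
    by (intro eventually_conj eventually_ge_at_top superlinear_exponent(1)[OF q_lim] v grad) simp
  then have "eventually (\<lambda>n. good (P n)) sequentially" using P_lim by (rule eventually_compose_filterlim)
  then obtain N where N: "\<And>n. n \<ge> N \<Longrightarrow> good (P n)" by (auto simp: eventually_sequentially)
  have g0: "good (P (n + N))" for n by (rule N) simp
  have "v (P (n + N)) \<in> W01p \<Omega> (P (n + N))" for n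
    using g0[of n] by (simp add: good_def positive_least_energy_solution_def positive_weak_solution_def weak_solution_def)
  moreover have "P (n + N) \<ge> 2 * real DIM('a)" "Lp_norm \<Omega> (P (n + N)) (weak_grad \<Omega> (v (P (n + N)))) \<le> l + 1" for n
    using g0[of n] by (simp_all add: good_def)
  ultimately obtain g k where k: "strict_mono (k :: nat \<Rightarrow> nat)" and gc: "continuous_on (closure \<Omega>) g"
    and lim': "uniform_limit (closure \<Omega>) (\<lambda>n. v (P (k n + N))) g sequentially"
    using W01p_compactness[of "\<lambda>n. v (P (n + N))" "\<lambda>n. P (n + N)"] by blast
  define r where "r n = k n + N" for n
  have r: "strict_mono r" using k by (auto simp: r_def strict_mono_def)
  define Q where "Q n = P (r n)" for n
  define u where "u n = v (Q n)" for n
  have lim: "uniform_limit (closure \<Omega>) u g sequentially" using lim' by (simp add: u_def[abs_def] Q_def r_def)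
  have Q_lim: "filterlim Q at_top sequentially"
    unfolding Q_def by (rule filterlim_compose[OF P_lim filterlim_subseq[OF r]])
  have good: "good (Q n)" for n unfolding Q_def r_def by (rule g0)
  have Q: "Q n \<ge> 2 * real DIM('a)" and Qq: "q (Q n) > Q n" for n using good[of n] by (simp_all add: good_def)
  note h = half_bound[OF Q]
  have pos: "positive_weak_solution \<Omega> (Q n) (q (Q n)) (\<mu> (Q n)) (u n)" for n
    using good[of n] by (simp add: good_def positive_least_energy_solution_def u_def)
  have um: "u n \<in> W01p \<Omega> (Q n)" for n using pos[of n] by (simp add: positive_weak_solution_def weak_solution_def)
  have u0: "u n x = 0" if "x \<in> frontier \<Omega>" for n x by (rule Morrey_W01p(3)[OF um h(3) that])
  have unn: "u n x \<ge> 0" if "x \<in> closure \<Omega>" for n x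
    using pos[of n] u0[of x n] that open_dom
    by (cases "x \<in> \<Omega>") (auto simp: positive_weak_solution_def frontier_def interior_open less_imp_le)
  have pw: "(\<lambda>n. u n x) \<longlonglongrightarrow> g x" if "x \<in> closure \<Omega>" for x by (rule tendsto_uniform_limitI[OF lim that])
  have gn: "g x \<ge> 0" if "x \<in> closure \<Omega>" for x by (rule LIMSEQ_le_const[OF pw[OF that]]) (use unn[OF that] in auto)
  have gfr: "g x = 0" if x: "x \<in> frontier \<Omega>" for x
  proof -
    have "x \<in> closure \<Omega>" using x by (simp add: frontier_def)
    from pw[OF this] show ?thesis using u0[OF x] by (simp add: LIMSEQ_const_iff)
  qed
  have lip: "\<bar>g x - g y\<bar> \<le> l * dist x y" if "x \<in> closure \<Omega>" "y \<in> closure \<Omega>" for x y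
  proof (rule limit_lipschitz[OF um Q Q_lim lim l0 _ that])
    fix L assume "L > l"
    from eventually_compose_filterlim[OF grad[OF this] Q_lim]
    show "eventually (\<lambda>n. Lp_norm \<Omega> (Q n) (weak_grad \<Omega> (u n)) \<le> L) sequentially" by (simp add: u_def)
  qed
  have gle: "g x \<le> inverse \<Theta>" if x: "x \<in> closure \<Omega>" for x
  proof -
    obtain y where y: "y \<in> frontier \<Omega>" "d x = dist x y" by (rule nearest_point)
    have "g x \<le> l * d x" using lip[OF x, of y] gfr[OF y(1)] y by (simp add: frontier_def)
    also have "\<dots> \<le> l * inrad" using l0 inradius x by (intro mult_left_mono) blast+
    also have "\<dots> = inverse \<Theta>" using Theta inradius by (metis l_def divide_inverse inverse_mult_distrib mult.assoc mult.left_neutral left_inverse less_numeral_extra(3) mult.right_neutral)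
    finally show ?thesis .
  qed
  define D where "D = \<Omega> - {x \<in> \<Omega>. g x = inverse \<Theta>}"
  have Deq: "D = {x \<in> \<Omega>. g x < inverse \<Theta>}"
    using gle closure_subset[of \<Omega>] by (auto simp: D_def less_le)
  have Dsub: "D \<subseteq> \<Omega>" by (auto simp: D_def)
  have Dopen: "open D"
  proof -
    have "continuous_on \<Omega> g" by (rule continuous_on_subset[OF gc closure_subset])
    then have "open (g -` {..<inverse \<Theta>} \<inter> \<Omega>)" using open_dom by (simp add: continuous_on_open_vimage)
    moreover have "g -` {..<inverse \<Theta>} \<inter> \<Omega> = D" by (auto simp: Deq)
    ultimately show ?thesis by simp
  qed
  define S where "S n x = \<mu> (Q n) * (\<bar>u n x\<bar> powr (q (Q n) - 2) * u n x)" for n x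
  have mp: "\<mu> (Q n) > 0" for n by (rule mu[OF h(3)])
  have Sc: "continuous_on (closure \<Omega>) (S n)" for n
    unfolding S_def using Qq[of n] h(4)[of n]
    by (intro continuous_on_mult continuous_on_const continuous_on_signed_powr W01p_mem(4)[OF um] unn) auto
  have weak: "(\<integral>x. norm (weak_grad \<Omega> (u n) x) powr (Q n - 2) * (weak_grad \<Omega> (u n) x \<bullet> weak_grad \<Omega> \<phi> x) \<partial>lebesgue_on \<Omega>)
      = (\<integral>x. S n x * \<phi> x \<partial>lebesgue_on \<Omega>)" if "\<phi> \<in> W01p \<Omega> (Q n)" for n \<phi>
    using pos[of n] that unfolding positive_weak_solution_def weak_solution_def S_def by (simp add: mult.assoc)
  \<comment> \<open>For the solutions themselves the source is nonnegative, so the required lower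
    bound is immediate.\<close>
  have super: "viscosity_supersolution D g"
  proof (rule viscosity_supersolution_limit[OF Dopen Dsub gc um Q dim Q_lim lim weak Sc])
    fix x and c :: real
    have "S n y \<ge> 0" if "y \<in> \<Omega>" for n y
      unfolding S_def using unn[of y n] mp[of n] that closure_subset[of \<Omega>] by (intro mult_nonneg_nonneg) (auto simp: less_imp_le)
    then have "- (c powr Q n) \<le> S n y" if "y \<in> \<Omega>" for n y
      using that powr_ge_zero[of c "Q n"] by (smt (verit))
    then show "\<exists>\<rho>>0. \<forall>\<^sub>F n in sequentially. \<forall>y\<in>cball x \<rho>. y \<in> \<Omega> \<longrightarrow> - (c powr Q n) \<le> S n y"
      by (intro exI[of _ 1]) simp
  qed
  \<comment> \<open>The negative of \<open>u n\<close>, in the shape expected by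
    \<open>W01p_add_cmult\<close>.\<close>
  define u' where "u' n x = - 1 * u n x + 0 * u n x" for n x
  have u'e: "u' n x = - u n x" for n x by (simp add: u'_def)
  have um': "u' n \<in> W01p \<Omega> (Q n)" for n unfolding u'_def by (rule W01p_add_cmult(1)[OF um um h(3)])
  have gu': "AE x in lebesgue_on \<Omega>. weak_grad \<Omega> (u' n) x = - weak_grad \<Omega> (u n) x" for n
    using W01p_add_cmult(2)[where a = "- 1" and c = 0, OF um[of n] um h(3)] by (simp add: u'_def[abs_def])
  \<comment> \<open>For the negatives the source is \<open>- S n\<close>. Here its decay is needed,
    and it is available only where the limit stays below \<open>1 / \<Theta>\<close>; this is what
    confines the argument to \<open>D\<close>.\<close>
  have "viscosity_supersolution D (\<lambda>x. - g x)"
  proof (rule viscosity_supersolution_limit[OF Dopen Dsub continuous_on_minus[OF gc] um' Q dim Q_lim, of "\<lambda>n x. - S n x"])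
    show "uniform_limit (closure \<Omega>) u' (\<lambda>x. - g x) sequentially"
      using uniform_limit_uminus[OF lim] by (simp add: u'e[abs_def])
    show "continuous_on (closure \<Omega>) (\<lambda>x. - S n x)" for n by (rule continuous_on_minus[OF Sc])
    fix n \<phi> assume \<phi>: "\<phi> \<in> W01p \<Omega> (Q n)"
    have "(\<integral>x. norm (weak_grad \<Omega> (u' n) x) powr (Q n - 2) * (weak_grad \<Omega> (u' n) x \<bullet> weak_grad \<Omega> \<phi> x) \<partial>lebesgue_on \<Omega>)
        = (\<integral>x. - (norm (weak_grad \<Omega> (u n) x) powr (Q n - 2) * (weak_grad \<Omega> (u n) x \<bullet> weak_grad \<Omega> \<phi> x)) \<partial>lebesgue_on \<Omega>)"
    proof (rule integral_cong_AE)
      note [measurable] = W01p_mem(2)[OF um, of n, unfolded Lp_mem_def, THEN conjunct1]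
        W01p_mem(2)[OF um', of n, unfolded Lp_mem_def, THEN conjunct1]
        W01p_mem(2)[OF \<phi>, unfolded Lp_mem_def, THEN conjunct1]
      show "(\<lambda>x. norm (weak_grad \<Omega> (u' n) x) powr (Q n - 2) * (weak_grad \<Omega> (u' n) x \<bullet> weak_grad \<Omega> \<phi> x)) \<in> borel_measurable (lebesgue_on \<Omega>)"
        "(\<lambda>x. - (norm (weak_grad \<Omega> (u n) x) powr (Q n - 2) * (weak_grad \<Omega> (u n) x \<bullet> weak_grad \<Omega> \<phi> x))) \<in> borel_measurable (lebesgue_on \<Omega>)"
        by measurable
      show "AE x in lebesgue_on \<Omega>. norm (weak_grad \<Omega> (u' n) x) powr (Q n - 2) * (weak_grad \<Omega> (u' n) x \<bullet> weak_grad \<Omega> \<phi> x)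
          = - (norm (weak_grad \<Omega> (u n) x) powr (Q n - 2) * (weak_grad \<Omega> (u n) x \<bullet> weak_grad \<Omega> \<phi> x))"
        using gu'[of n] by eventually_elim simp
    qed
    then show "(\<integral>x. norm (weak_grad \<Omega> (u' n) x) powr (Q n - 2) * (weak_grad \<Omega> (u' n) x \<bullet> weak_grad \<Omega> \<phi> x) \<partial>lebesgue_on \<Omega>)
        = (\<integral>x. - S n x * \<phi> x \<partial>lebesgue_on \<Omega>)"
      using weak[OF \<phi>] by simp
  next
    fix x and c :: real assume x: "x \<in> D" and c: "0 < c" "c < 1"
    have xO: "x \<in> closure \<Omega>" using x Dsub closure_subset[of \<Omega>] by blast
    have ev: "eventually (\<lambda>p. \<mu> p > 0) at_top"
      using eventually_gt_at_top[of "real DIM('a)"] by eventually_elim (rule mu)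
    obtain w where w: "w > g x"
      "\<forall>\<^sub>F p in at_top. \<forall>s. 0 \<le> s \<longrightarrow> s \<le> w \<longrightarrow> \<mu> p * (\<bar>s\<bar> powr (q p - 2) * s) \<le> c powr p"
      using source_decay[OF q_lim ev mu_lim Theta gn[OF xO] _ c] x by (auto simp: Deq)
    \<comment> \<open>Half the room between \<open>g x\<close> and \<open>w\<close>: one
      \<open>\<eta>\<close> for the continuity of \<open>g\<close>, one for the uniform
      convergence.\<close>
    define \<eta> where "\<eta> = (w - g x) / 2"
    have \<eta>: "\<eta> > 0" "g x + 2 * \<eta> = w" using w(1) by (auto simp: \<eta>_def field_simps)
    have "isCont g x"
      using gc continuous_on_interior[of "closure \<Omega>" g x] x Dsub interior_maximal[OF closure_subset open_dom] by blast
    then obtain \<rho> where \<rho>: "\<rho> > 0" "\<And>y. dist y x < \<rho> \<Longrightarrow> dist (g y) (g x) < \<eta>"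
      using \<eta>(1) unfolding continuous_at_eps_delta by (auto simp: dist_norm)
    have "\<forall>\<^sub>F n in sequentially. \<forall>y\<in>cball x (\<rho> / 2). y \<in> \<Omega> \<longrightarrow> - (c powr Q n) \<le> - S n y"
      using uniform_limitD[OF lim \<eta>(1)] eventually_compose_filterlim[OF w(2) Q_lim]
    proof eventually_elim
      case (elim n)
      show ?case
      proof (intro ballI impI)
        fix y assume y: "y \<in> cball x (\<rho> / 2)" "y \<in> \<Omega>"
        have yc: "y \<in> closure \<Omega>" using y closure_subset[of \<Omega>] by blast
        have "dist y x < \<rho>" using y(1) \<rho>(1) by (simp add: dist_commute)
        then have "g y < g x + \<eta>" using \<rho>(2) by (force simp: dist_real_def)
        moreover have "u n y < g y + \<eta>" using elim(1) yc by (force simp: dist_real_def)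
        ultimately have "u n y \<le> w" using \<eta> by linarith
        then show "- (c powr Q n) \<le> - S n y" using elim(2) unn[OF yc, of n] by (simp add: S_def)
      qed
    qed
    then show "\<exists>\<rho>>0. \<forall>\<^sub>F n in sequentially. \<forall>y\<in>cball x \<rho>. y \<in> \<Omega> \<longrightarrow> - (c powr Q n) \<le> - S n y"
      using \<rho>(1) by (intro exI[of _ "\<rho> / 2"]) simp
  qed
  then have "infinity_harmonic D g"
    using super viscosity_subsolution_uminus by (simp add: infinity_harmonic_def)
  then show ?thesis
    using r lim gc gfr lip unfolding u_def[abs_def] Q_def D_def l_def by blast
qed

lemma limit_identified:
  assumes Theta: "\<Theta> > 0" and gfr: "\<And>x. x \<in> frontier \<Omega> \<Longrightarrow> g x = 0"
    and lip: "\<And>x y. x \<in> closure \<Omega> \<Longrightarrow> y \<in> closure \<Omega> \<Longrightarrow> \<bar>g x - g y\<bar> \<le> 1 / (\<Theta> * inrad) * dist x y"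
    and gc: "continuous_on (closure \<Omega>) g"
    and M: "M = {x \<in> \<Omega>. g x = inverse \<Theta>}" and harm: "infinity_harmonic (\<Omega> - M) g"
  shows "closed M" "M \<subseteq> max_set \<Omega>"
    "(\<forall>x\<in>closure \<Omega>. g x = d x / (\<Theta> * inrad)) \<longleftrightarrow> M = max_set \<Omega> \<and> max_set \<Omega> = singular_set \<Omega>"
proof -
  obtain xm where xm: "xm \<in> \<Omega>" "d xm = inrad" "inrad > 0" "\<And>x. x \<in> closure \<Omega> \<Longrightarrow> d x \<le> inrad" using inradius by blast
  have split: "closure \<Omega> = \<Omega> \<union> frontier \<Omega>" using open_dom closure_subset[of \<Omega>] by (auto simp: frontier_def interior_open)
  have gd: "g x \<le> d x / (\<Theta> * inrad)" if x: "x \<in> closure \<Omega>" for x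
  proof -
    obtain y where y: "y \<in> frontier \<Omega>" "d x = dist x y" by (rule nearest_point)
    then show ?thesis using lip[OF x, of y] gfr[OF y(1)] by (simp add: frontier_def)
  qed
  \<comment> \<open>On the boundary \<open>g\<close> is 0 and not \<open>1 / \<Theta>\<close>, so
    the contact set cannot accumulate there and is closed in the whole space.\<close>
  have "M = {x \<in> closure \<Omega>. g x = inverse \<Theta>}" using gfr Theta by (auto simp: M split)
  moreover have "closed {x \<in> closure \<Omega>. g x = inverse \<Theta>}"
    by (rule continuous_closed_preimage_constant[OF gc]) simp
  ultimately show Mc: "closed M" by simp
  show "M \<subseteq> max_set \<Omega>"
  proof
    fix x assume x: "x \<in> M"
    then have xc: "x \<in> closure \<Omega>" and gx: "g x = inverse \<Theta>" by (auto simp: M split)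
    \<comment> \<open>At a contact point the upper bound for \<open>g\<close> leaves no slack: the
      value \<open>1 / \<Theta>\<close> is reached only if \<open>d\<close> is at least the
      inradius.\<close>
    have "inrad \<le> d x" using gd[OF xc] gx Theta xm(3) by (simp add: field_simps)
    then show "x \<in> max_set \<Omega>" using xm(4)[OF xc] x by (simp add: max_set_iff M)
  qed
  then have Msub: "M \<subseteq> max_set \<Omega>" .
  show "(\<forall>x\<in>closure \<Omega>. g x = d x / (\<Theta> * inrad)) \<longleftrightarrow> M = max_set \<Omega> \<and> max_set \<Omega> = singular_set \<Omega>"
  proof
    assume eq: "\<forall>x\<in>closure \<Omega>. g x = d x / (\<Theta> * inrad)"
    have "max_set \<Omega> \<subseteq> M"
    proof
      fix x assume "x \<in> max_set \<Omega>"
      then have x: "x \<in> \<Omega>" "d x = inrad" by (auto simp: max_set_iff)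
      then have "g x = inrad / (\<Theta> * inrad)" using eq by (simp add: split)
      then show "x \<in> M" using x(1) xm(3) by (simp add: M inverse_eq_divide)
    qed
    moreover have "singular_set \<Omega> \<subseteq> M"
    proof (rule ccontr)
      assume "\<not> singular_set \<Omega> \<subseteq> M"
      then obtain x where x: "x \<in> \<Omega> - M" "\<not> d differentiable (at x)" by (auto simp: singular_set_def)
      have "d differentiable (at x)"
      proof (rule subsolution_bdist_differentiable[of "\<Omega> - M" x "1 / (\<Theta> * inrad)" g])
        show "open (\<Omega> - M)" by (rule open_Diff[OF open_dom Mc])
        show "viscosity_subsolution (\<Omega> - M) g" using harm by (simp add: infinity_harmonic_def)
      qed (use x Theta xm(3) eq in \<open>auto simp: split\<close>)
      then show False using x(2) by simp
    qed
    ultimately show "M = max_set \<Omega> \<and> max_set \<Omega> = singular_set \<Omega>" using Msub max_set_subset_singular by blast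
  next
    assume e: "M = max_set \<Omega> \<and> max_set \<Omega> = singular_set \<Omega>"
    show "\<forall>x\<in>closure \<Omega>. g x = d x / (\<Theta> * inrad)"
    proof
      fix x assume xc: "x \<in> closure \<Omega>"
      show "g x = d x / (\<Theta> * inrad)"
      proof (cases "x \<in> \<Omega>")
        case True
        obtain m where m: "m \<in> M" "dist x m \<le> inrad - d x" using max_set_reached[OF conjunct2[OF e] True] e by blast
        have mc: "m \<in> closure \<Omega>" and gm: "g m = inverse \<Theta>" using m(1) by (auto simp: M split)
        have "inverse \<Theta> - g x \<le> 1 / (\<Theta> * inrad) * dist x m" using lip[OF xc mc] gm by linarith
        also have "\<dots> \<le> 1 / (\<Theta> * inrad) * (inrad - d x)" using m(2) Theta xm(3) by (intro mult_left_mono) auto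
        also have "\<dots> = inverse \<Theta> - d x / (\<Theta> * inrad)" using Theta xm(3) by (simp add: field_simps)
        finally show ?thesis using gd[OF xc] by linarith
      next
        case False
        then show ?thesis using xc gfr d_frontier by (simp add: split)
      qed
    qed
  qed
qed

end

theorem corollary1p4:
  fixes \<Omega> :: "'a::euclidean_space set"
    and q \<mu> :: "real \<Rightarrow> real" and \<Theta> :: real
    and v :: "real \<Rightarrow> 'a \<Rightarrow> real"
    and P :: "nat \<Rightarrow> real"
  assumes dim: "DIM('a) \<ge> 2"
    and dom: "bounded_smooth_domain \<Omega>"
    and q: "\<And>p. p > real DIM('a) \<Longrightarrow> q p \<ge> 1"
    and mu: "\<And>p. p > real DIM('a) \<Longrightarrow> \<mu> p > 0"
    and q_lim: "filterlim (\<lambda>p. q p / p) at_top at_top"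
    and mu_lim: "((\<lambda>p. \<mu> p powr (1 / q p)) \<longlongrightarrow> \<Theta>) at_top"
    and Theta_pos: "\<Theta> > 0"
    and v: "eventually (\<lambda>p. positive_least_energy_solution \<Omega> p (q p) (\<mu> p) (v p)) at_top"
    and P_lim: "filterlim P at_top sequentially"
  shows "\<exists>r v_inf M. strict_mono (r :: nat \<Rightarrow> nat) \<and>
           uniform_limit (closure \<Omega>) (\<lambda>n. v (P (r n))) v_inf sequentially \<and>
           v_inf \<in> C0_closure \<Omega> \<inter> W1inf \<Omega> \<and>
           closed M \<and> M \<subseteq> max_set \<Omega> \<and>
           infinity_dirichlet_solution \<Omega> M (inverse \<Theta>) v_inf \<and>
           ((\<forall>x\<in>closure \<Omega>. v_inf x = bdist \<Omega> x / (\<Theta> * Linf_norm \<Omega> (bdist \<Omega>))) \<longleftrightarrow>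
              M = max_set \<Omega> \<and> max_set \<Omega> = singular_set \<Omega>)"
proof -
  interpret bdd_domain \<Omega>
    using dom by unfold_locales (auto simp: bounded_smooth_domain_def)
  have conn: "connected \<Omega>" using dom by (simp add: bounded_smooth_domain_def)
  obtain r g where r: "strict_mono (r :: nat \<Rightarrow> nat)" and lim: "uniform_limit (closure \<Omega>) (\<lambda>n. v (P (r n))) g sequentially"
    and gc: "continuous_on (closure \<Omega>) g" and gfr: "\<And>x. x \<in> frontier \<Omega> \<Longrightarrow> g x = 0"
    and lip: "\<And>x y. x \<in> closure \<Omega> \<Longrightarrow> y \<in> closure \<Omega> \<Longrightarrow> \<bar>g x - g y\<bar> \<le> 1 / (\<Theta> * inrad) * dist x y"
    and harm: "infinity_harmonic (\<Omega> - {x \<in> \<Omega>. g x = inverse \<Theta>}) g"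
    using limit_exists[OF dim conn mu q_lim mu_lim Theta_pos v P_lim] by blast
  define M where "M = {x \<in> \<Omega>. g x = inverse \<Theta>}"
  note M = limit_identified[OF Theta_pos gfr lip gc M_def harm[folded M_def]]
  have "inrad > 0" using inradius by blast
  then have "g \<in> W1inf \<Omega>" using Theta_pos by (intro W1inf_lipschitz[OF lip gfr _ gc]) auto
  moreover have "g \<in> C0_closure \<Omega>" using gc gfr by (simp add: C0_closure_def)
  moreover have "infinity_dirichlet_solution \<Omega> M (inverse \<Theta>) g"
    using gc gfr harm by (auto simp: infinity_dirichlet_solution_def M_def)
  ultimately show ?thesis
    using r lim M unfolding inrad_def by blast
qed

end
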